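(* Let $\alpha\in[1,2]$ and $\varepsilon>0$. For any $N\in2^{\mathbb N_0}$, $A\in\mathbb R$, and $f\in L^2(\mathbb R\times\mathbb T)$ with the property $$\operatorname{supp}(\hat f)\subseteq\Big\{(\xi,\eta)\in\mathbb R^2:\ |\xi|\sim N,\ \Big|\frac{\eta}{\xi}-A\Big|\lesssim N^{\frac\alpha2}\Big\}$$ we have the estimate $$\|S_\alpha(t)f\|_{L^4_t([0,1],L^4_{xy}(\mathbb R\times\mathbb T))}\lesssim_\varepsilon N^{\frac{2-\alpha}{8}+\varepsilon}\|f\|_{L^2(\mathbb R\times\mathbb T)}.$$ The implicit constant is independent of $N$, $A$ and $f$.
   Context: $\mathbb T=\mathbb R/(2\pi\mathbb Z)$. For $f:\mathbb R\times\mathbb T\to\mathbb C$ the Fourier transform $\hat f(\xi,\eta)$ is a function on $\mathbb R\times\mathbb Z$. Let $\omega_\alpha(\xi,\eta)=\xi|\xi|^\alpha-\eta^2/\xi$ and $$S_\alpha(t)f(x,y)=\frac1{(2\pi)^2}\int_{\mathbb R}\sum_{\eta\in\mathbb Z}e^{i(x\xi+y\eta+t\omega_\alpha(\xi,\eta))}\hat f(\xi,\eta)\,d\xi .$$ $A\lesssim B$ means $A\le CB$ with a harmless constant $C$ (subscripts indicate further dependence), and $A\sim B$ means $A\lesssim B\lesssim A$; the constants in the support condition are fixed. *)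

theory Defs
  imports "HOL-Analysis.Analysis"
begin

text \<open>The torus is represented by its fundamental domain \<open>[0, 2\<pi>)\<close>: values of a function
  outside \<open>\<real> \<times> [0, 2\<pi>)\<close> play no role in any of the notions below. The measure on
  \<open>\<real> \<times> \<int>\<close> is Lebesgue times counting measure.\<close>

definition cylinder :: "(real \<times> real) measure" where
  "cylinder = lborel \<Otimes>\<^sub>M restrict_space lborel {0..<2 * pi}"

definition dual_cylinder :: "(real \<times> int) measure" where
  "dual_cylinder = lborel \<Otimes>\<^sub>M count_space UNIV"

text \<open>Norms take values in \<open>[0, \<infinity>]\<close>, so that an upper bound on a norm also asserts its
  finiteness, and so that mixed norms are obtained by iteration. The power \<open>ennpow x p\<close> is only
  meant for \<open>p > 0\<close>.\<close>

definition ennpow :: "ennreal \<Rightarrow> real \<Rightarrow> ennreal" where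
  "ennpow x p = (if x = \<infinity> then \<infinity> else ennreal (enn2real x powr p))"

definition ennLp :: "real \<Rightarrow> 'a measure \<Rightarrow> ('a \<Rightarrow> ennreal) \<Rightarrow> ennreal" where
  "ennLp p M u = ennpow (\<integral>\<^sup>+ z. ennpow (u z) p \<partial>M) (1 / p)"

definition Lp_norm :: "real \<Rightarrow> 'a measure \<Rightarrow> ('a \<Rightarrow> complex) \<Rightarrow> ennreal" where
  "Lp_norm p M f = ennLp p M (\<lambda>z. ennreal (norm (f z)))"

definition L2_space :: "'a measure \<Rightarrow> ('a \<Rightarrow> complex) set" where
  "L2_space M = {f \<in> borel_measurable M. Lp_norm 2 M f < \<infinity>}"

definition fourier_integral :: "(real \<times> real \<Rightarrow> complex) \<Rightarrow> real \<times> int \<Rightarrow> complex" where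
  "fourier_integral f = (\<lambda>(\<xi>, \<eta>).
     LINT (x, y)|cylinder. exp (- \<i> * of_real (x * \<xi> + y * of_int \<eta>)) * f (x, y))"

text \<open>The Fourier--Plancherel transform on \<open>L\<^sup>2(\<real> \<times> \<T>)\<close>: the limit in \<open>L\<^sup>2(\<real> \<times> \<int>)\<close> of the
  Fourier integrals of the truncations of \<open>f\<close> to \<open>\<bar>x\<bar> \<le> R\<close> (which are integrable). It is
  determined up to a null set; \<open>fourier f\<close> chooses a representative, and none of the notions
  below depends on this choice.\<close>

definition is_fourier_transform ::
    "(real \<times> real \<Rightarrow> complex) \<Rightarrow> (real \<times> int \<Rightarrow> complex) \<Rightarrow> bool" where
  "is_fourier_transform f g \<longleftrightarrow> g \<in> L2_space dual_cylinder \<and>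
     ((\<lambda>R. Lp_norm 2 dual_cylinder
         (\<lambda>\<zeta>. fourier_integral (\<lambda>(x, y). if \<bar>x\<bar> \<le> R then f (x, y) else 0) \<zeta> - g \<zeta>))
       \<longlongrightarrow> 0) at_top"

definition fourier :: "(real \<times> real \<Rightarrow> complex) \<Rightarrow> real \<times> int \<Rightarrow> complex" where
  "fourier f = (SOME g. is_fourier_transform f g)"

text \<open>Support of an almost-everywhere class: the complement of the largest open set on which
  the function vanishes almost everywhere.\<close>

definition ess_support :: "'a::topological_space measure \<Rightarrow> ('a \<Rightarrow> complex) \<Rightarrow> 'a set" where
  "ess_support M g =
     {z. \<forall>U. open U \<longrightarrow> z \<in> U \<longrightarrow> \<not> (AE w in M. w \<in> U \<longrightarrow> g w = 0)}"

definition dispersion :: "real \<Rightarrow> real \<Rightarrow> real \<Rightarrow> real" where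
  "dispersion \<alpha> \<xi> \<eta> = \<xi> * \<bar>\<xi>\<bar> powr \<alpha> - \<eta>\<^sup>2 / \<xi>"

definition propagator ::
    "real \<Rightarrow> real \<Rightarrow> (real \<times> real \<Rightarrow> complex) \<Rightarrow> real \<times> real \<Rightarrow> complex" where
  "propagator \<alpha> t f = (\<lambda>(x, y). 1 / (2 * of_real pi)\<^sup>2 *
     (LINT \<xi>|lborel. (\<Sum>\<^sub>\<infinity>\<eta>.
        exp (\<i> * of_real (x * \<xi> + y * of_int \<eta> + t * dispersion \<alpha> \<xi> (of_int \<eta>)))
          * fourier f (\<xi>, \<eta>))))"

text \<open>The constants \<open>c1\<close>, \<open>c2\<close> are those of \<open>\<bar>\<xi>\<bar> \<sim> N\<close>, and \<open>c3\<close> that of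
  \<open>\<bar>\<eta> / \<xi> - A\<bar> \<lesssim> N\<^bsup>\<alpha>/2\<^esup>\<close>.\<close>

definition frequency_region ::
    "real \<Rightarrow> real \<Rightarrow> real \<Rightarrow> real \<Rightarrow> real \<Rightarrow> real \<Rightarrow> (real \<times> int) set" where
  "frequency_region c1 c2 c3 \<alpha> N A = {(\<xi>, \<eta>). c1 * N \<le> \<bar>\<xi>\<bar> \<and> \<bar>\<xi>\<bar> \<le> c2 * N \<and>
     \<bar>of_int \<eta> / \<xi> - A\<bar> \<le> c3 * N powr (\<alpha> / 2)}"

end

theory Submission
  imports Defs "HOL-Probability.Probability" "HOL-Real_Asymp.Real_Asymp"
begin

text \<open>A Gaussian weight on \<open>[0, 1] \<times> \<real> \<times> \<T>\<close> and the \<open>T T\<^sup>*\<close> method, applied to the square of the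
  Fourier extension operator, reduce the \<open>L\<^sup>4\<close> bound to counting: for fixed \<open>(X, H, \<tau>)\<close>, one needs the
  measure of the frequencies \<open>(\<xi>, \<eta>)\<close> with \<open>\<omega>(\<xi>, \<eta>) + \<omega>(X - \<xi>, H - \<eta>) = \<tau> + O(1)\<close>. After rescaling
  to \<open>\<bar>\<xi>\<bar> \<sim> 1\<close> the spacing in \<open>\<eta>\<close> becomes \<open>h = N\<^bsup>-1-\<alpha>/2\<^esup>\<close> and the window \<open>\<delta> \<sim> N\<^bsup>-1-\<alpha>\<^esup>\<close>. The behaviour
  of the sum of the two dispersions is governed by \<open>curv = \<alpha>(\<alpha> + 1) - 2 \<eta>\<^sup>2 / \<xi>\<^bsup>\<alpha>+2\<^esup>\<close>, which may
  vanish. The frequency region is therefore split into \<open>O(1 + log N)\<close> pieces on which \<open>curv\<close> is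
  positive of dyadic size, negative of dyadic size, or at most \<open>1/(2N)\<close> in absolute value; on
  each of them the measure is \<open>O((1 + log N)\<^sup>2 \<delta>/h)\<close>. For large \<open>\<bar>A\<bar>\<close> only boundedly many dyadic sizes
  occur, so the number of pieces does not depend on \<open>A\<close>. Undoing the scaling gives
  \<open>N \<delta>/h \<sim> N\<^bsup>1-\<alpha>/2\<^esup>\<close>, whose fourth root is the claimed power.\<close>

section \<open>The dispersion relation\<close>

text \<open>Fix the sum of a pair and let g be the difference of its two \<open>disp_x\<close>
  values. Where |g| is about l, a slice in x has length at most about \<delta>/l, so the admissible
  \<eta> must number about l/h, up to a logarithm. The product \<delta>/h is the same on every
  dyadic level of |g|, and only the number of levels is lost. The obstacle is the bound l/h: it
  needs a move in \<eta> that changes the dispersion sum to first order, and the right move depends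
  on the sign of \<open>curv\<close>. For \<open>curv\<close> > 0 it is the move at fixed x. For
  \<open>curv\<close> < 0 the first-order term of that move may cancel, and x has to move along with
  \<eta>. Near \<open>curv\<close> = 0 convexity in x is lost, but \<open>curv\<close> then grows in
  x at a definite rate, so the set is thin. On a piece of curvature size d0 the lowest usable level
  is sqrt(\<delta> d0), which has to be at least h. With \<delta> = 4 N^(-1-\<alpha>) and h^2 =
  N^(-2-\<alpha>) this means d0 \<ge> 1/(4N), whence the threshold 1/(2N) for the innermost
  piece.\<close>

definition disp_x :: "real \<Rightarrow> real \<Rightarrow> real \<Rightarrow> real" where
  "disp_x \<alpha> x \<eta> = (\<alpha> + 1) * x powr \<alpha> + \<eta>\<^sup>2 / x\<^sup>2"

text \<open>The second x-derivative of the dispersion for x > 0, divided by x^(\<alpha>-1). That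
  factor is bounded above and below on the range considered, and after the division x and \<eta>
  occur in a single term only.\<close>

definition curv :: "real \<Rightarrow> real \<Rightarrow> real \<Rightarrow> real" where
  "curv \<alpha> x \<eta> = \<alpha> * (\<alpha> + 1) - 2 * \<eta>\<^sup>2 / x powr (\<alpha> + 2)"

lemma dispersion_pos: "x > 0 \<Longrightarrow> dispersion \<alpha> x \<eta> = x powr (\<alpha> + 1) - \<eta>\<^sup>2 / x"
  by (simp add: dispersion_def powr_add)

lemma has_real_derivative_dispersion:
  assumes "x > 0"
  shows "((\<lambda>x. dispersion \<alpha> x \<eta>) has_real_derivative disp_x \<alpha> x \<eta>) (at x)"
proof -
  have "((\<lambda>x. x powr (\<alpha> + 1) - \<eta>\<^sup>2 / x) has_real_derivative disp_x \<alpha> x \<eta>) (at x)"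
    unfolding disp_x_def using assms
    by (auto intro!: derivative_eq_intros simp: field_simps power2_eq_square)
  moreover have "\<forall>\<^sub>F y in nhds x. dispersion \<alpha> y \<eta> = y powr (\<alpha> + 1) - \<eta>\<^sup>2 / y"
    using eventually_gt_at_top[of 0] order_tendstoD(1)[OF filterlim_ident assms]
    by (auto elim!: eventually_mono intro: dispersion_pos)
  ultimately show ?thesis
    by (subst DERIV_cong_ev) (auto simp: )
qed

lemma has_real_derivative_disp_x:
  assumes "x > 0"
  shows "((\<lambda>x. disp_x \<alpha> x \<eta>) has_real_derivative x powr (\<alpha> - 1) * curv \<alpha> x \<eta>) (at x)"
proof -
  have "x powr (\<alpha> - 1) * (2 * \<eta>\<^sup>2 / x powr (\<alpha> + 2)) = 2 * \<eta>\<^sup>2 / x ^ 3"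
  proof -
    have "x powr (\<alpha> + 2) = x powr (\<alpha> - 1) * x ^ 3"
      using assms by (simp add: powr_add[symmetric] add.commute flip: powr_numeral)
    thus ?thesis using assms by (simp add: field_simps)
  qed
  hence eq: "x powr (\<alpha> - 1) * curv \<alpha> x \<eta> = (\<alpha> + 1) * (\<alpha> * x powr (\<alpha> - 1)) - 2 * \<eta>\<^sup>2 / x ^ 3"
    by (simp add: curv_def algebra_simps)
  show ?thesis unfolding disp_x_def eq using assms
    by (auto intro!: derivative_eq_intros simp: field_simps power2_eq_square power3_eq_cube)
qed

lemma has_real_derivative_reflect:
  assumes "(f has_real_derivative D) (at (X - t))"
  shows "((\<lambda>t. f (X - t :: real)) has_real_derivative - D) (at t)"
proof -
  have "((\<lambda>t. X - t) has_real_derivative -1) (at t)" by (auto intro!: derivative_eq_intros)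
  thus ?thesis using DERIV_chain2[of f D "\<lambda>t. X - t" t "-1" UNIV] assms by simp
qed

text \<open>With the \<eta>-components and the sum X fixed, a pair has one free variable t. The
  second derivative adds the two curvatures with positive weights, so a common sign of
  \<open>curv\<close> gives convexity or concavity.\<close>

lemma has_real_derivative_pair:
  assumes "0 < t" "0 < X - t"
  shows "((\<lambda>t. dispersion \<alpha> t e1 + dispersion \<alpha> (X - t) e2) has_real_derivative
      disp_x \<alpha> t e1 - disp_x \<alpha> (X - t) e2) (at t)"
    and "((\<lambda>t. disp_x \<alpha> t e1 - disp_x \<alpha> (X - t) e2) has_real_derivative
      t powr (\<alpha> - 1) * curv \<alpha> t e1 + (X - t) powr (\<alpha> - 1) * curv \<alpha> (X - t) e2) (at t)"
  using DERIV_add[OF has_real_derivative_dispersion[OF assms(1), of \<alpha> e1]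
      has_real_derivative_reflect[OF has_real_derivative_dispersion[OF assms(2), of \<alpha> e2]]]
    DERIV_diff[OF has_real_derivative_disp_x[OF assms(1), of \<alpha> e1]
      has_real_derivative_reflect[OF has_real_derivative_disp_x[OF assms(2), of \<alpha> e2]]]
  by simp_all

section \<open>Monotonicity of the curvature, and convex functions on a segment\<close>

lemma curv_mono_x:
  assumes "0 < x" "x \<le> y" "\<alpha> \<ge> 0"
  shows "curv \<alpha> x \<eta> \<le> curv \<alpha> y \<eta>"
proof -
  have "x powr (\<alpha> + 2) \<le> y powr (\<alpha> + 2)" using assms by (intro powr_mono2) auto
  hence "2 * \<eta>\<^sup>2 / y powr (\<alpha> + 2) \<le> 2 * \<eta>\<^sup>2 / x powr (\<alpha> + 2)"
    using assms by (intro divide_left_mono) auto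
  thus ?thesis by (simp add: curv_def)
qed

lemma curv_antimono_eta:
  assumes "0 \<le> \<eta>" "\<eta> \<le> \<zeta>"
  shows "curv \<alpha> x \<zeta> \<le> curv \<alpha> x \<eta>"
  using assms by (simp add: curv_def divide_right_mono power_mono)

lemma curv_diff_eta: "curv \<alpha> x \<eta> - curv \<alpha> x \<zeta> = 2 * (\<zeta>\<^sup>2 - \<eta>\<^sup>2) / x powr (\<alpha> + 2)"
  by (simp add: curv_def diff_divide_distrib algebra_simps)

text \<open>Convexity places f above its tangent at b, and the lower bound m on f'' makes f' grow at
  rate m. Writing the segment with \<open>min\<close> and \<open>max\<close> leaves the order of a
  and b open; in the applications it is not known on which side the second pair lies.\<close>

lemma convex_segment:
  fixes f f' f'' :: "real \<Rightarrow> real"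
  assumes f: "\<And>x. min a b \<le> x \<Longrightarrow> x \<le> max a b \<Longrightarrow> (f has_real_derivative f' x) (at x)"
    and f': "\<And>x. min a b \<le> x \<Longrightarrow> x \<le> max a b \<Longrightarrow> (f' has_real_derivative f'' x) (at x)"
    and f'': "\<And>x. min a b \<le> x \<Longrightarrow> x \<le> max a b \<Longrightarrow> m \<le> f'' x" and m: "0 \<le> m"
  shows "f b - f a \<le> f' b * (b - a)" and "m * \<bar>b - a\<bar> \<le> \<bar>f' b - f' a\<bar>"
proof -
  have inc: "m * (v - u) \<le> f' v - f' u" if "min a b \<le> u" "u \<le> v" "v \<le> max a b" for u v
  proof (cases "u = v")
    case False
    with that have "u < v" by simp
    then have "\<exists>z>u. z < v \<and> f' v - f' u = (v - u) * f'' z"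
      by (rule MVT2) (use that in \<open>auto intro: f'\<close>)
    then obtain z where "u < z" "z < v" "f' v - f' u = (v - u) * f'' z"
      by blast
    moreover have "m \<le> f'' z" using f'' that calculation by auto
    ultimately show ?thesis using that by (simp add: mult.commute mult_right_mono)
  qed simp
  show "m * \<bar>b - a\<bar> \<le> \<bar>f' b - f' a\<bar>"
  proof (cases "a \<le> b")
    case True thus ?thesis using inc[of a b] m by auto
  next
    case False thus ?thesis using inc[of b a] m by auto
  qed
  consider "a = b" | "a < b" | "b < a" by linarith
  thus "f b - f a \<le> f' b * (b - a)"
  proof cases
    case 2
    then have "\<exists>z>a. z < b \<and> f b - f a = (b - a) * f' z"
      by (rule MVT2) (use 2 in \<open>auto intro: f\<close>)
    then obtain z where z: "a < z" "z < b" "f b - f a = (b - a) * f' z"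
      by blast
    have "0 \<le> m * (b - z)" using z m by simp
    hence "f' z \<le> f' b" using inc[of z b] z 2 by auto
    thus ?thesis using z by (simp add: mult.commute mult_right_mono)
  next
    case 3
    then have "\<exists>z>b. z < a \<and> f a - f b = (a - b) * f' z"
      by (rule MVT2) (use 3 in \<open>auto intro: f\<close>)
    then obtain z where z: "b < z" "z < a" "f a - f b = (a - b) * f' z"
      by blast
    have "0 \<le> m * (z - b)" using z m by simp
    hence "f' b \<le> f' z" using inc[of b z] z 3 by auto
    hence "(a - b) * f' b \<le> (a - b) * f' z" using z by (intro mult_left_mono) auto
    thus ?thesis using z by (simp add: algebra_simps)
  qed simp
qed

text \<open>Completing the square in \<open>y1\<close> for a fixed sum \<open>y1 + y2\<close>.\<close>

lemma dispersion_sum: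
  fixes x1 x2 y1 y2 :: real
  assumes "x1 > 0" "x2 > 0"
  defines "\<theta> \<equiv> y1 - (y1 + y2) / (x1 + x2) * x1"
  shows "dispersion \<alpha> x1 y1 + dispersion \<alpha> x2 y2 =
    x1 powr (\<alpha> + 1) + x2 powr (\<alpha> + 1) - (y1 + y2)\<^sup>2 / (x1 + x2) - (1 / x1 + 1 / x2) * \<theta>\<^sup>2"
proof -
  have p: "x1 + x2 > 0" using assms by simp
  have t: "\<theta> = (y1 * x2 - y2 * x1) / (x1 + x2)"
    unfolding \<theta>_def using p by (simp add: field_simps)
  have q: "1 / x1 + 1 / x2 = (x1 + x2) / (x1 * x2)" using assms by (simp add: field_simps)
  have "(1 / x1 + 1 / x2) * \<theta>\<^sup>2 = (y1 * x2 - y2 * x1)\<^sup>2 / (x1 * x2 * (x1 + x2))"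
    unfolding t q power_divide using p by (simp add: power2_eq_square)
  moreover have "y1\<^sup>2 / x1 + y2\<^sup>2 / x2 = (y1 + y2)\<^sup>2 / (x1 + x2) +
      (y1 * x2 - y2 * x1)\<^sup>2 / (x1 * x2 * (x1 + x2))"
    using p assms by (simp add: divide_simps) (simp add: algebra_simps power2_eq_square)
  ultimately show ?thesis using assms by (simp add: dispersion_pos)
qed

text \<open>After rescaling the frequencies lie in [p, r]. The bounds are asked on the larger
  interval [p/2, 2r] because the argument for negative curvature passes through points slightly
  outside [p, r]. A single Q serves all weights, and Q \<ge> 6 lets numerical constants, such as the
  bound 6 for \<alpha>(\<alpha>+1), be absorbed into powers of Q.\<close>

locale dispersion_range =
  fixes \<alpha> p r Q :: real
  assumes alpha: "1 \<le> \<alpha>" "\<alpha> \<le> 2" and p: "0 < p" and pr: "p \<le> r" and Q: "6 \<le> Q"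
    and x_bounds: "\<And>x. p / 2 \<le> x \<Longrightarrow> x \<le> 2 * r \<Longrightarrow> 1 / Q \<le> x \<and> x \<le> Q"
    and x2_bounds: "\<And>x. p / 2 \<le> x \<Longrightarrow> x \<le> 2 * r \<Longrightarrow> 1 / Q \<le> 1 / x\<^sup>2 \<and> 1 / x\<^sup>2 \<le> Q"
    and powr_bounds: "\<And>x. p / 2 \<le> x \<Longrightarrow> x \<le> 2 * r \<Longrightarrow> 1 / Q \<le> x powr (\<alpha> - 1) \<and> x powr (\<alpha> - 1) \<le> Q"
    and inv_powr_bounds: "\<And>x. p / 2 \<le> x \<Longrightarrow> x \<le> 2 * r \<Longrightarrow>
          1 / Q \<le> 1 / x powr (\<alpha> + 2) \<and> 1 / x powr (\<alpha> + 2) \<le> Q"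
    and inv_powr_lipschitz: "\<And>x y. p / 2 \<le> x \<Longrightarrow> x \<le> y \<Longrightarrow> y \<le> 2 * r \<Longrightarrow>
          (y - x) / Q \<le> 1 / x powr (\<alpha> + 2) - 1 / y powr (\<alpha> + 2) \<and>
          1 / x powr (\<alpha> + 2) - 1 / y powr (\<alpha> + 2) \<le> Q * (y - x)"
begin

lemma alpha_prod: "2 \<le> \<alpha> * (\<alpha> + 1)" "\<alpha> * (\<alpha> + 1) \<le> 6"
  using mult_mono[of 1 \<alpha> 2 "\<alpha> + 1"] mult_mono[of \<alpha> 2 "\<alpha> + 1" 3] alpha by auto

lemma dom_pos: "p / 2 \<le> x \<Longrightarrow> x > 0"
  using p by linarith

text \<open>Mean value theorem with the weight z^(\<alpha>-1) between 1/Q and Q. Which end of this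
  range is the worse one depends on the sign of l, hence the case distinction in the bound.\<close>

lemma disp_x_incr_lower:
  assumes "p / 2 \<le> a" "a \<le> b" "b \<le> 2 * r" "\<And>x. a \<le> x \<Longrightarrow> x \<le> b \<Longrightarrow> l \<le> curv \<alpha> x \<eta>"
  shows "disp_x \<alpha> b \<eta> - disp_x \<alpha> a \<eta> \<ge> (if l \<ge> 0 then l / Q else l * Q) * (b - a)"
proof (cases "a = b")
  case False
  with assms have "a < b" by simp
  then have "\<exists>z>a. z < b \<and> disp_x \<alpha> b \<eta> - disp_x \<alpha> a \<eta> = (b - a) * (z powr (\<alpha> - 1) * curv \<alpha> z \<eta>)"
    by (rule MVT2) (use assms dom_pos in \<open>auto intro!: has_real_derivative_disp_x\<close>)
  then obtain z where z: "a < z" "z < b"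
    "disp_x \<alpha> b \<eta> - disp_x \<alpha> a \<eta> = (b - a) * (z powr (\<alpha> - 1) * curv \<alpha> z \<eta>)" by blast
  have pw: "1 / Q \<le> z powr (\<alpha> - 1)" "z powr (\<alpha> - 1) \<le> Q" "0 \<le> z powr (\<alpha> - 1)"
    using powr_bounds[of z] z assms by auto
  have "l \<le> curv \<alpha> z \<eta>" using assms z by auto
  hence "z powr (\<alpha> - 1) * l \<le> z powr (\<alpha> - 1) * curv \<alpha> z \<eta>"
    using pw by (intro mult_left_mono) auto
  moreover have "(if l \<ge> 0 then l / Q else l * Q) \<le> z powr (\<alpha> - 1) * l"
    using mult_right_mono[OF pw(1), of l] mult_right_mono_neg[OF pw(2), of l] by (auto simp: mult.commute)
  ultimately show ?thesis using z by (simp add: mult.commute mult_right_mono)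
qed simp

lemma disp_x_incr_upper:
  assumes "p / 2 \<le> a" "a \<le> b" "b \<le> 2 * r" "\<And>x. a \<le> x \<Longrightarrow> x \<le> b \<Longrightarrow> curv \<alpha> x \<eta> \<le> u" "0 \<le> u"
  shows "disp_x \<alpha> b \<eta> - disp_x \<alpha> a \<eta> \<le> Q * u * (b - a)"
proof (cases "a = b")
  case False
  with assms have "a < b" by simp
  then have "\<exists>z>a. z < b \<and> disp_x \<alpha> b \<eta> - disp_x \<alpha> a \<eta> = (b - a) * (z powr (\<alpha> - 1) * curv \<alpha> z \<eta>)"
    by (rule MVT2) (use assms dom_pos in \<open>auto intro!: has_real_derivative_disp_x\<close>)
  then obtain z where z: "a < z" "z < b"
    "disp_x \<alpha> b \<eta> - disp_x \<alpha> a \<eta> = (b - a) * (z powr (\<alpha> - 1) * curv \<alpha> z \<eta>)" by blast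
  have pw: "z powr (\<alpha> - 1) \<le> Q" "0 \<le> z powr (\<alpha> - 1)"
    using powr_bounds[of z] z assms by auto
  have "curv \<alpha> z \<eta> \<le> u" using assms z by auto
  hence "z powr (\<alpha> - 1) * curv \<alpha> z \<eta> \<le> z powr (\<alpha> - 1) * u"
    using pw by (intro mult_left_mono) auto
  also have "\<dots> \<le> Q * u" using pw assms by (intro mult_right_mono) auto
  finally show ?thesis using z by (simp add: mult.commute mult_right_mono)
qed simp

section \<open>Comparison of two pairs of positive curvature\<close>

lemma disp_x_diff:
  "disp_x \<alpha> x1 e1 - disp_x \<alpha> x2 e2 = (e1\<^sup>2 - e2\<^sup>2) / x1\<^sup>2 + (disp_x \<alpha> x1 e2 - disp_x \<alpha> x2 e2)"
  by (simp add: disp_x_def diff_divide_distrib)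

lemma sq_div_bounds:
  assumes "p / 2 \<le> x" "x \<le> 2 * r" "0 \<le> c"
  shows "c / Q \<le> c / x\<^sup>2" "c / x\<^sup>2 \<le> Q * c"
  using mult_left_mono[OF conjunct1[OF x2_bounds[OF assms(1,2)]] assms(3)]
    mult_left_mono[OF conjunct2[OF x2_bounds[OF assms(1,2)]] assms(3)] by (auto simp: mult.commute)

text \<open>Let k be half the difference and H the sum of e1 and e2. The larger \<eta> in the first
  slot raises \<open>disp_x\<close> by at least 2kH/Q, far more than the allowed difference l, so
  the change from x1 to x2 has to compensate. For \<open>curv\<close> > 0 the function
  \<open>disp_x\<close> increases in x, which puts x1 to the left of x2. Its slope between them is
  at most 2 Q d0, and this turns the compensation into a distance of order kH/d0.\<close>

lemma plus_left:
  assumes dom: "p \<le> x1" "x1 \<le> r" "p \<le> x2" "x2 \<le> r"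
    and e: "0 \<le> e2" "e2 < e1" and H: "1 / Q\<^sup>2 < e1 + e2"
    and d: "0 < d0" "d0 \<le> curv \<alpha> x2 e2" "curv \<alpha> x2 e2 \<le> 2 * d0"
    and l: "0 < l" "32 * Q ^ 12 * l \<le> (e1 - e2) / 2"
    and Fx: "disp_x \<alpha> x1 e1 - disp_x \<alpha> x2 e2 \<le> l"
  shows "x1 < x2" "(e1 - e2) / 2 * (e1 + e2) / (2 * Q\<^sup>2 * d0) \<le> x2 - x1"
proof -
  define k where "k = (e1 - e2) / 2"
  define H where "H = e1 + e2"
  have k: "0 < k" using e by (simp add: k_def)
  have Hp: "0 < H" using e by (simp add: H_def)
  have Q0: "0 < Q" using Q by simp
  have sq: "e1\<^sup>2 - e2\<^sup>2 = 2 * k * H" by (simp add: k_def H_def power2_eq_square algebra_simps)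
  have lk: "l * Q ^ 4 \<le> k"
  proof -
    have "l * Q ^ 4 \<le> l * Q ^ 12" using l Q by (intro mult_left_mono power_increasing) auto
    also have "\<dots> \<le> 32 * Q ^ 12 * l" using l Q0 by auto
    also have "\<dots> \<le> k" using l(2) by (simp only: k_def)
    finally show ?thesis .
  qed
  have HQ: "1 < H * Q\<^sup>2" using H Q0 by (simp add: H_def field_simps)
  \<comment> \<open>This is where H > 1/Q^2 enters: l Q^3 \<le> k, and k < k H Q^2.\<close>
  have lkH: "l < k * H / Q"
  proof -
    have "l * Q ^ 3 \<le> l * Q ^ 4" using l Q by (intro mult_left_mono power_increasing) auto
    hence "l * Q ^ 3 \<le> k" using lk by simp
    also have "k < k * (H * Q\<^sup>2)" using k HQ by simp
    finally have "l * Q * Q\<^sup>2 < k * H * Q\<^sup>2" by (simp add: power2_eq_square power3_eq_cube algebra_simps)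
    hence "l * Q < k * H" using Q0 by simp
    thus ?thesis using Q0 by (simp add: field_simps)
  qed
  have main: "2 * k * H / Q \<le> (e1\<^sup>2 - e2\<^sup>2) / x1\<^sup>2"
    unfolding sq using dom p k Hp by (intro sq_div_bounds) auto
  have pos: "0 < k * H / Q" using k Hp Q0 by simp
  show lt: "x1 < x2"
  proof (rule ccontr)
    assume "\<not> x1 < x2"
    hence "disp_x \<alpha> x1 e2 - disp_x \<alpha> x2 e2 \<ge> (if (0::real) \<ge> 0 then 0 / Q else 0 * Q) * (x1 - x2)"
      using dom p d alpha
      by (intro disp_x_incr_lower) (auto intro: order_trans[OF _ curv_mono_x[of x2]])
    hence "2 * k * H / Q \<le> l" using main Fx disp_x_diff[of x1 e1 x2 e2] by simp
    hence "2 * (k * H / Q) \<le> l" by (simp only: mult.assoc times_divide_eq_right)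
    thus False using lkH pos by (smt (verit))
  qed
  define M where "M = k * H / Q"
  have "disp_x \<alpha> x2 e2 - disp_x \<alpha> x1 e2 \<le> Q * (2 * d0) * (x2 - x1)"
    using dom p d lt alpha
    by (intro disp_x_incr_upper) (auto intro: order_trans[OF curv_mono_x[of _ x2]])
  moreover have "2 * M \<le> (e1\<^sup>2 - e2\<^sup>2) / x1\<^sup>2" using main by (simp add: M_def)
  ultimately have "M \<le> Q * (2 * d0) * (x2 - x1)"
    using lkH Fx disp_x_diff[of x1 e1 x2 e2] unfolding M_def[symmetric] by linarith
  hence "k * H \<le> (x2 - x1) * (2 * Q\<^sup>2 * d0)" using Q0 by (simp add: M_def field_simps power2_eq_square)
  thus "(e1 - e2) / 2 * (e1 + e2) / (2 * Q\<^sup>2 * d0) \<le> x2 - x1"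
    using Q0 d by (simp add: k_def H_def pos_divide_le_eq)
qed

lemma eta_bound:
  assumes "p / 2 \<le> x" "x \<le> 2 * r" "0 \<le> curv \<alpha> x e" "0 \<le> e"
  shows "e \<le> Q"
proof -
  have "2 * e\<^sup>2 * (1 / Q) \<le> 2 * e\<^sup>2 * (1 / x powr (\<alpha> + 2))"
    using inv_powr_bounds[of x] assms by (intro mult_left_mono) auto
  also have "\<dots> \<le> 6" using assms alpha_prod by (simp add: curv_def)
  finally have "e\<^sup>2 \<le> 3 * Q" using Q by (simp add: field_simps)
  also have "\<dots> \<le> Q\<^sup>2" using Q by (simp add: power2_eq_square)
  finally show ?thesis using Q by (simp add: power2_le_iff_abs_le)
qed

text \<open>Degeneracy requires the \<eta>-term to reach \<alpha>(\<alpha>+1) \<ge> 2. Pairs whose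
  \<eta> are below 1/Q^2 are therefore uniformly curved, which settles the case of small H that
  \<open>plus_left\<close> does not cover.\<close>

lemma curv_small_eta:
  assumes "p / 2 \<le> x" "x \<le> 2 * r" "0 \<le> e" "e \<le> 1 / Q\<^sup>2"
  shows "1 \<le> curv \<alpha> x e"
proof -
  have "2 * e\<^sup>2 * (1 / x powr (\<alpha> + 2)) \<le> 2 * e\<^sup>2 * Q"
    using inv_powr_bounds[of x] assms by (intro mult_left_mono) auto
  also have "\<dots> \<le> 2 * (1 / Q\<^sup>2)\<^sup>2 * Q" using assms Q by (intro mult_mono power_mono) auto
  also have "\<dots> = 2 / Q ^ 3" using Q by (simp add: field_simps power2_eq_square power3_eq_cube)
  also have "\<dots> \<le> 2 / 6 ^ 3" using Q by (intro divide_left_mono power_mono) auto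
  finally show ?thesis using alpha_prod by (simp add: curv_def)
qed

text \<open>The second pair is reached in two moves. Changing the \<eta>-components by D = f1 - e1
  at fixed x lowers the dispersion sum by at least about \<theta> D, by completing the square.
  Sliding x1 to y1 at the new \<eta> raises it by at most l |y1 - x1|, by convexity and the
  derivative bound at y1. The two sums differ by at most 2 \<delta>, and |y1 - x1| is of order (l +
  D)/d0, so \<theta> D d0 is of order l^2 + l D. As \<theta> is at least of order k/d0, the same
  holds for k D, and since k is a large multiple of l this leaves D \<le> l.\<close>

lemma plus_pair:
  assumes dom: "x1 \<in> {p..r}" "x2 \<in> {p..r}" "y1 \<in> {p..r}" "y2 \<in> {p..r}"
    and sums: "x1 + x2 = y1 + y2" "e1 + e2 = f1 + f2"
    and e: "0 \<le> e2" "0 \<le> f2" and k: "k = (e1 - e2) / 2"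
    and kk: "e1 \<le> f1" "f1 - e1 \<le> k / 2"
    and l: "0 < l" "32 * Q ^ 12 * l \<le> k"
    and d: "0 < d0" "d0 \<le> curv \<alpha> x1 e1" "curv \<alpha> x1 e1 \<le> 2 * d0"
      "d0 \<le> curv \<alpha> x2 e2" "curv \<alpha> x2 e2 \<le> 2 * d0"
      "d0 \<le> curv \<alpha> y1 f1" "curv \<alpha> y1 f1 \<le> 2 * d0"
      "d0 \<le> curv \<alpha> y2 f2" "curv \<alpha> y2 f2 \<le> 2 * d0"
    and Fx: "\<bar>disp_x \<alpha> x1 e1 - disp_x \<alpha> x2 e2\<bar> \<le> l" "\<bar>disp_x \<alpha> y1 f1 - disp_x \<alpha> y2 f2\<bar> \<le> l"
    and F: "\<bar>(dispersion \<alpha> x1 e1 + dispersion \<alpha> x2 e2) -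
        (dispersion \<alpha> y1 f1 + dispersion \<alpha> y2 f2)\<bar> \<le> 2 * \<delta>"
    and delta: "\<delta> * d0 \<le> l\<^sup>2"
  shows "f1 - e1 \<le> l"
proof -
  define H where "H = e1 + e2"
  define X where "X = x1 + x2"
  define D where "D = f1 - e1"
  define \<theta> where "\<theta> = e1 - (e1 + e2) / (x1 + x2) * x1"
  have Q0: "0 < Q" and Q1: "1 \<le> Q" using Q by auto
  have Qp: "0 < Q ^ n" "1 \<le> Q ^ n" for n using Q1 by auto
  have k0: "0 < k" using l Qp(1)[of 12] mult_pos_pos[of "32 * Q ^ 12" l] by linarith
  have xpos: "0 < x1" "0 < x2" "0 < y1" "0 < y2" using dom p by auto
  have dom': "p / 2 \<le> x1" "x1 \<le> 2 * r" "p / 2 \<le> x2" "x2 \<le> 2 * r"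
    "p / 2 \<le> y1" "y1 \<le> 2 * r" "p / 2 \<le> y2" "y2 \<le> 2 * r" using dom p by auto
  have e12: "e2 < e1" using k k0 by simp
  have D: "0 \<le> D" "D \<le> k / 2" using kk by (auto simp: D_def)
  have ff: "f1 = e1 + D" "f2 = e2 - D" using sums by (auto simp: D_def)
  have kH: "2 * k \<le> H" using k e by (simp add: H_def)
  have H0: "0 < H" using kH k0 by simp
  have eH: "e1 = H / 2 + k" "e2 = H / 2 - k" by (auto simp: H_def k field_simps)
  have H2Q: "H \<le> 2 * Q"
    using eta_bound[of x1 e1] eta_bound[of x2 e2] dom' d e e12 by (simp add: H_def)
  have X: "2 / Q \<le> X" "X \<le> 2 * Q" "0 < X"
    using x_bounds[of x1] x_bounds[of x2] dom' xpos by (auto simp: X_def)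
  \<comment> \<open>Both terms help: k is half the gap of the \<eta>-components, and by
    \<open>plus_left\<close> x2 - x1 is positive and at least of order k/d0 unless H is
    small.\<close>
  have theta: "\<theta> = k + H / X * (x2 - x1) / 2"
  proof -
    have x: "x2 - x1 = X - 2 * x1" by (simp add: X_def)
    have "H / X * (X - 2 * x1) / 2 = H / 2 - H / X * x1" using X by (simp add: field_simps)
    thus ?thesis
      unfolding \<theta>_def H_def[symmetric] X_def[symmetric] x by (simp add: eH(1))
  qed
  have lk: "c * Q ^ n * l \<le> k" if "n \<le> 12" "c \<le> 32" for n c
  proof -
    have "c * Q ^ n * l \<le> 32 * Q ^ n * l"
      using that l Qp(1)[of n] by (intro mult_right_mono) auto
    also have "\<dots> \<le> 32 * Q ^ 12 * l" using that Q1 l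
      by (intro mult_right_mono mult_left_mono power_increasing) auto
    finally show ?thesis using l(2) by (rule order_trans)
  qed
  have d6: "d0 \<le> 6"
  proof -
    have "curv \<alpha> x1 e1 \<le> \<alpha> * (\<alpha> + 1)" by (simp add: curv_def)
    thus ?thesis using d alpha_prod by simp
  qed
  have small: "1 \<le> curv \<alpha> x \<eta>" if "H \<le> 1 / Q\<^sup>2" "0 \<le> \<eta>" "\<eta> \<le> H" "p / 2 \<le> x" "x \<le> 2 * r" for x \<eta>
    using curv_small_eta that by simp
  have big: "x1 < x2 \<and> k * H / (2 * Q\<^sup>2 * d0) \<le> x2 - x1" if "\<not> H \<le> 1 / Q\<^sup>2"
    using plus_left[of x1 x2 e2 e1 d0 l] that dom e e12 d l Fx unfolding H_def k by auto
  \<comment> \<open>For H \<le> 1/Q^2 the curvatures are at least 1, so d0 \<ge> 1/2 and half of k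
    suffices; x1 may then exceed x2, but only by Q l. For larger H the term with x2 - x1 gives the
    bound, with H \<ge> 1/Q^2 used twice.\<close>
  have theta_ge: "k / (8 * Q ^ 7 * d0) \<le> \<theta>"
  proof (cases "H \<le> 1 / Q\<^sup>2")
    case True
    have "1 \<le> 2 * d0" using small[OF True, of e1 x1] d dom' e e12 by (simp add: H_def)
    hence "1 \<le> 2 * d0 * Q ^ 7" using Qp(2)[of 7] mult_mono[of 1 "2 * d0" 1 "Q ^ 7"] by simp
    hence "k * 2 \<le> k * (8 * Q ^ 7 * d0)" using k0 by (intro mult_left_mono) auto
    hence *: "k / (8 * Q ^ 7 * d0) \<le> k / 2" using d Qp(1)[of 7] by (simp add: field_simps)
    have "- (H / X * (x2 - x1) / 2) \<le> k / 2"
    proof (cases "x1 \<ge> x2")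
      case ge: True
      have "(if (1::real) \<ge> 0 then 1 / Q else 1 * Q) * (x1 - x2) \<le> disp_x \<alpha> x1 e2 - disp_x \<alpha> x2 e2"
        using ge dom' p e e12 by (intro disp_x_incr_lower small[OF True]) (auto simp: H_def)
      moreover have "0 \<le> (e1\<^sup>2 - e2\<^sup>2) / x1\<^sup>2" using e e12 by (simp add: power_mono)
      ultimately have "(x1 - x2) / Q \<le> l" using Fx disp_x_diff[of x1 e1 x2 e2] by simp
      hence s: "x1 - x2 \<le> Q * l" using Q0 by (simp add: field_simps)
      have "H / X \<le> (1 / Q\<^sup>2) / (2 / Q)" using True X Q0 H0 by (intro frac_le) auto
      also have "\<dots> \<le> 1" using Q by (simp add: power2_eq_square)
      finally have "H / X * (x1 - x2) \<le> 1 * (Q * l)" using s ge H0 X by (intro mult_mono) auto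
      also have "\<dots> \<le> k" using lk[of 1 1] by simp
      finally have *: "H / X * (x1 - x2) \<le> k" .
      define u where "u = H / X"
      have "u * x1 - u * x2 \<le> k" using * by (simp add: u_def right_diff_distrib)
      hence "(u * x1 - u * x2) / 2 \<le> k / 2" by (rule divide_right_mono) simp
      moreover have "- (u * (x2 - x1) / 2) = (u * x1 - u * x2) / 2"
        unfolding minus_divide_left by (simp only: right_diff_distrib minus_diff_eq)
      ultimately show ?thesis unfolding u_def[symmetric] by simp
    next
      case False
      hence "0 \<le> H / X * (x2 - x1) / 2" using H0 X by simp
      thus ?thesis using k0 by linarith
    qed
    thus ?thesis using * theta by linarith
  next
    case False
    have HQ: "1 \<le> H * Q\<^sup>2" using False Q0 by (simp add: field_simps)
    have "k / (8 * Q ^ 7 * d0) \<le> H / (2 * Q) * (k * H / (2 * Q\<^sup>2 * d0)) / 2"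
    proof -
      have "k * 1 \<le> k * ((H * Q\<^sup>2) * (H * Q\<^sup>2))"
        using HQ k0 mult_mono[of 1 "H * Q\<^sup>2" 1 "H * Q\<^sup>2"] by (intro mult_left_mono) auto
      thus ?thesis using d Q0 by (simp add: field_simps power2_eq_square eval_nat_numeral)
    qed
    also have "\<dots> \<le> H / X * (x2 - x1) / 2"
    proof (intro divide_right_mono mult_mono)
      show "H / (2 * Q) \<le> H / X" using X H0 by (intro divide_left_mono) auto
    qed (use big[OF False] H0 X k0 d in auto)
    finally show ?thesis using theta k0 by linarith
  qed
  \<comment> \<open>The mixed point (x1, f1) belongs to neither pair, so its curvature needs an
    argument. When H is not small, lowering \<eta> from e1 to e2 at x1 raises \<open>curv\<close> by
    at most d0, because curv at (x2, e2) is at most 2 d0 and x1 < x2. This controls k H, and raising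
    \<eta> by D \<le> k/2 then costs at most 9/16 of d0.\<close>
  have c_x1: "d0 / 6 \<le> curv \<alpha> x1 f1"
  proof (cases "H \<le> 1 / Q\<^sup>2")
    case True
    have "f1 \<le> H" using sums e by (simp add: H_def)
    thus ?thesis using small[OF True, of f1 x1] d6 dom' kk e e12 by simp
  next
    case False
    define w where "w = 1 / x1 powr (\<alpha> + 2)"
    have w: "0 < w" using inv_powr_bounds[of x1] dom' Q0 unfolding w_def
      using xpos(1) by auto
    have "curv \<alpha> x1 e2 \<le> curv \<alpha> x2 e2" using big[OF False] xpos alpha by (intro curv_mono_x) auto
    hence "curv \<alpha> x1 e2 - curv \<alpha> x1 e1 \<le> d0" using d by simp
    moreover have "curv \<alpha> x1 e2 - curv \<alpha> x1 e1 = 4 * k * H * w"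
    proof -
      have "e1\<^sup>2 - e2\<^sup>2 = 2 * k * H" unfolding eH by (simp add: power2_eq_square algebra_simps)
      thus ?thesis unfolding curv_diff_eta w_def by simp
    qed
    moreover have "curv \<alpha> x1 e1 - curv \<alpha> x1 f1 = 2 * (D * (H + 2 * k + D)) * w"
    proof -
      have "f1\<^sup>2 - e1\<^sup>2 = D * (H + 2 * k + D)"
        unfolding ff eH by (simp add: power2_eq_square algebra_simps)
      thus ?thesis unfolding curv_diff_eta w_def by simp
    qed
    moreover have "D * (H + 2 * k + D) \<le> k / 2 * (H + H + H / 4)"
      using D kH k0 H0 by (intro mult_mono) auto
    hence "2 * (D * (H + 2 * k + D)) \<le> 2 * (k / 2 * (H + H + H / 4))" by (rule mult_left_mono) simp
    hence "2 * (D * (H + 2 * k + D)) * w \<le> 2 * (k / 2 * (H + H + H / 4)) * w"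
      using w by (intro mult_right_mono) simp_all
    ultimately have "curv \<alpha> x1 e1 - curv \<alpha> x1 f1 \<le> 9 / 16 * d0" by (simp add: algebra_simps)
    thus ?thesis using d by simp
  qed
  have c_x2: "d0 / 6 \<le> curv \<alpha> x2 f2"
  proof -
    have "curv \<alpha> x2 e2 \<le> curv \<alpha> x2 f2" using e ff D by (intro curv_antimono_eta) auto
    thus ?thesis using d by simp
  qed
  define f where "f = (\<lambda>t. dispersion \<alpha> t f1 + dispersion \<alpha> (X - t) f2)"
  define f' where "f' = (\<lambda>t. disp_x \<alpha> t f1 - disp_x \<alpha> (X - t) f2)"
  define f'' where "f'' = (\<lambda>t. t powr (\<alpha> - 1) * curv \<alpha> t f1 +
     (X - t) powr (\<alpha> - 1) * curv \<alpha> (X - t) f2)"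
  have seg: "p \<le> t \<and> t \<le> r \<and> p \<le> X - t \<and> X - t \<le> r" if "min x1 y1 \<le> t" "t \<le> max x1 y1" for t
    using that dom sums by (auto simp: X_def min_def max_def split: if_splits)
  have df: "(f has_real_derivative f' t) (at t)" if "min x1 y1 \<le> t" "t \<le> max x1 y1" for t
  proof -
    have "0 < t" "0 < X - t" using seg[OF that] p by auto
    thus ?thesis unfolding f_def f'_def by (rule has_real_derivative_pair)
  qed
  have df': "(f' has_real_derivative f'' t) (at t)" if "min x1 y1 \<le> t" "t \<le> max x1 y1" for t
  proof -
    have "0 < t" "0 < X - t" using seg[OF that] p by auto
    thus ?thesis unfolding f'_def f''_def by (rule has_real_derivative_pair)
  qed
  \<comment> \<open>\<open>curv\<close> increases in x, so the left end of the segment is the worst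
    point for each component, and there the curvature is one already bounded.\<close>
  have lower: "d0 / (3 * Q) \<le> f'' t" if t: "min x1 y1 \<le> t" "t \<le> max x1 y1" for t
  proof -
    note s = seg[OF t]
    have "curv \<alpha> (min x1 y1) f1 \<le> curv \<alpha> t f1" using t xpos alpha by (intro curv_mono_x) auto
    hence 1: "d0 / 6 \<le> curv \<alpha> t f1" using c_x1 d by (auto simp: min_def split: if_splits)
    have "curv \<alpha> (min x2 y2) f2 \<le> curv \<alpha> (X - t) f2"
      using t xpos alpha sums by (intro curv_mono_x) (auto simp: X_def)
    hence 2: "d0 / 6 \<le> curv \<alpha> (X - t) f2" using c_x2 d by (auto simp: min_def split: if_splits)
    have "1 / Q * (d0 / 6) \<le> t powr (\<alpha> - 1) * curv \<alpha> t f1"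
      using powr_bounds[of t] s p 1 d by (intro mult_mono) auto
    moreover have "1 / Q * (d0 / 6) \<le> (X - t) powr (\<alpha> - 1) * curv \<alpha> (X - t) f2"
      using powr_bounds[of "X - t"] s p 2 d by (intro mult_mono) auto
    ultimately have "1 / Q * (d0 / 6) + 1 / Q * (d0 / 6) \<le> f'' t" unfolding f''_def by linarith
    thus ?thesis by (simp add: field_simps)
  qed
  have m0: "0 \<le> d0 / (3 * Q)" using d Q0 by simp
  note cs = convex_segment[where f = f and f' = f' and f'' = f'' and a = x1 and b = y1
      and m = "d0 / (3 * Q)", OF df df' lower m0]
  have Xy: "X - y1 = y2" "X - x1 = x2" using sums by (auto simp: X_def)
  have f'y: "\<bar>f' y1\<bar> \<le> l" using Fx by (simp add: f'_def Xy)
  \<comment> \<open>Only \<eta> changes between this derivative and the one bounded by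
    \<open>Fx\<close>; the change is at most 4 Q^2 D because H \<le> 2 Q.\<close>
  have f'x: "\<bar>f' x1\<bar> \<le> l + 4 * Q\<^sup>2 * D"
  proof -
    have eq: "f' x1 = disp_x \<alpha> x1 e1 - disp_x \<alpha> x2 e2 + (D * (f1 + e1) / x1\<^sup>2 + D * (f2 + e2) / x2\<^sup>2)"
    proof -
      have "f1\<^sup>2 = e1\<^sup>2 + D * (f1 + e1)" "f2\<^sup>2 = e2\<^sup>2 - D * (f2 + e2)"
        unfolding ff by (simp_all add: power2_eq_square algebra_simps)
      thus ?thesis unfolding f'_def Xy disp_x_def
        by (simp only: add_divide_distrib diff_divide_distrib)
    qed
    have a: "0 \<le> D * (f1 + e1) / x1\<^sup>2" "0 \<le> D * (f2 + e2) / x2\<^sup>2" using D kk e e12 by auto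
    have "D * (f1 + e1) / x1\<^sup>2 \<le> Q * (D * (f1 + e1))" "D * (f2 + e2) / x2\<^sup>2 \<le> Q * (D * (f2 + e2))"
      using dom' D kk e e12 by (intro sq_div_bounds; simp)+
    hence "D * (f1 + e1) / x1\<^sup>2 + D * (f2 + e2) / x2\<^sup>2 \<le> Q * D * (2 * H)"
      using sums by (simp add: H_def ff algebra_simps)
    also have "\<dots> \<le> Q * D * (2 * (2 * Q))" using H2Q Q0 D by (intro mult_left_mono) auto
    finally have "D * (f1 + e1) / x1\<^sup>2 + D * (f2 + e2) / x2\<^sup>2 \<le> 4 * Q\<^sup>2 * D"
      by (simp add: power2_eq_square algebra_simps)
    thus ?thesis using eq a Fx by linarith
  qed
  have yx: "d0 * \<bar>y1 - x1\<bar> \<le> 3 * Q * (2 * l + 4 * Q\<^sup>2 * D)"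
  proof -
    have "d0 / (3 * Q) * \<bar>y1 - x1\<bar> \<le> \<bar>f' y1 - f' x1\<bar>" by (rule cs(2))
    also have "\<dots> \<le> 2 * l + 4 * Q\<^sup>2 * D" using f'y f'x by linarith
    finally show ?thesis using Q0 by (simp add: field_simps)
  qed
  \<comment> \<open>The tangent is taken at y1 because the derivative there is at most l, without an
    error depending on D.\<close>
  have "f y1 - f x1 \<le> f' y1 * (y1 - x1)" by (rule cs(1))
  also have "\<dots> \<le> \<bar>f' y1\<bar> * \<bar>y1 - x1\<bar>" by (metis abs_ge_self abs_mult)
  also have "\<dots> \<le> l * \<bar>y1 - x1\<bar>" using f'y by (intro mult_right_mono) auto
  finally have step1: "f y1 - f x1 \<le> l * \<bar>y1 - x1\<bar>" .
  have step2: "f x1 - (dispersion \<alpha> x1 e1 + dispersion \<alpha> x2 e2) \<le> - (4 / Q * \<theta> * D)"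
  proof -
    have th': "f1 - (f1 + f2) / (x1 + x2) * x1 = \<theta> + D" using sums by (simp add: \<theta>_def D_def)
    have "f x1 = x1 powr (\<alpha> + 1) + x2 powr (\<alpha> + 1) - (f1 + f2)\<^sup>2 / (x1 + x2) - (1 / x1 + 1 / x2) * (\<theta> + D)\<^sup>2"
      unfolding f_def Xy using dispersion_sum[OF xpos(1,2), of \<alpha> f1 f2] unfolding th' by simp
    hence "f x1 - (dispersion \<alpha> x1 e1 + dispersion \<alpha> x2 e2) =
        - ((1 / x1 + 1 / x2) * (2 * \<theta> * D + D\<^sup>2))"
      using dispersion_sum[OF xpos(1,2), of \<alpha> e1 e2] sums
      unfolding \<theta>_def[symmetric] by (simp add: power2_eq_square algebra_simps)
    moreover have "(1 / Q + 1 / Q) * (2 * \<theta> * D) \<le> (1 / x1 + 1 / x2) * (2 * \<theta> * D + D\<^sup>2)"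
    proof (intro mult_mono add_mono)
      show "1 / Q \<le> 1 / x1" "1 / Q \<le> 1 / x2"
        using x_bounds[of x1] x_bounds[of x2] dom' xpos by (auto intro!: divide_left_mono simp: Q0)
      have "0 \<le> k / (8 * Q ^ 7 * d0)" using k0 d Q0 by auto
      hence "0 \<le> \<theta>" using theta_ge by linarith
      thus "0 \<le> 2 * \<theta> * D" using D by auto
    qed (use xpos in auto)
    ultimately show ?thesis by (simp add: algebra_simps)
  qed
  have fy: "f y1 = dispersion \<alpha> y1 f1 + dispersion \<alpha> y2 f2" by (simp add: f_def Xy)
  have "4 / Q * \<theta> * D \<le> 2 * \<delta> + l * \<bar>y1 - x1\<bar>" using step1 step2 F fy by linarith
  \<comment> \<open>Multiplying by d0 clears the denominators: \<delta> d0 is at most l^2, and d0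
    |y1 - x1| is bounded by \<open>yx\<close>.\<close>
  hence "4 / Q * \<theta> * D * d0 \<le> (2 * \<delta> + l * \<bar>y1 - x1\<bar>) * d0"
    using d by (intro mult_right_mono) auto
  also have "\<dots> = 2 * (\<delta> * d0) + l * (d0 * \<bar>y1 - x1\<bar>)" by (simp add: algebra_simps)
  also have "\<dots> \<le> 2 * l\<^sup>2 + l * (3 * Q * (2 * l + 4 * Q\<^sup>2 * D))"
    using yx delta l by (intro add_mono mult_left_mono) auto
  finally have up: "4 / Q * \<theta> * D * d0 \<le> 2 * l\<^sup>2 + 6 * Q * l\<^sup>2 + 12 * Q ^ 3 * l * D"
    by (simp add: power2_eq_square power3_eq_cube algebra_simps)
  have "4 / Q * (k / (8 * Q ^ 7 * d0)) * D * d0 \<le> 4 / Q * \<theta> * D * d0"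
    using theta_ge D d Q0 by (intro mult_right_mono mult_left_mono) auto
  moreover have "4 / Q * (k / (8 * Q ^ 7 * d0)) * D * d0 = k * D / (2 * Q ^ 8)"
    using d Q0 by (simp add: field_simps eval_nat_numeral)
  ultimately have "k * D / (2 * Q ^ 8) \<le> 2 * l\<^sup>2 + 6 * Q * l\<^sup>2 + 12 * Q ^ 3 * l * D" using up by linarith
  hence "k * D \<le> (2 * l\<^sup>2 + 6 * Q * l\<^sup>2 + 12 * Q ^ 3 * l * D) * (2 * Q ^ 8)"
    using Q0 by (simp add: pos_divide_le_eq)
  hence "k * D \<le> 4 * Q ^ 8 * l\<^sup>2 + 12 * Q ^ 9 * l\<^sup>2 + 24 * Q ^ 11 * l * D"
    by (simp add: algebra_simps eval_nat_numeral)
  \<comment> \<open>The factor 32 Q^12 of the hypothesis exceeds the coefficient 24 Q^11 of l D, so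
    that term can be moved to the left and still leaves 8 Q^12 l D.\<close>
  moreover have "32 * Q ^ 12 * l * D \<le> k * D" using l D by (intro mult_right_mono) auto
  moreover have "24 * Q ^ 11 * l * D \<le> 24 * Q ^ 12 * l * D"
    using l D Q1 by (intro mult_right_mono mult_left_mono power_increasing) auto
  ultimately have "8 * Q ^ 12 * l * D \<le> 4 * Q ^ 8 * l\<^sup>2 + 12 * Q ^ 9 * l\<^sup>2" by linarith
  also have "\<dots> \<le> 4 * Q ^ 9 * l\<^sup>2 + 12 * Q ^ 9 * l\<^sup>2"
    using Q1 by (intro add_right_mono mult_right_mono mult_left_mono power_increasing) auto
  also have "\<dots> = 16 * Q ^ 9 * l * l" by (simp add: power2_eq_square)
  also have "\<dots> \<le> 6 ^ 3 * Q ^ 9 * l * l" using l Q0 by (intro mult_right_mono) auto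
  also have "\<dots> \<le> Q ^ 3 * Q ^ 9 * l * l"
    using l Q by (intro mult_right_mono power_mono) auto
  finally have "8 * D * (Q ^ 12 * l) \<le> l * (Q ^ 12 * l)" by (simp add: eval_nat_numeral algebra_simps)
  hence "8 * D \<le> l" using l Q0 by simp
  hence "D \<le> l" using D(1) by (smt (verit))
  thus ?thesis by (simp only: D_def)
qed

section \<open>Comparison of two pairs of negative curvature\<close>

lemma powr_alpha_incr:
  assumes "p / 2 \<le> a" "a \<le> b" "b \<le> 2 * r"
  shows "(b - a) / Q \<le> b powr \<alpha> - a powr \<alpha>" "b powr \<alpha> - a powr \<alpha> \<le> 2 * Q * (b - a)"
proof -
  have "(b - a) / Q \<le> b powr \<alpha> - a powr \<alpha> \<and> b powr \<alpha> - a powr \<alpha> \<le> 2 * Q * (b - a)"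
  proof (cases "a = b")
    case False
    with assms have "a < b" by simp
    then have "\<exists>z>a. z < b \<and> b powr \<alpha> - a powr \<alpha> = (b - a) * (\<alpha> * z powr (\<alpha> - 1))"
      by (rule MVT2) (use assms dom_pos in \<open>auto intro!: derivative_eq_intros\<close>)
    then obtain z where z: "a < z" "z < b" "b powr \<alpha> - a powr \<alpha> = (b - a) * (\<alpha> * z powr (\<alpha> - 1))"
      by blast
    have pw: "1 / Q \<le> z powr (\<alpha> - 1)" "z powr (\<alpha> - 1) \<le> Q"
      using powr_bounds[of z] z assms by auto
    have "1 * (1 / Q) \<le> \<alpha> * z powr (\<alpha> - 1)" using pw alpha Q by (intro mult_mono) auto
    moreover have "\<alpha> * z powr (\<alpha> - 1) \<le> 2 * Q" using pw alpha by (intro mult_mono) auto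
    ultimately show ?thesis using z mult_left_mono[of "1 * (1 / Q)" "\<alpha> * z powr (\<alpha> - 1)" "b - a"]
        mult_left_mono[of "\<alpha> * z powr (\<alpha> - 1)" "2 * Q" "b - a"] by (simp add: mult.commute)
  qed simp
  thus "(b - a) / Q \<le> b powr \<alpha> - a powr \<alpha>" "b powr \<alpha> - a powr \<alpha> \<le> 2 * Q * (b - a)" by auto
qed

text \<open>Here d0 has no upper bound. The term 2 e^2 / x^(\<alpha>+2) equals \<alpha>(\<alpha>+1)
  - \<open>curv\<close> and lies between 2 + d0 and 6 + 2 d0, so sqrt(1 + d0) is the size of \<eta>.
  It is the scale V of the arguments below.\<close>

lemma minus_eta_bounds:
  assumes "p / 2 \<le> x" "x \<le> 2 * r" "0 \<le> e" "- 2 * d0 \<le> curv \<alpha> x e" "curv \<alpha> x e \<le> - d0" "0 < d0"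
  shows "sqrt (1 + d0) / Q \<le> e" "e \<le> Q * sqrt (1 + d0)"
proof -
  define w where "w = 1 / x powr (\<alpha> + 2)"
  have w: "1 / Q \<le> w" "w \<le> Q" using inv_powr_bounds[of x] assms by (auto simp: w_def)
  have c: "curv \<alpha> x e = \<alpha> * (\<alpha> + 1) - 2 * e\<^sup>2 * w" by (simp add: curv_def w_def)
  have Q0: "0 < Q" using Q by simp
  have "1 + d0 \<le> 2 * e\<^sup>2 * w" using c assms alpha_prod by linarith
  also have "\<dots> \<le> 2 * e\<^sup>2 * Q" using w by (intro mult_left_mono) auto
  also have "\<dots> \<le> Q * e\<^sup>2 * Q" using Q by (intro mult_right_mono) auto
  finally have "1 + d0 \<le> (Q * e)\<^sup>2" by (simp add: power2_eq_square algebra_simps)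
  hence "sqrt (1 + d0) \<le> Q * e" using assms Q0 by (intro real_le_lsqrt) auto
  thus "sqrt (1 + d0) / Q \<le> e" using Q0 by (simp add: field_simps)
  have "2 * e\<^sup>2 * (1 / Q) \<le> 2 * e\<^sup>2 * w" using w by (intro mult_left_mono) auto
  also have "\<dots> \<le> 6 * (1 + d0)" using c assms(4,6) alpha_prod(2) by (smt (verit))
  finally have "e\<^sup>2 \<le> 3 * Q * (1 + d0)" using Q0 by (simp add: field_simps)
  also have "\<dots> \<le> Q * Q * (1 + d0)" using Q assms by (intro mult_right_mono) auto
  finally have "e \<le> sqrt (Q\<^sup>2 * (1 + d0))" by (intro real_le_rsqrt) (simp add: power2_eq_square)
  thus "e \<le> Q * sqrt (1 + d0)" using Q0 by (simp add: real_sqrt_mult)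
qed

text \<open>The reasoning of \<open>plus_left\<close> with reversed monotonicity: for negative
  curvature \<open>disp_x\<close> decreases in x, so compensation forces x1 to the right of x2.
  Since H is of size V, the distance is at least of order k V/d0.\<close>

lemma minus_right:
  assumes dom: "p \<le> x1" "x1 \<le> r" "p \<le> x2" "x2 \<le> r"
    and e: "0 \<le> e2" "e2 < e1" and H: "2 * V / Q \<le> e1 + e2" and V: "1 \<le> V"
    and d: "0 < d0" "- 2 * d0 \<le> curv \<alpha> x2 e2" "curv \<alpha> x2 e2 \<le> - d0"
    and l: "0 < l" "32 * Q ^ 12 * l \<le> (e1 - e2) / 2"
    and Fx: "disp_x \<alpha> x1 e1 - disp_x \<alpha> x2 e2 \<le> l"
  shows "x2 < x1" "(e1 - e2) / 2 * V \<le> Q ^ 3 * d0 * (x1 - x2)"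
proof -
  define k where "k = (e1 - e2) / 2"
  define H where "H = e1 + e2"
  define M where "M = k * H / Q"
  have k: "0 < k" using e by (simp add: k_def)
  have Q0: "0 < Q" using Q by simp
  have Hp: "0 < H" using e by (simp add: H_def)
  have sq: "e1\<^sup>2 - e2\<^sup>2 = 2 * k * H" by (simp add: k_def H_def power2_eq_square algebra_simps)
  have lM: "l < M"
  proof -
    have "l * Q\<^sup>2 \<le> l * Q ^ 12" using l Q by (intro mult_left_mono power_increasing) auto
    also have "\<dots> \<le> 32 * Q ^ 12 * l" using l Q0 by auto
    also have "\<dots> \<le> k" using l(2) by (simp only: k_def)
    also have "k < 2 * k * V" using V k mult_left_mono[of 1 V k] by linarith
    finally have "l * Q\<^sup>2 < 2 * k * V" .
    moreover have "k * (2 * V / Q) \<le> k * H" using H k by (intro mult_left_mono) (auto simp: H_def)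
    hence "2 * k * V \<le> k * H * Q" using Q0 by (simp add: field_simps)
    ultimately have "l * Q * Q < k * H * Q" by (simp add: power2_eq_square algebra_simps)
    hence "l * Q < k * H" using Q0 by simp
    thus ?thesis using Q0 by (simp add: M_def field_simps)
  qed
  have main: "2 * M \<le> (e1\<^sup>2 - e2\<^sup>2) / x1\<^sup>2"
    using sq_div_bounds(1)[of x1 "2 * k * H"] dom p k Hp unfolding sq by (auto simp: M_def)
  have M0: "0 < M" using k Hp Q0 by (simp add: M_def)
  show lt: "x2 < x1"
  proof (rule ccontr)
    assume "\<not> x2 < x1"
    hence "disp_x \<alpha> x2 e2 - disp_x \<alpha> x1 e2 \<le> Q * 0 * (x2 - x1)"
      using dom p d alpha
      by (intro disp_x_incr_upper) (auto intro: order_trans[OF curv_mono_x[of _ x2]])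
    hence "2 * M \<le> l" using main Fx disp_x_diff[of x1 e1 x2 e2] by simp
    thus False using lM M0 by linarith
  qed
  have "(if 0 \<le> - (2 * d0) then - (2 * d0) / Q else - (2 * d0) * Q) * (x1 - x2) \<le>
      disp_x \<alpha> x1 e2 - disp_x \<alpha> x2 e2"
    using dom p d lt alpha
    by (intro disp_x_incr_lower) (auto intro: order_trans[OF _ curv_mono_x[of x2]])
  hence "- (2 * d0 * Q * (x1 - x2)) \<le> disp_x \<alpha> x1 e2 - disp_x \<alpha> x2 e2" using d by simp
  hence "M \<le> 2 * d0 * Q * (x1 - x2)"
    using main Fx lM disp_x_diff[of x1 e1 x2 e2] by linarith
  hence "k * H \<le> 2 * d0 * Q * (x1 - x2) * Q" using Q0 by (simp add: M_def pos_divide_le_eq)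
  moreover have "k * (2 * V / Q) \<le> k * H" using H k by (intro mult_left_mono) (auto simp: H_def)
  ultimately have "k * (2 * V / Q) \<le> 2 * d0 * Q * (x1 - x2) * Q" by linarith
  hence "k * V \<le> Q ^ 3 * d0 * (x1 - x2)" using Q0 by (simp add: field_simps power3_eq_cube)
  thus "(e1 - e2) / 2 * V \<le> Q ^ 3 * d0 * (x1 - x2)" by (simp only: k_def)
qed

text \<open>Now x1 > x2, so the two terms of \<theta> = k + (H/X)(x2 - x1)/2 have opposite signs and
  \<theta> may vanish: moving \<eta> at fixed x need not gain anything. Instead x moves with \<eta>
  by t = D/B, B = H/X, which keeps \<theta> and reaches (q1, f1), (q2, f2). The power part of the
  dispersion sum grows by at least order t S, where S = x1 - x2, and between q1 and y1 the sum drops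
  by at most l |y1 - q1|. Comparison gives t d0 S of order l^2. Since k V is at most of order d0 S,
  and D = B t with B at most of order V, it follows that D k is of order l^2. The cell size \<sigma>
  keeps \<theta>, S and t small enough for the error terms.\<close>

lemma minus_pair:
  assumes dom: "x1 \<in> {p..r}" "x2 \<in> {p..r}" "y1 \<in> {p..r}" "y2 \<in> {p..r}"
    and sums: "x1 + x2 = y1 + y2" "e1 + e2 = f1 + f2"
    and e: "0 \<le> e2" "0 \<le> f2" and k: "k = (e1 - e2) / 2"
    and kk: "e1 \<le> f1" "f1 - e1 \<le> k / 2"
    and l: "0 < l" "32 * Q ^ 12 * l \<le> k"
    and d: "0 < d0" "- 2 * d0 \<le> curv \<alpha> x1 e1" "curv \<alpha> x1 e1 \<le> - d0"
      "- 2 * d0 \<le> curv \<alpha> x2 e2" "curv \<alpha> x2 e2 \<le> - d0"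
      "- 2 * d0 \<le> curv \<alpha> y1 f1" "curv \<alpha> y1 f1 \<le> - d0"
      "- 2 * d0 \<le> curv \<alpha> y2 f2" "curv \<alpha> y2 f2 \<le> - d0"
    and Fx: "\<bar>disp_x \<alpha> x1 e1 - disp_x \<alpha> x2 e2\<bar> \<le> l" "\<bar>disp_x \<alpha> y1 f1 - disp_x \<alpha> y2 f2\<bar> \<le> l"
    and F: "\<bar>(dispersion \<alpha> x1 e1 + dispersion \<alpha> x2 e2) -
        (dispersion \<alpha> y1 f1 + dispersion \<alpha> y2 f2)\<bar> \<le> 2 * \<delta>"
    and delta: "\<delta> * d0 \<le> l\<^sup>2"
    and close: "\<bar>x1 - x2\<bar> \<le> \<sigma>" "\<bar>e1 / x1 - e2 / x2\<bar> \<le> \<sigma>" "Q ^ 10 * \<sigma> \<le> 1"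
  shows "f1 - e1 \<le> l"
proof -
  define H where "H = e1 + e2"
  define X where "X = x1 + x2"
  define D where "D = f1 - e1"
  define V where "V = sqrt (1 + d0)"
  define B where "B = H / X"
  define t where "t = D / B"
  define S where "S = x1 - x2"
  define \<theta> where "\<theta> = e1 - B * x1"
  have Q0: "0 < Q" and Q1: "1 \<le> Q" using Q by auto
  have Qp: "0 < Q ^ n" "1 \<le> Q ^ n" for n using Q1 by auto
  have k0: "0 < k" using l Qp(1)[of 12] mult_pos_pos[of "32 * Q ^ 12" l] by linarith
  have xpos: "0 < x1" "0 < x2" "0 < y1" "0 < y2" using dom p by auto
  have dom': "p / 2 \<le> x1" "x1 \<le> 2 * r" "p / 2 \<le> x2" "x2 \<le> 2 * r"
    "p / 2 \<le> y1" "y1 \<le> 2 * r" "p / 2 \<le> y2" "y2 \<le> 2 * r" using dom p by auto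
  have e12: "e2 < e1" using k k0 by simp
  have D: "0 \<le> D" "D \<le> k / 2" using kk by (auto simp: D_def)
  have ff: "f1 = e1 + D" "f2 = e2 - D" using sums by (auto simp: D_def)
  have V: "1 \<le> V" "0 < V" "d0 \<le> V\<^sup>2" using d by (auto simp: V_def)
  have eb: "V / Q \<le> e1" "e1 \<le> Q * V" "V / Q \<le> e2" "e2 \<le> Q * V"
    using minus_eta_bounds[of x1 e1 d0] minus_eta_bounds[of x2 e2 d0] d dom' e e12
    by (auto simp: V_def)
  have H: "2 * V / Q \<le> H" "H \<le> 2 * Q * V" using eb add_mono[OF eb(1,3)] by (simp_all add: H_def)
  have VQ: "0 < V / Q" using V Q0 by simp
  have H0: "0 < H" using H VQ by simp
  have X: "2 / Q \<le> X" "X \<le> 2 * Q" "0 < X"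
    using x_bounds[of x1] x_bounds[of x2] dom' xpos by (auto simp: X_def)
  have B0: "0 < B" using H0 X by (simp add: B_def)
  have B: "B \<le> Q\<^sup>2 * V"
  proof -
    have "B \<le> (2 * Q * V) / (2 / Q)" unfolding B_def using H X Q0 H0 by (intro frac_le) auto
    thus ?thesis using Q0 by (simp add: power2_eq_square mult_ac)
  qed
  note mr = minus_right[of x1 x2 e2 e1 V d0 l]
  have S0: "0 < S" and S1: "k * V \<le> Q ^ 3 * d0 * S"
    using mr dom e e12 H V d l Fx unfolding H_def k S_def by auto
  have sig: "S \<le> \<sigma>" using close by (simp add: S_def)
  \<comment> \<open>The closeness hypothesis in the form used below: up to ten powers of Q may be
    traded against S.\<close>
  have QS: "Q ^ n * S \<le> 1 / Q ^ (10 - n)" if "n \<le> 10" for n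
  proof -
    have "Q ^ 10 * S \<le> Q ^ 10 * \<sigma>" using sig Q0 by (intro mult_left_mono) auto
    hence "Q ^ 10 * S \<le> 1" using close by simp
    moreover have "Q ^ 10 = Q ^ (10 - n) * Q ^ n" using that by (simp flip: power_add)
    ultimately have "Q ^ (10 - n) * (Q ^ n * S) \<le> 1" by (simp add: mult.assoc)
    thus ?thesis using Qp(1)[of "10 - n"] by (simp add: pos_le_divide_eq mult.commute)
  qed
  have t0: "0 \<le> t" using D B0 by (simp add: t_def)
  have tB: "t * B = D" using B0 by (simp add: t_def)
  have tk: "t \<le> k * Q\<^sup>2 / (2 * V)"
  proof -
    have "t = D * X / H" using X by (simp add: t_def B_def)
    also have "\<dots> \<le> (k / 2 * (2 * Q)) / (2 * V / Q)"
      using D X H H0 k0 VQ Q0 by (intro frac_le mult_mono) auto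
    finally show ?thesis by (simp add: power2_eq_square)
  qed
  \<comment> \<open>t is at most of order k/V, and k V is at most of order d0 S \<le> V^2 S, so the
    shift is at most comparable to S.\<close>
  have tS: "t \<le> Q ^ 5 * S / 2"
  proof -
    have "k * V * V \<le> Q ^ 3 * d0 * S * V" using S1 V by (intro mult_right_mono) auto
    have "t * (2 * V\<^sup>2) \<le> k * Q\<^sup>2 / (2 * V) * (2 * V\<^sup>2)" using tk by (intro mult_right_mono) auto
    also have "\<dots> = Q\<^sup>2 * (k * V)" using V(2) by (simp add: power2_eq_square)
    also have "\<dots> \<le> Q\<^sup>2 * (Q ^ 3 * d0 * S)" using S1 by (intro mult_left_mono) auto
    also have "\<dots> = Q ^ 5 * S * d0" by (simp add: eval_nat_numeral algebra_simps)
    also have "\<dots> \<le> Q ^ 5 * S * V\<^sup>2" using V S0 Q0 by (intro mult_left_mono) auto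
    finally have "t * 2 * V\<^sup>2 \<le> Q ^ 5 * S * V\<^sup>2" by simp
    hence "t * 2 \<le> Q ^ 5 * S" using V by simp
    thus ?thesis by simp
  qed
  have p2: "1 / Q \<le> p / 2" using x_bounds[of "p / 2"] p pr by auto
  have t_small: "t \<le> p / 2"
  proof -
    have "Q ^ 5 * S \<le> 1 / Q ^ 5" using QS[of 5] by simp
    hence "t \<le> 1 / Q ^ 5" using tS t0 by linarith
    also have "\<dots> \<le> 1 / Q ^ 1" using Q1 Q0 by (intro divide_left_mono power_increasing) auto
    finally show ?thesis using p2 by simp
  qed
  \<comment> \<open>The moved points may leave [p, r], but as t \<le> p/2 they stay in
    [p/2, 2r].\<close>
  define q1 where "q1 = x1 + t"
  define q2 where "q2 = x2 - t"
  have qdom: "p / 2 \<le> q1" "q1 \<le> 2 * r" "p / 2 \<le> q2" "q2 \<le> 2 * r"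
    using t0 t_small dom p pr by (auto simp: q1_def q2_def)
  have qpos: "0 < q1" "0 < q2" using qdom p by auto
  have kV: "k * V * Q ^ 5 \<le> d0 / 2"
  proof -
    have "k * V * Q ^ 5 \<le> Q ^ 3 * d0 * S * Q ^ 5" using S1 Q0 by (intro mult_right_mono) auto
    also have "\<dots> = d0 * (Q ^ 8 * S)" by (simp add: eval_nat_numeral algebra_simps)
    also have "\<dots> \<le> d0 * (1 / Q\<^sup>2)" using QS[of 8] d by (intro mult_left_mono) auto
    also have "\<dots> \<le> d0 * (1 / 2)"
    proof -
      have "2 \<le> Q\<^sup>2" using Q mult_mono[of 6 Q 6 Q] by (simp add: power2_eq_square)
      hence "1 / Q\<^sup>2 \<le> 1 / 2" by (intro divide_left_mono) auto
      thus ?thesis using d(1) by (intro mult_left_mono) auto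
    qed
    finally show ?thesis by simp
  qed
  \<comment> \<open>The auxiliary point lies in neither pair. Raising \<eta> only makes
    \<open>curv\<close> more negative, and the shift of x by t raises it by at most k V Q^5 \<le>
    d0/2.\<close>
  have c_q1: "curv \<alpha> q1 f1 \<le> - d0 / 2"
  proof -
    have "curv \<alpha> q1 f1 \<le> curv \<alpha> q1 e1" using e e12 kk by (intro curv_antimono_eta) auto
    moreover have "curv \<alpha> q1 e1 - curv \<alpha> x1 e1 =
        2 * e1\<^sup>2 * (1 / x1 powr (\<alpha> + 2) - 1 / q1 powr (\<alpha> + 2))"
      by (simp add: curv_def algebra_simps)
    moreover have "\<dots> \<le> 2 * (Q * V)\<^sup>2 * (Q * (k * Q\<^sup>2 / (2 * V)))"
    proof (intro mult_mono)
      have "1 / x1 powr (\<alpha> + 2) - 1 / q1 powr (\<alpha> + 2) \<le> Q * (q1 - x1)"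
        using dom' qdom t0 by (intro inv_powr_lipschitz[THEN conjunct2]) (auto simp: q1_def)
      also have "\<dots> \<le> Q * (k * Q\<^sup>2 / (2 * V))"
        using tk Q0 by (intro mult_left_mono) (auto simp: q1_def)
      finally show "1 / x1 powr (\<alpha> + 2) - 1 / q1 powr (\<alpha> + 2) \<le> Q * (k * Q\<^sup>2 / (2 * V))" .
      show "0 \<le> 1 / x1 powr (\<alpha> + 2) - 1 / q1 powr (\<alpha> + 2)"
        using xpos t0 alpha by (auto intro!: divide_left_mono powr_mono2 simp: q1_def)
    qed (use eb e e12 in \<open>auto intro!: power_mono\<close>)
    moreover have "2 * (Q * V)\<^sup>2 * (Q * (k * Q\<^sup>2 / (2 * V))) = k * V * Q ^ 5"
      using V(2) by (simp add: field_simps eval_nat_numeral)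
    ultimately show ?thesis using kV d by linarith
  qed
  \<comment> \<open>In the second component the shift to the left helps, and it is the lowering of
    \<eta> by D \<le> k/2 that costs at most k V Q^5.\<close>
  have c_q2: "curv \<alpha> q2 f2 \<le> - d0 / 2"
  proof -
    have "curv \<alpha> q2 f2 \<le> curv \<alpha> x2 f2" using qpos t0 alpha by (intro curv_mono_x) (auto simp: q2_def)
    moreover have "curv \<alpha> x2 f2 - curv \<alpha> x2 e2 = 2 * (D * (e2 + f2)) * (1 / x2 powr (\<alpha> + 2))"
    proof -
      have "e2\<^sup>2 - f2\<^sup>2 = D * (e2 + f2)" unfolding ff by (simp add: power2_eq_square algebra_simps)
      thus ?thesis by (simp add: curv_diff_eta)
    qed
    moreover have "\<dots> \<le> 2 * (k / 2 * (2 * (Q * V))) * Q"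
      using D eb e ff inv_powr_bounds[of x2] dom' k0 V Q0
      by (intro mult_mono) (auto intro!: mult_nonneg_nonneg)
    moreover have "2 * (k / 2 * (2 * (Q * V))) * Q = k * V * (2 * Q\<^sup>2)"
      by (simp add: power2_eq_square)
    moreover have "k * V * (2 * Q\<^sup>2) \<le> k * V * Q ^ 5"
    proof -
      have "2 * Q\<^sup>2 \<le> Q * Q\<^sup>2" using Q by (intro mult_right_mono) auto
      also have "\<dots> = Q ^ 3" by (simp add: eval_nat_numeral)
      also have "\<dots> \<le> Q ^ 5" using Q1 by (intro power_increasing) auto
      finally show ?thesis using k0 V by (intro mult_left_mono) auto
    qed
    ultimately show ?thesis using kV d by linarith
  qed
  \<comment> \<open>The sign is reversed so that negative curvature becomes convexity.\<close>
  define f where "f = (\<lambda>t. - (dispersion \<alpha> t f1 + dispersion \<alpha> (X - t) f2))"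
  define f' where "f' = (\<lambda>t. - (disp_x \<alpha> t f1 - disp_x \<alpha> (X - t) f2))"
  define f'' where "f'' = (\<lambda>t. - (t powr (\<alpha> - 1) * curv \<alpha> t f1 +
     (X - t) powr (\<alpha> - 1) * curv \<alpha> (X - t) f2))"
  have Xq: "X - q1 = q2" "X - y1 = y2" using sums by (auto simp: X_def q1_def q2_def)
  have seg: "p / 2 \<le> u \<and> u \<le> 2 * r \<and> p / 2 \<le> X - u \<and> X - u \<le> 2 * r"
    if "min q1 y1 \<le> u" "u \<le> max q1 y1" for u
    using that dom' qdom Xq by (auto simp: min_def max_def split: if_splits)
  have df: "(f has_real_derivative f' u) (at u)" if "min q1 y1 \<le> u" "u \<le> max q1 y1" for u
  proof -
    have "0 < u" "0 < X - u" using seg[OF that] p by auto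
    thus ?thesis unfolding f_def f'_def by (intro DERIV_minus has_real_derivative_pair)
  qed
  have df': "(f' has_real_derivative f'' u) (at u)" if "min q1 y1 \<le> u" "u \<le> max q1 y1" for u
  proof -
    have "0 < u" "0 < X - u" using seg[OF that] p by auto
    thus ?thesis unfolding f'_def f''_def by (intro DERIV_minus has_real_derivative_pair)
  qed
  have lower: "d0 / Q \<le> f'' u" if u: "min q1 y1 \<le> u" "u \<le> max q1 y1" for u
  proof -
    note s = seg[OF u]
    have "curv \<alpha> u f1 \<le> curv \<alpha> (max q1 y1) f1" using s p u alpha by (intro curv_mono_x) auto
    hence 1: "d0 / 2 \<le> - curv \<alpha> u f1" using c_q1 d by (auto simp: max_def split: if_splits)
    have "curv \<alpha> (X - u) f2 \<le> curv \<alpha> (max q2 y2) f2"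
      using s p u alpha Xq by (intro curv_mono_x) auto
    hence 2: "d0 / 2 \<le> - curv \<alpha> (X - u) f2" using c_q2 d by (auto simp: max_def split: if_splits)
    have "1 / Q * (d0 / 2) \<le> u powr (\<alpha> - 1) * - curv \<alpha> u f1"
      using powr_bounds[of u] s p 1 d by (intro mult_mono) auto
    moreover have "1 / Q * (d0 / 2) \<le> (X - u) powr (\<alpha> - 1) * - curv \<alpha> (X - u) f2"
      using powr_bounds[of "X - u"] s p 2 d by (intro mult_mono) auto
    ultimately have "1 / Q * (d0 / 2) + 1 / Q * (d0 / 2) \<le> f'' u" unfolding f''_def by linarith
    thus ?thesis by (simp add: field_simps)
  qed
  have m0: "0 \<le> d0 / Q" using d Q0 by simp
  note cs = convex_segment[where f = f and f' = f' and f'' = f'' and a = q1 and b = y1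
      and m = "d0 / Q", OF df df' lower m0]
  have f'y: "\<bar>f' y1\<bar> \<le> l" using Fx by (simp add: f'_def Xq)
  have step1: "f y1 - f q1 \<le> l * \<bar>y1 - q1\<bar>"
  proof -
    have "f y1 - f q1 \<le> f' y1 * (y1 - q1)" by (rule cs(1))
    also have "\<dots> \<le> \<bar>f' y1\<bar> * \<bar>y1 - q1\<bar>" by (metis abs_ge_self abs_mult)
    also have "\<dots> \<le> l * \<bar>y1 - q1\<bar>" using f'y by (intro mult_right_mono) auto
    finally show ?thesis .
  qed
  have eB: "e1 = B * x1 + \<theta>" "e2 = B * x2 - \<theta>"
  proof -
    have "B * X = H" using X by (simp add: B_def)
    moreover have "B * X = B * x1 + B * x2" by (simp only: X_def distrib_left)
    ultimately show "e1 = B * x1 + \<theta>" "e2 = B * x2 - \<theta>" by (auto simp: \<theta>_def H_def)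
  qed
  have fB: "f1 = B * q1 + \<theta>" "f2 = B * q2 - \<theta>"
    using tB unfolding ff eB q1_def q2_def by (simp_all add: algebra_simps)
  define R where "R = 1 / x1 + 1 / x2"
  define Rq where "Rq = 1 / q1 + 1 / q2"
  have inv_b: "1 / Q \<le> 1 / x \<and> 1 / x \<le> Q" if "p / 2 \<le> x" "x \<le> 2 * r" for x
  proof -
    have x: "1 / Q \<le> x" "x \<le> Q" "0 < x" using x_bounds[OF that] that p by auto
    have "1 / Q \<le> 1 / x" using x Q0 by (intro divide_left_mono) auto
    moreover have "1 \<le> x * Q" using x(1) Q0 by (simp add: field_simps)
    hence "1 / x \<le> Q" using x by (simp add: field_simps)
    ultimately show ?thesis by simp
  qed
  have R: "2 / Q \<le> R" using inv_b[of x1] inv_b[of x2] dom' by (auto simp: R_def)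
  \<comment> \<open>As q1 + q2 = x1 + x2, the sum of the reciprocals depends on the product alone.
    Spreading the points apart lowers the product by t (S + t), a second-order quantity.\<close>
  have prod: "q1 * q2 = x1 * x2 - t * (S + t)" by (simp add: q1_def q2_def S_def algebra_simps)
  have Rdiff: "Rq - R = X * t * (S + t) / ((x1 * x2) * (q1 * q2))"
  proof -
    have "Rq = X / (q1 * q2)" using qpos Xq by (simp add: Rq_def field_simps)
    moreover have "R = X / (x1 * x2)" using xpos by (simp add: R_def X_def field_simps)
    moreover have "X / (q1 * q2) - X / (x1 * x2) = X * (x1 * x2 - q1 * q2) / ((x1 * x2) * (q1 * q2))"
      using qpos xpos by (simp add: field_simps)
    ultimately show ?thesis by (simp add: prod)
  qed
  have inv4: "1 / ((x1 * x2) * (q1 * q2)) \<le> Q ^ 4"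
  proof -
    have "(1 / x1 * (1 / x2)) * (1 / q1 * (1 / q2)) \<le> (Q * Q) * (Q * Q)"
      using inv_b[of x1] inv_b[of x2] inv_b[of q1] inv_b[of q2] dom' qdom xpos qpos Q0
      by (intro mult_mono) auto
    thus ?thesis by (simp add: eval_nat_numeral)
  qed
  have Stb: "S + t \<le> Q ^ 5 * S"
  proof -
    have "2 \<le> Q ^ 5" using power_increasing[of 1 5 Q] Q by simp
    hence "2 * S \<le> Q ^ 5 * S" using S0 by (intro mult_right_mono) auto
    thus ?thesis using tS by simp
  qed
  have Rd: "0 \<le> Rq - R" "Rq - R \<le> 2 * Q ^ 10 * (t * S)"
  proof -
    show "0 \<le> Rq - R" unfolding Rdiff using X t0 S0 xpos qpos by auto
    have "Rq - R = X * (t * (S + t)) * (1 / ((x1 * x2) * (q1 * q2)))" unfolding Rdiff by simp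
    also have "\<dots> \<le> (2 * Q) * (t * (Q ^ 5 * S)) * Q ^ 4"
      using X t0 S0 Stb inv4 xpos qpos Q0 by (intro mult_mono) (auto intro!: mult_nonneg_nonneg)
    finally show "Rq - R \<le> 2 * Q ^ 10 * (t * S)" by (simp add: eval_nat_numeral algebra_simps)
  qed
  \<comment> \<open>\<theta> R is the difference of the slopes e/x, so the slope part of the
    closeness hypothesis makes \<theta> small.\<close>
  have thR: "\<theta> * R = e1 / x1 - e2 / x2"
    unfolding eB R_def using xpos by (simp add: field_simps)
  have theta: "\<bar>\<theta>\<bar> \<le> Q * \<sigma> / 2"
  proof -
    have "\<bar>\<theta>\<bar> * (2 / Q) \<le> \<bar>\<theta>\<bar> * \<bar>R\<bar>" using R by (intro mult_left_mono) auto
    also have "\<dots> \<le> \<sigma>" using close(2) thR by (simp flip: abs_mult)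
    finally show ?thesis using Q0 by (simp add: field_simps)
  qed
  have sig0: "0 < \<sigma>" using S0 sig by simp
  have theta2: "\<theta>\<^sup>2 \<le> 1 / (4 * Q ^ 18)"
  proof -
    have "\<theta>\<^sup>2 \<le> (Q * \<sigma> / 2)\<^sup>2" using theta power_mono[of "\<bar>\<theta>\<bar>" "Q * \<sigma> / 2" 2] by simp
    also have "\<dots> = (Q ^ 10 * \<sigma>)\<^sup>2 / (4 * Q ^ 18)" using Q0 by (simp add: field_simps eval_nat_numeral)
    also have "\<dots> \<le> 1\<^sup>2 / (4 * Q ^ 18)"
      using close(3) sig0 Q0 by (intro divide_right_mono power_mono) auto
    finally show ?thesis by simp
  qed
  have theta2_1: "\<theta>\<^sup>2 \<le> 1"
  proof -
    have "1 \<le> 4 * Q ^ 18" using Qp(2)[of 18] by linarith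
    hence "1 / (4 * Q ^ 18) \<le> 1" by (simp add: divide_le_eq_1)
    thus ?thesis using theta2 by linarith
  qed
  text \<open>Moving along \<open>\<theta> = const\<close>, only the \<open>\<xi>\<close>-part of the sum varies to first order.\<close>
  define W where "W = t * S / Q"
  have gain: "W \<le> - f q1 - (dispersion \<alpha> x1 e1 + dispersion \<alpha> x2 e2)"
  proof -
    have th1: "e1 - (e1 + e2) / (x1 + x2) * x1 = \<theta>" by (simp add: \<theta>_def B_def H_def X_def)
    have th2: "f1 - (f1 + f2) / (q1 + q2) * q1 = \<theta>"
    proof -
      have "(f1 + f2) / (q1 + q2) = B" using sums by (simp add: B_def H_def X_def q1_def q2_def)
      thus ?thesis using fB by simp
    qed
    have fq: "- f q1 = q1 powr (\<alpha> + 1) + q2 powr (\<alpha> + 1) - (f1 + f2)\<^sup>2 / (q1 + q2) - Rq * \<theta>\<^sup>2"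
      unfolding f_def Xq using dispersion_sum[OF qpos, of \<alpha> f1 f2] unfolding th2 by (simp add: Rq_def)
    have sq: "q1 + q2 = x1 + x2" by (simp add: q1_def q2_def)
    have "- f q1 - (dispersion \<alpha> x1 e1 + dispersion \<alpha> x2 e2) =
       (q1 powr (\<alpha> + 1) + q2 powr (\<alpha> + 1)) - (x1 powr (\<alpha> + 1) + x2 powr (\<alpha> + 1)) - \<theta>\<^sup>2 * (Rq - R)"
      unfolding fq dispersion_sum[OF xpos(1,2), of \<alpha> e1 e2] th1 sq
      using sums by (simp add: R_def algebra_simps)
    moreover have "2 * W \<le>
        (q1 powr (\<alpha> + 1) + q2 powr (\<alpha> + 1)) - (x1 powr (\<alpha> + 1) + x2 powr (\<alpha> + 1))"
    proof (cases "t = 0")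
      case False
      hence "0 < t" using t0 by simp
      then have "\<exists>z>0. z < t \<and> ((x1 + t) powr (\<alpha> + 1) + (x2 - t) powr (\<alpha> + 1)) -
          ((x1 + 0) powr (\<alpha> + 1) + (x2 - 0) powr (\<alpha> + 1)) =
          (t - 0) * ((\<alpha> + 1) * (x1 + z) powr \<alpha> - (\<alpha> + 1) * (x2 - z) powr \<alpha>)"
        by (rule MVT2) (use xpos qpos in \<open>auto intro!: derivative_eq_intros simp: q2_def\<close>)
      then obtain z where z: "0 < z" "z < t" "((x1 + t) powr (\<alpha> + 1) + (x2 - t) powr (\<alpha> + 1)) -
          (x1 powr (\<alpha> + 1) + x2 powr (\<alpha> + 1)) =
          t * ((\<alpha> + 1) * (x1 + z) powr \<alpha> - (\<alpha> + 1) * (x2 - z) powr \<alpha>)" by auto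
      have "(x1 - x2) / Q \<le> x1 powr \<alpha> - x2 powr \<alpha>"
        using dom' S0 by (intro powr_alpha_incr) (auto simp: S_def)
      moreover have "x1 powr \<alpha> \<le> (x1 + z) powr \<alpha>" using z xpos alpha by (intro powr_mono2) auto
      moreover have "(x2 - z) powr \<alpha> \<le> x2 powr \<alpha>"
        using z qpos alpha by (intro powr_mono2) (auto simp: q2_def)
      ultimately have "S / Q \<le> (x1 + z) powr \<alpha> - (x2 - z) powr \<alpha>" by (simp add: S_def)
      hence "2 * (S / Q) \<le> (\<alpha> + 1) * ((x1 + z) powr \<alpha> - (x2 - z) powr \<alpha>)"
        using alpha S0 Q0 by (intro mult_mono) auto
      hence "t * (2 * (S / Q)) \<le> t * ((\<alpha> + 1) * ((x1 + z) powr \<alpha> - (x2 - z) powr \<alpha>))"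
        using t0 by (intro mult_left_mono) auto
      thus ?thesis using z(3) by (simp add: W_def q1_def q2_def algebra_simps)
    qed (simp add: W_def q1_def q2_def)
    \<comment> \<open>At fixed \<theta> the quadratic part changes only through R, whose change is
      itself of order t S. The smallness of \<theta>^2 makes this at most half of the gain 2
      W.\<close>
    moreover have "\<theta>\<^sup>2 * (Rq - R) \<le> W"
    proof -
      have "\<theta>\<^sup>2 * (Rq - R) \<le> 1 / (4 * Q ^ 18) * (2 * Q ^ 10 * (t * S))"
        using Rd theta2 Q0 by (intro mult_mono) auto
      also have "\<dots> = (t * S) * (1 / (2 * Q ^ 8))" using Q0 by (simp add: eval_nat_numeral)
      also have "\<dots> \<le> (t * S) * (1 / Q)"
      proof (intro mult_left_mono divide_left_mono)
        show "Q \<le> 2 * Q ^ 8" using power_increasing[of 1 8 Q] Q1 by simp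
      qed (use t0 S0 Q0 in auto)
      finally show ?thesis by (simp add: W_def)
    qed
    ultimately show ?thesis by linarith
  qed
  \<comment> \<open>In the coordinates B and \<theta> the large terms B^2 cancel between the two
    components, so the derivative difference contains B only through B \<theta>.\<close>
  have Fform: "disp_x \<alpha> a1 (B * a1 + \<theta>) - disp_x \<alpha> a2 (B * a2 - \<theta>) =
     (\<alpha> + 1) * (a1 powr \<alpha> - a2 powr \<alpha>) + 2 * B * \<theta> * (1 / a1 + 1 / a2) + \<theta>\<^sup>2 * (1 / a1\<^sup>2 - 1 / a2\<^sup>2)"
    if "0 < a1" "0 < a2" for a1 a2
  proof -
    have 1: "(B * a1 + \<theta>)\<^sup>2 / a1\<^sup>2 = B\<^sup>2 + 2 * B * \<theta> * (1 / a1) + \<theta>\<^sup>2 * (1 / a1\<^sup>2)"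
      using that by (simp add: field_simps power2_eq_square)
    have 2: "(B * a2 - \<theta>)\<^sup>2 / a2\<^sup>2 = B\<^sup>2 - 2 * B * \<theta> * (1 / a2) + \<theta>\<^sup>2 * (1 / a2\<^sup>2)"
      using that by (simp add: field_simps power2_eq_square)
    show ?thesis unfolding disp_x_def 1 2 by (simp add: algebra_simps)
  qed
  have invsq: "0 \<le> 1 / a\<^sup>2 - 1 / b\<^sup>2 \<and> 1 / a\<^sup>2 - 1 / b\<^sup>2 \<le> 2 * Q ^ 3 * (b - a)"
    if "p / 2 \<le> a" "a \<le> b" "b \<le> 2 * r" for a b
  proof -
    have ab: "0 < a" "0 < b" using that p by auto
    have "1 / a\<^sup>2 - 1 / b\<^sup>2 = (b + a) * (b - a) * ((1 / a\<^sup>2) * (1 / b\<^sup>2))"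
      using ab by (simp add: field_simps power2_eq_square)
    also have "\<dots> \<le> (Q + Q) * (b - a) * (Q * Q)"
      using that ab x_bounds[of a] x_bounds[of b] x2_bounds[of a] x2_bounds[of b]
      by (intro mult_mono add_mono) auto
    finally have "1 / a\<^sup>2 - 1 / b\<^sup>2 \<le> 2 * Q ^ 3 * (b - a)" by (simp add: eval_nat_numeral algebra_simps)
    moreover have "1 / b\<^sup>2 \<le> 1 / a\<^sup>2" using ab that by (intro divide_left_mono power_mono) auto
    ultimately show ?thesis by simp
  qed
  have Q36: "36 \<le> Q\<^sup>2" using Q mult_mono[of 6 Q 6 Q] by (simp add: power2_eq_square)
  \<comment> \<open>B can be as large as V, so B \<theta> is not estimated factor by factor. It is
    read off from the derivative condition at the first pair, which bounds it in terms of l and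
    S.\<close>
  have Bth: "2 * B * \<bar>\<theta>\<bar> \<le> Q / 2 * (l + 3 * Q ^ 3 * S)"
  proof -
    have "2 * B * \<theta> * R = (disp_x \<alpha> x1 e1 - disp_x \<alpha> x2 e2) - (\<alpha> + 1) * (x1 powr \<alpha> - x2 powr \<alpha>)
        + \<theta>\<^sup>2 * (1 / x2\<^sup>2 - 1 / x1\<^sup>2)"
      unfolding eB using Fform[OF xpos(1,2)] by (simp add: R_def algebra_simps)
    moreover have "0 \<le> (\<alpha> + 1) * (x1 powr \<alpha> - x2 powr \<alpha>)"
      using alpha xpos S0 by (auto intro!: mult_nonneg_nonneg powr_mono2 simp: S_def)
    moreover have "(\<alpha> + 1) * (x1 powr \<alpha> - x2 powr \<alpha>) \<le> 3 * (2 * Q * S)"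
      using powr_alpha_incr(2)[of x2 x1] dom' S0 alpha xpos
      by (intro mult_mono) (auto simp: S_def intro!: powr_mono2)
    moreover have "0 \<le> \<theta>\<^sup>2 * (1 / x2\<^sup>2 - 1 / x1\<^sup>2)" "\<theta>\<^sup>2 * (1 / x2\<^sup>2 - 1 / x1\<^sup>2) \<le> 1 * (2 * Q ^ 3 * S)"
      using invsq[of x2 x1] dom' S0 theta2_1
      by (intro mult_nonneg_nonneg mult_mono; simp add: S_def)+
    moreover have "6 * Q * S \<le> Q ^ 3 * S"
    proof -
      have "6 * Q \<le> Q\<^sup>2 * Q" using Q36 Q0 by (intro mult_right_mono) auto
      thus ?thesis using S0 by (intro mult_right_mono) (auto simp: eval_nat_numeral)
    qed
    ultimately have "\<bar>2 * B * \<theta> * R\<bar> \<le> l + 3 * Q ^ 3 * S" using Fx by linarith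
    moreover have "\<bar>2 * B * \<theta> * R\<bar> = 2 * B * \<bar>\<theta>\<bar> * R"
      using B0 R Q0 by (simp add: abs_mult) (metis abs_of_nonneg divide_nonneg_nonneg order_trans zero_le_numeral less_imp_le)
    moreover have "2 * B * \<bar>\<theta>\<bar> * (2 / Q) \<le> 2 * B * \<bar>\<theta>\<bar> * R" using R B0 by (intro mult_left_mono) auto
    ultimately have "2 * B * \<bar>\<theta>\<bar> * (2 / Q) \<le> l + 3 * Q ^ 3 * S" by linarith
    thus ?thesis using Q0 by (simp add: field_simps)
  qed
  \<comment> \<open>The formula at (q1, q2) differs from that at (x1, x2) by terms that each carry a
    factor t; the rest is the derivative condition \<open>Fx\<close>.\<close>
  have f'q: "\<bar>f' q1\<bar> \<le> l + t * (5 * Q ^ 3 + Q ^ 11 * l * S)"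
  proof -
    have gen: "\<bar>f\<bar> \<le> L + a + c + u" if "- f = E + A1 + A2 - A3" "0 \<le> A1" "A1 \<le> a"
      "\<bar>A2\<bar> \<le> u" "0 \<le> A3" "A3 \<le> c" "\<bar>E\<bar> \<le> L" for f E A1 A2 A3 a c u L :: real
      using that by linarith
    define U where "U = Q / 2 * (l + 3 * Q ^ 3 * S) * (2 * Q ^ 10 * (t * S))"
    define A1 where "A1 = (\<alpha> + 1) * ((q1 powr \<alpha> - x1 powr \<alpha>) + (x2 powr \<alpha> - q2 powr \<alpha>))"
    define A2 where "A2 = 2 * B * \<theta> * (Rq - R)"
    define A3 where "A3 = \<theta>\<^sup>2 * ((1 / x1\<^sup>2 - 1 / q1\<^sup>2) + (1 / q2\<^sup>2 - 1 / x2\<^sup>2))"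
    have "- f' q1 = (disp_x \<alpha> x1 e1 - disp_x \<alpha> x2 e2) + A1 + A2 - A3"
      unfolding f'_def Xq fB eB A1_def A2_def A3_def R_def Rq_def
      using Fform[OF xpos(1,2)] Fform[OF qpos] by (simp add: algebra_simps)
    moreover have "0 \<le> A1" "A1 \<le> 3 * (2 * Q * t + 2 * Q * t)"
      unfolding A1_def using powr_alpha_incr(2)[of x1 q1] powr_alpha_incr(2)[of q2 x2] dom' qdom t0 alpha xpos qpos
      by (intro mult_nonneg_nonneg mult_mono add_mono add_nonneg_nonneg;
          auto simp: q1_def q2_def intro!: powr_mono2 add_nonneg_nonneg)+
    moreover have "\<bar>A2\<bar> \<le> U"
    proof -
      have "\<bar>A2\<bar> = 2 * B * \<bar>\<theta>\<bar> * (Rq - R)" using B0 Rd by (simp add: A2_def abs_mult)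
      also have "\<dots> \<le> Q / 2 * (l + 3 * Q ^ 3 * S) * (2 * Q ^ 10 * (t * S))"
        by (rule mult_mono[OF Bth Rd(2)]) (use Rd l S0 Q0 in auto)
      finally show ?thesis by (simp only: U_def)
    qed
    moreover have "0 \<le> A3" "A3 \<le> 1 * (2 * Q ^ 3 * t + 2 * Q ^ 3 * t)"
      unfolding A3_def using invsq[of x1 q1] invsq[of q2 x2] dom' qdom t0 theta2_1
      by (intro mult_nonneg_nonneg mult_mono add_mono add_nonneg_nonneg;
          simp add: q1_def q2_def)+
    ultimately have "\<bar>f' q1\<bar> \<le> l + 3 * (2 * Q * t + 2 * Q * t) + 1 * (2 * Q ^ 3 * t + 2 * Q ^ 3 * t) + U"
      using Fx(1) by (rule gen)
    also have "\<dots> = l + t * (12 * Q + 4 * Q ^ 3 + Q ^ 11 * l * S + 3 * (Q ^ 7 * S) * (Q ^ 7 * S))"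
      by (simp add: U_def eval_nat_numeral algebra_simps)
    also have "\<dots> \<le> l + t * (5 * Q ^ 3 + Q ^ 11 * l * S)"
    proof -
      have "1 / Q ^ 3 \<le> 1" using Qp(2)[of 3] Q0 by (simp add: divide_le_eq_1)
      hence "Q ^ 7 * S \<le> 1" using QS[of 7] by simp
      hence "(Q ^ 7 * S) * (Q ^ 7 * S) \<le> 1 * 1" using S0 Q0 by (intro mult_mono) auto
      moreover have "12 * Q + 3 \<le> 36 * Q" using Q by simp
      moreover have "36 * Q \<le> Q\<^sup>2 * Q" using Q36 Q0 by (intro mult_right_mono) auto
      moreover have "Q\<^sup>2 * Q = Q ^ 3" by (simp add: eval_nat_numeral)
      ultimately have "12 * Q + 4 * Q ^ 3 + Q ^ 11 * l * S + 3 * (Q ^ 7 * S) * (Q ^ 7 * S) \<le>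
          5 * Q ^ 3 + Q ^ 11 * l * S" by linarith
      thus ?thesis using t0 by (intro add_left_mono mult_left_mono) auto
    qed
    finally show ?thesis .
  qed
  have yq: "d0 * \<bar>y1 - q1\<bar> \<le> Q * (2 * l + t * (5 * Q ^ 3 + Q ^ 11 * l * S))"
  proof -
    have "d0 / Q * \<bar>y1 - q1\<bar> \<le> \<bar>f' y1 - f' q1\<bar>" by (rule cs(2))
    also have "\<dots> \<le> 2 * l + t * (5 * Q ^ 3 + Q ^ 11 * l * S)" using f'y f'q by linarith
    finally show ?thesis using Q0 by (simp add: field_simps)
  qed
  have fy: "f y1 = - (dispersion \<alpha> y1 f1 + dispersion \<alpha> y2 f2)" by (simp add: f_def Xq)
  have "W \<le> 2 * \<delta> + l * \<bar>y1 - q1\<bar>" using step1 gain F fy by linarith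
  hence "W * d0 \<le> (2 * \<delta> + l * \<bar>y1 - q1\<bar>) * d0" using d by (intro mult_right_mono) auto
  also have "\<dots> = 2 * (\<delta> * d0) + l * (d0 * \<bar>y1 - q1\<bar>)" by (simp add: algebra_simps)
  also have "\<dots> \<le> 2 * l\<^sup>2 + l * (Q * (2 * l + t * (5 * Q ^ 3 + Q ^ 11 * l * S)))"
    using yq delta l by (intro add_mono mult_left_mono) auto
  finally have up: "W * d0 \<le> 2 * l\<^sup>2 + 2 * Q * l\<^sup>2 + 5 * Q ^ 4 * l * t + Q ^ 12 * l\<^sup>2 * S * t"
    by (simp add: eval_nat_numeral algebra_simps)
  \<comment> \<open>k \<ge> 32 Q^12 l together with \<open>S1\<close> makes d0 S large against l V.
    This absorbs both error terms that still contain t.\<close>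
  have lV: "32 * Q ^ 9 * (l * V) \<le> d0 * S"
  proof -
    have "32 * Q ^ 12 * l * V \<le> k * V" using l(2) V by (intro mult_right_mono) auto
    also have "\<dots> \<le> Q ^ 3 * d0 * S" by (rule S1)
    finally have "Q ^ 3 * (32 * Q ^ 9 * (l * V)) \<le> Q ^ 3 * (d0 * S)"
      by (simp add: eval_nat_numeral algebra_simps)
    thus ?thesis using Qp(1)[of 3] by simp
  qed
  have term1: "5 * Q ^ 4 * l * t \<le> W * d0 / 4"
  proof -
    have "20 * Q ^ 5 * l \<le> 32 * Q ^ 9 * (l * V)"
    proof -
      have "20 * Q ^ 5 * l * 1 \<le> 32 * Q ^ 9 * l * V"
        using V l Q1 Q0 by (intro mult_mono power_increasing) auto
      thus ?thesis by (simp add: algebra_simps)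
    qed
    hence "20 * Q ^ 5 * l \<le> d0 * S" using lV by (rule order_trans)
    hence "20 * Q ^ 5 * l * t \<le> d0 * S * t" using t0 by (intro mult_right_mono) auto
    thus ?thesis using Q0 by (simp add: W_def field_simps eval_nat_numeral)
  qed
  have term2: "Q ^ 12 * l\<^sup>2 * S * t \<le> W * d0 / 4"
  proof -
    have "(32 * Q ^ 9 * (l * V))\<^sup>2 \<le> (d0 * S)\<^sup>2" using lV l V Q0 by (intro power_mono) auto
    hence "1024 * Q ^ 18 * l\<^sup>2 * V\<^sup>2 \<le> d0 * d0 * S\<^sup>2" by (simp add: eval_nat_numeral algebra_simps)
    also have "\<dots> \<le> V\<^sup>2 * d0 * S\<^sup>2" using V d by (intro mult_right_mono) auto
    finally have "(1024 * Q ^ 18 * l\<^sup>2) * V\<^sup>2 \<le> (d0 * S\<^sup>2) * V\<^sup>2" by (simp add: algebra_simps)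
    hence "1024 * Q ^ 18 * l\<^sup>2 \<le> d0 * S\<^sup>2" using V by simp
    moreover have "4 * Q ^ 13 * l\<^sup>2 \<le> 1024 * Q ^ 18 * l\<^sup>2"
      using Q1 by (intro mult_right_mono mult_mono power_increasing) auto
    moreover have "S\<^sup>2 \<le> 1"
      using QS[of 0] Qp(2)[of 10] S0 by (simp add: field_simps power_le_one) (smt (verit) power_le_one Qp(1) divide_le_eq_1_pos)
    hence "d0 * S\<^sup>2 \<le> d0 * 1" using d by (intro mult_left_mono) auto
    ultimately have "4 * Q ^ 13 * l\<^sup>2 \<le> d0" by linarith
    hence "4 * Q ^ 13 * l\<^sup>2 * (S * t) \<le> d0 * (S * t)" using S0 t0 by (intro mult_right_mono) auto
    thus ?thesis using Q0 by (simp add: W_def field_simps eval_nat_numeral)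
  qed
  have "W * d0 / 2 \<le> 2 * l\<^sup>2 + 2 * Q * l\<^sup>2" using up term1 term2 by linarith
  also have "\<dots> \<le> 3 * Q * l\<^sup>2"
  proof -
    have "2 * l\<^sup>2 \<le> Q * l\<^sup>2" using Q by (intro mult_right_mono) auto
    thus ?thesis by simp
  qed
  finally have tsd: "t * (d0 * S) \<le> 6 * Q\<^sup>2 * l\<^sup>2" using Q0 by (simp add: W_def field_simps power2_eq_square)
  \<comment> \<open>Trading t back for D through D = B t costs a factor B \<le> Q^2 V, whose V
    cancels the one on the left.\<close>
  have "D * (k * V) \<le> D * (Q ^ 3 * d0 * S)" using S1 D by (intro mult_left_mono) auto
  also have "\<dots> = Q ^ 3 * B * (t * (d0 * S))" using tB by (simp add: algebra_simps)
  also have "\<dots> \<le> Q ^ 3 * (Q\<^sup>2 * V) * (6 * Q\<^sup>2 * l\<^sup>2)"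
    by (rule mult_mono[OF mult_left_mono[OF B] tsd]) (use B0 Q0 V t0 d(1) S0 in auto)
  finally have "(D * k) * V \<le> (6 * Q ^ 7 * l\<^sup>2) * V" by (simp add: eval_nat_numeral algebra_simps)
  hence Dk: "D * k \<le> 6 * Q ^ 7 * l\<^sup>2" using V by simp
  have "32 * Q ^ 12 * l * D \<le> k * D" using l D by (intro mult_right_mono) auto
  moreover have "6 * Q ^ 7 * l * D \<le> 32 * Q ^ 12 * l * D"
    using l D Q1 by (intro mult_right_mono mult_mono power_increasing) auto
  ultimately have "6 * Q ^ 7 * l * D \<le> 6 * Q ^ 7 * l * l"
    using Dk by (simp add: power2_eq_square algebra_simps)
  hence "D \<le> l" using l Qp(1)[of 7] by simp
  thus ?thesis by (simp only: D_def)
qed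

end

section \<open>Counting frequency pairs\<close>

lemma card_int_spread:
  fixes S :: "int set" and h l :: real
  assumes "0 < h" "0 \<le> l" "\<And>i j. i \<in> S \<Longrightarrow> j \<in> S \<Longrightarrow> h * real_of_int j - h * real_of_int i \<le> l"
  shows "finite S" "real (card S) \<le> l / h + 1"
proof -
  have "finite S \<and> real (card S) \<le> l / h + 1"
  proof (cases "S = {}")
    case True
    thus ?thesis using assms by simp
  next
    case False
    then obtain i0 where i0: "i0 \<in> S" by blast
    have d: "j - i \<le> \<lfloor>l / h\<rfloor>" if "i \<in> S" "j \<in> S" for i j
    proof -
      have "real_of_int (j - i) \<le> l / h"
        using assms(3)[OF that] \<open>0 < h\<close> by (simp add: field_simps)
      thus ?thesis by (simp add: le_floor_iff)
    qed
    have "S \<subseteq> {i0 - \<lfloor>l / h\<rfloor>..i0 + \<lfloor>l / h\<rfloor>}"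
      using d[OF _ i0] d[OF i0] by force
    hence fin: "finite S" by (rule finite_subset) simp
    define m where "m = Min S"
    have m: "m \<in> S" unfolding m_def using fin False by (rule Min_in)
    have "S \<subseteq> {m..m + \<lfloor>l / h\<rfloor>}"
      using d[OF m] fin by (force simp: m_def)
    hence "card S \<le> card {m..m + \<lfloor>l / h\<rfloor>}" by (rule card_mono[rotated]) simp
    also have "\<dots> = nat (\<lfloor>l / h\<rfloor> + 1)" by simp
    finally have "real (card S) \<le> real (nat (\<lfloor>l / h\<rfloor> + 1))" by (simp only: of_nat_le_iff)
    also have "\<dots> = real_of_int \<lfloor>l / h\<rfloor> + 1" using assms by (simp add: of_nat_nat)
    also have "\<dots> \<le> l / h + 1" by simp
    finally show ?thesis using fin by simp
  qed
  thus "finite S" "real (card S) \<le> l / h + 1" by auto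
qed

lemma geometric_block:
  fixes a q \<kappa> :: real
  assumes "0 < a" "1 < q" "a \<le> \<kappa>" "\<kappa> < a * q ^ m"
  shows "\<exists>j<m. a * q ^ j \<le> \<kappa> \<and> \<kappa> < a * q ^ Suc j"
  using assms
proof (induction m)
  case (Suc m)
  show ?case
  proof (cases "\<kappa> < a * q ^ m")
    case True
    then obtain j where "j < m" "a * q ^ j \<le> \<kappa> \<and> \<kappa> < a * q ^ Suc j" using Suc by blast
    thus ?thesis by (intro exI[of _ j]) auto
  qed (use Suc in auto)
qed simp

text \<open>Frequency offsets below \<open>C l\<close> are counted trivially; above it, each geometric block
  contributes only a window of length \<open>l\<close>.\<close>

lemma card_tangential:
  fixes A :: "int set" and h l c C Kmax :: real
  assumes h: "0 < h" and l: "0 < l" and C: "1 \<le> C"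
    and K: "\<And>i. i \<in> A \<Longrightarrow> \<bar>h * of_int i - c\<bar> \<le> Kmax" "Kmax < C * l * (3 / 2) ^ m"
    and pos: "\<And>i j. i \<in> A \<Longrightarrow> j \<in> A \<Longrightarrow> C * l \<le> h * of_int i - c \<Longrightarrow>
        h * of_int i - c \<le> h * of_int j - c \<Longrightarrow> h * of_int j - c \<le> 3 / 2 * (h * of_int i - c) \<Longrightarrow>
        h * of_int j - h * of_int i \<le> l"
    and neg: "\<And>i j. i \<in> A \<Longrightarrow> j \<in> A \<Longrightarrow> C * l \<le> c - h * of_int i \<Longrightarrow>
        c - h * of_int i \<le> c - h * of_int j \<Longrightarrow> c - h * of_int j \<le> 3 / 2 * (c - h * of_int i) \<Longrightarrow>
        h * of_int i - h * of_int j \<le> l"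
  shows "finite A" "real (card A) \<le> (2 * C + 1 + 2 * real m) * (l / h + 1)"
proof -
  define a where "a = C * l"
  have a: "0 < a" using l C by (simp add: a_def)
  define A0 where "A0 = {i \<in> A. \<bar>h * of_int i - c\<bar> \<le> a}"
  \<comment> \<open>The ratio 3/2 of consecutive blocks is the range in which \<open>pos\<close> and
    \<open>neg\<close> compare two offsets; the sign of the offset decides between P and N.\<close>
  define P where "P = (\<lambda>j. {i \<in> A. a * (3 / 2) ^ j \<le> h * of_int i - c \<and> h * of_int i - c < a * (3 / 2) ^ Suc j})"
  define N where "N = (\<lambda>j. {i \<in> A. a * (3 / 2) ^ j \<le> c - h * of_int i \<and> c - h * of_int i < a * (3 / 2) ^ Suc j})"
  have pw: "a \<le> a * (3 / 2) ^ j" for j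
    using mult_left_mono[of 1 "(3 / 2) ^ j" a] a by simp
  have A0: "finite A0 \<and> real (card A0) \<le> 2 * a / h + 1"
    using card_int_spread[of h "2 * a" A0] h a by (force simp: A0_def)
  have P: "finite (P j) \<and> real (card (P j)) \<le> l / h + 1" for j
  proof -
    have "h * real_of_int i' - h * real_of_int i \<le> l" if "i \<in> P j" "i' \<in> P j" for i i'
    proof (cases "i \<le> i'")
      case True
      hence "h * real_of_int i \<le> h * real_of_int i'" using h by simp
      thus ?thesis using pos[of i i'] that pw[of j] unfolding P_def a_def[symmetric] by auto
    next
      case False
      hence "h * real_of_int i' \<le> h * real_of_int i" using h by simp
      thus ?thesis using l by simp
    qed
    thus ?thesis using card_int_spread[of h l "P j"] h l by auto
  qed
  have N: "finite (N j) \<and> real (card (N j)) \<le> l / h + 1" for j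
  proof -
    have "h * real_of_int i' - h * real_of_int i \<le> l" if "i \<in> N j" "i' \<in> N j" for i i'
    proof (cases "i \<le> i'")
      case True
      hence "h * real_of_int i \<le> h * real_of_int i'" using h by simp
      thus ?thesis using neg[of i' i] that pw[of j] unfolding N_def a_def[symmetric] by auto
    next
      case False
      hence "h * real_of_int i' \<le> h * real_of_int i" using h by simp
      thus ?thesis using l by simp
    qed
    thus ?thesis using card_int_spread[of h l "N j"] h l by auto
  qed
  have cover: "A \<subseteq> A0 \<union> ((\<Union>j<m. P j) \<union> (\<Union>j<m. N j))"
  proof
    fix i assume i: "i \<in> A"
    have K': "\<bar>h * of_int i - c\<bar> < a * (3 / 2) ^ m" using K(1)[OF i] K(2) by (simp add: a_def)
    consider "\<bar>h * of_int i - c\<bar> \<le> a" | "a \<le> h * of_int i - c" | "a \<le> c - h * of_int i" by linarith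
    thus "i \<in> A0 \<union> ((\<Union>j<m. P j) \<union> (\<Union>j<m. N j))"
    proof cases
      case 1 thus ?thesis using i by (simp add: A0_def)
    next
      case 2
      then obtain j where "j < m" "a * (3 / 2) ^ j \<le> h * of_int i - c \<and> h * of_int i - c < a * (3 / 2) ^ Suc j"
        using geometric_block[of a "3 / 2" "h * of_int i - c" m] K' a by force
      thus ?thesis using i by (auto simp: P_def)
    next
      case 3
      then obtain j where "j < m" "a * (3 / 2) ^ j \<le> c - h * of_int i \<and> c - h * of_int i < a * (3 / 2) ^ Suc j"
        using geometric_block[of a "3 / 2" "c - h * of_int i" m] K' a by force
      thus ?thesis using i by (auto simp: N_def)
    qed
  qed
  have finU: "finite (A0 \<union> ((\<Union>j<m. P j) \<union> (\<Union>j<m. N j)))" using A0 P N by auto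
  show "finite A" using cover finU by (rule finite_subset)
  have "card A \<le> card (A0 \<union> ((\<Union>j<m. P j) \<union> (\<Union>j<m. N j)))" using cover finU by (rule card_mono[rotated])
  also have "\<dots> \<le> card A0 + (card (\<Union>j<m. P j) + card (\<Union>j<m. N j))"
    by (intro order_trans[OF card_Un_le] add_mono order_refl card_Un_le)
  also have "\<dots> \<le> card A0 + ((\<Sum>j<m. card (P j)) + (\<Sum>j<m. card (N j)))"
    by (intro add_mono order_refl card_UN_le) auto
  finally have "real (card A) \<le> real (card A0 + ((\<Sum>j<m. card (P j)) + (\<Sum>j<m. card (N j))))"
    by (simp only: of_nat_le_iff)
  also have "\<dots> = real (card A0) + ((\<Sum>j<m. real (card (P j))) + (\<Sum>j<m. real (card (N j))))" by simp
  also have "\<dots> \<le> (2 * a / h + 1) + ((\<Sum>j<m. l / h + 1) + (\<Sum>j<m. l / h + 1))"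
    using A0 P N by (intro add_mono sum_mono) auto
  also have "\<dots> = 2 * C * (l / h) + 1 + 2 * real m * (l / h + 1)" by (simp add: a_def algebra_simps)
  also have "\<dots> \<le> (2 * C + 1 + 2 * real m) * (l / h + 1)"
  proof -
    have "0 \<le> l / h" using l h by simp
    thus ?thesis using C by (simp add: algebra_simps)
  qed
  finally show "real (card A) \<le> (2 * C + 1 + 2 * real m) * (l / h + 1)" .
qed

text \<open>A nonempty U i k lies in the interval of radius l i around any of its points. Passing to
  these intervals gives the length 2 l i without measurability of the sets U i k, and the index k is
  counted through the nonempty ones.\<close>

lemma nn_integral_slices_le:
  fixes T :: "int \<Rightarrow> real set"
  assumes fin: "finite I"
    and cover: "\<And>k. T k \<subseteq> (\<Union>i\<in>I. U i k)"
    and A: "\<And>i. i \<in> I \<Longrightarrow> finite {k. U i k \<noteq> {}} \<and> real (card {k. U i k \<noteq> {}}) \<le> n i"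
    and l: "\<And>i. i \<in> I \<Longrightarrow> 0 \<le> l i" "\<And>i k x y. i \<in> I \<Longrightarrow> x \<in> U i k \<Longrightarrow> y \<in> U i k \<Longrightarrow> \<bar>x - y\<bar> \<le> l i"
  shows "(\<integral>\<^sup>+k. emeasure lborel (T k) \<partial>count_space UNIV) \<le> ennreal (\<Sum>i\<in>I. n i * (2 * l i))"
proof -
  have bd: "emeasure lborel (T k) \<le> (\<Sum>i\<in>I. ennreal (2 * l i) * indicator {k. U i k \<noteq> {}} k)" for k
  proof -
    define c where "c = (\<lambda>i. SOME x. x \<in> U i k)"
    define V where "V = (\<lambda>i. if U i k = {} then {} else {c i - l i..c i + l i})"
    have "U i k \<subseteq> V i" if "i \<in> I" for i
    proof
      fix x assume x: "x \<in> U i k"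
      hence "c i \<in> U i k" unfolding c_def by (rule someI)
      thus "x \<in> V i" using l(2)[OF that x, of "c i"] x by (auto simp: V_def abs_le_iff)
    qed
    hence "T k \<subseteq> (\<Union>i\<in>I. V i)" using cover[of k] by fastforce
    hence "emeasure lborel (T k) \<le> emeasure lborel (\<Union>i\<in>I. V i)"
      by (rule emeasure_mono) (auto simp: V_def fin)
    also have "\<dots> \<le> (\<Sum>i\<in>I. emeasure lborel (V i))"
      by (rule emeasure_subadditive_finite) (auto simp: V_def fin)
    also have "\<dots> \<le> (\<Sum>i\<in>I. ennreal (2 * l i) * indicator {k. U i k \<noteq> {}} k)"
      using l(1) by (intro sum_mono) (auto simp: V_def)
    finally show ?thesis .
  qed
  have "(\<integral>\<^sup>+k. emeasure lborel (T k) \<partial>count_space UNIV) \<le>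
      (\<integral>\<^sup>+k. (\<Sum>i\<in>I. ennreal (2 * l i) * indicator {k. U i k \<noteq> {}} k) \<partial>count_space UNIV)"
    by (intro nn_integral_mono bd)
  also have "\<dots> = (\<Sum>i\<in>I. \<integral>\<^sup>+k. ennreal (2 * l i) * indicator {k. U i k \<noteq> {}} k \<partial>count_space UNIV)"
    by (rule nn_integral_sum) auto
  also have "\<dots> = (\<Sum>i\<in>I. ennreal (2 * l i) * ennreal (real (card {k. U i k \<noteq> {}})))"
    using A by (intro sum.cong) (auto simp: nn_integral_cmult_indicator ennreal_of_nat_eq_real_of_nat)
  also have "\<dots> \<le> (\<Sum>i\<in>I. ennreal (2 * l i) * ennreal (n i))"
    using A by (intro sum_mono mult_left_mono ennreal_leI) auto
  also have "\<dots> = (\<Sum>i\<in>I. ennreal (n i * (2 * l i)))"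
  proof (intro sum.cong refl)
    fix i assume i: "i \<in> I"
    have "0 \<le> n i" using A[OF i] of_nat_0_le_iff order_trans by blast
    thus "ennreal (2 * l i) * ennreal (n i) = ennreal (n i * (2 * l i))"
      using l(1)[OF i] by (simp add: ennreal_mult mult.commute)
  qed
  also have "\<dots> = ennreal (\<Sum>i\<in>I. n i * (2 * l i))"
  proof (intro sum_ennreal)
    fix i assume i: "i \<in> I"
    have "0 \<le> n i" using A[OF i] of_nat_0_le_iff order_trans by blast
    thus "0 \<le> n i * (2 * l i)" using l(1)[OF i] by simp
  qed
  finally show ?thesis .
qed

text \<open>The counting scheme behind \<open>plus_count\<close> and \<open>minus_count\<close>,
  with g the difference of derivatives. On the layer where |g| is of size lam i,
  \<open>card_tangential\<close> allows at most a multiple of (m + 1) lam i / h indices, and each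
  slice has diameter at most L \<delta> / lam i. The size lam i cancels, so all 2 (m + 1) layers
  have the same bound, and their sum is of order (m + 1)^2 \<delta>/h.\<close>

lemma lattice_slices:
  fixes T :: "int \<Rightarrow> real set" and g :: "int \<Rightarrow> real \<Rightarrow> real"
    and h \<delta> l0 L \<Lambda> C Kmax c :: real
  assumes h: "0 < h" "h \<le> l0" and \<delta>: "0 < \<delta>" and L: "0 < L" and C: "1 \<le> C"
    and bound: "\<And>k x. x \<in> T k \<Longrightarrow> \<bar>g k x\<bar> \<le> \<Lambda>" "\<Lambda> < 2 ^ m * l0"
    and K: "\<And>k x. x \<in> T k \<Longrightarrow> \<bar>h * of_int k - c\<bar> \<le> Kmax" "Kmax < 2 ^ m * l0"
    and diam0: "\<And>k x y. x \<in> T k \<Longrightarrow> y \<in> T k \<Longrightarrow> \<bar>g k x\<bar> \<le> l0 \<Longrightarrow> \<bar>g k y\<bar> \<le> l0 \<Longrightarrow> \<bar>x - y\<bar> \<le> L * \<delta> / l0"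
    and diamp: "\<And>k x y l. x \<in> T k \<Longrightarrow> y \<in> T k \<Longrightarrow> 0 < l \<Longrightarrow> l \<le> g k x \<Longrightarrow> l \<le> g k y \<Longrightarrow> \<bar>x - y\<bar> \<le> L * \<delta> / (2 * l)"
    and diamn: "\<And>k x y l. x \<in> T k \<Longrightarrow> y \<in> T k \<Longrightarrow> 0 < l \<Longrightarrow> g k x \<le> - l \<Longrightarrow> g k y \<le> - l \<Longrightarrow> \<bar>x - y\<bar> \<le> L * \<delta> / (2 * l)"
    and pos: "\<And>l i j x y. l0 \<le> l \<Longrightarrow> x \<in> T i \<Longrightarrow> y \<in> T j \<Longrightarrow> \<bar>g i x\<bar> \<le> l \<Longrightarrow> \<bar>g j y\<bar> \<le> l \<Longrightarrow>
        C * l \<le> h * of_int i - c \<Longrightarrow>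
        h * of_int i - c \<le> h * of_int j - c \<Longrightarrow> h * of_int j - c \<le> 3 / 2 * (h * of_int i - c) \<Longrightarrow>
        h * of_int j - h * of_int i \<le> l"
    and neg: "\<And>l i j x y. l0 \<le> l \<Longrightarrow> x \<in> T i \<Longrightarrow> y \<in> T j \<Longrightarrow> \<bar>g i x\<bar> \<le> l \<Longrightarrow> \<bar>g j y\<bar> \<le> l \<Longrightarrow>
        C * l \<le> c - h * of_int i \<Longrightarrow>
        c - h * of_int i \<le> c - h * of_int j \<Longrightarrow> c - h * of_int j \<le> 3 / 2 * (c - h * of_int i) \<Longrightarrow>
        h * of_int i - h * of_int j \<le> l"
  shows "(\<integral>\<^sup>+k. emeasure lborel (T k) \<partial>count_space UNIV) \<le>
    ennreal (40 * L * C * (real m + 1)\<^sup>2 * \<delta> / h)"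
proof -
  define lam where "lam = (\<lambda>i::nat. 2 ^ i * l0)"
  have l0: "0 < l0" using h by simp
  have lam: "0 < lam i" "l0 \<le> lam i" "h \<le> lam i" for i
  proof -
    have "1 * l0 \<le> 2 ^ i * l0" using l0 by (intro mult_right_mono) auto
    thus "0 < lam i" "l0 \<le> lam i" "h \<le> lam i" unfolding lam_def using l0 h(2) by linarith+
  qed
  \<comment> \<open>Layer i = 0 collects |g| \<le> l0, where \<open>diam0\<close> gives the
    diameter. The other layers are split by the sign of g, encoded in b, since \<open>diamp\<close>
    and \<open>diamn\<close> ask for one sign at both points.\<close>
  define U where "U = (\<lambda>(b::nat, i::nat) k. {x \<in> T k. \<bar>g k x\<bar> \<le> lam i \<and>
     (i = 0 \<or> (if b = 0 then lam i / 2 \<le> g k x else g k x \<le> - (lam i / 2)))})"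
  define I where "I = {0::nat, 1} \<times> {..m}"
  define n where "n = (\<lambda>(b::nat, i::nat). (2 * C + 1 + 4 * real m) * (lam i / h + 1))"
  define ll where "ll = (\<lambda>(b::nat, i::nat). L * \<delta> / lam i)"
  have "(\<integral>\<^sup>+k. emeasure lborel (T k) \<partial>count_space UNIV) \<le> ennreal (\<Sum>i\<in>I. n i * (2 * ll i))"
  proof (rule nn_integral_slices_le[where U = U])
    show "finite I" by (simp add: I_def)
    show "T k \<subseteq> (\<Union>i\<in>I. U i k)" for k
    proof
      fix x assume x: "x \<in> T k"
      show "x \<in> (\<Union>i\<in>I. U i k)"
      proof (cases "\<bar>g k x\<bar> \<le> l0")
        case True
        hence "x \<in> U (0, 0) k" using x by (simp add: U_def lam_def)
        thus ?thesis by (force simp: I_def)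
      next
        case False
        have "\<bar>g k x\<bar> < l0 * 2 ^ m" using bound(1)[OF x] bound(2) by (simp add: mult.commute)
        then obtain j where j: "j < m" "l0 * 2 ^ j \<le> \<bar>g k x\<bar>" "\<bar>g k x\<bar> < l0 * 2 ^ Suc j"
          using geometric_block[of l0 2 "\<bar>g k x\<bar>" m] False l0 by force
        have "x \<in> U ((if g k x \<ge> 0 then 0 else 1), Suc j) k"
          using x j by (auto simp: U_def lam_def mult_ac)
        moreover have "((if g k x \<ge> 0 then 0 else 1), Suc j) \<in> I" using j by (auto simp: I_def)
        ultimately show ?thesis by blast
      qed
    qed
    show "0 \<le> ll i" for i using L \<delta> lam by (auto simp: ll_def split: prod.splits intro!: divide_nonneg_pos)
    show "\<bar>x - y\<bar> \<le> ll i" if "i \<in> I" "x \<in> U i k" "y \<in> U i k" for i k x y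
    proof -
      obtain b j where i: "i = (b, j)" by force
      show ?thesis
      proof (cases "j = 0")
        case True
        thus ?thesis using diam0[of x k y] that by (auto simp: i U_def ll_def lam_def)
      next
        case False
        thus ?thesis using diamp[of x k y "lam j / 2"] diamn[of x k y "lam j / 2"] lam[of j] that
          by (auto simp: i U_def ll_def split: if_splits)
      qed
    qed
    show "finite {k. U i k \<noteq> {}} \<and> real (card {k. U i k \<noteq> {}}) \<le> n i" if "i \<in> I" for i
    proof -
      obtain b j where i: "i = (b, j)" by force
      define A where "A = {k. U i k \<noteq> {}}"
      have A: "\<exists>x. x \<in> T k \<and> \<bar>g k x\<bar> \<le> lam j" if "k \<in> A" for k
        using that by (auto simp: A_def U_def i)
      \<comment> \<open>The blocks have ratio 3/2 instead of 2; twice as many suffice, because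
        (3/2)^2 \<ge> 2.\<close>
      have "Kmax < C * lam j * (3 / 2) ^ (2 * m)"
      proof -
        have "Kmax < 2 ^ m * l0" by (rule K)
        also have "\<dots> \<le> (3 / 2) ^ (2 * m) * lam j"
        proof (intro mult_mono)
          have "(2::real) ^ m \<le> (9 / 4) ^ m" by (intro power_mono) auto
          thus "(2::real) ^ m \<le> (3 / 2) ^ (2 * m)" by (simp add: power_mult power2_eq_square)
        qed (use lam l0 in auto)
        also have "\<dots> \<le> C * ((3 / 2) ^ (2 * m) * lam j)"
          using C lam[of j] mult_right_mono[of 1 C "(3 / 2) ^ (2 * m) * lam j"] by simp
        finally show ?thesis by (simp add: mult_ac)
      qed
      note ct = card_tangential[where A = A and h = h and l = "lam j" and c = c and C = C
          and Kmax = Kmax and m = "2 * m", OF h(1) lam(1) C _ this]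
      have "finite A \<and> real (card A) \<le> (2 * C + 1 + 2 * real (2 * m)) * (lam j / h + 1)"
        apply (rule conjI)
         apply (rule ct(1))
           apply (metis A K(1))
          apply (metis A pos lam(2))
         apply (metis A neg lam(2))
        apply (rule ct(2))
          apply (metis A K(1))
         apply (metis A pos lam(2))
        apply (metis A neg lam(2))
        done
      thus ?thesis by (simp add: A_def n_def i)
    qed
  qed
  also have "(\<Sum>i\<in>I. n i * (2 * ll i)) \<le> (\<Sum>i\<in>I. 4 * L * (2 * C + 1 + 4 * real m) * \<delta> / h)"
  proof (intro sum_mono)
    fix i assume "i \<in> I"
    obtain b j where i: "i = (b, j)" by force
    have "(lam j / h + 1) * (\<delta> / lam j) = \<delta> / h + \<delta> / lam j"
      using lam[of j] h by (simp add: field_simps)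
    \<comment> \<open>The term \<delta> / lam j comes from rounding up the number of indices; it is
      harmless because lam j \<ge> h.\<close>
    also have "\<dots> \<le> \<delta> / h + \<delta> / h" using lam[of j] h \<delta> by (intro add_left_mono divide_left_mono) auto
    finally have *: "(lam j / h + 1) * (\<delta> / lam j) \<le> \<delta> / h + \<delta> / h" .
    define M where "M = 2 * C + 1 + 4 * real m"
    have "n i * (2 * ll i) = (2 * L * M) * ((lam j / h + 1) * (\<delta> / lam j))"
      by (simp add: i n_def ll_def M_def)
    also have "\<dots> \<le> (2 * L * M) * (\<delta> / h + \<delta> / h)"
      using L C * by (intro mult_left_mono) (auto simp: M_def)
    also have "\<dots> = 4 * L * M * \<delta> / h" by simp
    finally show "n i * (2 * ll i) \<le> 4 * L * (2 * C + 1 + 4 * real m) * \<delta> / h"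
      by (simp only: M_def)
  qed
  also have "\<dots> = 8 * (real m + 1) * L * (2 * C + 1 + 4 * real m) * \<delta> / h"
    by (simp add: I_def algebra_simps)
  also have "\<dots> \<le> 8 * (real m + 1) * L * (5 * C * (real m + 1)) * \<delta> / h"
  proof -
    have "real m \<le> C * real m" using C mult_right_mono[of 1 C "real m"] by simp
    hence "2 * C + 1 + 4 * real m \<le> 5 * C * (real m + 1)" using C by (simp add: algebra_simps)
    thus ?thesis using L \<delta> h by (intro divide_right_mono mult_right_mono mult_left_mono) auto
  qed
  also have "\<dots> = 40 * L * C * (real m + 1)\<^sup>2 * \<delta> / h" by (simp add: power2_eq_square algebra_simps)
  finally show ?thesis by (simp add: ennreal_leI)
qed

text \<open>Monotonicity of f' puts the mean slope between its end values. If f' is at least l at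
  both ends, or at most -l at both, the values of f separate at rate l, and this bounds the length
  of a slice.\<close>

lemma MVT_slope:
  fixes f f' f'' :: "real \<Rightarrow> real"
  assumes f: "\<And>x. min a b \<le> x \<Longrightarrow> x \<le> max a b \<Longrightarrow> (f has_real_derivative f' x) (at x)"
    and f': "\<And>x. min a b \<le> x \<Longrightarrow> x \<le> max a b \<Longrightarrow> (f' has_real_derivative f'' x) (at x)"
    and f'': "\<And>x. min a b \<le> x \<Longrightarrow> x \<le> max a b \<Longrightarrow> 0 \<le> f'' x"
  shows "\<exists>s. f b - f a = (b - a) * s \<and> min (f' a) (f' b) \<le> s \<and> s \<le> max (f' a) (f' b)"
proof -
  have main: "\<exists>s. f v - f u = (v - u) * s \<and> f' u \<le> s \<and> s \<le> f' v" if uv: "min a b = u" "max a b = v" "u < v" for u v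
  proof -
    have "\<exists>z>u. z < v \<and> f v - f u = (v - u) * f' z"
      using uv(3) by (rule MVT2) (use uv f in auto)
    then obtain z where z: "u < z" "z < v" "f v - f u = (v - u) * f' z" by blast
    have inc: "f' c \<le> f' d" if "u \<le> c" "c \<le> d" "d \<le> v" for c d
    proof (rule DERIV_nonneg_imp_nondecreasing[OF that(2)])
      fix x assume "c \<le> x" "x \<le> d"
      hence "min a b \<le> x" "x \<le> max a b" using that uv by auto
      thus "\<exists>y. (f' has_real_derivative y) (at x) \<and> 0 \<le> y" using f' f'' by blast
    qed
    have "f' u \<le> f' z" "f' z \<le> f' v" using inc z by auto
    thus ?thesis using z by blast
  qed
  consider "a = b" | "a < b" | "b < a" by linarith
  thus ?thesis
  proof cases
    case 1 thus ?thesis by auto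
  next
    case 2
    then obtain s where "f b - f a = (b - a) * s" "f' a \<le> s" "s \<le> f' b" using main[of a b] by auto
    thus ?thesis by (intro exI[of _ s]) auto
  next
    case 3
    then obtain s where "f a - f b = (a - b) * s" "f' b \<le> s" "s \<le> f' a" using main[of b a] by auto
    thus ?thesis by (intro exI[of _ s]) (auto simp: algebra_simps)
  qed
qed

lemma MVT_slope_diam:
  fixes a b s l \<delta> F G :: real
  assumes "G - F = (b - a) * s" "\<bar>G - F\<bar> \<le> 2 * \<delta>" "0 < l" "l \<le> \<bar>s\<bar>"
  shows "\<bar>a - b\<bar> \<le> 2 * \<delta> / l"
proof -
  have "\<bar>b - a\<bar> * l \<le> \<bar>b - a\<bar> * \<bar>s\<bar>" using assms by (intro mult_left_mono) auto
  also have "\<dots> \<le> 2 * \<delta>" using assms by (simp flip: abs_mult)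
  finally show ?thesis using assms by (simp add: field_simps abs_minus_commute)
qed

section \<open>Measure of the slices for positive, negative and nearly vanishing curvature\<close>

definition pair_slice :: "real \<Rightarrow> (real \<times> real) set \<Rightarrow> real \<Rightarrow> real \<Rightarrow> real \<Rightarrow> real \<Rightarrow> real \<Rightarrow> real \<Rightarrow> real set" where
  "pair_slice \<alpha> P X H \<tau> \<delta> h e = {x. (x, e) \<in> P \<and> (X - x, H - e) \<in> P \<and>
     \<bar>dispersion \<alpha> x e + dispersion \<alpha> (X - x) (H - e) - \<tau>\<bar> \<le> \<delta>}"

context dispersion_range
begin

definition plus_region :: "real \<Rightarrow> (real \<times> real) set" where
  "plus_region d0 = {(x, e). p \<le> x \<and> x \<le> r \<and> 0 \<le> e \<and> d0 \<le> curv \<alpha> x e \<and> curv \<alpha> x e \<le> 2 * d0}"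

text \<open>The cell of side \<sigma> in x and in the slope e/x supplies the closeness assumptions
  of \<open>minus_pair\<close> for any two of its points.\<close>

definition minus_region :: "real \<Rightarrow> real \<Rightarrow> real \<Rightarrow> real \<Rightarrow> (real \<times> real) set" where
  "minus_region d0 x0 z0 \<sigma> = {(x, e). p \<le> x \<and> x \<le> r \<and> 0 \<le> e \<and> - 2 * d0 \<le> curv \<alpha> x e \<and> curv \<alpha> x e \<le> - d0 \<and>
     x0 \<le> x \<and> x \<le> x0 + \<sigma> \<and> z0 \<le> e / x \<and> e / x \<le> z0 + \<sigma>}"

definition core_region :: "real \<Rightarrow> (real \<times> real) set" where
  "core_region d0 = {(x, e). p \<le> x \<and> x \<le> r \<and> 0 \<le> e \<and> \<bar>curv \<alpha> x e\<bar> \<le> d0}"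

lemma powr_alpha_le:
  assumes "p / 2 \<le> x" "x \<le> 2 * r"
  shows "x powr \<alpha> \<le> Q\<^sup>2" "0 \<le> x powr \<alpha>"
proof -
  have x: "0 < x" using assms p by simp
  have "x powr \<alpha> = x powr (\<alpha> - 1) * x" using x by (simp add: powr_diff)
  also have "\<dots> \<le> Q * Q" using powr_bounds[OF assms] x_bounds[OF assms] x by (intro mult_mono) auto
  finally show "x powr \<alpha> \<le> Q\<^sup>2" by (simp add: power2_eq_square)
qed simp

text \<open>The variant of \<open>eta_bound\<close> for the core, where the curvature may be
  slightly negative.\<close>

lemma eta_bound':
  assumes "p / 2 \<le> x" "x \<le> 2 * r" "- 1 \<le> curv \<alpha> x e" "0 \<le> e"
  shows "e \<le> Q"
proof -
  have "2 * e\<^sup>2 * (1 / Q) \<le> 2 * e\<^sup>2 * (1 / x powr (\<alpha> + 2))"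
    using inv_powr_bounds[of x] assms by (intro mult_left_mono) auto
  also have "\<dots> \<le> 7" using assms alpha_prod by (simp add: curv_def)
  finally have "2 * e\<^sup>2 \<le> 7 * Q" using Q by (simp add: field_simps)
  moreover have "7 * Q \<le> 2 * Q\<^sup>2" using Q by (simp add: power2_eq_square)
  ultimately have "e\<^sup>2 \<le> Q\<^sup>2" by simp
  thus ?thesis using Q by (simp add: power2_le_iff_abs_le)
qed

text \<open>The bottom level l0 = sqrt(\<delta> d0) is where two bounds for the length of a slice
  agree: l0/d0 from strong convexity in x, and \<delta>/l0 from the slope. The assumption h^2 \<le>
  \<delta> d0 says h \<le> l0, and the condition on m lets m dyadic levels reach every derivative
  difference and every offset.\<close>

lemma plus_count:
  assumes h: "0 < h" "h\<^sup>2 \<le> \<delta> * d0" and \<delta>: "0 < \<delta>" and d0: "0 < d0"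
    and m: "Q ^ 4 * sqrt (1 + d0) < 2 ^ m * sqrt (\<delta> * d0)"
  shows "(\<integral>\<^sup>+k. emeasure lborel (pair_slice \<alpha> (plus_region d0) X H \<tau> \<delta> h (h * of_int k)) \<partial>count_space UNIV) \<le>
    ennreal (40 * Q * (32 * Q ^ 12) * (real m + 1)\<^sup>2 * \<delta> / h)"
proof -
  define T where "T = (\<lambda>k::int. pair_slice \<alpha> (plus_region d0) X H \<tau> \<delta> h (h * of_int k))"
  define g where "g = (\<lambda>(k::int) x. disp_x \<alpha> x (h * of_int k) - disp_x \<alpha> (X - x) (H - h * of_int k))"
  define l0 where "l0 = sqrt (\<delta> * d0)"
  have Q0: "0 < Q" and Q1: "1 \<le> Q" using Q by auto
  have l0: "0 < l0" "l0\<^sup>2 = \<delta> * d0" using \<delta> d0 by (auto simp: l0_def)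
  have hl0: "h \<le> l0" unfolding l0_def using h by (intro real_le_rsqrt)
  have C1: "1 \<le> 32 * Q ^ 12" using one_le_power[OF Q1, of 12] by linarith
  have TD: "p \<le> x"
      "x \<le> r"
      "p \<le> X - x"
      "X - x \<le> r"
      "0 \<le> h * of_int k"
      "0 \<le> H - h * of_int k"
      "d0 \<le> curv \<alpha> x (h * of_int k)"
      "curv \<alpha> x (h * of_int k) \<le> 2 * d0"
      "d0 \<le> curv \<alpha> (X - x) (H - h * of_int k)"
      "curv \<alpha> (X - x) (H - h * of_int k) \<le> 2 * d0"
      "\<bar>dispersion \<alpha> x (h * of_int k) + dispersion \<alpha> (X - x) (H - h * of_int k) - \<tau>\<bar> \<le> \<delta>"
      if "x \<in> T k" for x k
    using that by (simp_all add: T_def pair_slice_def plus_region_def)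
  have V1: "1 \<le> sqrt (1 + d0)" using d0 by simp
  have eQ: "h * of_int k \<le> Q \<and> H - h * of_int k \<le> Q" if "x \<in> T k" for x k
    using eta_bound[of x "h * of_int k"] eta_bound[of "X - x" "H - h * of_int k"] TD[OF that] p d0 by auto
  have disp_le: "0 \<le> disp_x \<alpha> x e \<and> disp_x \<alpha> x e \<le> Q ^ 4" if "p \<le> x" "x \<le> r" "0 \<le> e" "e \<le> Q" for x e
  proof -
    have x: "p / 2 \<le> x" "x \<le> 2 * r" using that p by auto
    have "(\<alpha> + 1) * x powr \<alpha> \<le> 3 * Q\<^sup>2" using powr_alpha_le[OF x] alpha by (intro mult_mono) auto
    moreover have "e\<^sup>2 / x\<^sup>2 \<le> Q * e\<^sup>2" using sq_div_bounds(2)[OF x, of "e\<^sup>2"] by simp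
    moreover have "Q * e\<^sup>2 \<le> Q * Q\<^sup>2" using that Q0 by (intro mult_left_mono power_mono) auto
    moreover have "3 * Q\<^sup>2 + Q * Q\<^sup>2 \<le> Q ^ 4"
    proof -
      have "3 * Q\<^sup>2 \<le> Q * Q\<^sup>2" using Q by (intro mult_right_mono) auto
      moreover have "2 * Q ^ 3 \<le> Q * Q ^ 3" using Q by (intro mult_right_mono) auto
      ultimately show ?thesis by (simp add: eval_nat_numeral)
    qed
    ultimately show ?thesis using alpha unfolding disp_x_def by (auto intro!: add_nonneg_nonneg mult_nonneg_nonneg)
  qed
  have deriv: "((\<lambda>t. dispersion \<alpha> t e + dispersion \<alpha> (X - t) e') has_real_derivative
      disp_x \<alpha> t e - disp_x \<alpha> (X - t) e') (at t)"
     "((\<lambda>t. disp_x \<alpha> t e - disp_x \<alpha> (X - t) e') has_real_derivative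
      t powr (\<alpha> - 1) * curv \<alpha> t e + (X - t) powr (\<alpha> - 1) * curv \<alpha> (X - t) e') (at t)"
    if "p \<le> t" "p \<le> X - t" for t e e'
    using has_real_derivative_pair[of t X] that p by auto
  have lower: "2 * d0 / Q \<le> t powr (\<alpha> - 1) * curv \<alpha> t (h * of_int k) +
      (X - t) powr (\<alpha> - 1) * curv \<alpha> (X - t) (H - h * of_int k) \<and> p \<le> t \<and> p \<le> X - t"
    if xy: "x \<in> T k" "y \<in> T k" and t: "min x y \<le> t" "t \<le> max x y" for x y k t
  proof -
    note D = TD[OF xy(1)] TD[OF xy(2)]
    have s: "p \<le> t" "t \<le> r" "p \<le> X - t" "X - t \<le> r" using D t by (auto simp: min_def max_def split: if_splits)
    have "curv \<alpha> (min x y) (h * of_int k) \<le> curv \<alpha> t (h * of_int k)"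
      using t D p alpha by (intro curv_mono_x) (auto simp: min_def)
    hence 1: "d0 \<le> curv \<alpha> t (h * of_int k)" using D by (auto simp: min_def split: if_splits)
    have "curv \<alpha> (X - max x y) (H - h * of_int k) \<le> curv \<alpha> (X - t) (H - h * of_int k)"
      using t D p alpha by (intro curv_mono_x) (auto simp: max_def)
    hence 2: "d0 \<le> curv \<alpha> (X - t) (H - h * of_int k)" using D by (auto simp: max_def split: if_splits)
    define LHS where "LHS = t powr (\<alpha> - 1) * curv \<alpha> t (h * of_int k) +
      (X - t) powr (\<alpha> - 1) * curv \<alpha> (X - t) (H - h * of_int k)"
    have "1 / Q * d0 \<le> t powr (\<alpha> - 1) * curv \<alpha> t (h * of_int k)"
      using powr_bounds[of t] s p 1 d0 by (intro mult_mono) auto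
    moreover have "1 / Q * d0 \<le> (X - t) powr (\<alpha> - 1) * curv \<alpha> (X - t) (H - h * of_int k)"
      using powr_bounds[of "X - t"] s p 2 d0 by (intro mult_mono) auto
    ultimately have "1 / Q * d0 + 1 / Q * d0 \<le> LHS" unfolding LHS_def by linarith
    thus ?thesis using s by (simp add: LHS_def)
  qed
  have slope: "\<exists>s. (dispersion \<alpha> y (h * of_int k) + dispersion \<alpha> (X - y) (H - h * of_int k)) -
       (dispersion \<alpha> x (h * of_int k) + dispersion \<alpha> (X - x) (H - h * of_int k)) = (y - x) * s \<and>
       min (g k x) (g k y) \<le> s \<and> s \<le> max (g k x) (g k y)" if xy: "x \<in> T k" "y \<in> T k" for x y k
  proof -
    have "0 \<le> 2 * d0 / Q" using d0 Q0 by simp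
    thus ?thesis unfolding g_def using lower[OF xy]
      by (intro MVT_slope[OF deriv(1) deriv(2)]) (auto intro: order_trans)
  qed
  have dF: "\<bar>(dispersion \<alpha> y (h * of_int j) + dispersion \<alpha> (X - y) (H - h * of_int j)) -
       (dispersion \<alpha> x (h * of_int k) + dispersion \<alpha> (X - x) (H - h * of_int k))\<bar> \<le> 2 * \<delta>"
    if "x \<in> T k" "y \<in> T j" for x y k j
    using TD[OF that(1)] TD[OF that(2)] by linarith
  have "(\<integral>\<^sup>+k. emeasure lborel (T k) \<partial>count_space UNIV) \<le>
    ennreal (40 * Q * (32 * Q ^ 12) * (real m + 1)\<^sup>2 * \<delta> / h)"
  proof (rule lattice_slices[where g = g and ?l0.0 = l0 and \<Lambda> = "Q ^ 4 * sqrt (1 + d0)" and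
        Kmax = "Q ^ 4 * sqrt (1 + d0)" and c = "H / 2"])
    \<comment> \<open>Q^4 alone bounds the derivatives here; the factor sqrt(1 + d0) makes the
      condition on m the same as in \<open>minus_count\<close>.\<close>
    have Q4: "Q ^ 4 \<le> Q ^ 4 * sqrt (1 + d0)" using mult_left_mono[OF V1, of "Q ^ 4"] Q0 by simp
    show "\<bar>g k x\<bar> \<le> Q ^ 4 * sqrt (1 + d0)" if "x \<in> T k" for k x
      using disp_le[of x "h * of_int k"] disp_le[of "X - x" "H - h * of_int k"] TD[OF that] eQ[OF that] Q4
      unfolding g_def by auto
    show "\<bar>h * of_int k - H / 2\<bar> \<le> Q ^ 4 * sqrt (1 + d0)" if "x \<in> T k" for k x
    proof -
      have "\<bar>h * of_int k - H / 2\<bar> \<le> Q" using TD[OF that] eQ[OF that] by linarith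
      also have "\<dots> \<le> Q ^ 4" using power_increasing[of 1 4 Q] Q1 by simp
      finally show ?thesis using Q4 by simp
    qed
    show "\<bar>x - y\<bar> \<le> Q * \<delta> / l0" if xy: "x \<in> T k" "y \<in> T k" and "\<bar>g k x\<bar> \<le> l0" "\<bar>g k y\<bar> \<le> l0" for k x y
    proof -
      have "2 * d0 / Q * \<bar>y - x\<bar> \<le> \<bar>g k y - g k x\<bar>"
        unfolding g_def using lower[OF xy] d0 Q0
        by (intro convex_segment(2)[OF deriv(1) deriv(2)]) auto
      also have "\<dots> \<le> 2 * l0" using that by linarith
      finally have "\<bar>x - y\<bar> * d0 \<le> Q * l0" using Q0 by (simp add: field_simps abs_minus_commute)
      \<comment> \<open>Strong convexity gives |x - y| d0 \<le> Q l0. Multiplying by \<delta> and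
        using d0 \<delta> = l0^2 brings this into the form Q \<delta>/l0.\<close>
      hence "\<bar>x - y\<bar> * (d0 * \<delta>) \<le> Q * \<delta> * l0" using \<delta> by (simp add: field_simps)
      moreover have "d0 * \<delta> = l0 * l0" using l0 by (simp add: power2_eq_square)
      ultimately have "\<bar>x - y\<bar> * (l0 * l0) \<le> Q * \<delta> * l0" by (simp only:)
      hence "(\<bar>x - y\<bar> * l0) * l0 \<le> (Q * \<delta>) * l0" by (simp only: mult.assoc)
      hence "\<bar>x - y\<bar> * l0 \<le> Q * \<delta>" using l0(1) by simp
      thus ?thesis using l0(1) by (simp add: field_simps)
    qed
    show "\<bar>x - y\<bar> \<le> Q * \<delta> / (2 * l)" if xy: "x \<in> T k" "y \<in> T k" and "0 < l" "l \<le> g k x" "l \<le> g k y" for k x y l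
    proof -
      obtain s where s: "(dispersion \<alpha> y (h * of_int k) + dispersion \<alpha> (X - y) (H - h * of_int k)) -
       (dispersion \<alpha> x (h * of_int k) + dispersion \<alpha> (X - x) (H - h * of_int k)) = (y - x) * s"
       "min (g k x) (g k y) \<le> s" "s \<le> max (g k x) (g k y)" using slope[OF xy] by blast
      have "\<bar>x - y\<bar> \<le> 2 * \<delta> / l" by (rule MVT_slope_diam[OF s(1) dF[OF xy]]) (use s that in auto)
      also have "\<dots> \<le> Q * \<delta> / (2 * l)" using Q \<delta> that by (simp add: field_simps)
      finally show ?thesis .
    qed
    show "\<bar>x - y\<bar> \<le> Q * \<delta> / (2 * l)" if xy: "x \<in> T k" "y \<in> T k" and "0 < l" "g k x \<le> - l" "g k y \<le> - l" for k x y l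
    proof -
      obtain s where s: "(dispersion \<alpha> y (h * of_int k) + dispersion \<alpha> (X - y) (H - h * of_int k)) -
       (dispersion \<alpha> x (h * of_int k) + dispersion \<alpha> (X - x) (H - h * of_int k)) = (y - x) * s"
       "min (g k x) (g k y) \<le> s" "s \<le> max (g k x) (g k y)" using slope[OF xy] by blast
      have "\<bar>x - y\<bar> \<le> 2 * \<delta> / l" by (rule MVT_slope_diam[OF s(1) dF[OF xy]]) (use s that in auto)
      also have "\<dots> \<le> Q * \<delta> / (2 * l)" using Q \<delta> that by (simp add: field_simps)
      finally show ?thesis .
    qed
    fix l i j x y
    assume l: "l0 \<le> l" and xy: "x \<in> T i" "y \<in> T j" and g: "\<bar>g i x\<bar> \<le> l" "\<bar>g j y\<bar> \<le> l"
    have dl: "\<delta> * d0 \<le> l\<^sup>2" using l l0 power_mono[of l0 l 2] by simp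
    have l': "0 < l" using l l0 by simp
    note D = TD[OF xy(1)] TD[OF xy(2)]
    note gg = g[unfolded g_def]
    have gen: "a - H / 2 = (a - (H - a)) / 2" "a - H / 2 \<le> b - H / 2 \<Longrightarrow> a \<le> b"
      "b - H / 2 \<le> 3 / 2 * (a - H / 2) \<Longrightarrow> b - a \<le> (a - H / 2) / 2"
      "H / 2 - a = (H - a - a) / 2" "H / 2 - a \<le> H / 2 - b \<Longrightarrow> H - a \<le> H - b"
      "H / 2 - b \<le> 3 / 2 * (H / 2 - a) \<Longrightarrow> (H - b) - (H - a) \<le> (H / 2 - a) / 2" for a b :: real
      by (simp_all add: field_simps)
    show "h * of_int j - h * of_int i \<le> l"
      if "32 * Q ^ 12 * l \<le> h * of_int i - H / 2" "h * of_int i - H / 2 \<le> h * of_int j - H / 2"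
        "h * of_int j - H / 2 \<le> 3 / 2 * (h * of_int i - H / 2)"
      proof (rule plus_pair[where ?x1.0 = x and ?x2.0 = "X - x" and ?y1.0 = y and ?y2.0 = "X - y" and
            ?e2.0 = "H - h * of_int i" and ?f2.0 = "H - h * of_int j" and k = "h * of_int i - H / 2" and ?d0.0 = d0 and \<delta> = \<delta>])
        show "x \<in> {p..r}" "X - x \<in> {p..r}" "y \<in> {p..r}" "X - y \<in> {p..r}" using D by auto
        show "\<bar>disp_x \<alpha> x (h * of_int i) - disp_x \<alpha> (X - x) (H - h * of_int i)\<bar> \<le> l" by (rule gg)
        show "\<bar>disp_x \<alpha> y (h * of_int j) - disp_x \<alpha> (X - y) (H - h * of_int j)\<bar> \<le> l" by (rule gg)
        show "\<bar>dispersion \<alpha> x (h * of_int i) + dispersion \<alpha> (X - x) (H - h * of_int i) -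
          (dispersion \<alpha> y (h * of_int j) + dispersion \<alpha> (X - y) (H - h * of_int j))\<bar> \<le> 2 * \<delta>"
          by (rule dF[OF xy(2,1)])
        show "h * of_int i - H / 2 = (h * of_int i - (H - h * of_int i)) / 2" by (rule gen)
        show "h * of_int i \<le> h * of_int j" "h * of_int j - h * of_int i \<le> (h * of_int i - H / 2) / 2"
          using gen(2,3) that(2,3) by blast+
      qed (insert TD(1-10)[OF xy(1)] TD(1-10)[OF xy(2)] that l' d0 dl, linarith+)
    \<comment> \<open>For negative offsets the two components of each pair are exchanged, so that
      \<open>plus_pair\<close> again sees the larger \<eta> first.\<close>
    show "h * of_int i - h * of_int j \<le> l"
      if "32 * Q ^ 12 * l \<le> H / 2 - h * of_int i" "H / 2 - h * of_int i \<le> H / 2 - h * of_int j"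
        "H / 2 - h * of_int j \<le> 3 / 2 * (H / 2 - h * of_int i)"
    proof -
      have "(H - h * of_int j) - (H - h * of_int i) \<le> l"
        proof (rule plus_pair[where ?x1.0 = "X - x" and ?x2.0 = x and ?y1.0 = "X - y" and ?y2.0 = y and
            ?e2.0 = "h * of_int i" and ?f2.0 = "h * of_int j" and k = "H / 2 - h * of_int i" and ?d0.0 = d0 and \<delta> = \<delta>])
        show "x \<in> {p..r}" "X - x \<in> {p..r}" "y \<in> {p..r}" "X - y \<in> {p..r}" using D by auto
        show "\<bar>disp_x \<alpha> (X - x) (H - h * of_int i) - disp_x \<alpha> x (h * of_int i)\<bar> \<le> l"
          using gg(1) by (simp only: abs_minus_commute)
        show "\<bar>disp_x \<alpha> (X - y) (H - h * of_int j) - disp_x \<alpha> y (h * of_int j)\<bar> \<le> l"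
          using gg(2) by (simp only: abs_minus_commute)
        show "\<bar>dispersion \<alpha> (X - x) (H - h * of_int i) + dispersion \<alpha> x (h * of_int i) -
          (dispersion \<alpha> (X - y) (H - h * of_int j) + dispersion \<alpha> y (h * of_int j))\<bar> \<le> 2 * \<delta>"
          using dF[OF xy(2,1)] by (simp only: add.commute)
        show "H / 2 - h * of_int i = (H - h * of_int i - h * of_int i) / 2" by (rule gen)
        show "H - h * of_int i \<le> H - h * of_int j"
          "(H - h * of_int j) - (H - h * of_int i) \<le> (H / 2 - h * of_int i) / 2"
          using gen(5,6) that(2,3) by blast+
      qed (insert TD(1-10)[OF xy(1)] TD(1-10)[OF xy(2)] that l' d0 dl, linarith+)
      thus ?thesis by simp
    qed
  qed (use h hl0 \<delta> Q0 C1 m in \<open>auto simp: l0_def\<close>)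
  thus ?thesis by (simp add: T_def)
qed

text \<open>The scheme of \<open>plus_count\<close> for the negated dispersion. The new point is the
  bound on the derivative difference: each \<open>disp_x\<close> may be of size V^2, and only the
  closeness of the two slopes e/x inside a cell brings the difference down to order V.\<close>

lemma minus_count:
  assumes h: "0 < h" "h\<^sup>2 \<le> \<delta> * d0" and \<delta>: "0 < \<delta>" and d0: "0 < d0"
    and \<sigma>: "Q ^ 10 * \<sigma> \<le> 1"
    and m: "Q ^ 4 * sqrt (1 + d0) < 2 ^ m * sqrt (\<delta> * d0)"
  shows "(\<integral>\<^sup>+k. emeasure lborel (pair_slice \<alpha> (minus_region d0 x0 z0 \<sigma>) X H \<tau> \<delta> h (h * of_int k)) \<partial>count_space UNIV) \<le>
    ennreal (40 * Q * (32 * Q ^ 12) * (real m + 1)\<^sup>2 * \<delta> / h)"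
proof -
  define T where "T = (\<lambda>k::int. pair_slice \<alpha> (minus_region d0 x0 z0 \<sigma>) X H \<tau> \<delta> h (h * of_int k))"
  define g where "g = (\<lambda>(k::int) x. disp_x \<alpha> x (h * of_int k) - disp_x \<alpha> (X - x) (H - h * of_int k))"
  define l0 where "l0 = sqrt (\<delta> * d0)"
  define V where "V = sqrt (1 + d0)"
  have Q0: "0 < Q" and Q1: "1 \<le> Q" using Q by auto
  have l0: "0 < l0" "l0\<^sup>2 = \<delta> * d0" using \<delta> d0 by (auto simp: l0_def)
  have hl0: "h \<le> l0" unfolding l0_def using h by (intro real_le_rsqrt)
  have C1: "1 \<le> 32 * Q ^ 12" using one_le_power[OF Q1, of 12] by linarith
  have TD: "p \<le> x"
      "x \<le> r"
      "p \<le> X - x"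
      "X - x \<le> r"
      "0 \<le> h * of_int k"
      "0 \<le> H - h * of_int k"
      "- (2 * d0) \<le> curv \<alpha> x (h * of_int k)"
      "curv \<alpha> x (h * of_int k) \<le> - d0"
      "- (2 * d0) \<le> curv \<alpha> (X - x) (H - h * of_int k)"
      "curv \<alpha> (X - x) (H - h * of_int k) \<le> - d0"
      "\<bar>dispersion \<alpha> x (h * of_int k) + dispersion \<alpha> (X - x) (H - h * of_int k) - \<tau>\<bar> \<le> \<delta>"
      "\<bar>x - (X - x)\<bar> \<le> \<sigma>"
      "\<bar>h * of_int k / x - (H - h * of_int k) / (X - x)\<bar> \<le> \<sigma>"
      if "x \<in> T k" for x k
    using that by (auto simp: T_def pair_slice_def minus_region_def abs_le_iff)
  have V1: "1 \<le> V" using d0 by (simp add: V_def)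
  have eQ: "h * of_int k \<le> Q * V \<and> H - h * of_int k \<le> Q * V" if "x \<in> T k" for x k
    using minus_eta_bounds(2)[of x "h * of_int k" d0] minus_eta_bounds(2)[of "X - x" "H - h * of_int k" d0]
      TD(1-10)[OF that] p d0 by (auto simp: V_def)
  have deriv: "((\<lambda>t. - (dispersion \<alpha> t e + dispersion \<alpha> (X - t) e')) has_real_derivative
      - (disp_x \<alpha> t e - disp_x \<alpha> (X - t) e')) (at t)"
     "((\<lambda>t. - (disp_x \<alpha> t e - disp_x \<alpha> (X - t) e')) has_real_derivative
      - (t powr (\<alpha> - 1) * curv \<alpha> t e + (X - t) powr (\<alpha> - 1) * curv \<alpha> (X - t) e')) (at t)"
    if "p \<le> t" "p \<le> X - t" for t e e'
    using has_real_derivative_pair[of t X] that p by (intro DERIV_minus; simp)+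
  have lower: "2 * d0 / Q \<le> - (t powr (\<alpha> - 1) * curv \<alpha> t (h * of_int k) +
      (X - t) powr (\<alpha> - 1) * curv \<alpha> (X - t) (H - h * of_int k)) \<and> p \<le> t \<and> p \<le> X - t"
    if xy: "x \<in> T k" "y \<in> T k" and t: "min x y \<le> t" "t \<le> max x y" for x y k t
  proof -
    note D = TD[OF xy(1)] TD[OF xy(2)]
    have s: "p \<le> t" "t \<le> r" "p \<le> X - t" "X - t \<le> r" using D(1-4,14-17) t by (auto simp: min_def max_def split: if_splits)
    have "curv \<alpha> t (h * of_int k) \<le> curv \<alpha> (max x y) (h * of_int k)"
      using t s p alpha by (intro curv_mono_x) auto
    hence 1: "d0 \<le> - curv \<alpha> t (h * of_int k)" using D(7-10,20-23) by (auto simp: max_def split: if_splits)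
    have "curv \<alpha> (X - t) (H - h * of_int k) \<le> curv \<alpha> (X - min x y) (H - h * of_int k)"
      using t s p alpha by (intro curv_mono_x) auto
    hence 2: "d0 \<le> - curv \<alpha> (X - t) (H - h * of_int k)" using D(7-10,20-23) by (auto simp: min_def split: if_splits)
    define LHS where "LHS = t powr (\<alpha> - 1) * - curv \<alpha> t (h * of_int k) +
      (X - t) powr (\<alpha> - 1) * - curv \<alpha> (X - t) (H - h * of_int k)"
    have "1 / Q * d0 \<le> t powr (\<alpha> - 1) * - curv \<alpha> t (h * of_int k)"
      using powr_bounds[of t] s p 1 d0 by (intro mult_mono) auto
    moreover have "1 / Q * d0 \<le> (X - t) powr (\<alpha> - 1) * - curv \<alpha> (X - t) (H - h * of_int k)"
      using powr_bounds[of "X - t"] s p 2 d0 by (intro mult_mono) auto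
    ultimately have "1 / Q * d0 + 1 / Q * d0 \<le> LHS" unfolding LHS_def by linarith
    thus ?thesis using s by (simp add: LHS_def)
  qed
  have slope: "\<exists>s. - (dispersion \<alpha> y (h * of_int k) + dispersion \<alpha> (X - y) (H - h * of_int k)) -
       - (dispersion \<alpha> x (h * of_int k) + dispersion \<alpha> (X - x) (H - h * of_int k)) = (y - x) * s \<and>
       min (- g k x) (- g k y) \<le> s \<and> s \<le> max (- g k x) (- g k y)" if xy: "x \<in> T k" "y \<in> T k" for x y k
  proof -
    have nn: "0 \<le> 2 * d0 / Q" using d0 Q0 by simp
    show ?thesis unfolding g_def
      by (intro MVT_slope[OF deriv(1) deriv(2)]) ((use lower[OF xy] order_trans[OF nn] in blast)+)
  qed
  have dF: "\<bar>(dispersion \<alpha> y (h * of_int j) + dispersion \<alpha> (X - y) (H - h * of_int j)) -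
       (dispersion \<alpha> x (h * of_int k) + dispersion \<alpha> (X - x) (H - h * of_int k))\<bar> \<le> 2 * \<delta>"
    if "x \<in> T k" "y \<in> T j" for x y k j
    using TD(11)[OF that(1)] TD(11)[OF that(2)] by linarith
  have dF': "\<bar>- (dispersion \<alpha> y (h * of_int j) + dispersion \<alpha> (X - y) (H - h * of_int j)) -
       - (dispersion \<alpha> x (h * of_int k) + dispersion \<alpha> (X - x) (H - h * of_int k))\<bar> \<le> 2 * \<delta>"
    if "x \<in> T k" "y \<in> T j" for x y k j
    using dF[OF that] by linarith
  have "(\<integral>\<^sup>+k. emeasure lborel (T k) \<partial>count_space UNIV) \<le>
    ennreal (40 * Q * (32 * Q ^ 12) * (real m + 1)\<^sup>2 * \<delta> / h)"
  proof (rule lattice_slices[where g = g and ?l0.0 = l0 and \<Lambda> = "Q ^ 4 * V" and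
        Kmax = "Q ^ 4 * V" and c = "H / 2"])
    show "\<bar>g k x\<bar> \<le> Q ^ 4 * V" if x: "x \<in> T k" for k x
    proof -
      define z1 where "z1 = h * of_int k / x"
      define z2 where "z2 = (H - h * of_int k) / (X - x)"
      note D = TD[OF x]
      have pos: "0 < x" "0 < X - x" using D(1-4) p by auto
      have dom: "p / 2 \<le> x" "x \<le> 2 * r" "p / 2 \<le> X - x" "X - x \<le> 2 * r" using D(1-4) p by auto
      have inv: "1 / y \<le> Q" if "p / 2 \<le> y" "y \<le> 2 * r" for y
      proof -
        have y: "1 / Q \<le> y" "0 < y" using x_bounds[OF that] that p by auto
        hence "1 \<le> y * Q" using Q0 by (simp add: field_simps)
        thus ?thesis using y by (simp add: field_simps)
      qed
      have "h * of_int k * (1 / x) \<le> (Q * V) * Q"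
        by (rule mult_mono) (use inv[of x] dom eQ[OF x] D(5,6) pos Q0 V1 in auto)
      moreover have "(H - h * of_int k) * (1 / (X - x)) \<le> (Q * V) * Q"
        by (rule mult_mono) (use inv[of "X - x"] dom eQ[OF x] D(5,6) pos Q0 V1 in auto)
      ultimately have z: "z1 \<le> Q\<^sup>2 * V" "z2 \<le> Q\<^sup>2 * V" "0 \<le> z1" "0 \<le> z2"
        using D(5,6) pos by (auto simp: z1_def z2_def power2_eq_square mult_ac)
      have "\<sigma> \<le> 1"
      proof (rule ccontr)
        assume "\<not> \<sigma> \<le> 1"
        hence "1 * 1 < Q ^ 10 * \<sigma>" using one_le_power[OF Q1, of 10] by (intro mult_le_less_imp_less) auto
        thus False using \<sigma> by simp
      qed
      \<comment> \<open>Factoring z1^2 - z2^2 exploits the cell: one factor is at most 1, the other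
        of order V.\<close>
      hence "\<bar>z1 - z2\<bar> * \<bar>z1 + z2\<bar> \<le> 1 * (2 * Q\<^sup>2 * V)"
        using D(13) z by (intro mult_mono) (auto simp: z1_def[symmetric] z2_def[symmetric])
      hence A: "\<bar>z1\<^sup>2 - z2\<^sup>2\<bar> \<le> 2 * Q\<^sup>2 * V"
        by (simp add: power2_eq_square square_diff_square_factored abs_mult mult.commute)
      have "(\<alpha> + 1) * x powr \<alpha> \<le> 3 * Q\<^sup>2" "(\<alpha> + 1) * (X - x) powr \<alpha> \<le> 3 * Q\<^sup>2"
        using powr_alpha_le[of x] powr_alpha_le[of "X - x"] dom alpha by (intro mult_mono; simp)+
      moreover have "0 \<le> (\<alpha> + 1) * x powr \<alpha>" "0 \<le> (\<alpha> + 1) * (X - x) powr \<alpha>" using alpha by auto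
      moreover have "g k x = (\<alpha> + 1) * x powr \<alpha> - (\<alpha> + 1) * (X - x) powr \<alpha> + (z1\<^sup>2 - z2\<^sup>2)"
        by (simp add: g_def disp_x_def z1_def z2_def power_divide)
      ultimately have "\<bar>g k x\<bar> \<le> 3 * Q\<^sup>2 + 2 * Q\<^sup>2 * V" using A by linarith
      also have "\<dots> \<le> 3 * Q\<^sup>2 * V + 2 * Q\<^sup>2 * V" using mult_left_mono[OF V1, of "3 * Q\<^sup>2"] by (simp add: mult.commute)
      also have "\<dots> \<le> Q ^ 4 * V"
      proof -
        have "5 * Q\<^sup>2 \<le> Q\<^sup>2 * Q\<^sup>2" using Q mult_mono[of 5 Q 1 Q] by (intro mult_right_mono) (auto simp: power2_eq_square)
        hence "5 * Q\<^sup>2 * V \<le> Q\<^sup>2 * Q\<^sup>2 * V" by (rule mult_right_mono) (use V1 in simp)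
        moreover have "3 * Q\<^sup>2 * V + 2 * Q\<^sup>2 * V = 5 * Q\<^sup>2 * V" by simp
        moreover have "Q\<^sup>2 * Q\<^sup>2 * V = Q ^ 4 * V" by (simp add: eval_nat_numeral)
        ultimately show ?thesis by (simp only:)
      qed
      finally show ?thesis .
    qed
    show "\<bar>h * of_int k - H / 2\<bar> \<le> Q ^ 4 * V" if "x \<in> T k" for k x
    proof -
      have "\<bar>h * of_int k - H / 2\<bar> \<le> Q * V" using TD(5,6)[OF that] eQ[OF that] by linarith
      also have "\<dots> \<le> Q ^ 4 * V" using power_increasing[of 1 4 Q] Q1 V1 by (intro mult_right_mono) auto
      finally show ?thesis .
    qed
    show "\<bar>x - y\<bar> \<le> Q * \<delta> / l0" if xy: "x \<in> T k" "y \<in> T k" and "\<bar>g k x\<bar> \<le> l0" "\<bar>g k y\<bar> \<le> l0" for k x y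
    proof -
      have "2 * d0 / Q * \<bar>y - x\<bar> \<le> \<bar>- g k y - - g k x\<bar>"
        unfolding g_def using lower[OF xy] d0 Q0
        by (intro convex_segment(2)[OF deriv(1) deriv(2)]) auto
      also have "\<dots> \<le> 2 * l0" using that by linarith
      finally have "\<bar>x - y\<bar> * d0 \<le> Q * l0" using Q0 by (simp add: field_simps abs_minus_commute)
      hence "\<bar>x - y\<bar> * (d0 * \<delta>) \<le> Q * \<delta> * l0" using \<delta> by (simp add: field_simps)
      moreover have "d0 * \<delta> = l0 * l0" using l0 by (simp add: power2_eq_square)
      ultimately have "\<bar>x - y\<bar> * (l0 * l0) \<le> Q * \<delta> * l0" by (simp only:)
      hence "(\<bar>x - y\<bar> * l0) * l0 \<le> (Q * \<delta>) * l0" by (simp only: mult.assoc)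
      hence "\<bar>x - y\<bar> * l0 \<le> Q * \<delta>" using l0(1) by simp
      thus ?thesis using l0(1) by (simp add: field_simps)
    qed
    show "\<bar>x - y\<bar> \<le> Q * \<delta> / (2 * l)" if xy: "x \<in> T k" "y \<in> T k" and "0 < l" "l \<le> g k x" "l \<le> g k y" for k x y l
    proof -
      obtain s where s: "- (dispersion \<alpha> y (h * of_int k) + dispersion \<alpha> (X - y) (H - h * of_int k)) -
       - (dispersion \<alpha> x (h * of_int k) + dispersion \<alpha> (X - x) (H - h * of_int k)) = (y - x) * s"
       "min (- g k x) (- g k y) \<le> s" "s \<le> max (- g k x) (- g k y)" using slope[OF xy] by blast
      have "\<bar>x - y\<bar> \<le> 2 * \<delta> / l" by (rule MVT_slope_diam[OF s(1) dF'[OF xy]]) (use s that in auto)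
      also have "\<dots> \<le> Q * \<delta> / (2 * l)" using Q \<delta> that by (simp add: field_simps)
      finally show ?thesis .
    qed
    show "\<bar>x - y\<bar> \<le> Q * \<delta> / (2 * l)" if xy: "x \<in> T k" "y \<in> T k" and "0 < l" "g k x \<le> - l" "g k y \<le> - l" for k x y l
    proof -
      obtain s where s: "- (dispersion \<alpha> y (h * of_int k) + dispersion \<alpha> (X - y) (H - h * of_int k)) -
       - (dispersion \<alpha> x (h * of_int k) + dispersion \<alpha> (X - x) (H - h * of_int k)) = (y - x) * s"
       "min (- g k x) (- g k y) \<le> s" "s \<le> max (- g k x) (- g k y)" using slope[OF xy] by blast
      have "\<bar>x - y\<bar> \<le> 2 * \<delta> / l" by (rule MVT_slope_diam[OF s(1) dF'[OF xy]]) (use s that in auto)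
      also have "\<dots> \<le> Q * \<delta> / (2 * l)" using Q \<delta> that by (simp add: field_simps)
      finally show ?thesis .
    qed
    fix l i j x y
    assume l: "l0 \<le> l" and xy: "x \<in> T i" "y \<in> T j" and g: "\<bar>g i x\<bar> \<le> l" "\<bar>g j y\<bar> \<le> l"
    have dl: "\<delta> * d0 \<le> l\<^sup>2" using l l0 power_mono[of l0 l 2] by simp
    have l': "0 < l" using l l0 by simp
    note D = TD[OF xy(1)] TD[OF xy(2)]
    note gg = g[unfolded g_def]
    have gen: "a - H / 2 = (a - (H - a)) / 2" "a - H / 2 \<le> b - H / 2 \<Longrightarrow> a \<le> b"
      "b - H / 2 \<le> 3 / 2 * (a - H / 2) \<Longrightarrow> b - a \<le> (a - H / 2) / 2"
      "H / 2 - a = (H - a - a) / 2" "H / 2 - a \<le> H / 2 - b \<Longrightarrow> H - a \<le> H - b"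
      "H / 2 - b \<le> 3 / 2 * (H / 2 - a) \<Longrightarrow> (H - b) - (H - a) \<le> (H / 2 - a) / 2" for a b :: real
      by (simp_all add: field_simps)
    show "h * of_int j - h * of_int i \<le> l"
      if "32 * Q ^ 12 * l \<le> h * of_int i - H / 2" "h * of_int i - H / 2 \<le> h * of_int j - H / 2"
        "h * of_int j - H / 2 \<le> 3 / 2 * (h * of_int i - H / 2)"
      proof (rule minus_pair[where ?x1.0 = x and ?x2.0 = "X - x" and ?y1.0 = y and ?y2.0 = "X - y" and
            ?e2.0 = "H - h * of_int i" and ?f2.0 = "H - h * of_int j" and k = "h * of_int i - H / 2" and ?d0.0 = d0 and \<delta> = \<delta> and \<sigma> = \<sigma>])
        show "x \<in> {p..r}" "X - x \<in> {p..r}" "y \<in> {p..r}" "X - y \<in> {p..r}" using D(1-4,14-17) by auto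
        show "\<bar>disp_x \<alpha> x (h * of_int i) - disp_x \<alpha> (X - x) (H - h * of_int i)\<bar> \<le> l" by (rule gg)
        show "\<bar>disp_x \<alpha> y (h * of_int j) - disp_x \<alpha> (X - y) (H - h * of_int j)\<bar> \<le> l" by (rule gg)
        show "\<bar>dispersion \<alpha> x (h * of_int i) + dispersion \<alpha> (X - x) (H - h * of_int i) -
          (dispersion \<alpha> y (h * of_int j) + dispersion \<alpha> (X - y) (H - h * of_int j))\<bar> \<le> 2 * \<delta>"
          by (rule dF[OF xy(2,1)])
        show "\<bar>x - (X - x)\<bar> \<le> \<sigma>" "\<bar>h * of_int i / x - (H - h * of_int i) / (X - x)\<bar> \<le> \<sigma>" by (rule D)+
        show "h * of_int i - H / 2 = (h * of_int i - (H - h * of_int i)) / 2" by (rule gen)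
        show "h * of_int i \<le> h * of_int j" "h * of_int j - h * of_int i \<le> (h * of_int i - H / 2) / 2"
          using gen(2,3) that(2,3) by blast+
      qed (insert TD(1-10)[OF xy(1)] TD(1-10)[OF xy(2)] that l' d0 dl \<sigma>, linarith+)
    show "h * of_int i - h * of_int j \<le> l"
      if "32 * Q ^ 12 * l \<le> H / 2 - h * of_int i" "H / 2 - h * of_int i \<le> H / 2 - h * of_int j"
        "H / 2 - h * of_int j \<le> 3 / 2 * (H / 2 - h * of_int i)"
    proof -
      have "(H - h * of_int j) - (H - h * of_int i) \<le> l"
        proof (rule minus_pair[where ?x1.0 = "X - x" and ?x2.0 = x and ?y1.0 = "X - y" and ?y2.0 = y and
            ?e2.0 = "h * of_int i" and ?f2.0 = "h * of_int j" and k = "H / 2 - h * of_int i" and ?d0.0 = d0 and \<delta> = \<delta> and \<sigma> = \<sigma>])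
        show "x \<in> {p..r}" "X - x \<in> {p..r}" "y \<in> {p..r}" "X - y \<in> {p..r}" using D(1-4,14-17) by auto
        show "\<bar>disp_x \<alpha> (X - x) (H - h * of_int i) - disp_x \<alpha> x (h * of_int i)\<bar> \<le> l"
          using gg(1) by (simp only: abs_minus_commute)
        show "\<bar>disp_x \<alpha> (X - y) (H - h * of_int j) - disp_x \<alpha> y (h * of_int j)\<bar> \<le> l"
          using gg(2) by (simp only: abs_minus_commute)
        show "\<bar>dispersion \<alpha> (X - x) (H - h * of_int i) + dispersion \<alpha> x (h * of_int i) -
          (dispersion \<alpha> (X - y) (H - h * of_int j) + dispersion \<alpha> y (h * of_int j))\<bar> \<le> 2 * \<delta>"
          using dF[OF xy(2,1)] by (simp only: add.commute)
        show "\<bar>X - x - x\<bar> \<le> \<sigma>" using TD(12)[OF xy(1)] by linarith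
        show "\<bar>(H - h * of_int i) / (X - x) - h * of_int i / x\<bar> \<le> \<sigma>"
          using TD(13)[OF xy(1)] by (simp only: abs_minus_commute)
        show "H / 2 - h * of_int i = (H - h * of_int i - h * of_int i) / 2" by (rule gen)
        show "H - h * of_int i \<le> H - h * of_int j"
          "(H - h * of_int j) - (H - h * of_int i) \<le> (H / 2 - h * of_int i) / 2"
          using gen(5,6) that(2,3) by blast+
      qed (insert TD(1-10)[OF xy(1)] TD(1-10)[OF xy(2)] that l' d0 dl \<sigma>, linarith+)
      thus ?thesis by simp
    qed
  qed (use h hl0 \<delta> Q0 C1 m in \<open>auto simp: l0_def V_def\<close>)
  thus ?thesis by (simp add: T_def)
qed

text \<open>A curvature of at most 1/2 forces the \<eta>-term to be at least 3/2, so \<eta> stays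
  away from 0 and the \<eta>-term decreases in x at a definite rate. For d0 \<le> 1/2 the sections
  of \<open>core_region\<close> in x therefore have length of order d0.\<close>

lemma curv_growth:
  assumes "p / 2 \<le> x" "x \<le> y" "y \<le> 2 * r" "0 \<le> e" "curv \<alpha> x e \<le> 1 / 2 \<or> curv \<alpha> y e \<le> 1 / 2"
  shows "2 * (y - x) / Q ^ 3 \<le> curv \<alpha> y e - curv \<alpha> x e" "1 / Q \<le> e"
proof -
  have Q0: "0 < Q" using Q by simp
  obtain t where t: "p / 2 \<le> t" "t \<le> 2 * r" "curv \<alpha> t e \<le> 1 / 2"
  proof (cases "curv \<alpha> x e \<le> 1 / 2")
    case True thus ?thesis using that[of x] assms by auto
  next
    case False thus ?thesis using that[of y] assms by auto
  qed
  have "3 / 2 \<le> 2 * e\<^sup>2 * (1 / t powr (\<alpha> + 2))" using t alpha_prod by (simp add: curv_def)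
  also have "\<dots> \<le> 2 * e\<^sup>2 * Q" using inv_powr_bounds[OF t(1,2)] by (intro mult_left_mono) auto
  finally have e2: "3 / 4 \<le> e\<^sup>2 * Q" by simp
  have "1 \<le> 3 / 4 * Q" using Q by simp
  also have "\<dots> \<le> e\<^sup>2 * Q * Q" using e2 Q0 by (intro mult_right_mono) auto
  finally have eQ: "1 \<le> e\<^sup>2 * Q\<^sup>2" by (simp add: power2_eq_square)
  hence "1\<^sup>2 \<le> (e * Q)\<^sup>2" by (simp add: power_mult_distrib)
  hence "1 \<le> e * Q" by (rule power2_le_imp_le) (use assms(4) Q0 in simp)
  thus "1 / Q \<le> e" using Q0 by (simp add: field_simps)
  have "(D - u / b) - (D - u / a) = u * (1 / a - 1 / b)" for D u a b :: real
    by (simp add: right_diff_distrib)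
  hence "curv \<alpha> y e - curv \<alpha> x e = 2 * e\<^sup>2 * (1 / x powr (\<alpha> + 2) - 1 / y powr (\<alpha> + 2))"
    unfolding curv_def .
  moreover have "2 * e\<^sup>2 * ((y - x) / Q) \<le> 2 * e\<^sup>2 * (1 / x powr (\<alpha> + 2) - 1 / y powr (\<alpha> + 2))"
    by (rule mult_left_mono[OF conjunct1[OF inv_powr_lipschitz[OF assms(1-3)]]]) simp
  moreover have "1 / Q\<^sup>2 \<le> e\<^sup>2" using eQ Q0 by (simp only: pos_divide_le_eq zero_less_power)
  hence "2 * (1 / Q\<^sup>2) * ((y - x) / Q) \<le> 2 * e\<^sup>2 * ((y - x) / Q)"
    using Q0 assms(2) by (intro mult_right_mono mult_left_mono) simp_all
  moreover have "2 * (1 / Q\<^sup>2) * ((y - x) / Q) = 2 * (y - x) / Q ^ 3"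
    by (simp add: power2_eq_square power3_eq_cube)
  ultimately show "2 * (y - x) / Q ^ 3 \<le> curv \<alpha> y e - curv \<alpha> x e" by linarith
qed

text \<open>The gap of the \<eta>-components contributes at least 4k/Q^2, k being half of it. The
  x-difference can oppose this only where \<open>curv\<close> at e2 has the wrong sign. By
  \<open>curv_growth\<close> this happens only within distance Q^3 d0 of x2, and there the
  wrong-signed part is at most d0, so the loss is of order d0^2.\<close>

lemma core_slope:
  assumes dom: "p \<le> x1" "x1 \<le> r" "p \<le> x2" "x2 \<le> r"
    and e: "0 \<le> e2" "e2 < e1"
    and d: "0 < d0" "d0 \<le> 1 / 2" "\<bar>curv \<alpha> x1 e1\<bar> \<le> d0" "\<bar>curv \<alpha> x2 e2\<bar> \<le> d0"
  shows "4 * ((e1 - e2) / 2) / Q\<^sup>2 - Q ^ 4 * d0\<^sup>2 \<le> disp_x \<alpha> x1 e1 - disp_x \<alpha> x2 e2"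
proof -
  have Q0: "0 < Q" and Q1: "1 \<le> Q" using Q by auto
  have dom': "p / 2 \<le> x1" "x1 \<le> 2 * r" "p / 2 \<le> x2" "x2 \<le> 2 * r" using dom p by auto
  have "1 / Q \<le> e1" "1 / Q \<le> e2"
    using curv_growth(2)[of x1 x1 e1] curv_growth(2)[of x2 x2 e2] dom' e d by auto
  hence H: "2 / Q \<le> e1 + e2" by simp
  define l where "l = d0 * Q ^ 3"
  have l0: "0 < l" using d Q0 by (simp add: l_def)
  have l2: "2 * l / Q ^ 3 = 2 * d0" using Q0 by (simp add: l_def)
  have Ql: "Q * d0 * l = Q ^ 4 * d0\<^sup>2" by (simp add: l_def power2_eq_square eval_nat_numeral)
  have "(e1 - e2) * (2 / Q) \<le> (e1 - e2) * (e1 + e2)" using H e by (intro mult_left_mono) auto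
  moreover have half: "4 * (a / 2) / Q = a * (2 / Q)" for a :: real by simp
  moreover have "e1\<^sup>2 - e2\<^sup>2 = (e1 - e2) * (e1 + e2)" by (simp add: power2_eq_square algebra_simps)
  ultimately have sq: "4 * ((e1 - e2) / 2) / Q \<le> e1\<^sup>2 - e2\<^sup>2" by (simp only: half)
  have "4 * ((e1 - e2) / 2) / Q / Q \<le> (e1\<^sup>2 - e2\<^sup>2) / Q" using sq Q0 by (intro divide_right_mono) auto
  also have "\<dots> \<le> (e1\<^sup>2 - e2\<^sup>2) / x1\<^sup>2" using dom' e by (intro sq_div_bounds) (auto intro: power_mono)
  finally have main: "4 * ((e1 - e2) / 2) / Q\<^sup>2 \<le> (e1\<^sup>2 - e2\<^sup>2) / x1\<^sup>2" by (simp add: power2_eq_square)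
  have "- (Q * d0 * l) \<le> disp_x \<alpha> x1 e2 - disp_x \<alpha> x2 e2"
  proof (cases "x2 \<le> x1")
    case True
    \<comment> \<open>Beyond m, unless x1 is reached first, the curvature at e2 has become
      nonnegative, and \<open>disp_x\<close> no longer decreases.\<close>
    define m where "m = min x1 (x2 + l)"
    have m: "x2 \<le> m" "m \<le> x1" "m \<le> x2 + l" using True l0 by (auto simp: m_def)
    have "(if 0 \<le> - d0 then - d0 / Q else - d0 * Q) * (m - x2) \<le> disp_x \<alpha> m e2 - disp_x \<alpha> x2 e2"
    proof (rule disp_x_incr_lower)
      fix x assume "x2 \<le> x" "x \<le> m"
      hence "curv \<alpha> x2 e2 \<le> curv \<alpha> x e2" using dom p alpha by (intro curv_mono_x) auto
      thus "- d0 \<le> curv \<alpha> x e2" using d by linarith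
    qed (use m dom' in auto)
    hence "- d0 * Q * (m - x2) \<le> disp_x \<alpha> m e2 - disp_x \<alpha> x2 e2" using d by simp
    moreover have "d0 * Q * (m - x2) \<le> d0 * Q * l" using m d Q0 by (intro mult_left_mono) auto
    moreover have "0 \<le> disp_x \<alpha> x1 e2 - disp_x \<alpha> m e2"
    proof (cases "m = x1")
      case False
      hence meq: "m = x2 + l" "x2 + l \<le> x1" by (auto simp: m_def)
      have "2 * (m - x2) / Q ^ 3 \<le> curv \<alpha> m e2 - curv \<alpha> x2 e2"
        using dom' m e d by (intro curv_growth) auto
      hence c: "0 \<le> curv \<alpha> m e2" using l2 d unfolding meq by simp
      have "(if (0::real) \<le> 0 then 0 / Q else 0 * Q) * (x1 - m) \<le> disp_x \<alpha> x1 e2 - disp_x \<alpha> m e2"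
      proof (rule disp_x_incr_lower)
        fix x assume "m \<le> x" "x \<le> x1"
        hence "curv \<alpha> m e2 \<le> curv \<alpha> x e2" using m dom p alpha by (intro curv_mono_x) auto
        thus "0 \<le> curv \<alpha> x e2" using c by linarith
      qed (use m dom' in auto)
      thus ?thesis by simp
    qed simp
    ultimately show ?thesis by (simp add: mult_ac)
  next
    case False
    define m where "m = max x1 (x2 - l)"
    have m: "x1 \<le> m" "m \<le> x2" "x2 - l \<le> m" using False l0 by (auto simp: m_def)
    have "disp_x \<alpha> x2 e2 - disp_x \<alpha> m e2 \<le> Q * d0 * (x2 - m)"
    proof (rule disp_x_incr_upper)
      fix x assume "m \<le> x" "x \<le> x2"
      hence "curv \<alpha> x e2 \<le> curv \<alpha> x2 e2" using m dom p alpha by (intro curv_mono_x) auto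
      thus "curv \<alpha> x e2 \<le> d0" using d by linarith
    qed (use m dom' d in auto)
    moreover have "Q * d0 * (x2 - m) \<le> Q * d0 * l" using m d Q0 by (intro mult_left_mono) auto
    moreover have "disp_x \<alpha> m e2 - disp_x \<alpha> x1 e2 \<le> 0"
    proof (cases "m = x1")
      case False
      hence meq: "m = x2 - l" "x1 \<le> x2 - l" by (auto simp: m_def)
      have "2 * (x2 - m) / Q ^ 3 \<le> curv \<alpha> x2 e2 - curv \<alpha> m e2"
        using dom' m e d by (intro curv_growth) auto
      hence c: "curv \<alpha> m e2 \<le> 0" using l2 d unfolding meq by simp
      have "disp_x \<alpha> m e2 - disp_x \<alpha> x1 e2 \<le> Q * 0 * (m - x1)"
      proof (rule disp_x_incr_upper)
        fix x assume "x1 \<le> x" "x \<le> m"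
        hence "curv \<alpha> x e2 \<le> curv \<alpha> m e2" using m dom p alpha by (intro curv_mono_x) auto
        thus "curv \<alpha> x e2 \<le> 0" using c by linarith
      qed (use m dom' in auto)
      thus ?thesis by simp
    qed simp
    ultimately show ?thesis by (simp add: mult_ac)
  qed
  thus ?thesis using main disp_x_diff[of x1 e1 x2 e2] unfolding Ql by linarith
qed

text \<open>Two ranges of the offset \<kappa> are treated. Up to K0 = Q^6 d0^2 + h no slope is
  available, but slices have length at most Q^3 d0 and number about K0/h; the resulting products
  d0^3/h and d0 explain the two bounds on d0 in terms of \<delta>. Above K0 the loss in
  \<open>core_slope\<close> is dominated and the slope is at least |\<kappa>|/Q^2, so on each dyadic
  range of |\<kappa>| length times number is again of order \<delta>/h.\<close>

lemma core_count:
  assumes h: "0 < h" and \<delta>: "0 < \<delta>" and d0: "0 < d0" "d0 \<le> 1 / 2" "d0 ^ 3 \<le> \<delta>" "d0 \<le> \<delta> / h"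
    and m: "Q < 2 ^ m * h"
  shows "(\<integral>\<^sup>+k. emeasure lborel (pair_slice \<alpha> (core_region d0) X H \<tau> \<delta> h (h * of_int k)) \<partial>count_space UNIV) \<le>
    ennreal (40 * Q * (32 * Q ^ 12) * (real m + 1)\<^sup>2 * \<delta> / h)"
proof -
  define T where "T = (\<lambda>k::int. pair_slice \<alpha> (core_region d0) X H \<tau> \<delta> h (h * of_int k))"
  define \<kappa> where "\<kappa> = (\<lambda>k::int. h * of_int k - H / 2)"
  define K0 where "K0 = Q ^ 6 * d0\<^sup>2 + h"
  have Q0: "0 < Q" and Q1: "1 \<le> Q" using Q by auto
  have K0: "0 < K0" "h \<le> K0" "Q ^ 6 * d0\<^sup>2 \<le> K0" 
  proof -
    have "0 \<le> Q ^ 6 * d0\<^sup>2" using Q0 by simp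
    thus "0 < K0" "h \<le> K0" "Q ^ 6 * d0\<^sup>2 \<le> K0" unfolding K0_def using h by linarith+
  qed
  have TD: "p \<le> x" "x \<le> r" "p \<le> X - x" "X - x \<le> r" "0 \<le> h * of_int k" "0 \<le> H - h * of_int k"
      "\<bar>curv \<alpha> x (h * of_int k)\<bar> \<le> d0" "\<bar>curv \<alpha> (X - x) (H - h * of_int k)\<bar> \<le> d0"
      "\<bar>dispersion \<alpha> x (h * of_int k) + dispersion \<alpha> (X - x) (H - h * of_int k) - \<tau>\<bar> \<le> \<delta>" if "x \<in> T k" for x k
    using that by (simp_all add: T_def pair_slice_def core_region_def)
  have conv: "p \<le> t \<and> t \<le> r \<and> p \<le> X - t \<and> X - t \<le> r \<and> \<bar>curv \<alpha> t (h * of_int k)\<bar> \<le> d0 \<and>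
      \<bar>curv \<alpha> (X - t) (H - h * of_int k)\<bar> \<le> d0"
    if xy: "x \<in> T k" "y \<in> T k" and t: "x \<le> t" "t \<le> y" for x y k t
  proof -
    note D = TD[OF xy(1)] TD[OF xy(2)]
    have s: "p \<le> t" "t \<le> r" "p \<le> X - t" "X - t \<le> r" using D(1-4,10-13) t by auto
    have "curv \<alpha> x (h * of_int k) \<le> curv \<alpha> t (h * of_int k)" "curv \<alpha> t (h * of_int k) \<le> curv \<alpha> y (h * of_int k)"
      "curv \<alpha> (X - t) (H - h * of_int k) \<le> curv \<alpha> (X - x) (H - h * of_int k)"
      "curv \<alpha> (X - y) (H - h * of_int k) \<le> curv \<alpha> (X - t) (H - h * of_int k)"
      using t s D(1-4,10-13) p alpha by (intro curv_mono_x; linarith)+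
    thus ?thesis using s D(7,8,16,17) unfolding abs_le_iff by (intro conjI; linarith)
  qed
  have diam: "\<bar>x - y\<bar> \<le> Q ^ 3 * d0" if "x \<in> T k" "y \<in> T k" for x y k
  proof -
    have main: "y - x \<le> Q ^ 3 * d0" if xy: "x \<in> T k" "y \<in> T k" "x \<le> y" for x y
    proof -
      note D = TD[OF xy(1)] TD[OF xy(2)]
      have "2 * (y - x) / Q ^ 3 \<le> curv \<alpha> y (h * of_int k) - curv \<alpha> x (h * of_int k)"
        using D(1-5,10-14) D(7)[unfolded abs_le_iff] p xy(3) d0 by (intro curv_growth) linarith+
      also have "\<dots> \<le> 2 * d0" using D(7,16) unfolding abs_le_iff by linarith
      finally show ?thesis using Q0 by (simp add: field_simps)
    qed
    show ?thesis using main[of x y] main[of y x] that by linarith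
  qed
  have diam2: "\<bar>x - y\<bar> \<le> 2 * \<delta> / (c / Q\<^sup>2)"
    if xy: "x \<in> T k" "y \<in> T k" and c: "K0 \<le> c" "c \<le> \<bar>\<kappa> k\<bar>" for x y k c
  proof -
    have c0: "0 < c" using K0 c by simp
    have main: "\<bar>y - x\<bar> \<le> 2 * \<delta> / (c / Q\<^sup>2)" if xy: "x \<in> T k" "y \<in> T k" "x < y" for x y
    proof -
      define f where "f = (\<lambda>t. dispersion \<alpha> t (h * of_int k) + dispersion \<alpha> (X - t) (H - h * of_int k))"
      define f' where "f' = (\<lambda>t. disp_x \<alpha> t (h * of_int k) - disp_x \<alpha> (X - t) (H - h * of_int k))"
      have "\<exists>z>x. z < y \<and> f y - f x = (y - x) * f' z"
        unfolding f_def f'_def using xy(3)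
        by (rule MVT2) (use conv[OF xy(1,2)] p in \<open>force intro!: has_real_derivative_pair\<close>)
      then obtain z where z: "x < z" "z < y" "f y - f x = (y - x) * f' z" by blast
      have zz: "p \<le> z" "z \<le> r" "p \<le> X - z" "X - z \<le> r" "\<bar>curv \<alpha> z (h * of_int k)\<bar> \<le> d0"
        "\<bar>curv \<alpha> (X - z) (H - h * of_int k)\<bar> \<le> d0" using conv[OF xy(1,2), of z] z by auto
      have slope: "c / Q\<^sup>2 \<le> \<bar>f' z\<bar>"
      proof -
        have "Q ^ 4 * d0\<^sup>2 = (Q ^ 6 * d0\<^sup>2) / Q\<^sup>2" using Q0 by (simp add: eval_nat_numeral)
        also have "\<dots> \<le> \<bar>\<kappa> k\<bar> / Q\<^sup>2" using K0 c by (intro divide_right_mono) auto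
        finally have 1: "Q ^ 4 * d0\<^sup>2 \<le> \<bar>\<kappa> k\<bar> / Q\<^sup>2" .
        have 2: "c / Q\<^sup>2 \<le> \<bar>\<kappa> k\<bar> / Q\<^sup>2" using c by (intro divide_right_mono) auto
        have 3: "4 * \<bar>\<kappa> k\<bar> / Q\<^sup>2 - Q ^ 4 * d0\<^sup>2 \<le> \<bar>f' z\<bar>"
        proof (cases "0 \<le> \<kappa> k")
          case True
          hence "0 < \<kappa> k" using c c0 by linarith
          hence "H - h * of_int k < h * of_int k" by (simp add: \<kappa>_def)
          from core_slope[OF zz(1-4) TD(6)[OF xy(1)] this d0(1,2) zz(5,6)]
          have "4 * ((h * of_int k - (H - h * of_int k)) / 2) / Q\<^sup>2 - Q ^ 4 * d0\<^sup>2 \<le> f' z" by (simp add: f'_def)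
          moreover have "(h * of_int k - (H - h * of_int k)) / 2 = \<bar>\<kappa> k\<bar>"
            using True by (simp add: \<kappa>_def field_simps)
          ultimately have "4 * \<bar>\<kappa> k\<bar> / Q\<^sup>2 - Q ^ 4 * d0\<^sup>2 \<le> f' z" by (simp only:)
          thus ?thesis using abs_ge_self by (rule order_trans)
        next
          case False
          hence "h * of_int k < H - h * of_int k" by (simp add: \<kappa>_def)
          from core_slope[OF zz(3,4,1,2) TD(5)[OF xy(1)] this d0(1,2) zz(6,5)]
          have "4 * ((H - h * of_int k - h * of_int k) / 2) / Q\<^sup>2 - Q ^ 4 * d0\<^sup>2 \<le> - f' z" by (simp add: f'_def)
          moreover have "(H - h * of_int k - h * of_int k) / 2 = \<bar>\<kappa> k\<bar>"
            using False by (simp add: \<kappa>_def field_simps)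
          ultimately have "4 * \<bar>\<kappa> k\<bar> / Q\<^sup>2 - Q ^ 4 * d0\<^sup>2 \<le> - f' z" by (simp only:)
          thus ?thesis using abs_ge_minus_self by (rule order_trans)
        qed
        have 4: "4 * \<bar>\<kappa> k\<bar> / Q\<^sup>2 = 4 * (\<bar>\<kappa> k\<bar> / Q\<^sup>2)" by simp
        have 5: "0 \<le> \<bar>\<kappa> k\<bar> / Q\<^sup>2" by simp
        show ?thesis using 1 2 3 5 unfolding 4 by linarith
      qed
      have "\<bar>x - y\<bar> \<le> 2 * \<delta> / (c / Q\<^sup>2)"
      proof (rule MVT_slope_diam[OF z(3) _ _ slope])
        show "\<bar>f y - f x\<bar> \<le> 2 * \<delta>" using TD(9)[OF xy(1)] TD(9)[OF xy(2)] unfolding f_def by linarith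
      qed (use c0 Q0 in auto)
      thus ?thesis by (simp only: abs_minus_commute)
    qed
    have nn: "0 \<le> 2 * \<delta> / (c / Q\<^sup>2)" using \<delta> c0 by simp
    consider "x = y" | "x < y" | "y < x" by linarith
    thus ?thesis using main[of x y] main[of y x] xy nn by cases (auto simp: abs_minus_commute)
  qed
  have kQ: "\<bar>\<kappa> k\<bar> \<le> Q" if "x \<in> T k" for x k
  proof -
    note D = TD[OF that]
    have "h * of_int k \<le> Q"
      by (rule eta_bound'[of x]) (use D(1-6) D(7)[unfolded abs_le_iff] p d0 in linarith)+
    moreover have "H - h * of_int k \<le> Q"
      by (rule eta_bound'[of "X - x"]) (use D(1-6) D(8)[unfolded abs_le_iff] p d0 in linarith)+
    ultimately
    show ?thesis using D(5,6) unfolding \<kappa>_def by linarith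
  qed
  define U where "U = (\<lambda>i::nat. \<lambda>k. if i = 0 then {x \<in> T k. \<bar>\<kappa> k\<bar> \<le> K0} else
     {x \<in> T k. K0 * 2 ^ (i - 1) \<le> \<bar>\<kappa> k\<bar> \<and> \<bar>\<kappa> k\<bar> \<le> K0 * 2 ^ i})"
  define n where "n = (\<lambda>i::nat. 2 * (K0 * 2 ^ i) / h + 1)"
  define ll where "ll = (\<lambda>i::nat. if i = 0 then Q ^ 3 * d0 else 2 * \<delta> / (K0 * 2 ^ (i - 1) / Q\<^sup>2))"
  have pw: "K0 \<le> K0 * 2 ^ i" for i using mult_left_mono[of 1 "2 ^ i" K0] K0 by simp
  have "(\<integral>\<^sup>+k. emeasure lborel (T k) \<partial>count_space UNIV) \<le> ennreal (\<Sum>i\<le>m. n i * (2 * ll i))"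
  proof (rule nn_integral_slices_le[where U = U])
    show "T k \<subseteq> (\<Union>i\<le>m. U i k)" for k
    proof
      fix x assume x: "x \<in> T k"
      show "x \<in> (\<Union>i\<le>m. U i k)"
      proof (cases "\<bar>\<kappa> k\<bar> \<le> K0")
        case True
        hence "x \<in> U 0 k" using x by (simp add: U_def)
        thus ?thesis by blast
      next
        case False
        have "\<bar>\<kappa> k\<bar> < K0 * 2 ^ m"
        proof -
          have "\<bar>\<kappa> k\<bar> \<le> Q" using kQ[OF x] .
          also have "\<dots> < 2 ^ m * h" by (rule m)
          also have "\<dots> \<le> 2 ^ m * K0" using K0 by (intro mult_left_mono) auto
          finally show ?thesis by (simp add: mult.commute)
        qed
        then obtain j where j: "j < m" "K0 * 2 ^ j \<le> \<bar>\<kappa> k\<bar>" "\<bar>\<kappa> k\<bar> < K0 * 2 ^ Suc j"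
          using geometric_block[of K0 2 "\<bar>\<kappa> k\<bar>" m] False K0 by force
        have "x \<in> U (Suc j) k" using x j by (simp add: U_def)
        thus ?thesis using j by (intro UN_I[of "Suc j"]) auto
      qed
    qed
    show "0 \<le> ll i" for i using \<delta> d0 Q0 K0 by (auto simp: ll_def)
    show "\<bar>x - y\<bar> \<le> ll i" if "x \<in> U i k" "y \<in> U i k" for i k x y
      using diam[of x k y] diam2[of x k y "K0 * 2 ^ (i - 1)"] pw[of "i - 1"] that
      by (auto simp: U_def ll_def split: if_splits)
    show "finite {k. U i k \<noteq> {}} \<and> real (card {k. U i k \<noteq> {}}) \<le> n i" for i
    proof -
      define A where "A = {k. U i k \<noteq> {}}"
      have A: "\<bar>\<kappa> k\<bar> \<le> K0 * 2 ^ i" if "k \<in> A" for k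
        using that by (auto simp: A_def U_def split: if_splits)
      have "h * real_of_int b - h * real_of_int a \<le> 2 * (K0 * 2 ^ i)" if "a \<in> A" "b \<in> A" for a b
        using A[OF that(1)] A[OF that(2)] unfolding \<kappa>_def by linarith
      thus ?thesis unfolding A_def[symmetric] n_def
        using card_int_spread[of h "2 * (K0 * 2 ^ i)" A] h K0 by simp
    qed
  qed simp
  also have "(\<Sum>i\<le>m. n i * (2 * ll i)) \<le> (\<Sum>i\<le>m. 20 * Q ^ 9 * (\<delta> / h))"
  proof (intro sum_mono)
    fix i assume "i \<in> {..m}"
    have Q9: "Q ^ a \<le> Q ^ 9" if "a \<le> 9" for a using that Q1 by (intro power_increasing)
    have dh: "0 < \<delta> / h" using \<delta> h by simp
    show "n i * (2 * ll i) \<le> 20 * Q ^ 9 * (\<delta> / h)"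
    proof (cases "i = 0")
      case True
      have "n i * (2 * ll i) = 4 * Q ^ 9 * (d0 ^ 3 / h) + 6 * Q ^ 3 * d0"
        using True h by (simp add: n_def ll_def K0_def field_simps eval_nat_numeral)
      also have "\<dots> \<le> 4 * Q ^ 9 * (\<delta> / h) + 6 * Q ^ 9 * (\<delta> / h)"
        using d0 h Q0 Q9[of 3] by (intro add_mono mult_mono divide_right_mono) auto
      also have "\<dots> = 10 * (Q ^ 9 * (\<delta> / h))" by simp
      also have "\<dots> \<le> 20 * (Q ^ 9 * (\<delta> / h))" by (rule mult_right_mono) (use dh Q0 in \<open>auto simp del: times_divide_eq_right\<close>)
      finally show ?thesis by (simp only: mult.assoc)
    next
      case False
      then obtain j where j: "i = Suc j" by (cases i) auto
      define c where "c = K0 * 2 ^ j"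
      have c: "h \<le> c" "0 < c" unfolding c_def using order_trans[OF K0(2) pw] K0(1) by simp_all
      have "n i * (2 * ll i) = (4 * c / h + 1) * (4 * \<delta> * Q\<^sup>2 / c)"
        unfolding n_def ll_def j c_def by simp
      also have "\<dots> = 16 * Q\<^sup>2 * (\<delta> / h) + 4 * Q\<^sup>2 * (\<delta> / c)"
        using c h by (simp add: field_simps)
      also have "\<dots> \<le> 16 * Q ^ 9 * (\<delta> / h) + 4 * Q ^ 9 * (\<delta> / h)"
        using c h \<delta> Q0 Q9[of 2] by (intro add_mono mult_mono divide_left_mono) auto
      also have "\<dots> = 20 * (Q ^ 9 * (\<delta> / h))" by simp
      finally show ?thesis by (simp only: mult.assoc)
    qed
  qed
  also have "\<dots> = 20 * Q ^ 9 * (real m + 1) * (\<delta> / h)" by simp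
  \<comment> \<open>The bound is weakened to the constant of the other two counts, 1280 Q^13 being
    the product of 40 Q and 32 Q^12, so that all pieces share one estimate.\<close>
  also have "\<dots> \<le> 1280 * Q ^ 13 * (real m + 1)\<^sup>2 * (\<delta> / h)"
  proof (intro mult_right_mono mult_mono)
    show "Q ^ 9 \<le> Q ^ 13" using Q1 by (intro power_increasing) auto
    show "real m + 1 \<le> (real m + 1)\<^sup>2" by (simp add: power2_eq_square algebra_simps)
  qed (use \<delta> h Q0 in auto)
  also have "\<dots> = 40 * Q * (32 * Q ^ 12) * (real m + 1)\<^sup>2 * \<delta> / h" by (simp add: eval_nat_numeral)
  finally show ?thesis by (simp add: T_def ennreal_leI)
qed

end

section \<open>The bilinear estimate\<close>

lemma borel_measurable_cis [measurable]: "cis \<in> borel_measurable borel"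
  by (intro borel_measurable_continuous_onI continuous_intros)

lemma borel_measurable_cnj [measurable]: "cnj \<in> borel_measurable borel"
  by (intro borel_measurable_continuous_onI continuous_intros)

text \<open>A rescaling of the characteristic function of the standard normal distribution. Gaussian
  weights are used for localisation because their transform is positive, as the Schur test below
  requires, and decays fast enough to be summed over unit windows.\<close>

lemma char_normal_density:
  assumes "0 < \<sigma>"
  shows "(LINT x|density lborel (normal_density 0 \<sigma>). cis (x * t)) = of_real (exp (- (\<sigma> * t)\<^sup>2 / 2))"
proof -
  have eq: "\<sigma> * normal_density 0 \<sigma> (\<sigma> * x) = std_normal_density x" for x
    using assms by (simp add: normal_density_def real_sqrt_mult power_mult_distrib)
  have "(LINT x|density lborel (normal_density 0 \<sigma>). cis (x * t)) =
      (LINT x|lborel. normal_density 0 \<sigma> x *\<^sub>R cis (x * t))"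
    by (subst integral_density) auto
  also have "\<dots> = \<bar>\<sigma>\<bar> *\<^sub>R (LINT x|lborel. normal_density 0 \<sigma> (0 + \<sigma> * x) *\<^sub>R cis ((0 + \<sigma> * x) * t))"
    using assms by (intro lborel_integral_real_affine) auto
  also have "\<dots> = (LINT x|lborel. \<sigma> *\<^sub>R (normal_density 0 \<sigma> (\<sigma> * x) *\<^sub>R cis ((\<sigma> * t) * x)))"
    unfolding integral_scaleR_right using assms by (simp add: mult_ac)
  also have "\<dots> = (LINT x|lborel. std_normal_density x *\<^sub>R cis ((\<sigma> * t) * x))"
    by (intro Bochner_Integration.integral_cong refl) (simp flip: eq)
  also have "\<dots> = (LINT x|std_normal_distribution. cis ((\<sigma> * t) * x))"
    by (subst integral_density) auto
  also have "\<dots> = char std_normal_distribution (\<sigma> * t)"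
    by (simp add: char_def cis_conv_exp)
  finally show ?thesis by (simp add: char_std_normal_distribution)
qed

lemma nn_integral_gauss:
  assumes "0 < \<sigma>"
  shows "(\<integral>\<^sup>+x. ennreal (exp (- (\<sigma> * (x - a))\<^sup>2 / 2)) \<partial>lborel) = ennreal (sqrt (2 * pi) / \<sigma>)"
proof -
  have eq: "exp (- (\<sigma> * (x - a))\<^sup>2 / 2) = sqrt (2 * pi) / \<sigma> * normal_density a (1 / \<sigma>) x" for x
    using assms by (simp add: normal_density_def real_sqrt_divide real_sqrt_mult power_mult_distrib power_divide)
  interpret prob_space "density lborel (normal_density a (1 / \<sigma>))"
    using assms by (intro prob_space_normal_density) auto
  have "(\<integral>\<^sup>+x. ennreal (normal_density a (1 / \<sigma>) x) \<partial>lborel) = 1"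
    using emeasure_space_1 by (simp add: emeasure_density)
  hence "(\<integral>\<^sup>+x. ennreal (sqrt (2 * pi) / \<sigma>) * ennreal (normal_density a (1 / \<sigma>) x) \<partial>lborel) =
      ennreal (sqrt (2 * pi) / \<sigma>)"
    by (subst nn_integral_cmult) auto
  thus ?thesis unfolding eq using assms by (subst ennreal_mult) auto
qed

text \<open>Expanding the square and integrating over W first leaves the double integral of G(p)
  cnj(G(p')) K(p, p'). By 2ab \<le> a^2 + b^2 and the symmetry of K only the row integrals of K
  matter, and the support of G restricts them to S. Integrability of G and finiteness of W justify
  Fubini, while the bound involves the L2 norm of G alone.\<close>

lemma TT_star_Schur:
  fixes G :: "'a \<Rightarrow> complex" and e :: "'a \<Rightarrow> 'b \<Rightarrow> complex" and K :: "'a \<Rightarrow> 'a \<Rightarrow> real"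
  assumes D: "sigma_finite_measure D" and W: "finite_measure W"
    and e[measurable]: "(\<lambda>(p, v). e p v) \<in> borel_measurable (D \<Otimes>\<^sub>M W)"
    and e1: "\<And>p v. norm (e p v) \<le> 1"
    and G: "integrable D G"
    and S[measurable]: "S \<in> sets D" and GS: "\<And>p. p \<notin> S \<Longrightarrow> G p = 0"
    and K[measurable]: "(\<lambda>(p, p'). K p p') \<in> borel_measurable (D \<Otimes>\<^sub>M D)"
    and kernel: "\<And>p p'. (LINT v|W. e p v * cnj (e p' v)) = of_real (K p p')"
    and K0: "\<And>p p'. 0 \<le> K p p'" and Ksym: "\<And>p p'. K p p' = K p' p"
    and schur: "\<And>p. p \<in> S \<Longrightarrow> (\<integral>\<^sup>+p'. ennreal (K p p') * indicator S p' \<partial>D) \<le> M"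
  shows "(\<integral>\<^sup>+v. ennreal ((norm (LINT p|D. G p * e p v))\<^sup>2) \<partial>W) \<le> M * (\<integral>\<^sup>+p. ennreal ((norm (G p))\<^sup>2) \<partial>D)"
proof -
  interpret D: sigma_finite_measure D by fact
  interpret W: finite_measure W by fact
  interpret DD: pair_sigma_finite D D ..
  interpret P: pair_sigma_finite "D \<Otimes>\<^sub>M D" W ..
  have Gm[measurable]: "G \<in> borel_measurable D" using G by auto
  define V where "V = (\<lambda>v. LINT p|D. G p * e p v)"
  define H where "H = (\<lambda>(q, v). (G (fst q) * e (fst q) v) * cnj (G (snd q) * e (snd q) v))"
  have e_sec[measurable]: "(\<lambda>p. e p v) \<in> borel_measurable D" if "v \<in> space W" for v
    using measurable_Pair1[OF e that] by simp
  have Hm[measurable]: "H \<in> borel_measurable ((D \<Otimes>\<^sub>M D) \<Otimes>\<^sub>M W)"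
  proof -
    have 1: "(\<lambda>x. e (fst (fst x)) (snd x)) \<in> borel_measurable ((D \<Otimes>\<^sub>M D) \<Otimes>\<^sub>M W)"
      using measurable_compose[OF _ e, of "\<lambda>x. (fst (fst x), snd x)"] by simp
    have 2: "(\<lambda>x. e (snd (fst x)) (snd x)) \<in> borel_measurable ((D \<Otimes>\<^sub>M D) \<Otimes>\<^sub>M W)"
      using measurable_compose[OF _ e, of "\<lambda>x. (snd (fst x), snd x)"] by simp
    show ?thesis unfolding H_def case_prod_beta
      using 1 2 by measurable
  qed
  have Gfin: "(\<integral>\<^sup>+p. ennreal (norm (G p)) \<partial>D) < \<infinity>" using G by (simp add: integrable_iff_bounded)
  have H_le: "norm (H (q, v)) \<le> norm (G (fst q)) * norm (G (snd q))" for q v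
  proof -
    have "norm (H (q, v)) = (norm (G (fst q)) * norm (G (snd q))) * (norm (e (fst q) v) * norm (e (snd q) v))"
      by (simp add: H_def norm_mult)
    also have "\<dots> \<le> (norm (G (fst q)) * norm (G (snd q))) * (1 * 1)"
      by (intro mult_left_mono mult_mono e1) auto
    finally show ?thesis by simp
  qed
  have GG: "(\<integral>\<^sup>+q. ennreal (norm (G (fst q)) * norm (G (snd q))) \<partial>(D \<Otimes>\<^sub>M D)) < \<infinity>"
  proof -
    have "(\<integral>\<^sup>+q. ennreal (norm (G (fst q)) * norm (G (snd q))) \<partial>(D \<Otimes>\<^sub>M D)) =
        (\<integral>\<^sup>+p. \<integral>\<^sup>+p'. ennreal (norm (G p)) * ennreal (norm (G p')) \<partial>D \<partial>D)"
      by (subst D.nn_integral_fst[symmetric]) (auto simp: ennreal_mult)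
    also have "\<dots> = (\<integral>\<^sup>+p. ennreal (norm (G p)) \<partial>D) * (\<integral>\<^sup>+p. ennreal (norm (G p)) \<partial>D)"
      by (simp add: nn_integral_cmult nn_integral_multc)
    also have "\<dots> < \<infinity>" using Gfin by (simp add: ennreal_mult_less_top)
    finally show ?thesis .
  qed
  have Hint: "integrable ((D \<Otimes>\<^sub>M D) \<Otimes>\<^sub>M W) H"
  proof (rule integrableI_bounded)
    have "(\<integral>\<^sup>+x. ennreal (norm (H x)) \<partial>((D \<Otimes>\<^sub>M D) \<Otimes>\<^sub>M W)) =
        (\<integral>\<^sup>+q. \<integral>\<^sup>+v. ennreal (norm (H (q, v))) \<partial>W \<partial>(D \<Otimes>\<^sub>M D))"
      by (subst W.nn_integral_fst[symmetric]) auto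
    also have "\<dots> \<le> (\<integral>\<^sup>+q. \<integral>\<^sup>+v. ennreal (norm (G (fst q)) * norm (G (snd q))) \<partial>W \<partial>(D \<Otimes>\<^sub>M D))"
      by (intro nn_integral_mono ennreal_leI H_le)
    also have "\<dots> = (\<integral>\<^sup>+q. ennreal (norm (G (fst q)) * norm (G (snd q))) \<partial>(D \<Otimes>\<^sub>M D)) * emeasure W (space W)"
      by (simp add: nn_integral_multc)
    also have "\<dots> < \<infinity>" using GG W.emeasure_finite[of "space W"]
      by (auto simp: ennreal_mult_eq_top_iff less_top[symmetric])
    finally show "(\<integral>\<^sup>+x. ennreal (norm (H x)) \<partial>((D \<Otimes>\<^sub>M D) \<Otimes>\<^sub>M W)) < \<infinity>" .
  qed auto
  have VV: "(LINT q|(D \<Otimes>\<^sub>M D). H (q, v)) = of_real ((norm (V v))\<^sup>2)" if v: "v \<in> space W" for v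
  proof -
    define g where "g = (\<lambda>p. G p * e p v)"
    have gm[measurable]: "g \<in> borel_measurable D" unfolding g_def using Gm e_sec[OF v] by (rule borel_measurable_times)
    have gi: "integrable D g"
      by (rule Bochner_Integration.integrable_bound[OF G gm])
        (auto simp: g_def norm_mult intro!: AE_I2 mult_left_le e1)
    have gi': "integrable D (\<lambda>p. cnj (g p))" using gi by simp
    have i: "integrable (D \<Otimes>\<^sub>M D) (\<lambda>q. g (fst q) * cnj (g (snd q)))"
    proof (rule DD.Fubini_integrable)
      show "(\<lambda>q. g (fst q) * cnj (g (snd q))) \<in> borel_measurable (D \<Otimes>\<^sub>M D)" by measurable
      show "integrable D (\<lambda>x. LINT y|D. norm (g (fst (x, y)) * cnj (g (snd (x, y)))))"
        using gi by (simp add: norm_mult)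
      show "AE x in D. integrable D (\<lambda>y. g (fst (x, y)) * cnj (g (snd (x, y))))" using gi' by simp
    qed
    have "(LINT q|(D \<Otimes>\<^sub>M D). H (q, v)) = (LINT q|(D \<Otimes>\<^sub>M D). g (fst q) * cnj (g (snd q)))"
      by (simp add: H_def g_def)
    also have "\<dots> = (LINT p|D. LINT p'|D. g (fst (p, p')) * cnj (g (snd (p, p'))))"
      by (rule DD.integral_fst'[OF i, symmetric])
    also have "\<dots> = V v * cnj (V v)" by (simp add: V_def g_def[symmetric])
    finally show ?thesis by (simp only: complex_norm_square)
  qed
  have Hint2: "integrable W (\<lambda>v. LINT q|(D \<Otimes>\<^sub>M D). H (q, v))"
    using P.integrable_snd[of "\<lambda>q v. H (q, v)"] Hint by simp
  have Vint: "integrable W (\<lambda>v. (norm (V v))\<^sup>2)"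
  proof -
    have "integrable W (\<lambda>v. Re (LINT q|(D \<Otimes>\<^sub>M D). H (q, v)))" using Hint2 by simp
    thus ?thesis by (rule Bochner_Integration.integrable_cong[THEN iffD1, rotated -1]) (auto simp: VV)
  qed
  have Hker: "(LINT v|W. H (q, v)) = G (fst q) * cnj (G (snd q)) * of_real (K (fst q) (snd q))" for q
    unfolding H_def by (simp add: kernel[symmetric] mult_ac flip: integral_mult_right_zero)
  have kint: "integrable (D \<Otimes>\<^sub>M D) (\<lambda>q. LINT v|W. H (q, v))"
    using P.integrable_fst[of "\<lambda>q v. H (q, v)"] Hint by simp
  have "(LINT v|W. LINT q|(D \<Otimes>\<^sub>M D). H (q, v)) = (LINT q|(D \<Otimes>\<^sub>M D). LINT v|W. H (q, v))"
    using P.Fubini_integral[of "\<lambda>q v. H (q, v)"] Hint by simp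
  moreover have "(LINT v|W. LINT q|(D \<Otimes>\<^sub>M D). H (q, v)) = of_real (LINT v|W. (norm (V v))\<^sup>2)"
    by (subst integral_complex_of_real[symmetric], intro Bochner_Integration.integral_cong refl) (simp add: VV)
  ultimately have eq: "of_real (LINT v|W. (norm (V v))\<^sup>2) = (LINT q|(D \<Otimes>\<^sub>M D). LINT v|W. H (q, v))" by simp
  have nn: "0 \<le> (LINT v|W. (norm (V v))\<^sup>2)" by simp
  define u where "u = (\<lambda>p p'. ennreal ((norm (G p))\<^sup>2) * (ennreal (K p p') * indicator S p'))"
  have um[measurable]: "(\<lambda>(p, p'). u p p') \<in> borel_measurable (D \<Otimes>\<^sub>M D)"
    unfolding u_def by measurable
  have um'[measurable]: "(\<lambda>(p, p'). u p' p) \<in> borel_measurable (D \<Otimes>\<^sub>M D)"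
    using measurable_compose[OF measurable_pair_swap um] by (simp add: case_prod_beta')
  define I where "I = (\<integral>\<^sup>+p. \<integral>\<^sup>+p'. u p p' \<partial>D \<partial>D)"
  have "(\<integral>\<^sup>+v. ennreal ((norm (V v))\<^sup>2) \<partial>W) = ennreal (LINT v|W. (norm (V v))\<^sup>2)"
    using Vint by (intro nn_integral_eq_integral) auto
  also have "\<dots> = ennreal (norm (LINT q|(D \<Otimes>\<^sub>M D). LINT v|W. H (q, v)))"
    using eq[symmetric] nn by simp
  also have "\<dots> \<le> (\<integral>\<^sup>+q. ennreal (norm (LINT v|W. H (q, v))) \<partial>(D \<Otimes>\<^sub>M D))"
    by (rule integral_norm_bound_ennreal[OF kint])
  \<comment> \<open>The arithmetic-geometric mean splits the integrand into two halves that are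
    interchanged by swapping p and p'; both have the integral I.\<close>
  also have "\<dots> \<le> (\<integral>\<^sup>+q. ennreal (1 / 2) * (u (fst q) (snd q) + u (snd q) (fst q)) \<partial>(D \<Otimes>\<^sub>M D))"
  proof (intro nn_integral_mono)
    fix q assume "q \<in> space (D \<Otimes>\<^sub>M D)"
    obtain p p' where q: "q = (p, p')" by force
    show "ennreal (norm (LINT v|W. H (q, v))) \<le> ennreal (1 / 2) * (u (fst q) (snd q) + u (snd q) (fst q))"
    proof (cases "p \<in> S \<and> p' \<in> S")
      case True
      have "norm (G p) * norm (G p') \<le> 1 / 2 * ((norm (G p))\<^sup>2 + (norm (G p'))\<^sup>2)"
        using sum_squares_bound[of "norm (G p)" "norm (G p')"] by simp
      hence "norm (G p) * norm (G p') * K p p' \<le> 1 / 2 * ((norm (G p))\<^sup>2 + (norm (G p'))\<^sup>2) * K p p'"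
        by (intro mult_right_mono K0)
      hence "norm (LINT v|W. H (q, v)) \<le> 1 / 2 * ((norm (G p))\<^sup>2 * K p p' + (norm (G p'))\<^sup>2 * K p' p)"
        using K0[of p p'] Ksym[of p p'] by (simp add: Hker q norm_mult algebra_simps)
      hence "ennreal (norm (LINT v|W. H (q, v))) \<le>
          ennreal (1 / 2 * ((norm (G p))\<^sup>2 * K p p' + (norm (G p'))\<^sup>2 * K p' p))" by (rule ennreal_leI)
      also have "\<dots> = ennreal (1 / 2) * (u p p' + u p' p)"
        using True K0 by (subst ennreal_mult) (auto simp: u_def ennreal_mult ennreal_plus)
      finally show ?thesis by (simp add: q)
    next
      case False
      thus ?thesis using GS by (auto simp: Hker q)
    qed
  qed
  also have "\<dots> = ennreal (1 / 2) * ((\<integral>\<^sup>+q. u (fst q) (snd q) \<partial>(D \<Otimes>\<^sub>M D)) + (\<integral>\<^sup>+q. u (snd q) (fst q) \<partial>(D \<Otimes>\<^sub>M D)))"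
    using um um' by (subst nn_integral_cmult) (auto simp: nn_integral_add case_prod_beta')
  also have "(\<integral>\<^sup>+q. u (fst q) (snd q) \<partial>(D \<Otimes>\<^sub>M D)) = I"
    unfolding I_def using um by (subst D.nn_integral_fst[symmetric]) (auto simp: case_prod_beta')
  also have "(\<integral>\<^sup>+q. u (snd q) (fst q) \<partial>(D \<Otimes>\<^sub>M D)) = I"
    unfolding I_def using um' by (subst DD.nn_integral_snd[symmetric]) (auto simp: case_prod_beta')
  also have "ennreal (1 / 2) * (I + I) = I"
  proof -
    have "I + I = ennreal 2 * I" by (simp add: mult_2)
    moreover have "ennreal (1 / 2) * (ennreal 2 * I) = ennreal (1 / 2 * 2) * I"
      by (subst ennreal_mult) (auto simp: mult.assoc)
    ultimately show ?thesis by simp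
  qed
  also have "I \<le> (\<integral>\<^sup>+p. ennreal ((norm (G p))\<^sup>2) * M \<partial>D)"
    unfolding I_def
  proof (intro nn_integral_mono)
    fix p assume p: "p \<in> space D"
    show "(\<integral>\<^sup>+p'. u p p' \<partial>D) \<le> ennreal ((norm (G p))\<^sup>2) * M"
    proof (cases "p \<in> S")
      case True
      have Kp: "(\<lambda>p'. K p p') \<in> borel_measurable D" using measurable_Pair2[OF K p] by simp
      have "(\<integral>\<^sup>+p'. u p p' \<partial>D) = ennreal ((norm (G p))\<^sup>2) * (\<integral>\<^sup>+p'. ennreal (K p p') * indicator S p' \<partial>D)"
        unfolding u_def using Kp S
        by (intro nn_integral_cmult borel_measurable_times_ennreal borel_measurable_indicator
            measurable_compose[OF Kp measurable_ennreal])
      also have "\<dots> \<le> ennreal ((norm (G p))\<^sup>2) * M" by (intro mult_left_mono schur True) auto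
      finally show ?thesis .
    qed (simp add: u_def GS)
  qed
  also have "\<dots> = M * (\<integral>\<^sup>+p. ennreal ((norm (G p))\<^sup>2) \<partial>D)"
    by (subst mult.commute, rule nn_integral_cmult) measurable
  finally show ?thesis by (simp add: V_def)
qed

section \<open>Integration on the torus and on the dual cylinder\<close>

definition torus :: "real measure" where
  "torus = restrict_space lborel {0..<2 * pi}"

lemma cylinder_torus: "cylinder = lborel \<Otimes>\<^sub>M torus"
  by (simp add: cylinder_def torus_def)

lemma emeasure_torus: "emeasure torus (space torus) = ennreal (2 * pi)"
  by (simp add: torus_def emeasure_restrict_space space_restrict_space)

lemma finite_measure_torus: "finite_measure torus"
  by (rule finite_measureI) (simp add: emeasure_torus)

lemma measurable_torus: "f \<in> borel_measurable borel \<Longrightarrow> f \<in> borel_measurable torus"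
  unfolding torus_def by (rule measurable_restrict_space1) simp

lemma sigma_finite_int: "sigma_finite_measure (count_space (UNIV :: int set))"
  by (rule sigma_finite_measure_count_space)

lemma sigma_finite_dual_cylinder: "sigma_finite_measure dual_cylinder"
  unfolding dual_cylinder_def
  by (intro sigma_finite_pair_measure sigma_finite_lborel sigma_finite_int)

lemma measurable_fst_dual [measurable]: "fst \<in> borel_measurable dual_cylinder"
  unfolding dual_cylinder_def by (rule measurable_compose[OF measurable_fst]) simp

lemma measurable_snd_dual [measurable]: "(\<lambda>\<zeta>. real_of_int (snd \<zeta>)) \<in> borel_measurable dual_cylinder"
  unfolding dual_cylinder_def by (rule measurable_compose[OF measurable_snd]) simp

lemma space_dual_cylinder [simp]: "space dual_cylinder = UNIV"
  by (simp add: dual_cylinder_def space_pair_measure)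

lemma integral_cis_torus:
  "(LINT y|torus. cis (y * of_int k)) = (if k = 0 then 2 * of_real pi else 0)"
proof (cases "k = 0")
  case True
  interpret finite_measure torus by (rule finite_measure_torus)
  have "measure torus (space torus) = 2 * pi" using emeasure_torus by (simp add: measure_def)
  thus ?thesis using True by (simp add: scaleR_conv_of_real)
next
  case False
  define F where "F = (\<lambda>y. exp (\<i> * of_int k * of_real y) / (\<i> * of_int k))"
  have cis_eq: "cis (y * of_int k) = exp (\<i> * of_int k * of_real y)" for y
    by (simp add: cis_conv_exp mult_ac)
  have "has_bochner_integral lborel (\<lambda>y. indicator {0..2 * pi} y *\<^sub>R cis (y * of_int k)) (F (2 * pi) - F 0)"
  proof (rule has_bochner_integral_FTC_Icc)
    fix x :: real assume "0 \<le> x" "x \<le> 2 * pi"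
    show "(F has_vector_derivative cis (x * of_int k)) (at x within {0..2 * pi})"
      unfolding F_def cis_eq
      by (rule has_vector_derivative_real_field) (use False in \<open>auto intro!: derivative_eq_intros\<close>)
  qed (auto intro!: continuous_intros)
  moreover have "F (2 * pi) = F 0"
    using cis_multiple_2pi[of "of_int k"] cis_eq[of "2 * pi"] by (simp add: F_def mult_ac)
  ultimately have "(LINT y|lborel. indicator {0..2 * pi} y *\<^sub>R cis (y * of_int k)) = 0"
    by (simp add: has_bochner_integral_integral_eq)
  \<comment> \<open>The fundamental theorem of calculus works on the closed interval; the torus is
    half-open, and the endpoint is a null set.\<close>
  moreover have "(LINT y|lborel. indicator {0..2 * pi} y *\<^sub>R cis (y * of_int k)) =
      (LINT y|lborel. indicator {0..<2 * pi} y *\<^sub>R cis (y * of_int k))"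
  proof (rule integral_cong_AE)
    have "AE y in lborel. y \<noteq> 2 * pi" by (rule AE_lborel_singleton)
    thus "AE y in lborel. indicator {0..2 * pi} y *\<^sub>R cis (y * of_int k) =
        indicator {0..<2 * pi} y *\<^sub>R cis (y * of_int k)"
      by eventually_elim (auto simp: indicator_def)
  qed measurable
  moreover have "(LINT y|torus. cis (y * of_int k)) = (LINT y|lborel. indicator {0..<2 * pi} y *\<^sub>R cis (y * of_int k))"
    unfolding torus_def by (subst integral_restrict_space) auto
  ultimately show ?thesis using False by simp
qed

text \<open>From (|u| - 1)^2 \<ge> 0 the exponent -u^2/2 is at most 1/2 - |u|, hence at most 1/2 - n
  for the integer part n of |u|. Then exp(1/2) \<le> 2 and exp(-1) \<le> 1/2 give the weights. A
  Gaussian is thus replaced by unit windows with summable weights.\<close>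

lemma exp_sq_le_windows:
  fixes u :: real
  shows "ennreal (exp (- u\<^sup>2 / 2)) \<le>
    (\<Sum>n. ennreal (2 * (1 / 2) ^ n) * (indicator {v. \<bar>v - real n\<bar> \<le> 1} u + indicator {v. \<bar>v + real n\<bar> \<le> 1} u))"
proof -
  define n where "n = nat \<lfloor>\<bar>u\<bar>\<rfloor>"
  have n: "real n \<le> \<bar>u\<bar>" "\<bar>u\<bar> < real n + 1" by (simp_all add: n_def)
  have "\<bar>u\<bar> - 1 / 2 \<le> u\<^sup>2 / 2"
    using zero_le_power2[of "\<bar>u\<bar> - 1"] by (simp add: power2_diff)
  hence "exp (- u\<^sup>2 / 2) \<le> exp (1 / 2 - real n)" using n by simp
  also have "\<dots> = exp (1 / 2) * exp (- 1) ^ n" by (simp add: exp_of_nat_mult[symmetric] mult_exp_exp)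
  also have "\<dots> \<le> 2 * (1 / 2) ^ n"
  proof (intro mult_mono power_mono)
    have "exp (1 / 2 :: real) \<le> 1 + 1 / 2 + (1 / 2)\<^sup>2" by (rule exp_bound) auto
    thus "exp (1 / 2 :: real) \<le> 2" by (simp add: power2_eq_square)
    have "2 \<le> exp (1 :: real)" using exp_ge_add_one_self[of 1] by simp
    thus "exp (- 1 :: real) \<le> 1 / 2" by (simp add: exp_minus field_simps)
  qed auto
  finally have "ennreal (exp (- u\<^sup>2 / 2)) \<le> ennreal (2 * (1 / 2) ^ n)" by (rule ennreal_leI)
  also have "\<dots> \<le> ennreal (2 * (1 / 2) ^ n) * (indicator {v. \<bar>v - real n\<bar> \<le> 1} u + indicator {v. \<bar>v + real n\<bar> \<le> 1} u)"
    using n mult_left_mono[of 1 "indicator {v. \<bar>v - real n\<bar> \<le> 1} u + indicator {v. \<bar>v + real n\<bar> \<le> 1} u :: ennreal"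
        "ennreal (2 * (1 / 2) ^ n)"]
    by (auto simp: indicator_def abs_if split: if_splits)
  also have "\<dots> \<le> (\<Sum>n. ennreal (2 * (1 / 2) ^ n) * (indicator {v. \<bar>v - real n\<bar> \<le> 1} u + indicator {v. \<bar>v + real n\<bar> \<le> 1} u))"
    using sum_le_suminf[of "\<lambda>n. ennreal (2 * (1 / 2) ^ n) * (indicator {v. \<bar>v - real n\<bar> \<le> 1} u + indicator {v. \<bar>v + real n\<bar> \<le> 1} u)" "{n}"]
    by simp
  finally show ?thesis .
qed

lemma suminf_geometric_ennreal: "(\<Sum>n. ennreal (2 * (1 / 2) ^ n)) = 4"
proof -
  have "(\<lambda>n. 2 * (1 / 2 :: real) ^ n) sums (2 * (1 / (1 - 1 / 2)))"
    by (intro sums_mult geometric_sums) simp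
  moreover have "2 * (1 / (1 - 1 / 2)) = (4 :: real)" by simp
  ultimately have "(\<lambda>n. 2 * (1 / 2 :: real) ^ n) sums 4" by (simp only:)
  hence "(\<Sum>n. ennreal (2 * (1 / 2) ^ n)) = ennreal 4" by (rule suminf_ennreal_eq[rotated]) simp
  also have "ennreal 4 = 4" by (rule ennreal_numeral)
  finally show ?thesis .
qed

text \<open>The order with the integer variable outermost is the one in which the counting bounds
  are stated.\<close>

lemma nn_integral_dual:
  assumes "f \<in> borel_measurable dual_cylinder"
  shows "(\<integral>\<^sup>+\<zeta>. f \<zeta> \<partial>dual_cylinder) = (\<integral>\<^sup>+k. \<integral>\<^sup>+x. f (x, k) \<partial>lborel \<partial>count_space UNIV)"
proof -
  interpret pair_sigma_finite "lborel :: real measure" "count_space (UNIV :: int set)"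
    by (intro pair_sigma_finite.intro sigma_finite_lborel sigma_finite_int)
  show ?thesis using nn_integral_snd[of f] assms by (simp add: dual_cylinder_def)
qed

lemma measurable_dual_section:
  assumes "f \<in> borel_measurable dual_cylinder"
  shows "(\<lambda>x. f (x, k)) \<in> borel_measurable borel"
  using measurable_compose[OF measurable_Pair2'[of k "count_space UNIV" lborel] assms[unfolded dual_cylinder_def]] by simp

lemma nn_integral_swap_int:
  assumes "\<And>k :: int. (\<lambda>x. f k x) \<in> borel_measurable (lborel :: real measure)"
  shows "(\<integral>\<^sup>+k. \<integral>\<^sup>+x. f k x \<partial>lborel \<partial>count_space UNIV) = (\<integral>\<^sup>+x. \<integral>\<^sup>+k. f k x \<partial>count_space UNIV \<partial>lborel)"
proof -
  interpret pair_sigma_finite "count_space (UNIV :: int set)" "lborel :: real measure"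
    by (rule pair_sigma_finite.intro[OF sigma_finite_int sigma_finite_lborel])
  have "(\<lambda>(k, x). f k x) \<in> borel_measurable (count_space UNIV \<Otimes>\<^sub>M lborel)"
    by (rule measurable_pair_measure_countable1) (simp_all only: case_prod_conv assms countableI_type)
  thus ?thesis by (rule Fubini'[symmetric])
qed

text \<open>The bound M is uniform in the centre of the window, so it applies to all windows centred
  at \<tau> + n and \<tau> - n. The weights sum to 4 and both signs occur, whence the 8.\<close>

lemma weighted_window_bound:
  fixes w :: "real \<times> int \<Rightarrow> real"
  assumes w[measurable]: "w \<in> borel_measurable dual_cylinder" and R[measurable]: "R \<in> sets dual_cylinder"
    and M: "\<And>\<tau>. (\<integral>\<^sup>+k1. emeasure lborel {x. (x, k1) \<in> R \<and> (s - x, k - k1) \<in> R \<and>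
        \<bar>w (x, k1) + w (s - x, k - k1) - \<tau>\<bar> \<le> 1} \<partial>count_space UNIV) \<le> M"
  shows "(\<integral>\<^sup>+k1. \<integral>\<^sup>+x. indicator R (x, k1) * indicator R (s - x, k - k1) *
      ennreal (exp (- (w (x, k1) + w (s - x, k - k1) - \<tau>)\<^sup>2 / 2)) \<partial>lborel \<partial>count_space UNIV) \<le> 8 * M"
proof -
  define F where "F = (\<lambda>k1 x. w (x, k1) + w (s - x, k - k1))"
  define T where "T = (\<lambda>\<tau> k1. {x. (x, k1) \<in> R \<and> (s - x, k - k1) \<in> R \<and> \<bar>F k1 x - \<tau>\<bar> \<le> 1})"
  have w'[measurable]: "(\<lambda>x. w (x, k1)) \<in> borel_measurable borel" for k1
    by (rule measurable_dual_section[OF w])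
  have w''[measurable]: "(\<lambda>x. w (s - x, k1)) \<in> borel_measurable borel" for k1
    by (rule measurable_compose[OF _ w'[of k1]]) simp
  have R': "(\<lambda>x. indicator R (x, k1) :: ennreal) \<in> borel_measurable borel" for k1
    by (rule measurable_dual_section) simp
  have R'': "(\<lambda>x. indicator R (s - x, k1) :: ennreal) \<in> borel_measurable borel" for k1
    by (rule measurable_compose[OF _ R'[of k1]]) simp
  have Rs[measurable]: "{x. (x, k1) \<in> R} \<in> sets borel" for k1
  proof -
    have "{x. (x, k1) \<in> R} = (\<lambda>x. indicator R (x, k1) :: ennreal) -` {1} \<inter> space borel"
      by (auto simp: indicator_def)
    thus ?thesis using measurable_sets[OF R'[of k1], of "{1}"] by simp
  qed
  have Rs'[measurable]: "{x. (s - x, k1) \<in> R} \<in> sets borel" for k1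
  proof -
    have "{x. (s - x, k1) \<in> R} = (\<lambda>x. indicator R (s - x, k1) :: ennreal) -` {1} \<inter> space borel"
      by (auto simp: indicator_def)
    thus ?thesis using measurable_sets[OF R''[of k1], of "{1}"] by simp
  qed
  have Fm[measurable]: "F k1 \<in> borel_measurable borel" for k1
    unfolding F_def by (intro borel_measurable_add w' w'')
  have Tm[measurable]: "T a k1 \<in> sets borel" for a k1
  proof -
    have "T a k1 = {x. (x, k1) \<in> R} \<inter> {x. (s - x, k - k1) \<in> R} \<inter> {x \<in> space borel. \<bar>F k1 x - a\<bar> \<le> 1}"
      by (auto simp: T_def)
    thus ?thesis by simp
  qed
  have "(\<integral>\<^sup>+k1. \<integral>\<^sup>+x. indicator R (x, k1) * indicator R (s - x, k - k1) *
      ennreal (exp (- (F k1 x - \<tau>)\<^sup>2 / 2)) \<partial>lborel \<partial>count_space UNIV) \<le>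
    (\<integral>\<^sup>+k1. \<integral>\<^sup>+x. (\<Sum>n. ennreal (2 * (1 / 2) ^ n) * (indicator (T (\<tau> + real n) k1) x + indicator (T (\<tau> - real n) k1) x))
       \<partial>lborel \<partial>count_space UNIV)"
  proof (intro nn_integral_mono)
    fix k1 x
    show "indicator R (x, k1) * indicator R (s - x, k - k1) * ennreal (exp (- (F k1 x - \<tau>)\<^sup>2 / 2)) \<le>
      (\<Sum>n. ennreal (2 * (1 / 2) ^ n) * (indicator (T (\<tau> + real n) k1) x + indicator (T (\<tau> - real n) k1) x))"
    proof (cases "(x, k1) \<in> R \<and> (s - x, k - k1) \<in> R")
      case True
      have "ennreal (exp (- (F k1 x - \<tau>)\<^sup>2 / 2)) \<le> (\<Sum>n. ennreal (2 * (1 / 2) ^ n) *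
          (indicator {v. \<bar>v - real n\<bar> \<le> 1} (F k1 x - \<tau>) + indicator {v. \<bar>v + real n\<bar> \<le> 1} (F k1 x - \<tau>)))"
        by (rule exp_sq_le_windows)
      also have "\<dots> = (\<Sum>n. ennreal (2 * (1 / 2) ^ n) * (indicator (T (\<tau> + real n) k1) x + indicator (T (\<tau> - real n) k1) x))"
        using True by (intro suminf_cong arg_cong2[where f = "(*)"] arg_cong2[where f = "(+)"] refl)
          (auto simp: T_def indicator_def algebra_simps)
      finally show ?thesis using True by simp
    qed auto
  qed
  also have "\<dots> = (\<integral>\<^sup>+k1. (\<Sum>n. \<integral>\<^sup>+x. ennreal (2 * (1 / 2) ^ n) * (indicator (T (\<tau> + real n) k1) x + indicator (T (\<tau> - real n) k1) x) \<partial>lborel)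
       \<partial>count_space UNIV)"
    by (intro nn_integral_cong nn_integral_suminf) measurable
  also have "\<dots> = (\<Sum>n. \<integral>\<^sup>+k1. \<integral>\<^sup>+x. ennreal (2 * (1 / 2) ^ n) * (indicator (T (\<tau> + real n) k1) x + indicator (T (\<tau> - real n) k1) x) \<partial>lborel
       \<partial>count_space UNIV)"
    by (rule nn_integral_suminf) simp
  also have "\<dots> = (\<Sum>n. ennreal (2 * (1 / 2) ^ n) * ((\<integral>\<^sup>+k1. emeasure lborel (T (\<tau> + real n) k1) \<partial>count_space UNIV) +
       (\<integral>\<^sup>+k1. emeasure lborel (T (\<tau> - real n) k1) \<partial>count_space UNIV)))"
    by (simp add: nn_integral_cmult nn_integral_add)
  also have "\<dots> \<le> (\<Sum>n. ennreal (2 * (1 / 2) ^ n) * (M + M))"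
    using M by (intro suminf_le mult_left_mono add_mono) (auto simp: T_def F_def)
  also have "\<dots> = (\<Sum>n. ennreal (2 * (1 / 2) ^ n)) * (M + M)" by simp
  also have "\<dots> = 8 * M"
  proof -
    have "4 * (M + M) = (4 * 2) * M" by (simp only: mult_2 distrib_left distrib_right mult.assoc)
    also have "(4 * 2 :: ennreal) = 8" by simp
    finally have "4 * (M + M) = 8 * M" .
    thus ?thesis by (simp only: suminf_geometric_ennreal)
  qed
  finally show ?thesis by (simp only: F_def)
qed

lemma integral_pair_mult:
  fixes f :: "'a \<Rightarrow> complex" and g :: "'b \<Rightarrow> complex"
  assumes M: "sigma_finite_measure M" and N: "sigma_finite_measure N"
    and f: "integrable M f" and g: "integrable N g"
  shows "integrable (M \<Otimes>\<^sub>M N) (\<lambda>q. f (fst q) * g (snd q))"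
    and "(LINT q|(M \<Otimes>\<^sub>M N). f (fst q) * g (snd q)) = (LINT x|M. f x) * (LINT y|N. g y)"
proof -
  interpret pair_sigma_finite M N by (rule pair_sigma_finite.intro[OF M N])
  have [measurable]: "f \<in> borel_measurable M" "g \<in> borel_measurable N" using f g by auto
  show i: "integrable (M \<Otimes>\<^sub>M N) (\<lambda>q. f (fst q) * g (snd q))"
  proof (rule Fubini_integrable)
    show "(\<lambda>q. f (fst q) * g (snd q)) \<in> borel_measurable (M \<Otimes>\<^sub>M N)" by measurable
    show "integrable M (\<lambda>x. LINT y|N. norm (f (fst (x, y)) * g (snd (x, y))))"
      using f by (simp add: norm_mult)
    show "AE x in M. integrable N (\<lambda>y. f (fst (x, y)) * g (snd (x, y)))" using g by simp
  qed
  have "(LINT q|(M \<Otimes>\<^sub>M N). f (fst q) * g (snd q)) = (LINT x|M. LINT y|N. f (fst (x, y)) * g (snd (x, y)))"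
    by (rule integral_fst'[OF i, symmetric])
  thus "(LINT q|(M \<Otimes>\<^sub>M N). f (fst q) * g (snd q)) = (LINT x|M. f x) * (LINT y|N. g y)" by simp
qed

section \<open>Physical space with Gaussian weights\<close>

definition gauss :: "real \<Rightarrow> real measure" where
  "gauss \<sigma> = density lborel (normal_density 0 \<sigma>)"

lemma finite_measure_gauss: "0 < \<sigma> \<Longrightarrow> finite_measure (gauss \<sigma>)"
  unfolding gauss_def by (intro prob_space.finite_measure prob_space_normal_density)

lemma measurable_gauss: "f \<in> borel_measurable borel \<Longrightarrow> f \<in> borel_measurable (gauss \<sigma>)"
  by (simp add: gauss_def)

lemma sigma_finite_torus: "sigma_finite_measure torus"
  using finite_measure_torus by (rule finite_measure.axioms)

lemma sigma_finite_gauss: "0 < \<sigma> \<Longrightarrow> sigma_finite_measure (gauss \<sigma>)"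
  using finite_measure_gauss by (rule finite_measure.axioms)

lemma finite_measure_pair:
  assumes "finite_measure M" "finite_measure N"
  shows "finite_measure (M \<Otimes>\<^sub>M N)"
proof -
  interpret M: finite_measure M by fact
  interpret N: finite_measure N by fact
  show ?thesis
    by (rule finite_measureI)
      (simp add: space_pair_measure N.emeasure_pair_measure_Times ennreal_mult_eq_top_iff)
qed

lemma integrable_cis:
  assumes "finite_measure M" "f \<in> borel_measurable M"
  shows "integrable M (\<lambda>x. cis (f x))"
  by (rule finite_measure.integrable_const_bound[OF assms(1), of _ 1])
    (auto intro: measurable_compose[OF assms(2) borel_measurable_cis])

text \<open>The coordinates are (t, (x, y)). The weight in time is bounded below on [0, 1]; the
  weight of width \<sigma> in x is removed later by letting \<sigma> grow. Both make the measure
  finite, as \<open>TT_star_Schur\<close> requires.\<close>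

definition phys :: "real \<Rightarrow> (real \<times> real \<times> real) measure" where
  "phys \<sigma> = gauss 1 \<Otimes>\<^sub>M (gauss \<sigma> \<Otimes>\<^sub>M torus)"

lemma finite_measure_phys: "0 < \<sigma> \<Longrightarrow> finite_measure (phys \<sigma>)"
  unfolding phys_def by (intro finite_measure_pair finite_measure_gauss finite_measure_torus) auto

text \<open>The Gaussian weights turn exact conservation in t and x into concentration near a = 0
  and b = 0, whereas the torus enforces equality of the integer frequencies exactly.\<close>

lemma integral_cis_phys:
  assumes "0 < \<sigma>"
  shows "(LINT v|phys \<sigma>. cis (fst v * a + (fst (snd v) * b + snd (snd v) * of_int c))) =
    of_real (exp (- a\<^sup>2 / 2) * (exp (- (\<sigma> * b)\<^sup>2 / 2) * (if c = 0 then 2 * pi else 0)))"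
proof -
  have i1: "integrable (gauss \<sigma>') (\<lambda>t. cis (t * a))" if "0 < \<sigma>'" for \<sigma>' a
    using that by (intro integrable_cis finite_measure_gauss measurable_gauss) auto
  have i2: "integrable torus (\<lambda>y. cis (y * of_int c))"
    by (intro integrable_cis finite_measure_torus measurable_torus) auto
  note i3 = integral_pair_mult[OF sigma_finite_gauss[OF assms] sigma_finite_torus i1[OF assms, of b] i2]
  have sf: "sigma_finite_measure (gauss \<sigma> \<Otimes>\<^sub>M torus)"
    using finite_measure_pair[OF finite_measure_gauss[OF assms] finite_measure_torus] by (rule finite_measure.axioms)
  note i4 = integral_pair_mult(2)[OF sigma_finite_gauss[of 1] sf i1[of 1 a] i3(1)]
  have "(LINT v|phys \<sigma>. cis (fst v * a + (fst (snd v) * b + snd (snd v) * of_int c))) =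
    (LINT v|phys \<sigma>. cis (fst v * a) * (cis (fst (snd v) * b) * cis (snd (snd v) * of_int c)))"
    by (simp only: cis_mult)
  also have "\<dots> = (LINT t|gauss 1. cis (t * a)) * ((LINT x|gauss \<sigma>. cis (x * b)) * (LINT y|torus. cis (y * of_int c)))"
    unfolding phys_def using i4 i3(2) by simp
  finally show ?thesis
    using assms by (simp add: gauss_def char_normal_density integral_cis_torus)
qed

lemma nn_integral_count_space_single:
  assumes "\<And>k. k \<noteq> a \<Longrightarrow> f k = 0"
  shows "(\<integral>\<^sup>+k. f k \<partial>count_space UNIV) = (f a :: ennreal)"
proof -
  have "(\<integral>\<^sup>+k. f k \<partial>count_space UNIV) = (\<Sum>k\<in>{a}. f k)"
    using assms by (intro nn_integral_count_space') auto
  thus ?thesis by simp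
qed

text \<open>This is the row integral of the kernel for a fixed pair with frequency sum (s, k) and
  phase sum \<Phi>. The integer constraint determines k2 = k - k1. Taking the sum s' of the
  x-frequencies as a variable separates the Gaussian in s' - s from the window bound, which holds
  for every s'. The remaining integral over s' gives the factor 1/\<sigma>.\<close>

lemma bilinear_schur:
  fixes w :: "real \<times> int \<Rightarrow> real"
  assumes w: "w \<in> borel_measurable dual_cylinder" and R: "R \<in> sets dual_cylinder" and \<sigma>: "0 < \<sigma>"
    and M: "\<And>s k \<tau>. (\<integral>\<^sup>+k1. emeasure lborel {x. (x, k1) \<in> R \<and> (s - x, k - k1) \<in> R \<and>
        \<bar>w (x, k1) + w (s - x, k - k1) - \<tau>\<bar> \<le> 1} \<partial>count_space UNIV) \<le> M"
  shows "(\<integral>\<^sup>+q. ennreal (exp (- (\<Phi> - (w (fst q) + w (snd q)))\<^sup>2 / 2) *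
        (exp (- (\<sigma> * (s - (fst (fst q) + fst (snd q))))\<^sup>2 / 2) *
         (if k - (snd (fst q) + snd (snd q)) = 0 then 2 * pi else 0))) * indicator (R \<times> R) q
      \<partial>(dual_cylinder \<Otimes>\<^sub>M dual_cylinder)) \<le> ennreal (2 * pi * (sqrt (2 * pi) / \<sigma>)) * (8 * M)"
    (is "(\<integral>\<^sup>+q. ?h q \<partial>_) \<le> _")
proof -
  interpret D: sigma_finite_measure dual_cylinder by (rule sigma_finite_dual_cylinder)
  note [measurable] = w R
  have wk[measurable]: "(\<lambda>x. w (x, k)) \<in> borel_measurable borel" for k by (rule measurable_dual_section) simp
  have rk[measurable]: "(\<lambda>x. indicator R (x, k) :: ennreal) \<in> borel_measurable borel" for k
    by (rule measurable_dual_section) simp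
  define E where "E = (\<lambda>s'. ennreal (2 * pi * exp (- (\<sigma> * (s' - s))\<^sup>2 / 2)))"
  define Z where "Z = (\<lambda>k1 x s'. indicator R (x, k1) * indicator R (s' - x, k - k1) *
      ennreal (exp (- (w (x, k1) + w (s' - x, k - k1) - \<Phi>)\<^sup>2 / 2)))"
  have hm: "?h \<in> borel_measurable (dual_cylinder \<Otimes>\<^sub>M dual_cylinder)"
  proof -
    have 1: "(\<lambda>q. w (fst q)) \<in> borel_measurable (dual_cylinder \<Otimes>\<^sub>M dual_cylinder)"
      "(\<lambda>q. w (snd q)) \<in> borel_measurable (dual_cylinder \<Otimes>\<^sub>M dual_cylinder)"
      "(\<lambda>q. fst (fst q)) \<in> borel_measurable (dual_cylinder \<Otimes>\<^sub>M dual_cylinder)"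
      "(\<lambda>q. fst (snd q)) \<in> borel_measurable (dual_cylinder \<Otimes>\<^sub>M dual_cylinder)"
      by (rule measurable_compose[OF measurable_fst w] measurable_compose[OF measurable_snd w]
          measurable_compose[OF measurable_fst measurable_fst_dual] measurable_compose[OF measurable_snd measurable_fst_dual])+
    have sn: "snd \<in> measurable dual_cylinder (count_space UNIV)" by (simp add: dual_cylinder_def)
    have "(\<lambda>q. k - (snd (fst q) + snd (snd q))) \<in> measurable (dual_cylinder \<Otimes>\<^sub>M dual_cylinder) (count_space UNIV)"
      using measurable_compose[OF measurable_fst sn] measurable_compose[OF measurable_snd sn] by measurable
    hence 2: "(\<lambda>q. if k - (snd (fst q) + snd (snd q)) = 0 then 2 * pi else (0::real)) \<in> borel_measurable (dual_cylinder \<Otimes>\<^sub>M dual_cylinder)"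
      by measurable
    have 3: "(\<lambda>q. indicator (R \<times> R) q :: ennreal) \<in> borel_measurable (dual_cylinder \<Otimes>\<^sub>M dual_cylinder)"
      using R by (intro borel_measurable_indicator) (auto intro: pair_measureI)
    show ?thesis using 1 2 3 by measurable
  qed
  have Em[measurable]: "E \<in> borel_measurable borel" unfolding E_def by measurable
  have Zm1[measurable]: "(\<lambda>x. Z k1 x s') \<in> borel_measurable borel" for k1 s'
    unfolding Z_def by (intro borel_measurable_times_ennreal rk measurable_compose[OF _ rk]
        measurable_compose[OF _ measurable_ennreal] borel_measurable_exp
        borel_measurable_divide borel_measurable_uminus borel_measurable_power borel_measurable_diff
        borel_measurable_add wk measurable_compose[OF _ wk]) auto
  have Zm[measurable]: "(\<lambda>(x, s'). Z k1 x s') \<in> borel_measurable (borel \<Otimes>\<^sub>M borel)" for k1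
  proof -
    have d: "(\<lambda>q::real\<times>real. snd q - fst q) \<in> borel_measurable (borel \<Otimes>\<^sub>M borel)" by measurable
    show ?thesis unfolding Z_def case_prod_beta
      using measurable_compose[OF measurable_fst wk[of k1], of borel]
        measurable_compose[OF measurable_fst rk[of k1], of borel]
        measurable_compose[OF d wk[of "k - k1"]] measurable_compose[OF d rk[of "k - k1"]]
      by measurable
  qed
  have inner: "(\<integral>\<^sup>+\<zeta>2. ?h ((x, k1), \<zeta>2) \<partial>dual_cylinder) = (\<integral>\<^sup>+s'. E s' * Z k1 x s' \<partial>lborel)" for x k1
  proof -
    have hs: "(\<lambda>\<zeta>2. ?h ((x, k1), \<zeta>2)) \<in> borel_measurable dual_cylinder"
      by (rule measurable_Pair2[OF hm]) simp
    have "(\<integral>\<^sup>+\<zeta>2. ?h ((x, k1), \<zeta>2) \<partial>dual_cylinder) =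
        (\<integral>\<^sup>+k2. \<integral>\<^sup>+x2. ?h ((x, k1), (x2, k2)) \<partial>lborel \<partial>count_space UNIV)"
      by (rule nn_integral_dual[OF hs])
    also have "\<dots> = (\<integral>\<^sup>+x2. ?h ((x, k1), (x2, k - k1)) \<partial>lborel)"
      by (rule nn_integral_count_space_single) auto
    \<comment> \<open>The translation x2 = s' - x, written as an affine substitution of slope
      1.\<close>
    also have "\<dots> = ennreal \<bar>1\<bar> * (\<integral>\<^sup>+s'. ?h ((x, k1), (- x + 1 * s', k - k1)) \<partial>lborel)"
      using measurable_dual_section[OF hs, of "k - k1"] by (intro nn_integral_real_affine) auto
    also have "\<dots> = (\<integral>\<^sup>+s'. E s' * Z k1 x s' \<partial>lborel)"
    proof -
      have "?h ((x, k1), (- x + 1 * s', k - k1)) = E s' * Z k1 x s'" for s'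
      proof -
        have 1: "(\<Phi> - (w (x, k1) + w (- x + 1 * s', k - k1)))\<^sup>2 = (w (x, k1) + w (s' - x, k - k1) - \<Phi>)\<^sup>2"
          by (simp add: power2_commute)
        have 2: "(\<sigma> * (s - (x + (- x + 1 * s'))))\<^sup>2 = (\<sigma> * (s' - s))\<^sup>2"
          by (simp add: power_mult_distrib power2_commute)
        show ?thesis
          by (simp add: E_def Z_def 1[simplified] 2[simplified] ennreal_mult indicator_times mult_ac)
      qed
      thus ?thesis by simp
    qed
    finally show ?thesis .
  qed
  have "(\<integral>\<^sup>+q. ?h q \<partial>(dual_cylinder \<Otimes>\<^sub>M dual_cylinder)) =
      (\<integral>\<^sup>+\<zeta>1. \<integral>\<^sup>+\<zeta>2. ?h (\<zeta>1, \<zeta>2) \<partial>dual_cylinder \<partial>dual_cylinder)"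
    by (rule D.nn_integral_fst[OF hm, symmetric])
  also have "\<dots> = (\<integral>\<^sup>+k1. \<integral>\<^sup>+x. \<integral>\<^sup>+\<zeta>2. ?h ((x, k1), \<zeta>2) \<partial>dual_cylinder \<partial>lborel \<partial>count_space UNIV)"
    by (rule nn_integral_dual[OF D.borel_measurable_nn_integral_fst[OF hm]])
  also have "\<dots> = (\<integral>\<^sup>+k1. \<integral>\<^sup>+x. \<integral>\<^sup>+s'. E s' * Z k1 x s' \<partial>lborel \<partial>lborel \<partial>count_space UNIV)"
    by (simp only: inner)
  also have "\<dots> = (\<integral>\<^sup>+k1. \<integral>\<^sup>+s'. \<integral>\<^sup>+x. E s' * Z k1 x s' \<partial>lborel \<partial>lborel \<partial>count_space UNIV)"
  proof (rule nn_integral_cong)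
    fix k1
    show "(\<integral>\<^sup>+x. \<integral>\<^sup>+s'. E s' * Z k1 x s' \<partial>lborel \<partial>lborel) = (\<integral>\<^sup>+s'. \<integral>\<^sup>+x. E s' * Z k1 x s' \<partial>lborel \<partial>lborel)"
      by (rule lborel_pair.Fubini'[symmetric]) measurable
  qed
  also have "\<dots> = (\<integral>\<^sup>+k1. \<integral>\<^sup>+s'. E s' * (\<integral>\<^sup>+x. Z k1 x s' \<partial>lborel) \<partial>lborel \<partial>count_space UNIV)"
    by (intro nn_integral_cong nn_integral_cmult) measurable
  also have "\<dots> = (\<integral>\<^sup>+s'. \<integral>\<^sup>+k1. E s' * (\<integral>\<^sup>+x. Z k1 x s' \<partial>lborel) \<partial>count_space UNIV \<partial>lborel)"
  proof (rule nn_integral_swap_int)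
    fix k1
    have "(\<lambda>(s', x). Z k1 x s') \<in> borel_measurable (lborel \<Otimes>\<^sub>M lborel)"
      using measurable_compose[OF measurable_pair_swap Zm[of k1]] by (simp add: case_prod_beta')
    hence "(\<lambda>s'. \<integral>\<^sup>+x. Z k1 x s' \<partial>lborel) \<in> borel_measurable lborel"
      using lborel.borel_measurable_nn_integral[of "\<lambda>s' x. Z k1 x s'" lborel] by simp
    thus "(\<lambda>s'. E s' * (\<integral>\<^sup>+x. Z k1 x s' \<partial>lborel)) \<in> borel_measurable lborel" by measurable
  qed
  also have "\<dots> = (\<integral>\<^sup>+s'. E s' * (\<integral>\<^sup>+k1. \<integral>\<^sup>+x. Z k1 x s' \<partial>lborel \<partial>count_space UNIV) \<partial>lborel)"
    by (intro nn_integral_cong nn_integral_cmult) simp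
  also have "\<dots> \<le> (\<integral>\<^sup>+s'. E s' * (8 * M) \<partial>lborel)"
    unfolding Z_def by (intro nn_integral_mono mult_left_mono weighted_window_bound w R M) simp
  also have "\<dots> = (\<integral>\<^sup>+s'. E s' \<partial>lborel) * (8 * M)"
    by (rule nn_integral_multc) simp
  also have "(\<integral>\<^sup>+s'. E s' \<partial>lborel) = ennreal (2 * pi) * (\<integral>\<^sup>+s'. ennreal (exp (- (\<sigma> * (s' - s))\<^sup>2 / 2)) \<partial>lborel)"
    unfolding E_def by (subst nn_integral_cmult[symmetric]) (auto simp: ennreal_mult)
  also have "\<dots> = ennreal (2 * pi) * ennreal (sqrt (2 * pi) / \<sigma>)" by (simp only: nn_integral_gauss[OF \<sigma>])
  also have "\<dots> = ennreal (2 * pi * (sqrt (2 * pi) / \<sigma>))"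
    by (rule ennreal_mult[symmetric]) (use \<sigma> in auto)
  finally show ?thesis .
qed

text \<open>The solution with frequency data g and phase w at v = (t, (x, y)), without the prefactor
  of the inverse transform. Integrating over both frequencies jointly makes theorems on product
  measures applicable.\<close>

definition extension :: "(real \<times> int \<Rightarrow> real) \<Rightarrow> (real \<times> int \<Rightarrow> complex) \<Rightarrow> real \<times> real \<times> real \<Rightarrow> complex" where
  "extension w g = (\<lambda>v. LINT \<zeta>|dual_cylinder. g \<zeta> *
     cis (fst v * w \<zeta> + (fst (snd v) * fst \<zeta> + snd (snd v) * of_int (snd \<zeta>))))"

lemma measurable_extension:
  assumes g: "g \<in> borel_measurable dual_cylinder" and w: "w \<in> borel_measurable dual_cylinder"
    and v: "fst \<in> borel_measurable N" "(\<lambda>v. fst (snd v)) \<in> borel_measurable N" "(\<lambda>v. snd (snd v)) \<in> borel_measurable N"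
  shows "extension w g \<in> borel_measurable N"
proof -
  interpret D: sigma_finite_measure dual_cylinder by (rule sigma_finite_dual_cylinder)
  have 1: "(\<lambda>q. g (snd q)) \<in> borel_measurable (N \<Otimes>\<^sub>M dual_cylinder)"
    "(\<lambda>q. w (snd q)) \<in> borel_measurable (N \<Otimes>\<^sub>M dual_cylinder)"
    "(\<lambda>q. fst (snd q)) \<in> borel_measurable (N \<Otimes>\<^sub>M dual_cylinder)"
    "(\<lambda>q. real_of_int (snd (snd q))) \<in> borel_measurable (N \<Otimes>\<^sub>M dual_cylinder)"
    "(\<lambda>q. fst (fst q)) \<in> borel_measurable (N \<Otimes>\<^sub>M dual_cylinder)"
    "(\<lambda>q. fst (snd (fst q))) \<in> borel_measurable (N \<Otimes>\<^sub>M dual_cylinder)"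
    "(\<lambda>q. snd (snd (fst q))) \<in> borel_measurable (N \<Otimes>\<^sub>M dual_cylinder)"
    by (rule measurable_compose[OF measurable_snd g] measurable_compose[OF measurable_snd w]
        measurable_compose[OF measurable_snd measurable_fst_dual] measurable_compose[OF measurable_snd measurable_snd_dual]
        measurable_compose[OF measurable_fst v(1)] measurable_compose[OF measurable_fst v(2)]
        measurable_compose[OF measurable_fst v(3)])+
  have "(\<lambda>(v, \<zeta>). g \<zeta> * cis (fst v * w \<zeta> + (fst (snd v) * fst \<zeta> + snd (snd v) * of_int (snd \<zeta>))))
      \<in> borel_measurable (N \<Otimes>\<^sub>M dual_cylinder)"
    unfolding case_prod_beta using 1 by measurable
  thus ?thesis unfolding extension_def by (rule D.borel_measurable_lebesgue_integral)
qed

lemma measurable_phys: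
  "fst \<in> borel_measurable (phys \<sigma>)" "(\<lambda>v. fst (snd v)) \<in> borel_measurable (phys \<sigma>)"
  "(\<lambda>v. snd (snd v)) \<in> borel_measurable (phys \<sigma>)"
proof -
  have i: "(\<lambda>x. x) \<in> borel_measurable (gauss s)" "(\<lambda>x. x) \<in> borel_measurable torus" for s
    by (auto intro!: measurable_gauss measurable_torus)
  show "fst \<in> borel_measurable (phys \<sigma>)"
    unfolding phys_def by (rule measurable_compose[OF measurable_fst i(1)])
  show "(\<lambda>v. fst (snd v)) \<in> borel_measurable (phys \<sigma>)"
    unfolding phys_def by (rule measurable_compose[OF measurable_snd measurable_compose[OF measurable_fst i(1)]])
  show "(\<lambda>v. snd (snd v)) \<in> borel_measurable (phys \<sigma>)"
    unfolding phys_def by (rule measurable_compose[OF measurable_snd measurable_compose[OF measurable_snd i(2)]])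
qed

text \<open>The fourth power of the modulus is the squared modulus of the square, and the square of
  \<open>extension w g\<close> is the transform of g(p1) g(p2) over pairs of frequencies. So
  \<open>TT_star_Schur\<close> applies on the product space, with row integrals from
  \<open>bilinear_schur\<close>; the L2 norm of the product function is the square of that of
  g.\<close>

lemma bilinear_phys:
  fixes w :: "real \<times> int \<Rightarrow> real" and g :: "real \<times> int \<Rightarrow> complex"
  assumes g: "integrable dual_cylinder g" and gR: "\<And>\<zeta>. \<zeta> \<notin> R \<Longrightarrow> g \<zeta> = 0"
    and w: "w \<in> borel_measurable dual_cylinder" and R: "R \<in> sets dual_cylinder" and \<sigma>: "0 < \<sigma>"
    and M: "\<And>s k \<tau>. (\<integral>\<^sup>+k1. emeasure lborel {x. (x, k1) \<in> R \<and> (s - x, k - k1) \<in> R \<and>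
        \<bar>w (x, k1) + w (s - x, k - k1) - \<tau>\<bar> \<le> 1} \<partial>count_space UNIV) \<le> M"
  shows "(\<integral>\<^sup>+v. ennreal (norm (extension w g v) ^ 4) \<partial>phys \<sigma>) \<le>
     ennreal (2 * pi * (sqrt (2 * pi) / \<sigma>)) * (8 * M) * (\<integral>\<^sup>+\<zeta>. ennreal ((norm (g \<zeta>))\<^sup>2) \<partial>dual_cylinder)\<^sup>2"
proof -
  interpret D: sigma_finite_measure dual_cylinder by (rule sigma_finite_dual_cylinder)
  interpret DD: pair_sigma_finite dual_cylinder dual_cylinder ..
  have gm[measurable]: "g \<in> borel_measurable dual_cylinder" using g by auto
  define ph where "ph = (\<lambda>\<zeta> v. fst v * w \<zeta> + (fst (snd v) * fst \<zeta> + snd (snd v) * of_int (snd \<zeta>)))"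
  define e where "e = (\<lambda>(p::(real \<times> int) \<times> (real \<times> int)) (v::real \<times> real \<times> real). cis (ph (fst p) v) * cis (ph (snd p) v))"
  define G where "G = (\<lambda>p. g (fst p) * g (snd p))"
  define K where "K = (\<lambda>p q. exp (- ((w (fst p) + w (snd p)) - (w (fst q) + w (snd q)))\<^sup>2 / 2) *
        (exp (- (\<sigma> * ((fst (fst p) + fst (snd p)) - (fst (fst q) + fst (snd q))))\<^sup>2 / 2) *
         (if (snd (fst p) + snd (snd p)) - (snd (fst q) + snd (snd q)) = 0 then 2 * pi else 0)))"
  have ph: "(\<lambda>x. ph (a x) (b x)) \<in> borel_measurable N"
    if "(\<lambda>x. w (a x)) \<in> borel_measurable N" "(\<lambda>x. fst (a x)) \<in> borel_measurable N"
      "(\<lambda>x. real_of_int (snd (a x))) \<in> borel_measurable N" "(\<lambda>x. fst (b x)) \<in> borel_measurable N"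
      "(\<lambda>x. fst (snd (b x))) \<in> borel_measurable N" "(\<lambda>x. snd (snd (b x))) \<in> borel_measurable N"
    for a :: "'x \<Rightarrow> real \<times> int" and b :: "'x \<Rightarrow> real \<times> real \<times> real" and N
    unfolding ph_def using that by measurable
  have "(\<integral>\<^sup>+v. ennreal ((norm (LINT p|(dual_cylinder \<Otimes>\<^sub>M dual_cylinder). G p * e p v))\<^sup>2) \<partial>phys \<sigma>) \<le>
      (ennreal (2 * pi * (sqrt (2 * pi) / \<sigma>)) * (8 * M)) * (\<integral>\<^sup>+p. ennreal ((norm (G p))\<^sup>2) \<partial>(dual_cylinder \<Otimes>\<^sub>M dual_cylinder))"
  proof (rule TT_star_Schur[where S = "R \<times> R" and K = K])
    show "sigma_finite_measure (dual_cylinder \<Otimes>\<^sub>M dual_cylinder)"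
      by (intro sigma_finite_pair_measure sigma_finite_dual_cylinder)
    show "finite_measure (phys \<sigma>)" by (rule finite_measure_phys[OF \<sigma>])
    have ff: "(\<lambda>q. fst (fst q)) \<in> measurable ((dual_cylinder \<Otimes>\<^sub>M dual_cylinder) \<Otimes>\<^sub>M phys \<sigma>) dual_cylinder"
      "(\<lambda>q. snd (fst q)) \<in> measurable ((dual_cylinder \<Otimes>\<^sub>M dual_cylinder) \<Otimes>\<^sub>M phys \<sigma>) dual_cylinder"
      by measurable
    show "(\<lambda>(p, v). e p v) \<in> borel_measurable ((dual_cylinder \<Otimes>\<^sub>M dual_cylinder) \<Otimes>\<^sub>M phys \<sigma>)"
      unfolding e_def case_prod_beta
      by (intro borel_measurable_times measurable_compose[OF _ borel_measurable_cis] ph;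
        rule measurable_compose[OF ff(1) w] measurable_compose[OF ff(2) w]
          measurable_compose[OF ff(1) measurable_fst_dual] measurable_compose[OF ff(2) measurable_fst_dual]
          measurable_compose[OF ff(1) measurable_snd_dual] measurable_compose[OF ff(2) measurable_snd_dual]
          measurable_compose[OF measurable_snd measurable_phys(1)] measurable_compose[OF measurable_snd measurable_phys(2)]
          measurable_compose[OF measurable_snd measurable_phys(3)])
    show "norm (e p v) \<le> 1" for p v by (simp add: e_def norm_mult)
    show "integrable (dual_cylinder \<Otimes>\<^sub>M dual_cylinder) G"
      unfolding G_def by (rule integral_pair_mult(1)[OF sigma_finite_dual_cylinder sigma_finite_dual_cylinder g g])
    show "R \<times> R \<in> sets (dual_cylinder \<Otimes>\<^sub>M dual_cylinder)" by (intro pair_measureI R)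
    show "G p = 0" if "p \<notin> R \<times> R" for p using that gR by (cases p) (auto simp: G_def)
    show "(LINT v|phys \<sigma>. e p v * cnj (e q v)) = of_real (K p q)" for p q
    proof -
      have "e p v * cnj (e q v) = cis (fst v * ((w (fst p) + w (snd p)) - (w (fst q) + w (snd q))) +
         (fst (snd v) * ((fst (fst p) + fst (snd p)) - (fst (fst q) + fst (snd q))) +
          snd (snd v) * of_int ((snd (fst p) + snd (snd p)) - (snd (fst q) + snd (snd q)))))" for v
        unfolding e_def ph_def cis_mult cis_cnj complex_cnj_mult by (simp add: algebra_simps)
      thus ?thesis unfolding K_def by (simp only: integral_cis_phys[OF \<sigma>])
    qed
    show "0 \<le> K p q" for p q by (simp add: K_def)
    show "K p q = K q p" for p q
    proof -
      have 1: "((w (fst p) + w (snd p)) - (w (fst q) + w (snd q)))\<^sup>2 = ((w (fst q) + w (snd q)) - (w (fst p) + w (snd p)))\<^sup>2"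
        by (rule power2_commute)
      have 2: "(\<sigma> * ((fst (fst p) + fst (snd p)) - (fst (fst q) + fst (snd q))))\<^sup>2 =
          (\<sigma> * ((fst (fst q) + fst (snd q)) - (fst (fst p) + fst (snd p))))\<^sup>2"
        unfolding power_mult_distrib by (subst power2_commute) (rule refl)
      have 3: "((snd (fst p) + snd (snd p)) - (snd (fst q) + snd (snd q)) = 0) =
          ((snd (fst q) + snd (snd q)) - (snd (fst p) + snd (snd p)) = 0)" by auto
      show ?thesis unfolding K_def 1 2 3 by (rule refl)
    qed
    show "(\<lambda>(p, q). K p q) \<in> borel_measurable ((dual_cylinder \<Otimes>\<^sub>M dual_cylinder) \<Otimes>\<^sub>M (dual_cylinder \<Otimes>\<^sub>M dual_cylinder))"
      (is "_ \<in> borel_measurable ?D4")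
    proof -
      have pr: "(\<lambda>x. fst (fst x)) \<in> measurable ?D4 dual_cylinder" "(\<lambda>x. snd (fst x)) \<in> measurable ?D4 dual_cylinder"
        "(\<lambda>x. fst (snd x)) \<in> measurable ?D4 dual_cylinder" "(\<lambda>x. snd (snd x)) \<in> measurable ?D4 dual_cylinder"
        by measurable
      note ws = pr[THEN measurable_compose, OF w]
      note fs = pr[THEN measurable_compose, OF measurable_fst_dual]
      have sn: "snd \<in> measurable dual_cylinder (count_space UNIV)" by (simp add: dual_cylinder_def)
      note ss = pr[THEN measurable_compose, OF sn]
      have "(\<lambda>x. (snd (fst (fst x)) + snd (snd (fst x))) - (snd (fst (snd x)) + snd (snd (snd x)))) \<in> measurable ?D4 (count_space UNIV)"
        using ss by measurable
      hence "(\<lambda>x. if (snd (fst (fst x)) + snd (snd (fst x))) - (snd (fst (snd x)) + snd (snd (snd x))) = 0 then 2 * pi else (0::real)) \<in> borel_measurable ?D4"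
        by measurable
      thus ?thesis unfolding K_def case_prod_beta using ws fs by measurable
    qed
    show "(\<integral>\<^sup>+q. ennreal (K p q) * indicator (R \<times> R) q \<partial>(dual_cylinder \<Otimes>\<^sub>M dual_cylinder)) \<le>
        ennreal (2 * pi * (sqrt (2 * pi) / \<sigma>)) * (8 * M)" for p
      unfolding K_def by (rule bilinear_schur[OF w R \<sigma> M])
  qed
  moreover have "norm (LINT p|(dual_cylinder \<Otimes>\<^sub>M dual_cylinder). G p * e p v) = norm (extension w g v) ^ 2" for v
  proof -
    have i: "integrable dual_cylinder (\<lambda>\<zeta>. g \<zeta> * cis (ph \<zeta> v))"
    proof (rule Bochner_Integration.integrable_bound[OF g])
      have "(\<lambda>\<zeta>. cis (ph \<zeta> v)) \<in> borel_measurable dual_cylinder"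
        by (intro measurable_compose[OF _ borel_measurable_cis] ph w measurable_fst_dual measurable_snd_dual) auto
      thus "(\<lambda>\<zeta>. g \<zeta> * cis (ph \<zeta> v)) \<in> borel_measurable dual_cylinder" by measurable
    qed (simp add: norm_mult)
    have "(LINT p|(dual_cylinder \<Otimes>\<^sub>M dual_cylinder). G p * e p v) =
        (LINT p|(dual_cylinder \<Otimes>\<^sub>M dual_cylinder). (g (fst p) * cis (ph (fst p) v)) * (g (snd p) * cis (ph (snd p) v)))"
      by (simp add: G_def e_def mult_ac)
    also have "\<dots> = (LINT \<zeta>|dual_cylinder. g \<zeta> * cis (ph \<zeta> v)) * (LINT \<zeta>|dual_cylinder. g \<zeta> * cis (ph \<zeta> v))"
      by (rule integral_pair_mult(2)[OF sigma_finite_dual_cylinder sigma_finite_dual_cylinder i i])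
    finally show ?thesis by (simp add: extension_def ph_def norm_mult power2_eq_square)
  qed
  moreover have "(\<integral>\<^sup>+p. ennreal ((norm (G p))\<^sup>2) \<partial>(dual_cylinder \<Otimes>\<^sub>M dual_cylinder)) =
      (\<integral>\<^sup>+\<zeta>. ennreal ((norm (g \<zeta>))\<^sup>2) \<partial>dual_cylinder)\<^sup>2"
  proof -
    have "(\<integral>\<^sup>+p. ennreal ((norm (G p))\<^sup>2) \<partial>(dual_cylinder \<Otimes>\<^sub>M dual_cylinder)) =
        (\<integral>\<^sup>+\<zeta>1. \<integral>\<^sup>+\<zeta>2. ennreal ((norm (g \<zeta>1))\<^sup>2) * ennreal ((norm (g \<zeta>2))\<^sup>2) \<partial>dual_cylinder \<partial>dual_cylinder)"
      unfolding G_def by (subst D.nn_integral_fst[symmetric]) (auto simp: norm_mult power_mult_distrib ennreal_mult)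
    also have "\<dots> = (\<integral>\<^sup>+\<zeta>. ennreal ((norm (g \<zeta>))\<^sup>2) \<partial>dual_cylinder)\<^sup>2"
      by (simp add: nn_integral_cmult nn_integral_multc power2_eq_square)
    finally show ?thesis .
  qed
  ultimately show ?thesis by (simp add: power_mult[symmetric])
qed

section \<open>Removal of the Gaussian weights\<close>

lemma sets_phys: "sets (phys \<sigma>) = sets (lborel \<Otimes>\<^sub>M cylinder)"
  unfolding phys_def cylinder_torus gauss_def by (intro sets_pair_measure_cong sets_density refl)

lemma sigma_finite_cylinder: "sigma_finite_measure cylinder"
  unfolding cylinder_torus by (intro sigma_finite_pair_measure sigma_finite_lborel sigma_finite_torus)

lemma measurable_fst_cylinder: "fst \<in> borel_measurable cylinder"
  unfolding cylinder_torus by (rule measurable_compose[OF measurable_fst]) simp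

lemma nn_integral_gauss_torus:
  assumes f: "f \<in> borel_measurable cylinder" and \<sigma>: "0 < \<sigma>"
  shows "(\<integral>\<^sup>+z. f z \<partial>(gauss \<sigma> \<Otimes>\<^sub>M torus)) = (\<integral>\<^sup>+z. ennreal (normal_density 0 \<sigma> (fst z)) * f z \<partial>cylinder)"
proof -
  interpret T: sigma_finite_measure torus by (rule sigma_finite_torus)
  have f': "f \<in> borel_measurable (lborel \<Otimes>\<^sub>M torus)" using f by (simp add: cylinder_torus)
  have "sets (gauss \<sigma> \<Otimes>\<^sub>M torus) = sets (lborel \<Otimes>\<^sub>M torus)"
    unfolding gauss_def by (intro sets_pair_measure_cong sets_density refl)
  hence f'': "f \<in> borel_measurable (gauss \<sigma> \<Otimes>\<^sub>M torus)" using f' measurable_cong_sets by blast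
  have fs: "(\<lambda>y. f (x, y)) \<in> borel_measurable torus" for x
    by (rule measurable_Pair2[OF f']) simp
  have m: "(\<lambda>x. \<integral>\<^sup>+y. f (x, y) \<partial>torus) \<in> borel_measurable lborel"
    by (rule T.borel_measurable_nn_integral_fst[OF f'])
  have "(\<integral>\<^sup>+z. f z \<partial>(gauss \<sigma> \<Otimes>\<^sub>M torus)) = (\<integral>\<^sup>+x. \<integral>\<^sup>+y. f (x, y) \<partial>torus \<partial>gauss \<sigma>)"
    by (rule T.nn_integral_fst[OF f'', symmetric])
  also have "\<dots> = (\<integral>\<^sup>+x. ennreal (normal_density 0 \<sigma> x) * (\<integral>\<^sup>+y. f (x, y) \<partial>torus) \<partial>lborel)"
    unfolding gauss_def using m by (intro nn_integral_density) auto
  also have "\<dots> = (\<integral>\<^sup>+x. \<integral>\<^sup>+y. ennreal (normal_density 0 \<sigma> (fst (x, y))) * f (x, y) \<partial>torus \<partial>lborel)"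
    using fs by (simp add: nn_integral_cmult)
  also have "\<dots> = (\<integral>\<^sup>+z. ennreal (normal_density 0 \<sigma> (fst z)) * f z \<partial>cylinder)"
    unfolding cylinder_torus
    by (intro T.nn_integral_fst borel_measurable_times_ennreal f' measurable_compose[OF measurable_fst]) measurable
  finally show ?thesis .
qed

lemma nn_integral_phys:
  assumes u: "u \<in> borel_measurable (lborel \<Otimes>\<^sub>M cylinder)" and \<sigma>: "0 < \<sigma>"
  shows "(\<integral>\<^sup>+v. u v \<partial>phys \<sigma>) = (\<integral>\<^sup>+t. ennreal (normal_density 0 1 t) *
     (\<integral>\<^sup>+z. ennreal (normal_density 0 \<sigma> (fst z)) * u (t, z) \<partial>cylinder) \<partial>lborel)"
proof -
  have "finite_measure (gauss \<sigma> \<Otimes>\<^sub>M torus)"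
    by (intro finite_measure_pair finite_measure_gauss finite_measure_torus \<sigma>)
  then interpret S: finite_measure "gauss \<sigma> \<Otimes>\<^sub>M torus" .
  have u': "u \<in> borel_measurable (gauss 1 \<Otimes>\<^sub>M (gauss \<sigma> \<Otimes>\<^sub>M torus))"
    using u sets_phys[of \<sigma>] measurable_cong_sets unfolding phys_def by blast
  have us: "(\<lambda>z. u (t, z)) \<in> borel_measurable cylinder" for t
    by (rule measurable_Pair2[OF u]) simp
  have m: "(\<lambda>t. \<integral>\<^sup>+z. u (t, z) \<partial>(gauss \<sigma> \<Otimes>\<^sub>M torus)) \<in> borel_measurable lborel"
    using S.borel_measurable_nn_integral_fst[OF u'] by (simp add: gauss_def)
  have "(\<integral>\<^sup>+v. u v \<partial>phys \<sigma>) = (\<integral>\<^sup>+t. \<integral>\<^sup>+z. u (t, z) \<partial>(gauss \<sigma> \<Otimes>\<^sub>M torus) \<partial>gauss 1)"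
    unfolding phys_def by (rule S.nn_integral_fst[OF u', symmetric])
  also have "\<dots> = (\<integral>\<^sup>+t. ennreal (normal_density 0 1 t) * (\<integral>\<^sup>+z. u (t, z) \<partial>(gauss \<sigma> \<Otimes>\<^sub>M torus)) \<partial>lborel)"
    unfolding gauss_def[of 1] using m by (intro nn_integral_density) auto
  also have "\<dots> = (\<integral>\<^sup>+t. ennreal (normal_density 0 1 t) *
     (\<integral>\<^sup>+z. ennreal (normal_density 0 \<sigma> (fst z)) * u (t, z) \<partial>cylinder) \<partial>lborel)"
    by (simp only: nn_integral_gauss_torus[OF us \<sigma>])
  finally show ?thesis .
qed

text \<open>Uses exp(-1/2) \<ge> 1/2 and sqrt(2 pi) \<le> 3. Cutting off sharply to the time
  interval [0, 1] therefore costs a factor 6.\<close>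

lemma std_normal_density_lower:
  assumes "0 \<le> t" "t \<le> 1"
  shows "1 \<le> 6 * normal_density 0 1 t"
proof -
  have "t\<^sup>2 \<le> 1" using assms by (simp add: power_le_one)
  hence "exp (- 1 / 2) \<le> exp (- t\<^sup>2 / 2)" by simp
  moreover have "1 / 2 \<le> exp (- 1 / 2 :: real)"
    using exp_ge_add_one_self[of "- 1 / 2 :: real"] by simp
  ultimately have "1 / 2 \<le> exp (- t\<^sup>2 / 2)" by linarith
  moreover have "sqrt (2 * pi) \<le> 3"
  proof (rule real_le_lsqrt)
    show "2 * pi \<le> 3\<^sup>2" using pi_less_4 by simp
  qed auto
  ultimately have "sqrt (2 * pi) \<le> 6 * exp (- t\<^sup>2 / 2)" by linarith
  thus ?thesis by (simp add: std_normal_density_def pos_le_divide_eq)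
qed

lemma gauss_weight_SUP:
  fixes x :: real
  shows "(SUP n. ennreal (exp (- x\<^sup>2 / (2 * (real n + 1)\<^sup>2)))) = 1" "incseq (\<lambda>n. ennreal (exp (- x\<^sup>2 / (2 * (real n + 1)\<^sup>2))))"
proof -
  show inc: "incseq (\<lambda>n. ennreal (exp (- x\<^sup>2 / (2 * (real n + 1)\<^sup>2))))"
  proof (rule incseq_SucI)
    fix n
    have "x\<^sup>2 / (2 * (real (Suc n) + 1)\<^sup>2) \<le> x\<^sup>2 / (2 * (real n + 1)\<^sup>2)"
      by (intro divide_left_mono mult_left_mono power_mono) auto
    thus "ennreal (exp (- x\<^sup>2 / (2 * (real n + 1)\<^sup>2))) \<le> ennreal (exp (- x\<^sup>2 / (2 * (real (Suc n) + 1)\<^sup>2)))"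
      by (intro ennreal_leI) simp
  qed
  have "(\<lambda>n. exp (- x\<^sup>2 / (2 * (real n + 1)\<^sup>2))) \<longlonglongrightarrow> 1" by real_asymp
  hence "(\<lambda>n. ennreal (exp (- x\<^sup>2 / (2 * (real n + 1)\<^sup>2)))) \<longlonglongrightarrow> ennreal 1" by (rule tendsto_ennrealI)
  from LIMSEQ_unique[OF LIMSEQ_SUP[OF inc] this]
  show "(SUP n. ennreal (exp (- x\<^sup>2 / (2 * (real n + 1)\<^sup>2)))) = 1" by simp
qed

text \<open>Multiplying the density of width \<sigma> by sqrt(2 pi) \<sigma> gives a weight that
  increases to 1. This \<sigma> cancels the 1/\<sigma> of \<open>bilinear_phys\<close>, so the bound
  is uniform and survives monotone convergence. The constant is 6 times 8 times (2 pi)^2.\<close>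

lemma bilinear_L4:
  fixes w :: "real \<times> int \<Rightarrow> real" and g :: "real \<times> int \<Rightarrow> complex"
  assumes g: "integrable dual_cylinder g" and gR: "\<And>\<zeta>. \<zeta> \<notin> R \<Longrightarrow> g \<zeta> = 0"
    and w: "w \<in> borel_measurable dual_cylinder" and R: "R \<in> sets dual_cylinder"
    and M: "\<And>s k \<tau>. (\<integral>\<^sup>+k1. emeasure lborel {x. (x, k1) \<in> R \<and> (s - x, k - k1) \<in> R \<and>
        \<bar>w (x, k1) + w (s - x, k - k1) - \<tau>\<bar> \<le> 1} \<partial>count_space UNIV) \<le> M"
  shows "(\<integral>\<^sup>+t. \<integral>\<^sup>+z. ennreal (norm (extension w g (t, z)) ^ 4) \<partial>cylinder \<partial>restrict_space lborel {0..1}) \<le>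
     ennreal (192 * pi\<^sup>2) * M * (\<integral>\<^sup>+\<zeta>. ennreal ((norm (g \<zeta>))\<^sup>2) \<partial>dual_cylinder)\<^sup>2"
proof -
  interpret C: sigma_finite_measure cylinder by (rule sigma_finite_cylinder)
  define B where "B = (\<integral>\<^sup>+\<zeta>. ennreal ((norm (g \<zeta>))\<^sup>2) \<partial>dual_cylinder)\<^sup>2"
  define u where "u = (\<lambda>v. ennreal (norm (extension w g v) ^ 4))"
  define E where "E = (\<lambda>(n::nat) x::real. ennreal (exp (- x\<^sup>2 / (2 * (real n + 1)\<^sup>2))))"
  have Em: "E n \<in> borel_measurable borel" for n unfolding E_def by measurable
  have um: "u \<in> borel_measurable (lborel \<Otimes>\<^sub>M cylinder)"
  proof -
    have "extension w g \<in> borel_measurable (phys 1)"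
      by (rule measurable_extension[OF _ w measurable_phys]) (use g in auto)
    hence "extension w g \<in> borel_measurable (lborel \<Otimes>\<^sub>M cylinder)"
      using sets_phys[of 1] measurable_cong_sets by blast
    thus ?thesis unfolding u_def by measurable
  qed
  have us: "(\<lambda>z. u (t, z)) \<in> borel_measurable cylinder" for t
    by (rule measurable_Pair2[OF um]) simp
  have Ef: "(\<lambda>z. E n (fst z)) \<in> borel_measurable cylinder" for n
    by (rule measurable_compose[OF measurable_fst_cylinder Em])
  have Eum: "(\<lambda>v. E n (fst (snd v)) * u v) \<in> borel_measurable (lborel \<Otimes>\<^sub>M cylinder)" for n
    by (intro borel_measurable_times_ennreal um measurable_compose[OF measurable_snd Ef])
  define A where "A = (\<lambda>n t. \<integral>\<^sup>+z. E n (fst z) * u (t, z) \<partial>cylinder)"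
  have Am: "A n \<in> borel_measurable lborel" for n
    unfolding A_def using C.borel_measurable_nn_integral_fst[OF Eum[of n]] by simp
  have bound: "(\<integral>\<^sup>+t. A n t \<partial>restrict_space lborel {0..1}) \<le> ennreal (192 * pi\<^sup>2) * M * B" for n
  proof -
    define \<sigma> where "\<sigma> = real n + 1"
    have \<sigma>: "0 < \<sigma>" by (simp add: \<sigma>_def)
    have En: "E n x = ennreal (sqrt (2 * pi) * \<sigma>) * ennreal (normal_density 0 \<sigma> x)" for x
    proof -
      have "exp (- x\<^sup>2 / (2 * \<sigma>\<^sup>2)) = (sqrt (2 * pi) * \<sigma>) * normal_density 0 \<sigma> x"
        using \<sigma> by (simp add: normal_density_def real_sqrt_mult)
      thus ?thesis using \<sigma> by (simp add: E_def \<sigma>_def[symmetric] ennreal_mult)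
    qed
    have An: "A n t = ennreal (sqrt (2 * pi) * \<sigma>) * (\<integral>\<^sup>+z. ennreal (normal_density 0 \<sigma> (fst z)) * u (t, z) \<partial>cylinder)" for t
      unfolding A_def En mult.assoc
      by (rule nn_integral_cmult)
        (intro borel_measurable_times_ennreal us measurable_compose[OF measurable_fst_cylinder]; measurable)
    have "(\<integral>\<^sup>+t. A n t \<partial>restrict_space lborel {0..1}) = (\<integral>\<^sup>+t. A n t * indicator {0..1} t \<partial>lborel)"
      by (rule nn_integral_restrict_space) simp
    also have "\<dots> \<le> (\<integral>\<^sup>+t. ennreal (6 * (sqrt (2 * pi) * \<sigma>)) * (ennreal (normal_density 0 1 t) *
       (\<integral>\<^sup>+z. ennreal (normal_density 0 \<sigma> (fst z)) * u (t, z) \<partial>cylinder)) \<partial>lborel)"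
    proof (intro nn_integral_mono)
      fix t :: real
      have "indicator {0..1} t \<le> ennreal (6 * normal_density 0 1 t)"
        using std_normal_density_lower[of t] by (auto simp: indicator_def ennreal_ge_1)
      hence "A n t * indicator {0..1} t \<le> A n t * ennreal (6 * normal_density 0 1 t)" by (intro mult_left_mono) auto
      also have "\<dots> = ennreal (6 * (sqrt (2 * pi) * \<sigma>)) * (ennreal (normal_density 0 1 t) *
       (\<integral>\<^sup>+z. ennreal (normal_density 0 \<sigma> (fst z)) * u (t, z) \<partial>cylinder))"
        using \<sigma> by (simp add: An ennreal_mult mult_ac)
      finally show "A n t * indicator {0..1} t \<le> ennreal (6 * (sqrt (2 * pi) * \<sigma>)) * (ennreal (normal_density 0 1 t) *
       (\<integral>\<^sup>+z. ennreal (normal_density 0 \<sigma> (fst z)) * u (t, z) \<partial>cylinder))" .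
    qed
    also have "\<dots> = ennreal (6 * (sqrt (2 * pi) * \<sigma>)) * (\<integral>\<^sup>+v. u v \<partial>phys \<sigma>)"
    proof -
      have "(\<lambda>t. \<integral>\<^sup>+z. ennreal (normal_density 0 \<sigma> (fst z)) * u (t, z) \<partial>cylinder) \<in> borel_measurable lborel"
      proof -
        have "(\<lambda>v. ennreal (normal_density 0 \<sigma> (fst (snd v))) * u v) \<in> borel_measurable (lborel \<Otimes>\<^sub>M cylinder)"
          by (intro borel_measurable_times_ennreal um measurable_compose[OF measurable_compose[OF measurable_snd measurable_fst_cylinder]]; measurable)
        from C.borel_measurable_nn_integral_fst[OF this] show ?thesis by simp
      qed
      hence "(\<lambda>t. ennreal (normal_density 0 1 t) * (\<integral>\<^sup>+z. ennreal (normal_density 0 \<sigma> (fst z)) * u (t, z) \<partial>cylinder)) \<in> borel_measurable lborel"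
        by measurable
      thus ?thesis unfolding nn_integral_phys[OF um \<sigma>] by (rule nn_integral_cmult)
    qed
    also have "\<dots> \<le> ennreal (6 * (sqrt (2 * pi) * \<sigma>)) * (ennreal (2 * pi * (sqrt (2 * pi) / \<sigma>)) * (8 * M) * B)"
      unfolding u_def B_def by (intro mult_left_mono bilinear_phys[OF g gR w R \<sigma> M]) auto
    also have "\<dots> = (ennreal (6 * (sqrt (2 * pi) * \<sigma>)) * ennreal (2 * pi * (sqrt (2 * pi) / \<sigma>)) * ennreal 8) * M * B"
      by (simp add: mult_ac)
    also have "ennreal (6 * (sqrt (2 * pi) * \<sigma>)) * ennreal (2 * pi * (sqrt (2 * pi) / \<sigma>)) * ennreal 8 = ennreal (192 * pi\<^sup>2)"
    proof -
      have "ennreal (6 * (sqrt (2 * pi) * \<sigma>)) * ennreal (2 * pi * (sqrt (2 * pi) / \<sigma>)) * ennreal 8 =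
          ennreal (6 * (sqrt (2 * pi) * \<sigma>) * (2 * pi * (sqrt (2 * pi) / \<sigma>)) * 8)"
        using \<sigma> by (simp only: ennreal_mult[symmetric] mult_nonneg_nonneg divide_nonneg_nonneg real_sqrt_ge_zero less_imp_le pi_ge_zero zero_le_numeral)
      also have "6 * (sqrt (2 * pi) * \<sigma>) * (2 * pi * (sqrt (2 * pi) / \<sigma>)) * 8 = 96 * pi * (sqrt (2 * pi) * sqrt (2 * pi))"
        using \<sigma> by simp
      also have "sqrt (2 * pi) * sqrt (2 * pi) = 2 * pi" by simp
      finally show ?thesis by (simp add: power2_eq_square)
    qed
    finally show ?thesis .
  qed
  have Einc: "incseq (\<lambda>n. E n x)" for x unfolding E_def by (rule gauss_weight_SUP)
  have uz: "u (t, z) = (SUP n. E n (fst z) * u (t, z))" for t z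
    using gauss_weight_SUP(1)[of "fst z"] by (simp add: E_def SUP_mult_right_ennreal[symmetric])
  have inner: "(\<integral>\<^sup>+z. u (t, z) \<partial>cylinder) = (SUP n. A n t)" for t
  proof -
    have "(\<integral>\<^sup>+z. u (t, z) \<partial>cylinder) = (\<integral>\<^sup>+z. (SUP n. E n (fst z) * u (t, z)) \<partial>cylinder)"
      by (subst uz) (rule refl)
    also have "\<dots> = (SUP n. \<integral>\<^sup>+z. E n (fst z) * u (t, z) \<partial>cylinder)"
    proof (rule nn_integral_monotone_convergence_SUP)
      show "incseq (\<lambda>n z. E n (fst z) * u (t, z))"
        using Einc by (auto simp: incseq_def le_fun_def intro!: mult_right_mono)
      show "(\<lambda>z. E n (fst z) * u (t, z)) \<in> borel_measurable cylinder" for n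
        by (intro borel_measurable_times_ennreal us Ef)
    qed
    finally show ?thesis by (simp only: A_def)
  qed
  have "(\<integral>\<^sup>+t. \<integral>\<^sup>+z. u (t, z) \<partial>cylinder \<partial>restrict_space lborel {0..1}) =
      (\<integral>\<^sup>+t. (SUP n. A n t) \<partial>restrict_space lborel {0..1})" by (simp only: inner)
  also have "\<dots> = (SUP n. \<integral>\<^sup>+t. A n t \<partial>restrict_space lborel {0..1})"
  proof (rule nn_integral_monotone_convergence_SUP)
    show "incseq A"
      using Einc by (auto simp: incseq_def le_fun_def A_def intro!: nn_integral_mono mult_right_mono)
    show "A n \<in> borel_measurable (restrict_space lborel {0..1})" for n
      by (rule measurable_restrict_space1[OF Am])
  qed
  also have "\<dots> \<le> ennreal (192 * pi\<^sup>2) * M * B" by (intro SUP_least bound)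
  finally show ?thesis by (simp only: u_def B_def)
qed

section \<open>The Fourier--Plancherel transform\<close>

text \<open>The L2 distance between h and its finite Fourier sum p/(2 pi) is nonnegative; expanding
  it with the orthogonality of the characters bounds every finite sum of coefficients. An inequality
  suffices, since the transform has to be bounded but not unitary.\<close>

lemma Bessel_torus:
  assumes h: "integrable torus h"
  shows "(\<integral>\<^sup>+k. ennreal ((norm (LINT y|torus. h y * cis (- (y * of_int k))))\<^sup>2) \<partial>count_space UNIV) \<le>
    ennreal (2 * pi) * (\<integral>\<^sup>+y. ennreal ((norm (h y))\<^sup>2) \<partial>torus)"
proof (cases "(\<integral>\<^sup>+y. ennreal ((norm (h y))\<^sup>2) \<partial>torus) = \<infinity>")
  case True
  thus ?thesis by (simp add: ennreal_mult_top)
next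
  case False
  interpret finite_measure torus by (rule finite_measure_torus)
  have hm[measurable]: "h \<in> borel_measurable torus" using h by auto
  have h2: "integrable torus (\<lambda>y. (norm (h y))\<^sup>2)"
    by (rule integrableI_bounded) (use False in \<open>auto simp: top.not_eq_extremum\<close>)
  define c where "c = (\<lambda>k::int. LINT y|torus. h y * cis (- (y * of_int k)))"
  have cm: "(\<lambda>y. cis (y * a)) \<in> borel_measurable torus" for a
    by (rule measurable_torus) measurable
  have ci: "integrable torus (\<lambda>y. cis (y * a))" for a
    by (rule integrable_cis[OF finite_measure_torus measurable_torus]) simp
  have hc: "integrable torus (\<lambda>y. h y * cis (- (y * a)))" for a
  proof (rule Bochner_Integration.integrable_bound[OF h])
    show "(\<lambda>y. h y * cis (- (y * a))) \<in> borel_measurable torus"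
      using cm[of "- a"] by (intro borel_measurable_times hm) simp
  qed (simp add: norm_mult)
  have fin: "ennreal (\<Sum>k\<in>A. (norm (c k))\<^sup>2) \<le> ennreal (2 * pi) * (\<integral>\<^sup>+y. ennreal ((norm (h y))\<^sup>2) \<partial>torus)"
    if A: "finite A" for A
  proof -
    define p where "p = (\<lambda>y. \<Sum>k\<in>A. c k * cis (y * of_int k))"
    define E where "E = (\<Sum>k\<in>A. (norm (c k))\<^sup>2)"
    have hp_eq: "h y * cnj (p y) = (\<Sum>k\<in>A. cnj (c k) * (h y * cis (- (y * of_int k))))" for y
      by (simp add: p_def cnj_sum sum_distrib_left cis_cnj mult_ac)
    have hp: "integrable torus (\<lambda>y. h y * cnj (p y))"
      unfolding hp_eq using hc by (intro Bochner_Integration.integrable_sum Bochner_Integration.integrable_mult_right) auto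
    have hpI: "(LINT y|torus. h y * cnj (p y)) = of_real E"
    proof -
      have "(LINT y|torus. h y * cnj (p y)) = (\<Sum>k\<in>A. LINT y|torus. cnj (c k) * (h y * cis (- (y * of_int k))))"
        unfolding hp_eq using hc by (subst Bochner_Integration.integral_sum) (auto intro!: Bochner_Integration.integrable_mult_right)
      also have "\<dots> = (\<Sum>k\<in>A. cnj (c k) * c k)" by (simp add: c_def)
      also have "\<dots> = of_real E" unfolding E_def of_real_sum
        by (intro sum.cong refl) (simp only: complex_norm_square mult.commute)
      finally show ?thesis .
    qed
    have pp_eq: "p y * cnj (p y) = (\<Sum>k\<in>A. \<Sum>l\<in>A. c k * cnj (c l) * cis (y * of_int (k - l)))" for y
    proof -
      have "p y * cnj (p y) = (\<Sum>k\<in>A. \<Sum>l\<in>A. (c k * cis (y * of_int k)) * (cnj (c l) * cis (- (y * of_int l))))"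
        by (simp add: p_def cnj_sum sum_product cis_cnj)
      also have "\<dots> = (\<Sum>k\<in>A. \<Sum>l\<in>A. c k * cnj (c l) * (cis (y * of_int k) * cis (- (y * of_int l))))"
        by (simp add: mult_ac)
      also have "\<dots> = (\<Sum>k\<in>A. \<Sum>l\<in>A. c k * cnj (c l) * cis (y * of_int (k - l)))"
        unfolding cis_mult by (simp add: algebra_simps)
      finally show ?thesis .
    qed
    have pp: "integrable torus (\<lambda>y. p y * cnj (p y))"
      unfolding pp_eq using ci by (intro Bochner_Integration.integrable_sum Bochner_Integration.integrable_mult_right) auto
    have ppI: "(LINT y|torus. p y * cnj (p y)) = of_real (2 * pi * E)"
    proof -
      have "(LINT y|torus. p y * cnj (p y)) = (\<Sum>k\<in>A. \<Sum>l\<in>A. LINT y|torus. c k * cnj (c l) * cis (y * of_int (k - l)))"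
        unfolding pp_eq using ci
        by (subst Bochner_Integration.integral_sum, intro Bochner_Integration.integrable_sum Bochner_Integration.integrable_mult_right, simp)
          (intro sum.cong refl Bochner_Integration.integral_sum Bochner_Integration.integrable_mult_right, simp)
      also have "\<dots> = (\<Sum>k\<in>A. \<Sum>l\<in>A. if k = l then c k * cnj (c l) * (2 * of_real pi) else 0)"
        by (intro sum.cong refl) (simp only: integral_mult_right_zero integral_cis_torus, simp)
      also have "\<dots> = (\<Sum>k\<in>A. c k * cnj (c k) * (2 * of_real pi))"
        using A by (simp add: sum.delta)
      also have "\<dots> = of_real (2 * pi * E)"
        unfolding E_def sum_distrib_left of_real_sum
        by (intro sum.cong refl) (simp add: complex_norm_square[symmetric])
      finally show ?thesis .
    qed
    have sq: "(norm (h y - p y / of_real (2 * pi)))\<^sup>2 =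
        (norm (h y))\<^sup>2 - Re (h y * cnj (p y)) / pi + Re (p y * cnj (p y)) / (4 * pi\<^sup>2)" for y
    proof -
      have "(norm (h y - p y / of_real (2 * pi)))\<^sup>2 = Re ((h y - p y / of_real (2 * pi)) * cnj (h y - p y / of_real (2 * pi)))"
        by (metis Re_complex_of_real complex_norm_square of_real_power)
      also have "(h y - p y / of_real (2 * pi)) * cnj (h y - p y / of_real (2 * pi)) =
          h y * cnj (h y) - (h y * cnj (p y) + cnj (h y * cnj (p y))) / of_real (2 * pi) + p y * cnj (p y) / of_real (4 * pi\<^sup>2)"
        by (simp add: field_simps power2_eq_square)
      also have "Re \<dots> = (norm (h y))\<^sup>2 - Re (h y * cnj (p y)) / pi + Re (p y * cnj (p y)) / (4 * pi\<^sup>2)"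
        by (simp add: complex_norm_square[symmetric] Re_divide_of_real del: of_real_mult of_real_numeral) (simp add: divide_simps)
      finally show ?thesis .
    qed
    have "0 \<le> (LINT y|torus. (norm (h y - p y / of_real (2 * pi)))\<^sup>2)" by simp
    also have "\<dots> = (LINT y|torus. (norm (h y))\<^sup>2) - (LINT y|torus. Re (h y * cnj (p y)) / pi) + (LINT y|torus. Re (p y * cnj (p y)) / (4 * pi\<^sup>2))"
      unfolding sq using h2 hp pp
      by (subst Bochner_Integration.integral_add, simp_all add: Bochner_Integration.integral_diff del: complex_cnj_mult times_complex.sel)
    also have "(LINT y|torus. Re (h y * cnj (p y)) / pi) = E / pi"
      using integral_Re[OF hp] hpI by (simp del: times_complex.sel)
    also have "(LINT y|torus. Re (p y * cnj (p y)) / (4 * pi\<^sup>2)) = 2 * pi * E / (4 * pi\<^sup>2)"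
      using integral_Re[OF pp] unfolding ppI by (simp del: times_complex.sel of_real_mult)
    also have "2 * pi * E / (4 * pi\<^sup>2) = E / pi / 2" by (simp add: power2_eq_square)
    finally have "E / pi / 2 \<le> (LINT y|torus. (norm (h y))\<^sup>2)" by linarith
    hence "E \<le> 2 * pi * (LINT y|torus. (norm (h y))\<^sup>2)" by (simp add: field_simps)
    hence "ennreal E \<le> ennreal (2 * pi * (LINT y|torus. (norm (h y))\<^sup>2))" by (rule ennreal_leI)
    also have "\<dots> = ennreal (2 * pi) * ennreal (LINT y|torus. (norm (h y))\<^sup>2)" by (simp add: ennreal_mult)
    also have "ennreal (LINT y|torus. (norm (h y))\<^sup>2) = (\<integral>\<^sup>+y. ennreal ((norm (h y))\<^sup>2) \<partial>torus)"
      using h2 by (intro nn_integral_eq_integral[symmetric]) auto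
    finally show ?thesis by (simp only: E_def)
  qed
  \<comment> \<open>Enumerating the integers by \<open>int_decode\<close> makes the sum a supremum
    of finite partial sums, each covered by \<open>fin\<close>.\<close>
  have "(\<integral>\<^sup>+k. ennreal ((norm (c k))\<^sup>2) \<partial>count_space UNIV) = (\<Sum>n. ennreal ((norm (c (int_decode n)))\<^sup>2))"
    unfolding nn_integral_count_space_nat[symmetric]
    by (rule nn_integral_bij_count_space[OF bij_int_decode, symmetric])
  also have "\<dots> = (SUP n. \<Sum>i<n. ennreal ((norm (c (int_decode i)))\<^sup>2))" by (rule suminf_eq_SUP)
  also have "\<dots> \<le> ennreal (2 * pi) * (\<integral>\<^sup>+y. ennreal ((norm (h y))\<^sup>2) \<partial>torus)"
  proof (rule SUP_least)
    fix n :: nat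
    have "(\<Sum>i<n. ennreal ((norm (c (int_decode i)))\<^sup>2)) = ennreal (\<Sum>k\<in>int_decode ` {..<n}. (norm (c k))\<^sup>2)"
      by (subst sum.reindex) (auto simp: sum_ennreal inj_int_decode)
    also have "\<dots> \<le> ennreal (2 * pi) * (\<integral>\<^sup>+y. ennreal ((norm (h y))\<^sup>2) \<partial>torus)" by (rule fin) simp
    finally show "(\<Sum>i<n. ennreal ((norm (c (int_decode i)))\<^sup>2)) \<le> ennreal (2 * pi) * (\<integral>\<^sup>+y. ennreal ((norm (h y))\<^sup>2) \<partial>torus)" .
  qed
  finally show ?thesis by (simp only: c_def)
qed

text \<open>Another use of \<open>TT_star_Schur\<close>: with a Gaussian weight of width \<sigma> in
  \<xi> the kernel is a Gaussian in x - x' with row integral sqrt(2 pi)/\<sigma>. Normalising the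
  weight so that it increases to 1 leaves the constant 2 pi, independent of \<sigma>.\<close>

lemma Plancherel_le:
  fixes \<phi> :: "real \<Rightarrow> complex"
  assumes \<phi>: "\<phi> \<in> borel_measurable borel"
  shows "(\<integral>\<^sup>+\<xi>. ennreal ((norm (LINT x|lborel. \<phi> x * cis (- (x * \<xi>))))\<^sup>2) \<partial>lborel) \<le>
    ennreal (2 * pi) * (\<integral>\<^sup>+x. ennreal ((norm (\<phi> x))\<^sup>2) \<partial>lborel)"
proof (cases "integrable lborel \<phi>")
  case False
  \<comment> \<open>For non-integrable \<phi> the integral takes the default value 0 at every \<xi>,
    so there is nothing to bound.\<close>
  have "\<not> integrable lborel (\<lambda>x. \<phi> x * cis (- (x * \<xi>)))" for \<xi>
  proof
    assume i: "integrable lborel (\<lambda>x. \<phi> x * cis (- (x * \<xi>)))"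
    have "integrable lborel \<phi>"
      by (rule Bochner_Integration.integrable_bound[OF i]) (use \<phi> in \<open>auto simp: norm_mult\<close>)
    thus False using False by simp
  qed
  hence "(LINT x|lborel. \<phi> x * cis (- (x * \<xi>))) = 0" for \<xi> by (rule not_integrable_integral_eq)
  thus ?thesis by simp
next
  case True
  define F where "F = (\<lambda>\<xi>. LINT x|lborel. \<phi> x * cis (- (x * \<xi>)))"
  define E where "E = (\<lambda>(n::nat) x::real. ennreal (exp (- x\<^sup>2 / (2 * (real n + 1)\<^sup>2))))"
  have Fm: "F \<in> borel_measurable borel"
  proof -
    have "(\<lambda>(\<xi>, x). \<phi> x * cis (- (x * \<xi>))) \<in> borel_measurable (borel \<Otimes>\<^sub>M lborel)"
      unfolding case_prod_beta using measurable_compose[OF measurable_snd \<phi>, of borel] by measurable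
    thus ?thesis unfolding F_def by (rule lborel.borel_measurable_lebesgue_integral)
  qed
  have bound: "(\<integral>\<^sup>+\<xi>. E n \<xi> * ennreal ((norm (F \<xi>))\<^sup>2) \<partial>lborel) \<le>
    ennreal (2 * pi) * (\<integral>\<^sup>+x. ennreal ((norm (\<phi> x))\<^sup>2) \<partial>lborel)" for n
  proof -
    define \<sigma> where "\<sigma> = real n + 1"
    have \<sigma>: "0 < \<sigma>" by (simp add: \<sigma>_def)
    have En: "E n x = ennreal (sqrt (2 * pi) * \<sigma>) * ennreal (normal_density 0 \<sigma> x)" for x
    proof -
      have "exp (- x\<^sup>2 / (2 * \<sigma>\<^sup>2)) = (sqrt (2 * pi) * \<sigma>) * normal_density 0 \<sigma> x"
        using \<sigma> by (simp add: normal_density_def real_sqrt_mult)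
      thus ?thesis using \<sigma> by (simp add: E_def \<sigma>_def[symmetric] ennreal_mult)
    qed
    have "(\<integral>\<^sup>+\<xi>. ennreal ((norm (LINT x|lborel. \<phi> x * cis (- (x * \<xi>))))\<^sup>2) \<partial>gauss \<sigma>) \<le>
        ennreal (sqrt (2 * pi) / \<sigma>) * (\<integral>\<^sup>+x. ennreal ((norm (\<phi> x))\<^sup>2) \<partial>lborel)"
    proof (rule TT_star_Schur[where S = UNIV and K = "\<lambda>x x'. exp (- (\<sigma> * (x' - x))\<^sup>2 / 2)"])
      show "sigma_finite_measure (lborel :: real measure)" by (rule sigma_finite_lborel)
      show "finite_measure (gauss \<sigma>)" by (rule finite_measure_gauss[OF \<sigma>])
      show "(\<lambda>(p, v). cis (- (p * v))) \<in> borel_measurable (lborel \<Otimes>\<^sub>M gauss \<sigma>)"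
        unfolding gauss_def by measurable
      show "(LINT v|gauss \<sigma>. cis (- (x * v)) * cnj (cis (- (x' * v)))) = of_real (exp (- (\<sigma> * (x' - x))\<^sup>2 / 2))" for x x'
      proof -
        have "cis (- (x * v)) * cnj (cis (- (x' * v))) = cis (v * (x' - x))" for v
          unfolding cis_cnj cis_mult by (simp add: algebra_simps)
        thus ?thesis by (simp add: gauss_def char_normal_density[OF \<sigma>])
      qed
      show "exp (- (\<sigma> * (x' - x))\<^sup>2 / 2) = exp (- (\<sigma> * (x - x'))\<^sup>2 / 2)" for x x'
        unfolding power_mult_distrib by (subst power2_commute) (rule refl)
      show "(\<integral>\<^sup>+x'. ennreal (exp (- (\<sigma> * (x' - x))\<^sup>2 / 2)) * indicator UNIV x' \<partial>lborel) \<le> ennreal (sqrt (2 * pi) / \<sigma>)" for x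
        using nn_integral_gauss[OF \<sigma>, of x] by simp
    qed (use True in auto)
    hence "(\<integral>\<^sup>+\<xi>. ennreal ((norm (F \<xi>))\<^sup>2) \<partial>gauss \<sigma>) \<le>
        ennreal (sqrt (2 * pi) / \<sigma>) * (\<integral>\<^sup>+x. ennreal ((norm (\<phi> x))\<^sup>2) \<partial>lborel)" by (simp only: F_def)
    moreover have "(\<integral>\<^sup>+\<xi>. ennreal ((norm (F \<xi>))\<^sup>2) \<partial>gauss \<sigma>) =
        (\<integral>\<^sup>+\<xi>. ennreal (normal_density 0 \<sigma> \<xi>) * ennreal ((norm (F \<xi>))\<^sup>2) \<partial>lborel)"
      unfolding gauss_def using Fm by (intro nn_integral_density) measurable
    moreover have "(\<integral>\<^sup>+\<xi>. E n \<xi> * ennreal ((norm (F \<xi>))\<^sup>2) \<partial>lborel) = ennreal (sqrt (2 * pi) * \<sigma>) *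
        (\<integral>\<^sup>+\<xi>. ennreal (normal_density 0 \<sigma> \<xi>) * ennreal ((norm (F \<xi>))\<^sup>2) \<partial>lborel)"
      unfolding En mult.assoc using Fm by (intro nn_integral_cmult) measurable
    ultimately have "(\<integral>\<^sup>+\<xi>. E n \<xi> * ennreal ((norm (F \<xi>))\<^sup>2) \<partial>lborel) \<le> ennreal (sqrt (2 * pi) * \<sigma>) *
        (ennreal (sqrt (2 * pi) / \<sigma>) * (\<integral>\<^sup>+x. ennreal ((norm (\<phi> x))\<^sup>2) \<partial>lborel))"
      by (simp only: mult_left_mono zero_le)
    also have "\<dots> = ennreal (sqrt (2 * pi) * \<sigma> * (sqrt (2 * pi) / \<sigma>)) * (\<integral>\<^sup>+x. ennreal ((norm (\<phi> x))\<^sup>2) \<partial>lborel)"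
      using \<sigma> by (subst ennreal_mult[of "sqrt (2 * pi) * \<sigma>" "sqrt (2 * pi) / \<sigma>"]) (simp, simp, simp only: mult.assoc)
    also have "sqrt (2 * pi) * \<sigma> * (sqrt (2 * pi) / \<sigma>) = 2 * pi" using \<sigma> by simp
    finally show ?thesis .
  qed
  have "(\<integral>\<^sup>+\<xi>. ennreal ((norm (F \<xi>))\<^sup>2) \<partial>lborel) = (\<integral>\<^sup>+\<xi>. (SUP n. E n \<xi> * ennreal ((norm (F \<xi>))\<^sup>2)) \<partial>lborel)"
    using gauss_weight_SUP(1) by (simp add: E_def SUP_mult_right_ennreal[symmetric])
  also have "\<dots> = (SUP n. \<integral>\<^sup>+\<xi>. E n \<xi> * ennreal ((norm (F \<xi>))\<^sup>2) \<partial>lborel)"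
  proof (rule nn_integral_monotone_convergence_SUP)
    show "incseq (\<lambda>n \<xi>. E n \<xi> * ennreal ((norm (F \<xi>))\<^sup>2))"
      using gauss_weight_SUP(2) by (auto simp: incseq_def le_fun_def E_def intro!: mult_right_mono)
    show "(\<lambda>\<xi>. E n \<xi> * ennreal ((norm (F \<xi>))\<^sup>2)) \<in> borel_measurable lborel" for n
      unfolding E_def using Fm by measurable
  qed
  also have "\<dots> \<le> ennreal (2 * pi) * (\<integral>\<^sup>+x. ennreal ((norm (\<phi> x))\<^sup>2) \<partial>lborel)"
    by (intro SUP_least bound)
  finally show ?thesis by (simp only: F_def)
qed

text \<open>Integrating in x first gives a partial transform that is integrable in y, so
  \<open>Bessel_torus\<close> applies for each \<xi>; exchanging the integrals,
  \<open>Plancherel_le\<close> applies for each y. The two constants 2 pi multiply to 4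
  pi^2.\<close>

lemma fourier_integral_Plancherel_le:
  assumes f: "integrable cylinder f"
  shows "fourier_integral f \<in> borel_measurable dual_cylinder"
    and "(\<integral>\<^sup>+\<zeta>. ennreal ((norm (fourier_integral f \<zeta>))\<^sup>2) \<partial>dual_cylinder) \<le>
      ennreal (4 * pi\<^sup>2) * (\<integral>\<^sup>+z. ennreal ((norm (f z))\<^sup>2) \<partial>cylinder)"
proof -
  interpret T: sigma_finite_measure torus by (rule sigma_finite_torus)
  interpret C: pair_sigma_finite "lborel :: real measure" torus
    by (rule pair_sigma_finite.intro[OF sigma_finite_lborel sigma_finite_torus])
  have f': "integrable (lborel \<Otimes>\<^sub>M torus) f" using f by (simp add: cylinder_torus)
  hence fm: "f \<in> borel_measurable (lborel \<Otimes>\<^sub>M torus)" by auto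
  define h where "h = (\<lambda>\<xi> y. LINT x|lborel. f (x, y) * cis (- (x * \<xi>)))"
  have hi: "integrable (lborel \<Otimes>\<^sub>M torus) (\<lambda>z. f z * cis (- (fst z * \<xi>)))" for \<xi>
  proof (rule Bochner_Integration.integrable_bound[OF f'])
    have "(\<lambda>z. cis (- (fst z * \<xi>))) \<in> borel_measurable (lborel \<Otimes>\<^sub>M torus)"
      by (rule measurable_compose[OF measurable_fst]) measurable
    thus "(\<lambda>z. f z * cis (- (fst z * \<xi>))) \<in> borel_measurable (lborel \<Otimes>\<^sub>M torus)"
      using fm by (intro borel_measurable_times)
  qed (simp add: norm_mult)
  have hint: "integrable torus (h \<xi>)" for \<xi>
    using C.integrable_snd[of "\<lambda>x y. f (x, y) * cis (- (x * \<xi>))"] hi[of \<xi>]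
    by (simp add: h_def case_prod_beta')
  have eq: "fourier_integral f (\<xi>, k) = (LINT y|torus. h \<xi> y * cis (- (y * of_int k)))" for \<xi> k
  proof -
    have i: "integrable (lborel \<Otimes>\<^sub>M torus) (\<lambda>z. f z * cis (- (fst z * \<xi>)) * cis (- (snd z * of_int k)))"
    proof (rule Bochner_Integration.integrable_bound[OF hi])
      have "(\<lambda>y. cis (- (y * of_int k))) \<in> borel_measurable torus" by (rule measurable_torus) measurable
      hence "(\<lambda>z. cis (- (snd z * of_int k))) \<in> borel_measurable (lborel \<Otimes>\<^sub>M torus)"
        by (rule measurable_compose[OF measurable_snd])
      from borel_measurable_times[OF borel_measurable_integrable[OF hi[of \<xi>]] this]
      show "(\<lambda>z. f z * cis (- (fst z * \<xi>)) * cis (- (snd z * of_int k))) \<in> borel_measurable (lborel \<Otimes>\<^sub>M torus)" .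
    qed (simp add: norm_mult)
    have ex: "exp (- \<i> * of_real (x * \<xi> + y * of_int k)) = cis (- (x * \<xi>)) * cis (- (y * of_int k))" for x y
      by (simp add: cis_conv_exp exp_add[symmetric] algebra_simps)
    have "fourier_integral f (\<xi>, k) = (LINT z|(lborel \<Otimes>\<^sub>M torus). f z * cis (- (fst z * \<xi>)) * cis (- (snd z * of_int k)))"
      unfolding fourier_integral_def cylinder_torus case_prod_conv unfolding ex case_prod_beta' by (simp add: mult_ac)
    also have "\<dots> = (LINT y|torus. LINT x|lborel. f (x, y) * cis (- (x * \<xi>)) * cis (- (y * of_int k)))"
      using C.integral_snd[of "\<lambda>x y. f (x, y) * cis (- (x * \<xi>)) * cis (- (y * of_int k))"] i
      by (simp add: case_prod_beta')
    also have "\<dots> = (LINT y|torus. h \<xi> y * cis (- (y * of_int k)))" by (simp add: h_def)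
    finally show ?thesis .
  qed
  have hm3: "(\<lambda>(q, x). f (x, snd q) * cis (- (x * fst q))) \<in> borel_measurable ((lborel \<Otimes>\<^sub>M torus) \<Otimes>\<^sub>M lborel)"
  proof -
    have "(\<lambda>r. (snd r, snd (fst r))) \<in> measurable ((lborel \<Otimes>\<^sub>M torus) \<Otimes>\<^sub>M lborel) (lborel \<Otimes>\<^sub>M torus)"
      by measurable
    from measurable_compose[OF this fm]
    have "(\<lambda>r. f (snd r, snd (fst r))) \<in> borel_measurable ((lborel \<Otimes>\<^sub>M torus) \<Otimes>\<^sub>M lborel)" .
    moreover have "(\<lambda>r. cis (- (snd r * fst (fst r)))) \<in> borel_measurable ((lborel \<Otimes>\<^sub>M torus) \<Otimes>\<^sub>M lborel)"
      by measurable
    ultimately show ?thesis unfolding case_prod_beta by (intro borel_measurable_times)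
  qed
  have hm: "(\<lambda>q. h (fst q) (snd q)) \<in> borel_measurable (lborel \<Otimes>\<^sub>M torus)"
    unfolding h_def using lborel.borel_measurable_lebesgue_integral[of "\<lambda>q x. f (x, snd q) * cis (- (x * fst q))"] hm3 by simp
  show Fm: "fourier_integral f \<in> borel_measurable dual_cylinder"
  proof -
    have "(\<lambda>\<xi>. fourier_integral f (\<xi>, k)) \<in> borel_measurable lborel" for k
    proof -
      have "(\<lambda>y. cis (- (y * of_int k))) \<in> borel_measurable torus" by (rule measurable_torus) measurable
      hence "(\<lambda>z. cis (- (snd z * of_int k))) \<in> borel_measurable (lborel \<Otimes>\<^sub>M torus)"
        by (rule measurable_compose[OF measurable_snd])
      hence "(\<lambda>(\<xi>, y). h \<xi> y * cis (- (y * of_int k))) \<in> borel_measurable (lborel \<Otimes>\<^sub>M torus)"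
        using hm unfolding case_prod_beta by (intro borel_measurable_times)
      thus ?thesis unfolding eq by (rule T.borel_measurable_lebesgue_integral)
    qed
    hence "(\<lambda>(k, \<xi>). fourier_integral f (\<xi>, k)) \<in> borel_measurable (count_space UNIV \<Otimes>\<^sub>M lborel)"
      by (intro measurable_pair_measure_countable1) simp_all
    from measurable_compose[OF measurable_pair_swap' this] show ?thesis
      by (simp add: dual_cylinder_def case_prod_beta')
  qed
  have "(\<integral>\<^sup>+\<zeta>. ennreal ((norm (fourier_integral f \<zeta>))\<^sup>2) \<partial>dual_cylinder) =
      (\<integral>\<^sup>+\<xi>. \<integral>\<^sup>+k. ennreal ((norm (fourier_integral f (\<xi>, k)))\<^sup>2) \<partial>count_space UNIV \<partial>lborel)"
    unfolding dual_cylinder_def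
    by (rule sigma_finite_measure.nn_integral_fst[OF sigma_finite_int, symmetric])
      (use Fm in \<open>simp add: dual_cylinder_def\<close>)
  also have "\<dots> \<le> (\<integral>\<^sup>+\<xi>. ennreal (2 * pi) * (\<integral>\<^sup>+y. ennreal ((norm (h \<xi> y))\<^sup>2) \<partial>torus) \<partial>lborel)"
    unfolding eq by (intro nn_integral_mono Bessel_torus hint)
  also have "\<dots> = ennreal (2 * pi) * (\<integral>\<^sup>+\<xi>. \<integral>\<^sup>+y. ennreal ((norm (h \<xi> y))\<^sup>2) \<partial>torus \<partial>lborel)"
    using T.borel_measurable_nn_integral_fst[of "\<lambda>q. ennreal ((norm (h (fst q) (snd q)))\<^sup>2)" lborel] hm
    by (intro nn_integral_cmult) simp
  also have "(\<integral>\<^sup>+\<xi>. \<integral>\<^sup>+y. ennreal ((norm (h \<xi> y))\<^sup>2) \<partial>torus \<partial>lborel) =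
      (\<integral>\<^sup>+y. \<integral>\<^sup>+\<xi>. ennreal ((norm (h \<xi> y))\<^sup>2) \<partial>lborel \<partial>torus)"
    by (rule C.Fubini'[symmetric]) (use hm in \<open>simp add: case_prod_beta'\<close>)
  also have "\<dots> \<le> (\<integral>\<^sup>+y. ennreal (2 * pi) * (\<integral>\<^sup>+x. ennreal ((norm (f (x, y)))\<^sup>2) \<partial>lborel) \<partial>torus)"
  proof (rule nn_integral_mono)
    fix y assume y: "y \<in> space torus"
    have "(\<lambda>x. f (x, y)) \<in> borel_measurable borel" using measurable_Pair1[OF fm y] by simp
    thus "(\<integral>\<^sup>+\<xi>. ennreal ((norm (h \<xi> y))\<^sup>2) \<partial>lborel) \<le> ennreal (2 * pi) * (\<integral>\<^sup>+x. ennreal ((norm (f (x, y)))\<^sup>2) \<partial>lborel)"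
      unfolding h_def by (rule Plancherel_le)
  qed
  also have "\<dots> = ennreal (2 * pi) * (\<integral>\<^sup>+y. \<integral>\<^sup>+x. ennreal ((norm (f (x, y)))\<^sup>2) \<partial>lborel \<partial>torus)"
  proof (rule nn_integral_cmult)
    have "(\<lambda>(y, x). ennreal ((norm (f (x, y)))\<^sup>2)) \<in> borel_measurable (torus \<Otimes>\<^sub>M lborel)"
      using measurable_compose[OF measurable_pair_swap' fm] by (simp add: case_prod_beta')
    thus "(\<lambda>y. \<integral>\<^sup>+x. ennreal ((norm (f (x, y)))\<^sup>2) \<partial>lborel) \<in> borel_measurable torus"
      by (rule lborel.borel_measurable_nn_integral)
  qed
  also have "(\<integral>\<^sup>+y. \<integral>\<^sup>+x. ennreal ((norm (f (x, y)))\<^sup>2) \<partial>lborel \<partial>torus) = (\<integral>\<^sup>+z. ennreal ((norm (f z))\<^sup>2) \<partial>cylinder)"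
    unfolding cylinder_torus by (rule C.nn_integral_snd) (use fm in measurable)
  also have "ennreal (2 * pi) * (ennreal (2 * pi) * (\<integral>\<^sup>+z. ennreal ((norm (f z))\<^sup>2) \<partial>cylinder)) =
      ennreal (4 * pi\<^sup>2) * (\<integral>\<^sup>+z. ennreal ((norm (f z))\<^sup>2) \<partial>cylinder)"
  proof -
    have "ennreal (2 * pi) * ennreal (2 * pi) = ennreal (4 * pi\<^sup>2)"
      by (simp add: ennreal_mult[symmetric] power2_eq_square)
    thus ?thesis by (simp only: mult.assoc[symmetric])
  qed
  finally show "(\<integral>\<^sup>+\<zeta>. ennreal ((norm (fourier_integral f \<zeta>))\<^sup>2) \<partial>dual_cylinder) \<le>
      ennreal (4 * pi\<^sup>2) * (\<integral>\<^sup>+z. ennreal ((norm (f z))\<^sup>2) \<partial>cylinder)" by (simp add: mult_left_mono)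
qed

section \<open>Powers and norms with values in [0, \<infinity>]\<close>

lemma ennpow_mono: "x \<le> y \<Longrightarrow> 0 < p \<Longrightarrow> ennpow x p \<le> ennpow y p"
  by (auto simp: ennpow_def top_unique less_top intro!: ennreal_leI powr_mono2 enn2real_mono)

lemma ennpow_ennreal: "0 \<le> r \<Longrightarrow> ennpow (ennreal r) p = ennreal (r powr p)"
  by (simp add: ennpow_def)

lemma ennpow_less_top_iff: "ennpow x p < \<infinity> \<longleftrightarrow> x < \<infinity>"
  by (simp add: ennpow_def less_top)

lemma ennpow_ennpow: "ennpow (ennpow x p) q = ennpow x (p * q)"
  by (simp add: ennpow_def powr_powr)

lemma ennpow_one: "ennpow x 1 = x"
  by (simp add: ennpow_def less_top)

lemma ennpow_mult:
  assumes "0 < c" "0 < p"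
  shows "ennpow (ennreal c * x) p = ennreal (c powr p) * ennpow x p"
proof (cases x rule: ennreal_cases)
  case (real r)
  thus ?thesis using assms by (simp add: ennpow_ennreal ennreal_mult[symmetric] powr_mult)
next
  case top
  thus ?thesis using assms by (simp add: ennpow_def ennreal_mult_top)
qed

lemma Lp_norm_2: "Lp_norm 2 M f = ennpow (\<integral>\<^sup>+z. ennreal ((norm (f z))\<^sup>2) \<partial>M) (1 / 2)"
  unfolding Lp_norm_def ennLp_def by (simp add: ennpow_ennreal powr_numeral)

lemma Lp_norm_4: "Lp_norm 4 M f = ennpow (\<integral>\<^sup>+z. ennreal (norm (f z) ^ 4) \<partial>M) (1 / 4)"
  unfolding Lp_norm_def ennLp_def by (simp add: ennpow_ennreal powr_numeral)

lemma ennLp_4_Lp_norm_4: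
  "ennLp 4 M (\<lambda>t. Lp_norm 4 M' (f t)) = ennpow (\<integral>\<^sup>+t. \<integral>\<^sup>+z. ennreal (norm (f t z) ^ 4) \<partial>M' \<partial>M) (1 / 4)"
  unfolding ennLp_def Lp_norm_4 ennpow_ennpow by (simp add: ennpow_one)

lemma ennpow_tendsto_0:
  assumes "(f \<longlongrightarrow> 0) F" "0 < p"
  shows "((\<lambda>x. ennpow (f x) p) \<longlongrightarrow> 0) F"
proof (rule order_tendstoI)
  fix a :: ennreal assume "0 < a"
  then obtain y where y: "0 < y" "y < a" using dense by blast
  then obtain b where b: "y = ennreal b" "0 < b"
    by (cases y rule: ennreal_cases) auto
  have "\<forall>\<^sub>F x in F. f x < ennreal (b powr (1 / p))"
    using assms(1) b by (intro order_tendstoD) auto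
  thus "\<forall>\<^sub>F x in F. ennpow (f x) p < a"
  proof eventually_elim
    case (elim x)
    have "ennpow (f x) p \<le> ennpow (ennreal (b powr (1 / p))) p"
      using elim assms(2) by (intro ennpow_mono) auto
    also have "\<dots> = y" using b assms(2) by (simp add: ennpow_ennreal powr_powr)
    finally show ?case using y by simp
  qed
qed simp

lemma L2_space_iff:
  "f \<in> L2_space M \<longleftrightarrow> f \<in> borel_measurable M \<and> (\<integral>\<^sup>+z. ennreal ((norm (f z))\<^sup>2) \<partial>M) < \<infinity>"
  unfolding L2_space_def Lp_norm_2 by (simp add: ennpow_less_top_iff del: infinity_ennreal_def)

lemma norm_add_sq_le: "(norm (a + b))\<^sup>2 \<le> 2 * (norm a)\<^sup>2 + 2 * (norm b)\<^sup>2"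
proof -
  have "(norm (a + b))\<^sup>2 \<le> (norm a + norm b)\<^sup>2" by (intro power_mono norm_triangle_ineq) simp
  also have "\<dots> \<le> 2 * (norm a)\<^sup>2 + 2 * (norm b)\<^sup>2"
    using sum_squares_bound[of "norm a" "norm b"] by (simp add: power2_sum)
  finally show ?thesis .
qed

lemma nn_integral_norm_sq_triangle:
  fixes u v :: "'a \<Rightarrow> complex"
  assumes [measurable]: "u \<in> borel_measurable M" "v \<in> borel_measurable M"
  shows "(\<integral>\<^sup>+z. ennreal ((norm (u z))\<^sup>2) \<partial>M) \<le>
    2 * (\<integral>\<^sup>+z. ennreal ((norm (v z))\<^sup>2) \<partial>M) + 2 * (\<integral>\<^sup>+z. ennreal ((norm (v z - u z))\<^sup>2) \<partial>M)"
proof -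
  have le: "ennreal ((norm (u z))\<^sup>2) \<le> 2 * ennreal ((norm (v z))\<^sup>2) + 2 * ennreal ((norm (v z - u z))\<^sup>2)" for z
  proof -
    have "(norm (u z))\<^sup>2 \<le> 2 * (norm (v z))\<^sup>2 + 2 * (norm (v z - u z))\<^sup>2"
      using norm_add_sq_le[of "v z" "u z - v z"] by (simp add: norm_minus_commute)
    hence "ennreal ((norm (u z))\<^sup>2) \<le> ennreal (2 * (norm (v z))\<^sup>2 + 2 * (norm (v z - u z))\<^sup>2)" by (rule ennreal_leI)
    thus ?thesis by (simp add: ennreal_plus ennreal_mult)
  qed
  have "(\<integral>\<^sup>+z. ennreal ((norm (u z))\<^sup>2) \<partial>M) \<le> (\<integral>\<^sup>+z. 2 * ennreal ((norm (v z))\<^sup>2) + 2 * ennreal ((norm (v z - u z))\<^sup>2) \<partial>M)"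
    by (intro nn_integral_mono le)
  also have "\<dots> = 2 * (\<integral>\<^sup>+z. ennreal ((norm (v z))\<^sup>2) \<partial>M) + 2 * (\<integral>\<^sup>+z. ennreal ((norm (v z - u z))\<^sup>2) \<partial>M)"
    by (subst nn_integral_add) (auto simp: nn_integral_cmult)
  finally show ?thesis .
qed

lemma four_power_eq_square: "(4::real) ^ k = (2 ^ k)\<^sup>2"
proof -
  have "(4::real) ^ k = (2\<^sup>2) ^ k" by simp
  also have "\<dots> = (2 ^ k)\<^sup>2" by (simp only: power_mult[symmetric] mult.commute)
  finally show ?thesis .
qed

text \<open>With the weights 4^k the integrals still form a convergent series, so the weighted sum S
  is finite almost everywhere. At such points the k-th increment is at most sqrt(S) 2^(-k), and the
  telescoping series converges.\<close>

lemma AE_convergent_of_L2_increments: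
  fixes F :: "nat \<Rightarrow> 'a \<Rightarrow> complex"
  assumes [measurable]: "\<And>k. F k \<in> borel_measurable M"
    and incr: "\<And>k. (\<integral>\<^sup>+z. ennreal ((norm (F (Suc k) z - F k z))\<^sup>2) \<partial>M) \<le> ennreal (c * (1 / 8) ^ k)"
    and c: "0 \<le> c"
  shows "AE z in M. (\<lambda>k. F k z) \<longlonglongrightarrow> lim (\<lambda>k. F k z)"
proof -
  define S where "S = (\<lambda>z. \<Sum>k. ennreal (4 ^ k) * ennreal ((norm (F (Suc k) z - F k z))\<^sup>2))"
  have "(\<integral>\<^sup>+z. S z \<partial>M) = (\<Sum>k. ennreal (4 ^ k) * (\<integral>\<^sup>+z. ennreal ((norm (F (Suc k) z - F k z))\<^sup>2) \<partial>M))"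
    unfolding S_def by (subst nn_integral_suminf) (auto simp: nn_integral_cmult)
  also have "\<dots> \<le> (\<Sum>k. ennreal (4 ^ k) * ennreal (c * (1 / 8) ^ k))"
    by (intro suminf_le mult_left_mono incr summableI) auto
  also have "\<dots> = (\<Sum>k. ennreal (c * (1 / 2) ^ k))"
  proof -
    have "ennreal (4 ^ k) * ennreal (c * (1 / 8) ^ k) = ennreal (c * (1 / 2) ^ k)" for k
    proof -
      have "(4::real) ^ k * (c * (1 / 8) ^ k) = c * (4 * (1 / 8)) ^ k" by (simp only: power_mult_distrib mult_ac)
      also have "(4::real) * (1 / 8) = 1 / 2" by simp
      finally show ?thesis using c by (subst ennreal_mult[symmetric]) simp_all
    qed
    thus ?thesis by simp
  qed
  also have "\<dots> < \<infinity>"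
  proof -
    have "summable (\<lambda>k. c * (1 / 2 :: real) ^ k)" by (intro summable_mult summable_geometric) simp
    thus ?thesis using c by (simp add: suminf_ennreal2)
  qed
  finally have "AE z in M. S z \<noteq> \<infinity>"
    by (intro nn_integral_PInf_AE) (auto simp: S_def)
  thus ?thesis
  proof eventually_elim
    case (elim z)
    define B where "B = enn2real (S z)"
    have B: "ennreal B = S z" "0 \<le> B" using elim by (simp_all add: B_def less_top)
    have bd: "norm (F (Suc k) z - F k z) \<le> sqrt B * (1 / 2) ^ k" for k
    proof -
      have "ennreal (4 ^ k * (norm (F (Suc k) z - F k z))\<^sup>2) = ennreal (4 ^ k) * ennreal ((norm (F (Suc k) z - F k z))\<^sup>2)"
        by (rule ennreal_mult) auto
      also have "\<dots> \<le> S z"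
        using sum_le_suminf[of "\<lambda>k. ennreal (4 ^ k) * ennreal ((norm (F (Suc k) z - F k z))\<^sup>2)" "{k}"]
        by (simp add: S_def summableI)
      finally have "4 ^ k * (norm (F (Suc k) z - F k z))\<^sup>2 \<le> B"
        using B by (metis ennreal_le_iff)
      moreover have "(4::real) ^ k = (2 ^ k)\<^sup>2" using four_power_eq_square[of k] .
      ultimately have "(2 ^ k * norm (F (Suc k) z - F k z))\<^sup>2 \<le> B" by (simp add: power_mult_distrib)
      hence "2 ^ k * norm (F (Suc k) z - F k z) \<le> sqrt B" by (rule real_le_rsqrt)
      thus ?thesis by (simp add: field_simps power_one_over)
    qed
    have "summable (\<lambda>k. F (Suc k) z - F k z)"
      by (rule summable_comparison_test'[OF summable_mult[OF summable_geometric[of "1 / 2 :: real"], of "sqrt B"]])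
        (use bd in auto)
    hence "(\<lambda>n. (\<Sum>k<n. F (Suc k) z - F k z) + F 0 z) \<longlonglongrightarrow> (\<Sum>k. F (Suc k) z - F k z) + F 0 z"
      by (intro tendsto_add summable_LIMSEQ tendsto_const)
    hence "convergent (\<lambda>n. F n z)" unfolding sum_lessThan_telescope[of "\<lambda>k. F k z"] by (simp add: convergentI)
    thus ?case by (simp add: convergent_LIMSEQ_iff)
  qed
qed

section \<open>Truncations and existence of the transform\<close>

definition truncation :: "real \<Rightarrow> (real \<times> real \<Rightarrow> complex) \<Rightarrow> real \<times> real \<Rightarrow> complex" where
  "truncation R f = (\<lambda>(x, y). if \<bar>x\<bar> \<le> R then f (x, y) else 0)"

definition tail_mass :: "(real \<times> real \<Rightarrow> complex) \<Rightarrow> real \<Rightarrow> ennreal" where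
  "tail_mass f R = (\<integral>\<^sup>+z. ennreal ((norm (f z))\<^sup>2) * indicator {z. R < \<bar>fst z\<bar>} z \<partial>cylinder)"

lemma measurable_abs_fst_less:
  "{z \<in> space cylinder. r < \<bar>fst z\<bar>} \<in> sets cylinder" "{z \<in> space cylinder. \<bar>fst z\<bar> \<le> r} \<in> sets cylinder"
proof -
  have a: "(\<lambda>z. \<bar>fst z\<bar>) \<in> borel_measurable cylinder"
    by (rule measurable_compose[OF measurable_fst_cylinder]) measurable
  show "{z \<in> space cylinder. r < \<bar>fst z\<bar>} \<in> sets cylinder" "{z \<in> space cylinder. \<bar>fst z\<bar> \<le> r} \<in> sets cylinder"
    by (rule borel_measurable_less[OF borel_measurable_const a], rule borel_measurable_le[OF a borel_measurable_const])
qed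

lemma measurable_tail:
  assumes "f \<in> borel_measurable cylinder"
  shows "(\<lambda>z. ennreal ((norm (f z))\<^sup>2) * indicator {z. R < \<bar>fst z\<bar>} z) \<in> borel_measurable cylinder"
proof -
  have "{z. R < \<bar>fst z\<bar>} \<inter> space cylinder \<in> sets cylinder"
  proof -
    have "{z. R < \<bar>fst z\<bar>} \<inter> space cylinder = {z \<in> space cylinder. R < \<bar>fst z\<bar>}" by blast
    thus ?thesis using measurable_abs_fst_less(1)[of R] by simp
  qed
  hence "(indicator {z. R < \<bar>fst z\<bar>} :: real \<times> real \<Rightarrow> ennreal) \<in> borel_measurable cylinder"
    by (simp add: borel_measurable_indicator_iff)
  thus ?thesis by (intro borel_measurable_times_ennreal measurable_compose[OF _ measurable_ennreal] borel_measurable_power measurable_compose[OF assms borel_measurable_norm])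
qed

text \<open>On the strip of the truncation, which has finite measure, |f| \<le> 1 + |f|^2.\<close>

lemma integrable_truncation:
  assumes f: "f \<in> L2_space cylinder"
  shows "integrable cylinder (truncation R f)"
proof (rule integrableI_bounded)
  have fm[measurable]: "f \<in> borel_measurable cylinder" and f2: "(\<integral>\<^sup>+z. ennreal ((norm (f z))\<^sup>2) \<partial>cylinder) < \<infinity>"
    using f by (simp_all add: L2_space_iff del: infinity_ennreal_def)
  show tm: "truncation R f \<in> borel_measurable cylinder"
    unfolding truncation_def case_prod_beta prod.collapse
    by (rule measurable_If[OF fm borel_measurable_const measurable_abs_fst_less(2)])
  have "emeasure cylinder ({- R..R} \<times> space torus) = emeasure lborel {- R..R} * emeasure torus (space torus)"
    unfolding cylinder_torus by (rule sigma_finite_measure.emeasure_pair_measure_Times[OF sigma_finite_torus]) auto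
  hence fin: "emeasure cylinder ({- R..R} \<times> space torus) < \<infinity>"
    by (auto simp: emeasure_torus ennreal_mult_less_top emeasure_lborel_Icc_eq)
  have bm: "{- R..R} \<times> space torus \<in> sets cylinder" unfolding cylinder_torus by (intro pair_measureI) auto
  have "(\<integral>\<^sup>+z. ennreal (norm (truncation R f z)) \<partial>cylinder) \<le>
      (\<integral>\<^sup>+z. indicator ({- R..R} \<times> space torus) z + ennreal ((norm (f z))\<^sup>2) \<partial>cylinder)"
  proof (rule nn_integral_mono)
    fix z assume "z \<in> space cylinder"
    hence z: "snd z \<in> space torus" by (auto simp: cylinder_torus space_pair_measure)
    have le: "norm (f z) \<le> 1 + (norm (f z))\<^sup>2"
      using sum_squares_bound[of 1 "norm (f z)"] norm_ge_zero[of "f z"] unfolding power_one mult_1_right by linarith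
    show "ennreal (norm (truncation R f z)) \<le> indicator ({- R..R} \<times> space torus) z + ennreal ((norm (f z))\<^sup>2)"
    proof (cases "\<bar>fst z\<bar> \<le> R")
      case True
      hence "z \<in> {- R..R} \<times> space torus" using z by (cases z) (auto simp: abs_le_iff)
      moreover have "ennreal (norm (f z)) \<le> 1 + ennreal ((norm (f z))\<^sup>2)"
        using ennreal_leI[OF le] by (simp add: ennreal_plus)
      ultimately show ?thesis using True by (cases z) (simp add: truncation_def)
    qed (simp add: truncation_def case_prod_beta)
  qed
  also have "\<dots> = emeasure cylinder ({- R..R} \<times> space torus) + (\<integral>\<^sup>+z. ennreal ((norm (f z))\<^sup>2) \<partial>cylinder)"
    using bm by (subst nn_integral_add) auto
  also have "\<dots> < \<infinity>" using fin f2 by (simp add: less_top)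
  finally show "(\<integral>\<^sup>+z. ennreal (norm (truncation R f z)) \<partial>cylinder) < \<infinity>" .
qed

lemma fourier_integral_diff:
  assumes "integrable cylinder f" "integrable cylinder g"
  shows "fourier_integral f \<zeta> - fourier_integral g \<zeta> = fourier_integral (\<lambda>z. f z - g z) \<zeta>"
proof -
  obtain \<xi> k where \<zeta>: "\<zeta> = (\<xi>, k)" using prod.exhaust[of \<zeta> thesis] by blast
  define E :: "real \<times> real \<Rightarrow> complex" where "E = (\<lambda>z. cis (- (fst z * \<xi> + snd z * of_int k)))"
  have E: "exp (- \<i> * of_real (fst z * \<xi> + snd z * of_int k)) = E z" for z
  proof -
    have "exp (- \<i> * of_real a) = cis (- a)" for a by (simp add: cis_conv_exp)
    thus ?thesis by (simp only: E_def)
  qed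
  have mult: "integrable cylinder (\<lambda>z. E z * u z)" if u: "integrable cylinder u" for u
  proof (rule Bochner_Integration.integrable_bound[OF u])
    have s: "snd \<in> borel_measurable cylinder"
      unfolding cylinder_torus by (rule measurable_compose[OF measurable_snd measurable_torus]) simp
    have "(\<lambda>z. - (fst z * \<xi> + snd z * of_int k)) \<in> borel_measurable cylinder"
      by (intro borel_measurable_uminus borel_measurable_add borel_measurable_times measurable_fst_cylinder s borel_measurable_const)
    from measurable_compose[OF this borel_measurable_cis]
    have "E \<in> borel_measurable cylinder" by (simp only: E_def)
    from borel_measurable_times[OF this borel_measurable_integrable[OF u]]
    show "(\<lambda>z. E z * u z) \<in> borel_measurable cylinder" .
  qed (simp add: norm_mult E_def)
  have F: "fourier_integral u \<zeta> = (LINT z|cylinder. E z * u z)" for u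
    unfolding \<zeta> fourier_integral_def case_prod_conv unfolding case_prod_beta' prod.collapse E ..
  show ?thesis unfolding F right_diff_distrib
    by (rule Bochner_Integration.integral_diff[OF mult[OF assms(1)] mult[OF assms(2)], symmetric])
qed

text \<open>Where the two truncations differ, |x| exceeds one of the radii and the difference is f
  up to sign. Adding both tails avoids a case distinction on which radius is larger.\<close>

lemma truncation_diff_le:
  assumes f: "f \<in> L2_space cylinder"
  shows "(\<integral>\<^sup>+\<zeta>. ennreal ((norm (fourier_integral (truncation R f) \<zeta> - fourier_integral (truncation S f) \<zeta>))\<^sup>2) \<partial>dual_cylinder) \<le>
    ennreal (4 * pi\<^sup>2) * (tail_mass f R + tail_mass f S)"
proof -
  have fm[measurable]: "f \<in> borel_measurable cylinder" using f by (simp add: L2_space_iff)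
  have i: "integrable cylinder (\<lambda>z. truncation R f z - truncation S f z)"
    by (intro Bochner_Integration.integrable_diff integrable_truncation f)
  have "(\<integral>\<^sup>+\<zeta>. ennreal ((norm (fourier_integral (truncation R f) \<zeta> - fourier_integral (truncation S f) \<zeta>))\<^sup>2) \<partial>dual_cylinder) \<le>
      ennreal (4 * pi\<^sup>2) * (\<integral>\<^sup>+z. ennreal ((norm (truncation R f z - truncation S f z))\<^sup>2) \<partial>cylinder)"
    unfolding fourier_integral_diff[OF integrable_truncation[OF f] integrable_truncation[OF f]]
    by (rule fourier_integral_Plancherel_le(2)[OF i])
  also have "\<dots> \<le> ennreal (4 * pi\<^sup>2) * (\<integral>\<^sup>+z. ennreal ((norm (f z))\<^sup>2) * indicator {z. R < \<bar>fst z\<bar>} z +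
      ennreal ((norm (f z))\<^sup>2) * indicator {z. S < \<bar>fst z\<bar>} z \<partial>cylinder)"
    by (intro mult_left_mono nn_integral_mono) (auto simp: truncation_def split: split_indicator)
  also have "\<dots> = ennreal (4 * pi\<^sup>2) * (tail_mass f R + tail_mass f S)"
    unfolding tail_mass_def nn_integral_add[OF measurable_tail[OF fm] measurable_tail[OF fm]] by (rule refl)
  finally show ?thesis .
qed

lemma tail_mass_tendsto:
  assumes f: "f \<in> L2_space cylinder"
  shows "(tail_mass f \<longlongrightarrow> 0) at_top"
proof (rule tendsto_at_topI_sequentially)
  fix X :: "nat \<Rightarrow> real" assume X: "filterlim X at_top sequentially"
  have fm[measurable]: "f \<in> borel_measurable cylinder" and f2: "(\<integral>\<^sup>+z. ennreal ((norm (f z))\<^sup>2) \<partial>cylinder) < \<infinity>"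
    using f by (simp_all add: L2_space_iff del: infinity_ennreal_def)
  have "(\<lambda>n. tail_mass f (X n)) \<longlonglongrightarrow> (\<integral>\<^sup>+z. 0 \<partial>cylinder)"
    unfolding tail_mass_def
  proof (rule nn_integral_dominated_convergence[where w = "\<lambda>z. ennreal ((norm (f z))\<^sup>2)"])
    show "AE z in cylinder. (\<lambda>n. ennreal ((norm (f z))\<^sup>2) * indicator {z. X n < \<bar>fst z\<bar>} z) \<longlonglongrightarrow> 0"
    proof (rule AE_I2)
      fix z :: "real \<times> real"
      have "\<forall>\<^sub>F n in sequentially. \<bar>fst z\<bar> \<le> X n" using X by (simp add: filterlim_at_top)
      hence "\<forall>\<^sub>F n in sequentially. ennreal ((norm (f z))\<^sup>2) * indicator {z. X n < \<bar>fst z\<bar>} z = 0"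
        by eventually_elim (simp add: not_less)
      thus "(\<lambda>n. ennreal ((norm (f z))\<^sup>2) * indicator {z. X n < \<bar>fst z\<bar>} z) \<longlonglongrightarrow> 0" by (rule tendsto_eventually)
    qed
  qed (use f2 measurable_tail[OF fm] in \<open>auto split: split_indicator\<close>)
  thus "(\<lambda>n. tail_mass f (X n)) \<longlonglongrightarrow> 0" by simp
qed

text \<open>The choice in \<open>fourier\<close> is meaningful only once a transform exists. Radii
  with tail mass at most 8^(-k) give truncations whose transforms converge almost everywhere.
  Fatou's lemma then bounds the squared L2 distance of F R to the limit by a multiple of the tail
  mass beyond R, for every R.\<close>

lemma is_fourier_transform_exists:
  assumes f: "f \<in> L2_space cylinder"
  shows "\<exists>g. is_fourier_transform f g"
proof -
  define F where "F = (\<lambda>R. fourier_integral (truncation R f))"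
  have Fm[measurable]: "F R \<in> borel_measurable dual_cylinder" for R
    unfolding F_def by (rule fourier_integral_Plancherel_le(1)[OF integrable_truncation[OF f]])
  have "\<exists>r. tail_mass f r \<le> ennreal ((1 / 8) ^ k)" for k :: nat
  proof -
    have "\<forall>\<^sub>F r in at_top. tail_mass f r < ennreal ((1 / 8) ^ k)"
      by (rule order_tendstoD(2)[OF tail_mass_tendsto[OF f]]) simp
    from eventually_happens[OF this] show ?thesis by (auto intro: less_imp_le)
  qed
  then obtain r where r: "\<And>k::nat. tail_mass f (r k) \<le> ennreal ((1 / 8) ^ k)" by metis
  define g where "g = (\<lambda>\<zeta>. lim (\<lambda>k. F (r k) \<zeta>))"
  have gm[measurable]: "g \<in> borel_measurable dual_cylinder" unfolding g_def by (rule borel_measurable_lim_metric) simp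
  have conv: "AE \<zeta> in dual_cylinder. (\<lambda>k. F (r k) \<zeta>) \<longlonglongrightarrow> g \<zeta>"
    unfolding g_def
  proof (rule AE_convergent_of_L2_increments[where c = "8 * pi\<^sup>2"])
    fix k
    have "(\<integral>\<^sup>+\<zeta>. ennreal ((norm (F (r (Suc k)) \<zeta> - F (r k) \<zeta>))\<^sup>2) \<partial>dual_cylinder) \<le>
        ennreal (4 * pi\<^sup>2) * (tail_mass f (r (Suc k)) + tail_mass f (r k))"
      unfolding F_def by (rule truncation_diff_le[OF f])
    also have "\<dots> \<le> ennreal (4 * pi\<^sup>2) * (ennreal ((1 / 8) ^ k) + ennreal ((1 / 8) ^ k))"
    proof (intro mult_left_mono add_mono r)
      have "ennreal ((1 / 8) ^ Suc k) \<le> ennreal ((1 / 8) ^ k)" by (intro ennreal_leI) simp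
      with r[of "Suc k"] show "tail_mass f (r (Suc k)) \<le> ennreal ((1 / 8) ^ k)" by (rule order_trans)
    qed simp
    also have "\<dots> = ennreal (8 * pi\<^sup>2 * (1 / 8) ^ k)"
    proof -
      have "ennreal (4 * pi\<^sup>2) * (ennreal ((1 / 8) ^ k) + ennreal ((1 / 8) ^ k)) = ennreal (4 * pi\<^sup>2 * ((1 / 8) ^ k + (1 / 8) ^ k))"
        by (simp only: ennreal_plus[symmetric] ennreal_mult[symmetric] zero_le_power zero_le_divide_1_iff zero_le_numeral add_nonneg_nonneg mult_nonneg_nonneg zero_le_power2)
      thus ?thesis by simp
    qed
    finally show "(\<integral>\<^sup>+\<zeta>. ennreal ((norm (F (r (Suc k)) \<zeta> - F (r k) \<zeta>))\<^sup>2) \<partial>dual_cylinder) \<le> ennreal (8 * pi\<^sup>2 * (1 / 8) ^ k)" .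
  qed simp_all
  have r0: "(\<lambda>k. tail_mass f (r k)) \<longlonglongrightarrow> 0"
  proof (rule tendsto_sandwich[OF _ _ tendsto_const])
    have "(\<lambda>k. ennreal ((1 / 8) ^ k)) \<longlonglongrightarrow> ennreal 0" by (intro tendsto_ennrealI LIMSEQ_power_zero) simp
    thus "(\<lambda>k. ennreal ((1 / 8) ^ k)) \<longlonglongrightarrow> 0" by simp
  qed (use r in auto)
  have FR: "(\<integral>\<^sup>+\<zeta>. ennreal ((norm (F R \<zeta> - g \<zeta>))\<^sup>2) \<partial>dual_cylinder) \<le> ennreal (4 * pi\<^sup>2) * tail_mass f R" for R
  proof -
    have "(\<integral>\<^sup>+\<zeta>. ennreal ((norm (F R \<zeta> - g \<zeta>))\<^sup>2) \<partial>dual_cylinder) =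
        (\<integral>\<^sup>+\<zeta>. liminf (\<lambda>k. ennreal ((norm (F R \<zeta> - F (r k) \<zeta>))\<^sup>2)) \<partial>dual_cylinder)"
    proof (rule nn_integral_cong_AE)
      show "AE \<zeta> in dual_cylinder. ennreal ((norm (F R \<zeta> - g \<zeta>))\<^sup>2) = liminf (\<lambda>k. ennreal ((norm (F R \<zeta> - F (r k) \<zeta>))\<^sup>2))"
        using conv
      proof eventually_elim
        case (elim \<zeta>)
        hence "(\<lambda>k. ennreal ((norm (F R \<zeta> - F (r k) \<zeta>))\<^sup>2)) \<longlonglongrightarrow> ennreal ((norm (F R \<zeta> - g \<zeta>))\<^sup>2)"
          by (intro tendsto_ennrealI tendsto_power tendsto_norm tendsto_diff tendsto_const)
        thus ?case by (intro lim_imp_Liminf[symmetric]) simp_all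
      qed
    qed
    also have "\<dots> \<le> liminf (\<lambda>k. \<integral>\<^sup>+\<zeta>. ennreal ((norm (F R \<zeta> - F (r k) \<zeta>))\<^sup>2) \<partial>dual_cylinder)"
      by (rule nn_integral_liminf) measurable
    also have "\<dots> \<le> liminf (\<lambda>k. ennreal (4 * pi\<^sup>2) * (tail_mass f R + tail_mass f (r k)))"
      unfolding F_def by (intro Liminf_mono always_eventually allI truncation_diff_le f)
    also have "\<dots> = ennreal (4 * pi\<^sup>2) * (tail_mass f R + 0)"
      by (intro lim_imp_Liminf ennreal_tendsto_cmult tendsto_add tendsto_const r0) simp_all
    finally show ?thesis by simp
  qed
  have lim: "((\<lambda>R. \<integral>\<^sup>+\<zeta>. ennreal ((norm (F R \<zeta> - g \<zeta>))\<^sup>2) \<partial>dual_cylinder) \<longlongrightarrow> 0) at_top"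
  proof (rule tendsto_sandwich[OF _ _ tendsto_const])
    have "((\<lambda>R. ennreal (4 * pi\<^sup>2) * tail_mass f R) \<longlongrightarrow> ennreal (4 * pi\<^sup>2) * 0) at_top"
      by (intro ennreal_tendsto_cmult tail_mass_tendsto f) simp
    thus "((\<lambda>R. ennreal (4 * pi\<^sup>2) * tail_mass f R) \<longlongrightarrow> 0) at_top" by simp
  qed (use FR in auto)
  \<comment> \<open>A single R at distance less than 1 from g already shows that g is in L2.\<close>
  have "\<forall>\<^sub>F R in at_top. (\<integral>\<^sup>+\<zeta>. ennreal ((norm (F R \<zeta> - g \<zeta>))\<^sup>2) \<partial>dual_cylinder) < 1"
    by (rule order_tendstoD(2)[OF lim]) simp
  from eventually_happens[OF this] obtain R where
    R: "(\<integral>\<^sup>+\<zeta>. ennreal ((norm (F R \<zeta> - g \<zeta>))\<^sup>2) \<partial>dual_cylinder) < 1" by auto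
  have "(\<integral>\<^sup>+\<zeta>. ennreal ((norm (F R \<zeta>))\<^sup>2) \<partial>dual_cylinder) \<le>
      ennreal (4 * pi\<^sup>2) * (\<integral>\<^sup>+z. ennreal ((norm (truncation R f z))\<^sup>2) \<partial>cylinder)"
    unfolding F_def by (rule fourier_integral_Plancherel_le(2)[OF integrable_truncation[OF f]])
  also have "\<dots> \<le> ennreal (4 * pi\<^sup>2) * (\<integral>\<^sup>+z. ennreal ((norm (f z))\<^sup>2) \<partial>cylinder)"
    by (intro mult_left_mono nn_integral_mono) (auto simp: truncation_def)
  also have "\<dots> < \<infinity>" using f by (simp add: L2_space_iff ennreal_mult_less_top)
  finally have FR2: "(\<integral>\<^sup>+\<zeta>. ennreal ((norm (F R \<zeta>))\<^sup>2) \<partial>dual_cylinder) < \<infinity>" .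
  have "(\<integral>\<^sup>+\<zeta>. ennreal ((norm (g \<zeta>))\<^sup>2) \<partial>dual_cylinder) \<le> 2 * (\<integral>\<^sup>+\<zeta>. ennreal ((norm (F R \<zeta>))\<^sup>2) \<partial>dual_cylinder) +
      2 * (\<integral>\<^sup>+\<zeta>. ennreal ((norm (F R \<zeta> - g \<zeta>))\<^sup>2) \<partial>dual_cylinder)"
    by (rule nn_integral_norm_sq_triangle) measurable
  also have "\<dots> < \<infinity>" using FR2 order_less_trans[OF R ennreal_one_less_top] by (simp add: ennreal_mult_less_top)
  finally have "g \<in> L2_space dual_cylinder" using gm by (simp add: L2_space_iff)
  moreover have "((\<lambda>R. Lp_norm 2 dual_cylinder (\<lambda>\<zeta>. F R \<zeta> - g \<zeta>)) \<longlongrightarrow> 0) at_top"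
    unfolding Lp_norm_2 by (rule ennpow_tendsto_0[OF lim]) simp
  ultimately have "is_fourier_transform f g"
    unfolding is_fourier_transform_def F_def truncation_def by blast
  thus ?thesis by blast
qed

text \<open>The chosen representative is known only through its defining property, so its norm is
  compared with that of a truncation by (a + b)^2 \<le> 2 a^2 + 2 b^2, and R is sent to infinity.
  The factor 2 turns 4 pi^2 into 8 pi^2, which is harmless.\<close>

lemma fourier_bound:
  assumes f: "f \<in> L2_space cylinder"
  shows "fourier f \<in> borel_measurable dual_cylinder"
    and "(\<integral>\<^sup>+\<zeta>. ennreal ((norm (fourier f \<zeta>))\<^sup>2) \<partial>dual_cylinder) \<le> ennreal (8 * pi\<^sup>2) * (\<integral>\<^sup>+z. ennreal ((norm (f z))\<^sup>2) \<partial>cylinder)"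
proof -
  have ft: "is_fourier_transform f (fourier f)"
    unfolding fourier_def by (rule someI_ex[OF is_fourier_transform_exists[OF f]])
  define F where "F = (\<lambda>R. fourier_integral (truncation R f))"
  have Fm[measurable]: "F R \<in> borel_measurable dual_cylinder" for R
    unfolding F_def by (rule fourier_integral_Plancherel_le(1)[OF integrable_truncation[OF f]])
  show gm[measurable]: "fourier f \<in> borel_measurable dual_cylinder"
    using ft by (simp add: is_fourier_transform_def L2_space_iff)
  have "((\<lambda>R. Lp_norm 2 dual_cylinder (\<lambda>\<zeta>. F R \<zeta> - fourier f \<zeta>)) \<longlongrightarrow> 0) at_top"
    using ft unfolding is_fourier_transform_def F_def truncation_def by blast
  from ennpow_tendsto_0[OF this, of 2]
  have lim: "((\<lambda>R. \<integral>\<^sup>+\<zeta>. ennreal ((norm (F R \<zeta> - fourier f \<zeta>))\<^sup>2) \<partial>dual_cylinder) \<longlongrightarrow> 0) at_top"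
    unfolding Lp_norm_2 ennpow_ennpow by (simp add: ennpow_one)
  have le: "(\<integral>\<^sup>+\<zeta>. ennreal ((norm (fourier f \<zeta>))\<^sup>2) \<partial>dual_cylinder) \<le> 2 * (ennreal (4 * pi\<^sup>2) * (\<integral>\<^sup>+z. ennreal ((norm (f z))\<^sup>2) \<partial>cylinder)) +
      2 * (\<integral>\<^sup>+\<zeta>. ennreal ((norm (F R \<zeta> - fourier f \<zeta>))\<^sup>2) \<partial>dual_cylinder)" for R
  proof -
    have "(\<integral>\<^sup>+\<zeta>. ennreal ((norm (F R \<zeta>))\<^sup>2) \<partial>dual_cylinder) \<le>
        ennreal (4 * pi\<^sup>2) * (\<integral>\<^sup>+z. ennreal ((norm (truncation R f z))\<^sup>2) \<partial>cylinder)"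
      unfolding F_def by (rule fourier_integral_Plancherel_le(2)[OF integrable_truncation[OF f]])
    also have "\<dots> \<le> ennreal (4 * pi\<^sup>2) * (\<integral>\<^sup>+z. ennreal ((norm (f z))\<^sup>2) \<partial>cylinder)"
      by (intro mult_left_mono nn_integral_mono) (auto simp: truncation_def)
    finally have 1: "(\<integral>\<^sup>+\<zeta>. ennreal ((norm (F R \<zeta>))\<^sup>2) \<partial>dual_cylinder) \<le> ennreal (4 * pi\<^sup>2) * (\<integral>\<^sup>+z. ennreal ((norm (f z))\<^sup>2) \<partial>cylinder)" .
    have "(\<integral>\<^sup>+\<zeta>. ennreal ((norm (fourier f \<zeta>))\<^sup>2) \<partial>dual_cylinder) \<le> 2 * (\<integral>\<^sup>+\<zeta>. ennreal ((norm (F R \<zeta>))\<^sup>2) \<partial>dual_cylinder) +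
        2 * (\<integral>\<^sup>+\<zeta>. ennreal ((norm (F R \<zeta> - fourier f \<zeta>))\<^sup>2) \<partial>dual_cylinder)"
      by (rule nn_integral_norm_sq_triangle) measurable
    also have "\<dots> \<le> 2 * (ennreal (4 * pi\<^sup>2) * (\<integral>\<^sup>+z. ennreal ((norm (f z))\<^sup>2) \<partial>cylinder)) +
        2 * (\<integral>\<^sup>+\<zeta>. ennreal ((norm (F R \<zeta> - fourier f \<zeta>))\<^sup>2) \<partial>dual_cylinder)"
      by (intro add_right_mono mult_left_mono 1) simp
    finally show ?thesis .
  qed
  have "((\<lambda>R. 2 * (ennreal (4 * pi\<^sup>2) * (\<integral>\<^sup>+z. ennreal ((norm (f z))\<^sup>2) \<partial>cylinder)) +
      2 * (\<integral>\<^sup>+\<zeta>. ennreal ((norm (F R \<zeta> - fourier f \<zeta>))\<^sup>2) \<partial>dual_cylinder)) \<longlongrightarrow>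
      2 * (ennreal (4 * pi\<^sup>2) * (\<integral>\<^sup>+z. ennreal ((norm (f z))\<^sup>2) \<partial>cylinder)) + 2 * 0) at_top"
    by (intro tendsto_add tendsto_const ennreal_tendsto_cmult lim) simp
  hence "(\<integral>\<^sup>+\<zeta>. ennreal ((norm (fourier f \<zeta>))\<^sup>2) \<partial>dual_cylinder) \<le>
      2 * (ennreal (4 * pi\<^sup>2) * (\<integral>\<^sup>+z. ennreal ((norm (f z))\<^sup>2) \<partial>cylinder)) + 2 * 0"
    by (rule tendsto_lowerbound) (auto simp: le)
  also have "\<dots> = ennreal (8 * pi\<^sup>2) * (\<integral>\<^sup>+z. ennreal ((norm (f z))\<^sup>2) \<partial>cylinder)"
  proof -
    have "(2::ennreal) * ennreal (4 * pi\<^sup>2) = ennreal 2 * ennreal (4 * pi\<^sup>2)" by simp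
    also have "\<dots> = ennreal (8 * pi\<^sup>2)" by (subst ennreal_mult[symmetric]) auto
    finally show ?thesis by (simp add: mult.assoc[symmetric])
  qed
  finally show "(\<integral>\<^sup>+\<zeta>. ennreal ((norm (fourier f \<zeta>))\<^sup>2) \<partial>dual_cylinder) \<le> ennreal (8 * pi\<^sup>2) * (\<integral>\<^sup>+z. ennreal ((norm (f z))\<^sup>2) \<partial>cylinder)" .
qed

text \<open>Open rays with integer endpoints form a countable subbase. The instance makes the
  Lindelof property available on \<open>real \<times> int\<close>, where the essential support
  lives.\<close>

instance int :: second_countable_topology
proof
  show "\<exists>B :: int set set. countable B \<and> open = generate_topology B"
    by (intro exI[of _ "range lessThan \<union> range greaterThan"]) (simp add: open_int_def)
qed

text \<open>The complement of the essential support is a union of possibly uncountably many open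
  sets on each of which g vanishes almost everywhere. By Lindelof countably many of them suffice,
  and then so do countably many null sets.\<close>

lemma AE_zero_outside_ess_support:
  fixes g :: "'a::second_countable_topology \<Rightarrow> complex"
  assumes "ess_support M g \<subseteq> S"
  shows "AE w in M. w \<notin> S \<longrightarrow> g w = 0"
proof -
  define \<U> where "\<U> = {U. open U \<and> (AE w in M. w \<in> U \<longrightarrow> g w = 0)}"
  obtain \<V> where V: "\<V> \<subseteq> \<U>" "countable \<V>" "\<Union>\<V> = \<Union>\<U>"
    using Lindelof[of \<U>] unfolding \<U>_def by blast
  have "AE w in M. \<forall>U\<in>\<V>. w \<in> U \<longrightarrow> g w = 0"
    using V by (subst AE_ball_countable) (auto simp: \<U>_def)
  thus ?thesis
  proof eventually_elim
    case (elim w)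
    show ?case
    proof
      assume "w \<notin> S"
      hence "w \<notin> ess_support M g" using assms by blast
      hence "w \<in> \<Union>\<U>" unfolding ess_support_def \<U>_def by blast
      thus "g w = 0" using elim V(3) by blast
    qed
  qed
qed

text \<open>Summability of complex families is absolute, so both sides fall back to the default
  value 0 in exactly the same cases. The sum in the propagator can thus be treated as an integral
  even at those \<xi> where it does not converge.\<close>

lemma infsum_eq_integral:
  fixes f :: "'a \<Rightarrow> complex"
  shows "infsum f A = (LINT k|count_space A. f k)"
proof (cases "(\<lambda>x. norm (f x)) summable_on A")
  case True
  hence "Infinite_Set_Sum.abs_summable_on f A" by (simp add: abs_summable_equivalent)
  from infsetsum_infsum[OF this] show ?thesis by (simp add: infsetsum_def)
next
  case False
  hence "\<not> f summable_on A" by (simp add: summable_on_iff_abs_summable_on_complex)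
  moreover have "\<not> integrable (count_space A) f"
    using False unfolding abs_summable_equivalent Infinite_Set_Sum.abs_summable_on_def .
  ultimately show ?thesis by (simp add: infsum_not_exists not_integrable_integral_eq)
qed

section \<open>The propagator as an extension operator, and its splitting into pieces\<close>

lemma measurable_dispersion_dual:
  "(\<lambda>\<zeta>. dispersion \<alpha> (fst \<zeta>) (of_int (snd \<zeta>))) \<in> borel_measurable dual_cylinder"
proof -
  have "(\<lambda>(\<xi>, \<eta>). dispersion \<alpha> \<xi> \<eta>) \<in> borel_measurable (borel \<Otimes>\<^sub>M borel)"
    unfolding dispersion_def by measurable
  from measurable_compose[OF measurable_Pair[OF measurable_fst_dual measurable_snd_dual] this]
  show ?thesis by simp
qed

text \<open>For almost every \<xi> the functions \<open>fourier f\<close> and g' agree at all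
  integers, so the iterated integrals coincide; integrability of g' then merges them into one
  integral by Fubini.\<close>

lemma propagator_eq_extension:
  assumes gm: "fourier f \<in> borel_measurable dual_cylinder" and g': "integrable dual_cylinder g'"
    and ae: "AE \<zeta> in dual_cylinder. fourier f \<zeta> = g' \<zeta>"
  shows "propagator \<alpha> t f z = 1 / (2 * of_real pi)\<^sup>2 *
    extension (\<lambda>\<zeta>. dispersion \<alpha> (fst \<zeta>) (of_int (snd \<zeta>))) g' (t, z)"
proof -
  obtain x y where z: "z = (x, y)" using prod.exhaust[of z thesis] by blast
  interpret I: sigma_finite_measure "count_space (UNIV :: int set)" by (rule sigma_finite_int)
  interpret D: pair_sigma_finite "lborel :: real measure" "count_space (UNIV :: int set)"
    by (rule pair_sigma_finite.intro[OF sigma_finite_lborel sigma_finite_int])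
  define E :: "real \<times> int \<Rightarrow> complex" where "E = (\<lambda>\<zeta>. cis (t * dispersion \<alpha> (fst \<zeta>) (of_int (snd \<zeta>)) + (x * fst \<zeta> + y * of_int (snd \<zeta>))))"
  have Em: "E \<in> borel_measurable dual_cylinder" unfolding E_def
    by (intro measurable_compose[OF _ borel_measurable_cis] borel_measurable_add borel_measurable_times
      borel_measurable_const measurable_dispersion_dual measurable_fst_dual measurable_snd_dual)
  have g'm: "g' \<in> borel_measurable dual_cylinder" using g' by auto
  have int: "integrable dual_cylinder (\<lambda>\<zeta>. g' \<zeta> * E \<zeta>)"
    by (rule Bochner_Integration.integrable_bound[OF g' borel_measurable_times[OF g'm Em]]) (simp add: norm_mult E_def)
  have ex: "exp (\<i> * of_real (x * \<xi> + y * of_int k + t * dispersion \<alpha> \<xi> (of_int k))) = E (\<xi>, k)" for \<xi> k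
  proof -
    have "exp (\<i> * of_real a) = cis a" for a by (simp add: cis_conv_exp)
    thus ?thesis by (simp only: E_def fst_conv snd_conv add.commute add.left_commute)
  qed
  have meas: "(\<lambda>\<xi>. LINT k|count_space UNIV. u (\<xi>, k) * E (\<xi>, k)) \<in> borel_measurable lborel"
    if "u \<in> borel_measurable dual_cylinder" for u
  proof (rule I.borel_measurable_lebesgue_integral)
    show "(\<lambda>(\<xi>, k). u (\<xi>, k) * E (\<xi>, k)) \<in> borel_measurable (lborel \<Otimes>\<^sub>M count_space UNIV)"
      using borel_measurable_times[OF that Em] by (simp add: dual_cylinder_def case_prod_beta')
  qed
  have "(LINT \<xi>|lborel. infsum (\<lambda>k. exp (\<i> * of_real (x * \<xi> + y * of_int k + t * dispersion \<alpha> \<xi> (of_int k))) * fourier f (\<xi>, k)) UNIV) =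
      (LINT \<xi>|lborel. LINT k|count_space UNIV. fourier f (\<xi>, k) * E (\<xi>, k))"
    unfolding ex infsum_eq_integral mult.commute[of "E _"] ..
  also have "\<dots> = (LINT \<xi>|lborel. LINT k|count_space UNIV. g' (\<xi>, k) * E (\<xi>, k))"
  proof (rule integral_cong_AE[OF meas[OF gm] meas[OF g'm]])
    have "AE \<xi> in lborel. AE k in count_space UNIV. fourier f (\<xi>, k) = g' (\<xi>, k)"
      using D.AE_pair[of "\<lambda>\<zeta>. fourier f \<zeta> = g' \<zeta>"] ae by (simp only: dual_cylinder_def)
    thus "AE \<xi> in lborel. (LINT k|count_space UNIV. fourier f (\<xi>, k) * E (\<xi>, k)) = (LINT k|count_space UNIV. g' (\<xi>, k) * E (\<xi>, k))"
      by eventually_elim (simp add: AE_count_space)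
  qed
  also have "\<dots> = (LINT \<zeta>|dual_cylinder. g' \<zeta> * E \<zeta>)"
    unfolding dual_cylinder_def by (rule D.integral_fst') (use int in \<open>simp add: dual_cylinder_def\<close>)
  finally show ?thesis unfolding z propagator_def extension_def E_def by simp
qed

text \<open>Cauchy-Schwarz against the constant 1, applied twice.\<close>

lemma norm_sum_power4_le:
  fixes a :: "'l \<Rightarrow> complex"
  assumes "finite L"
  shows "norm (\<Sum>l\<in>L. a l) ^ 4 \<le> real (card L) ^ 3 * (\<Sum>l\<in>L. norm (a l) ^ 4)"
proof -
  have sq: "(\<Sum>l\<in>L. u l)\<^sup>2 \<le> real (card L) * (\<Sum>l\<in>L. (u l)\<^sup>2)" for u :: "'l \<Rightarrow> real"
    using Cauchy_Schwarz_ineq_sum[of u "\<lambda>_. 1" L] by (simp add: mult.commute)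
  have "norm (\<Sum>l\<in>L. a l) ^ 4 \<le> (\<Sum>l\<in>L. norm (a l)) ^ 4" by (intro power_mono norm_sum) simp
  also have "\<dots> = ((\<Sum>l\<in>L. norm (a l))\<^sup>2)\<^sup>2" by simp
  also have "\<dots> \<le> (real (card L) * (\<Sum>l\<in>L. (norm (a l))\<^sup>2))\<^sup>2" by (intro power_mono sq) simp
  also have "\<dots> = (real (card L))\<^sup>2 * (\<Sum>l\<in>L. (norm (a l))\<^sup>2)\<^sup>2" by (rule power_mult_distrib)
  also have "\<dots> \<le> (real (card L))\<^sup>2 * (real (card L) * (\<Sum>l\<in>L. ((norm (a l))\<^sup>2)\<^sup>2))"
    by (intro mult_left_mono sq) simp
  also have "\<dots> = real (card L) ^ 3 * (\<Sum>l\<in>L. norm (a l) ^ 4)"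
    by (simp add: power2_eq_square power3_eq_cube power4_eq_xxxx mult.assoc)
  finally show ?thesis .
qed

lemma extension_sum:
  assumes w: "w \<in> borel_measurable dual_cylinder" and g: "\<And>l. l \<in> L \<Longrightarrow> integrable dual_cylinder (g l)"
  shows "extension w (\<lambda>\<zeta>. \<Sum>l\<in>L. g l \<zeta>) v = (\<Sum>l\<in>L. extension w (g l) v)"
proof -
  define E :: "real \<times> int \<Rightarrow> complex" where "E = (\<lambda>\<zeta>. cis (fst v * w \<zeta> + (fst (snd v) * fst \<zeta> + snd (snd v) * of_int (snd \<zeta>))))"
  have Em: "E \<in> borel_measurable dual_cylinder" unfolding E_def
    by (intro measurable_compose[OF _ borel_measurable_cis] borel_measurable_add borel_measurable_times
      borel_measurable_const w measurable_fst_dual measurable_snd_dual)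
  have "integrable dual_cylinder (\<lambda>\<zeta>. g l \<zeta> * E \<zeta>)" if "l \<in> L" for l
    by (rule Bochner_Integration.integrable_bound[OF g[OF that] borel_measurable_times[OF borel_measurable_integrable[OF g[OF that]] Em]])
      (simp add: norm_mult E_def)
  thus ?thesis
    unfolding extension_def E_def[symmetric] sum_distrib_right
    by (subst Bochner_Integration.integral_sum[symmetric]) (auto simp: E_def)
qed

text \<open>\<open>lab\<close> splits S into pieces on each of which the window bound holds. The
  loss is the cube of the number of pieces, from the fourth power of a sum, and one factor more from
  adding the pieces. It is tolerable because this number will grow only logarithmically in
  N.\<close>

lemma extension_L4_pieces:
  fixes lab :: "real \<times> int \<Rightarrow> 'l"
  assumes g: "integrable dual_cylinder g" and gS: "\<And>\<zeta>. \<zeta> \<notin> S \<Longrightarrow> g \<zeta> = 0"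
    and w: "w \<in> borel_measurable dual_cylinder"
    and L: "finite L" "lab ` S \<subseteq> L"
    and R: "\<And>l. l \<in> L \<Longrightarrow> {\<zeta>\<in>S. lab \<zeta> = l} \<in> sets dual_cylinder"
    and M: "\<And>l s k \<tau>. l \<in> L \<Longrightarrow> (\<integral>\<^sup>+k1. emeasure lborel {x. (x, k1) \<in> {\<zeta>\<in>S. lab \<zeta> = l} \<and>
        (s - x, k - k1) \<in> {\<zeta>\<in>S. lab \<zeta> = l} \<and> \<bar>w (x, k1) + w (s - x, k - k1) - \<tau>\<bar> \<le> 1} \<partial>count_space UNIV) \<le> M"
  shows "(\<integral>\<^sup>+t. \<integral>\<^sup>+z. ennreal (norm (extension w g (t, z)) ^ 4) \<partial>cylinder \<partial>restrict_space lborel {0..1}) \<le>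
     ennreal (real (card L) ^ 4) * (ennreal (192 * pi\<^sup>2) * M * (\<integral>\<^sup>+\<zeta>. ennreal ((norm (g \<zeta>))\<^sup>2) \<partial>dual_cylinder)\<^sup>2)"
proof -
  define P where "P = (\<lambda>l. {\<zeta>\<in>S. lab \<zeta> = l})"
  define G where "G = (\<lambda>l \<zeta>. indicator (P l) \<zeta> * g \<zeta> :: complex)"
  define B where "B = ennreal (192 * pi\<^sup>2) * M * (\<integral>\<^sup>+\<zeta>. ennreal ((norm (g \<zeta>))\<^sup>2) \<partial>dual_cylinder)\<^sup>2"
  have gm: "g \<in> borel_measurable dual_cylinder" using g by auto
  have Gi: "integrable dual_cylinder (G l)" if "l \<in> L" for l
  proof (rule Bochner_Integration.integrable_bound[OF g])
    show "G l \<in> borel_measurable dual_cylinder"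
      unfolding G_def using R[OF that] gm unfolding P_def by (intro borel_measurable_times borel_measurable_indicator)
  qed (simp add: G_def norm_mult split: split_indicator)
  have sum: "g = (\<lambda>\<zeta>. \<Sum>l\<in>L. G l \<zeta>)"
  proof
    fix \<zeta>
    show "g \<zeta> = (\<Sum>l\<in>L. G l \<zeta>)"
    proof (cases "\<zeta> \<in> S")
      case True
      hence "lab \<zeta> \<in> L" using L by blast
      have "(\<Sum>l\<in>L. G l \<zeta>) = (\<Sum>l\<in>L. if l = lab \<zeta> then g \<zeta> else 0)"
        using True by (intro sum.cong) (auto simp: G_def P_def)
      also have "\<dots> = g \<zeta>" using L \<open>lab \<zeta> \<in> L\<close> by simp
      finally show ?thesis ..
    qed (simp add: gS G_def)
  qed
  have each: "(\<integral>\<^sup>+t. \<integral>\<^sup>+z. ennreal (norm (extension w (G l) (t, z)) ^ 4) \<partial>cylinder \<partial>restrict_space lborel {0..1}) \<le> B"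
    if l: "l \<in> L" for l
  proof -
    have "(\<integral>\<^sup>+t. \<integral>\<^sup>+z. ennreal (norm (extension w (G l) (t, z)) ^ 4) \<partial>cylinder \<partial>restrict_space lborel {0..1}) \<le>
        ennreal (192 * pi\<^sup>2) * M * (\<integral>\<^sup>+\<zeta>. ennreal ((norm (G l \<zeta>))\<^sup>2) \<partial>dual_cylinder)\<^sup>2"
      by (rule bilinear_L4[OF Gi[OF l] _ w R[OF l] M[OF l]]) (auto simp: G_def P_def)
    also have "\<dots> \<le> B"
      unfolding B_def by (intro mult_left_mono power_mono nn_integral_mono) (auto simp: G_def norm_mult split: split_indicator)
    finally show ?thesis .
  qed
  interpret C: sigma_finite_measure cylinder by (rule sigma_finite_cylinder)
  have em: "(\<lambda>v. ennreal (norm (extension w (G l) v) ^ 4)) \<in> borel_measurable (lborel \<Otimes>\<^sub>M cylinder)" if l: "l \<in> L" for l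
  proof -
    have s: "snd \<in> borel_measurable cylinder"
      unfolding cylinder_torus by (rule measurable_compose[OF measurable_snd measurable_torus]) simp
    have f: "fst \<in> borel_measurable (lborel \<Otimes>\<^sub>M cylinder)"
      using measurable_fst[of "lborel :: real measure" cylinder] by simp
    have "extension w (G l) \<in> borel_measurable (lborel \<Otimes>\<^sub>M cylinder)"
      by (rule measurable_extension[OF borel_measurable_integrable[OF Gi[OF l]] w f
        measurable_compose[OF measurable_snd measurable_fst_cylinder] measurable_compose[OF measurable_snd s]])
    thus ?thesis by measurable
  qed
  have sec: "(\<lambda>z. ennreal (norm (extension w (G l) (t, z)) ^ 4)) \<in> borel_measurable cylinder" if "l \<in> L" for l t
    using measurable_compose[OF measurable_Pair1' em[OF that], of t] by simp
  have inner: "(\<lambda>t. \<integral>\<^sup>+z. ennreal (norm (extension w (G l) (t, z)) ^ 4) \<partial>cylinder) \<in> borel_measurable (restrict_space lborel {0..1})"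
    if "l \<in> L" for l
    using C.borel_measurable_nn_integral_fst[OF em[OF that]] by (intro measurable_restrict_space1) simp
  have "(\<integral>\<^sup>+t. \<integral>\<^sup>+z. ennreal (norm (extension w g (t, z)) ^ 4) \<partial>cylinder \<partial>restrict_space lborel {0..1}) \<le>
      (\<integral>\<^sup>+t. \<integral>\<^sup>+z. ennreal (real (card L) ^ 3) * (\<Sum>l\<in>L. ennreal (norm (extension w (G l) (t, z)) ^ 4)) \<partial>cylinder \<partial>restrict_space lborel {0..1})"
  proof (intro nn_integral_mono)
    fix t z
    have "norm (extension w g (t, z)) ^ 4 \<le> real (card L) ^ 3 * (\<Sum>l\<in>L. norm (extension w (G l) (t, z)) ^ 4)"
      by (subst sum, subst extension_sum[OF w Gi]) (simp_all add: norm_sum_power4_le[OF L(1)])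
    hence "ennreal (norm (extension w g (t, z)) ^ 4) \<le> ennreal (real (card L) ^ 3 * (\<Sum>l\<in>L. norm (extension w (G l) (t, z)) ^ 4))"
      by (rule ennreal_leI)
    also have "\<dots> = ennreal (real (card L) ^ 3) * (\<Sum>l\<in>L. ennreal (norm (extension w (G l) (t, z)) ^ 4))"
      by (subst ennreal_mult) (auto simp: sum_nonneg sum_ennreal)
    finally show "ennreal (norm (extension w g (t, z)) ^ 4) \<le> ennreal (real (card L) ^ 3) * (\<Sum>l\<in>L. ennreal (norm (extension w (G l) (t, z)) ^ 4))" .
  qed
  also have "\<dots> = ennreal (real (card L) ^ 3) * (\<Sum>l\<in>L. \<integral>\<^sup>+t. \<integral>\<^sup>+z. ennreal (norm (extension w (G l) (t, z)) ^ 4) \<partial>cylinder \<partial>restrict_space lborel {0..1})"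
  proof -
    have "(\<integral>\<^sup>+z. ennreal (real (card L) ^ 3) * (\<Sum>l\<in>L. ennreal (norm (extension w (G l) (t, z)) ^ 4)) \<partial>cylinder) =
        ennreal (real (card L) ^ 3) * (\<Sum>l\<in>L. \<integral>\<^sup>+z. ennreal (norm (extension w (G l) (t, z)) ^ 4) \<partial>cylinder)" for t
      using sec by (subst nn_integral_cmult) (auto simp: nn_integral_sum simp del: sum_ennreal)
    moreover have "(\<integral>\<^sup>+t. ennreal (real (card L) ^ 3) * (\<Sum>l\<in>L. \<integral>\<^sup>+z. ennreal (norm (extension w (G l) (t, z)) ^ 4) \<partial>cylinder) \<partial>restrict_space lborel {0..1}) =
        ennreal (real (card L) ^ 3) * (\<Sum>l\<in>L. \<integral>\<^sup>+t. \<integral>\<^sup>+z. ennreal (norm (extension w (G l) (t, z)) ^ 4) \<partial>cylinder \<partial>restrict_space lborel {0..1})"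
      using inner by (subst nn_integral_cmult) (auto simp: nn_integral_sum simp del: sum_ennreal)
    ultimately show ?thesis by simp
  qed
  also have "\<dots> \<le> ennreal (real (card L) ^ 3) * (\<Sum>l\<in>L. B)"
    by (intro mult_left_mono sum_mono each) simp_all
  also have "\<dots> = ennreal (real (card L) ^ 4) * B"
  proof -
    have "ennreal (real (card L) ^ 3) * of_nat (card L) = ennreal (real (card L) ^ 4)"
      by (simp add: ennreal_of_nat_eq_real_of_nat ennreal_mult[symmetric] power3_eq_cube power4_eq_xxxx)
    thus ?thesis by (simp add: mult.assoc[symmetric])
  qed
  finally show ?thesis by (simp only: B_def)
qed

lemma integrable_of_L2_finite_support:
  fixes g :: "'a \<Rightarrow> complex"
  assumes g[measurable]: "g \<in> borel_measurable M" and g2: "(\<integral>\<^sup>+z. ennreal ((norm (g z))\<^sup>2) \<partial>M) < \<infinity>"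
    and S[measurable]: "S \<in> sets M" and fin: "emeasure M S < \<infinity>"
  shows "integrable M (\<lambda>z. indicator S z * g z)"
proof (rule integrableI_bounded)
  have "(\<integral>\<^sup>+z. ennreal (norm (indicator S z * g z)) \<partial>M) \<le> (\<integral>\<^sup>+z. indicator S z + ennreal ((norm (g z))\<^sup>2) \<partial>M)"
  proof (rule nn_integral_mono)
    fix z
    have "norm (g z) \<le> 1 + (norm (g z))\<^sup>2"
      using sum_squares_bound[of 1 "norm (g z)"] norm_ge_zero[of "g z"] unfolding power_one mult_1_right by linarith
    from ennreal_leI[OF this] have "ennreal (norm (g z)) \<le> 1 + ennreal ((norm (g z))\<^sup>2)"
      by (simp add: ennreal_plus)
    thus "ennreal (norm (indicator S z * g z)) \<le> indicator S z + ennreal ((norm (g z))\<^sup>2)"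
      by (simp split: split_indicator)
  qed
  also have "\<dots> = emeasure M S + (\<integral>\<^sup>+z. ennreal ((norm (g z))\<^sup>2) \<partial>M)"
    by (subst nn_integral_add) auto
  also have "\<dots> < \<infinity>" using fin g2 by (simp add: less_top)
  finally show "(\<integral>\<^sup>+z. ennreal (norm (indicator S z * g z)) \<partial>M) < \<infinity>" .
qed simp

text \<open>Cutting \<open>fourier f\<close> off outside S changes it on a null set only, and finite
  measure of S makes the result integrable, so that the extension operator applies. The prefactor (2
  pi)^(-2) is estimated by 1.\<close>

lemma propagator_L4_pieces:
  fixes lab :: "real \<times> int \<Rightarrow> 'l"
  assumes f: "f \<in> L2_space cylinder" and supp: "ess_support dual_cylinder (fourier f) \<subseteq> S"
    and S: "S \<in> sets dual_cylinder" "emeasure dual_cylinder S < \<infinity>"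
    and w: "w = (\<lambda>\<zeta>. dispersion \<alpha> (fst \<zeta>) (of_int (snd \<zeta>)))"
    and L: "finite L" "lab ` S \<subseteq> L"
    and R: "\<And>l. l \<in> L \<Longrightarrow> {\<zeta>\<in>S. lab \<zeta> = l} \<in> sets dual_cylinder"
    and M: "\<And>l s k \<tau>. l \<in> L \<Longrightarrow> (\<integral>\<^sup>+k1. emeasure lborel {x. (x, k1) \<in> {\<zeta>\<in>S. lab \<zeta> = l} \<and>
        (s - x, k - k1) \<in> {\<zeta>\<in>S. lab \<zeta> = l} \<and> \<bar>w (x, k1) + w (s - x, k - k1) - \<tau>\<bar> \<le> 1} \<partial>count_space UNIV) \<le> M"
  shows "(\<integral>\<^sup>+t. \<integral>\<^sup>+z. ennreal (norm (propagator \<alpha> t f z) ^ 4) \<partial>cylinder \<partial>restrict_space lborel {0..1}) \<le>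
     ennreal (real (card L) ^ 4) * (ennreal (192 * pi\<^sup>2) * M * (ennreal (8 * pi\<^sup>2) * (\<integral>\<^sup>+z. ennreal ((norm (f z))\<^sup>2) \<partial>cylinder))\<^sup>2)"
proof -
  define g where "g = (\<lambda>\<zeta>. indicator S \<zeta> * fourier f \<zeta>)"
  have fm: "fourier f \<in> borel_measurable dual_cylinder" by (rule fourier_bound(1)[OF f])
  have f2: "(\<integral>\<^sup>+\<zeta>. ennreal ((norm (fourier f \<zeta>))\<^sup>2) \<partial>dual_cylinder) \<le> ennreal (8 * pi\<^sup>2) * (\<integral>\<^sup>+z. ennreal ((norm (f z))\<^sup>2) \<partial>cylinder)"
    by (rule fourier_bound(2)[OF f])
  also have "\<dots> < \<infinity>" using f by (simp add: L2_space_iff ennreal_mult_less_top)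
  finally have fin: "(\<integral>\<^sup>+\<zeta>. ennreal ((norm (fourier f \<zeta>))\<^sup>2) \<partial>dual_cylinder) < \<infinity>" .
  have gi: "integrable dual_cylinder g"
    unfolding g_def by (rule integrable_of_L2_finite_support[OF fm fin S])
  have ae: "AE \<zeta> in dual_cylinder. fourier f \<zeta> = g \<zeta>"
    using AE_zero_outside_ess_support[OF supp] by eventually_elim (auto simp: g_def)
  have wm: "w \<in> borel_measurable dual_cylinder" unfolding w by (rule measurable_dispersion_dual)
  have "norm (propagator \<alpha> t f z) \<le> norm (extension w g (t, z))" for t z
  proof -
    have "1 \<le> (2 * pi)\<^sup>2" using pi_gt3 by (intro one_le_power) linarith
    hence "norm (1 / (2 * of_real pi)\<^sup>2 :: complex) \<le> 1" by (simp add: norm_divide norm_mult norm_power)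
    from mult_right_mono[OF this norm_ge_zero[of "extension w g (t, z)"]] show ?thesis
      unfolding propagator_eq_extension[OF fm gi ae] w[symmetric] norm_mult by simp
  qed
  hence "(\<integral>\<^sup>+t. \<integral>\<^sup>+z. ennreal (norm (propagator \<alpha> t f z) ^ 4) \<partial>cylinder \<partial>restrict_space lborel {0..1}) \<le>
      (\<integral>\<^sup>+t. \<integral>\<^sup>+z. ennreal (norm (extension w g (t, z)) ^ 4) \<partial>cylinder \<partial>restrict_space lborel {0..1})"
    by (intro nn_integral_mono ennreal_leI power_mono) auto
  also have "\<dots> \<le> ennreal (real (card L) ^ 4) * (ennreal (192 * pi\<^sup>2) * M * (\<integral>\<^sup>+\<zeta>. ennreal ((norm (g \<zeta>))\<^sup>2) \<partial>dual_cylinder)\<^sup>2)"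
    by (rule extension_L4_pieces[OF gi _ wm L R M]) (simp_all add: g_def)
  also have "\<dots> \<le> ennreal (real (card L) ^ 4) * (ennreal (192 * pi\<^sup>2) * M * (ennreal (8 * pi\<^sup>2) * (\<integral>\<^sup>+z. ennreal ((norm (f z))\<^sup>2) \<partial>cylinder))\<^sup>2)"
  proof (intro mult_left_mono power_mono)
    have "(\<integral>\<^sup>+\<zeta>. ennreal ((norm (g \<zeta>))\<^sup>2) \<partial>dual_cylinder) \<le> (\<integral>\<^sup>+\<zeta>. ennreal ((norm (fourier f \<zeta>))\<^sup>2) \<partial>dual_cylinder)"
      by (intro nn_integral_mono) (auto simp: g_def norm_mult split: split_indicator)
    also note f2
    finally show "(\<integral>\<^sup>+\<zeta>. ennreal ((norm (g \<zeta>))\<^sup>2) \<partial>dual_cylinder) \<le> ennreal (8 * pi\<^sup>2) * (\<integral>\<^sup>+z. ennreal ((norm (f z))\<^sup>2) \<partial>cylinder)" .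
  qed simp_all
  finally show ?thesis .
qed

section \<open>Measurability and finite measure of the frequency region\<close>

lemma sets_dual_cylinderI:
  assumes "\<And>k. {x. (x, k) \<in> A} \<in> sets borel"
  shows "A \<in> sets dual_cylinder"
proof -
  have "A = (\<Union>k. {x. (x, k) \<in> A} \<times> {k})" by auto
  also have "\<dots> \<in> sets dual_cylinder"
    unfolding dual_cylinder_def using assms by (intro sets.countable_UN' pair_measureI) auto
  finally show ?thesis .
qed

text \<open>The measure may depend on A, but only its finiteness enters, to make the frequency data
  integrable; no constant of the estimate is taken from here.\<close>

lemma frequency_region_measure:
  assumes "0 < c1" "0 < N"
  shows "frequency_region c1 c2 c3 \<alpha> N A \<in> sets dual_cylinder"
    and "emeasure dual_cylinder (frequency_region c1 c2 c3 \<alpha> N A) < \<infinity>"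
proof -
  show S: "frequency_region c1 c2 c3 \<alpha> N A \<in> sets dual_cylinder"
    by (rule sets_dual_cylinderI) (simp add: frequency_region_def)
  define K where "K = \<lceil>(\<bar>A\<bar> + c3 * N powr (\<alpha> / 2)) * (c2 * N)\<rceil>"
  have sub: "frequency_region c1 c2 c3 \<alpha> N A \<subseteq> {- (c2 * N)..c2 * N} \<times> {- K..K}"
  proof
    fix \<zeta> assume z: "\<zeta> \<in> frequency_region c1 c2 c3 \<alpha> N A"
    obtain \<xi> k where \<zeta>: "\<zeta> = (\<xi>, k)" using prod.exhaust[of \<zeta> thesis] by blast
    have 1: "c1 * N \<le> \<bar>\<xi>\<bar>" "\<bar>\<xi>\<bar> \<le> c2 * N" "\<bar>of_int k / \<xi> - A\<bar> \<le> c3 * N powr (\<alpha> / 2)"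
      using z by (simp_all add: \<zeta> frequency_region_def)
    \<comment> \<open>Excludes \<xi> = 0, where the quotient would take the default value 0 and
      leave \<eta> unbounded.\<close>
    have "0 < c1 * N" using assms by simp
    hence \<xi>: "\<xi> \<noteq> 0" using 1(1) by auto
    have "\<bar>of_int k / \<xi>\<bar> \<le> \<bar>A\<bar> + c3 * N powr (\<alpha> / 2)" using 1(3) by linarith
    hence "\<bar>of_int k / \<xi>\<bar> * \<bar>\<xi>\<bar> \<le> (\<bar>A\<bar> + c3 * N powr (\<alpha> / 2)) * (c2 * N)"
      using 1(2) by (intro mult_mono) linarith+
    hence "\<bar>of_int k\<bar> \<le> (\<bar>A\<bar> + c3 * N powr (\<alpha> / 2)) * (c2 * N)" using \<xi> by (simp add: abs_divide)
    hence "real_of_int \<bar>k\<bar> \<le> of_int K" unfolding K_def of_int_abs using le_of_int_ceiling order_trans by blast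
    hence "\<bar>k\<bar> \<le> K" by linarith
    thus "\<zeta> \<in> {- (c2 * N)..c2 * N} \<times> {- K..K}" using 1(2) by (auto simp: \<zeta> abs_le_iff)
  qed
  have "emeasure dual_cylinder (frequency_region c1 c2 c3 \<alpha> N A) \<le> emeasure dual_cylinder ({- (c2 * N)..c2 * N} \<times> {- K..K})"
    by (rule emeasure_mono[OF sub]) (simp add: dual_cylinder_def pair_measureI)
  also have "\<dots> = emeasure lborel {- (c2 * N)..c2 * N} * emeasure (count_space UNIV) {- K..K}"
    unfolding dual_cylinder_def by (rule sigma_finite_measure.emeasure_pair_measure_Times[OF sigma_finite_int]) auto
  also have "\<dots> < \<infinity>" by (auto simp: emeasure_lborel_Icc_eq ennreal_mult_less_top of_nat_less_top)
  finally show "emeasure dual_cylinder (frequency_region c1 c2 c3 \<alpha> N A) < \<infinity>" .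
qed

section \<open>Decomposition of the frequency region\<close>

text \<open>Q is the sum of 6 and of bounds for each weight and its reciprocal on [p/2, 2r]; all
  summands being nonnegative, Q dominates each of them. The factor 4 in the last summand covers
  \<alpha> + 2 in the derivative of x^(-\<alpha>-2).\<close>

lemma dispersion_range_exists:
  assumes alpha: "1 \<le> \<alpha>" "\<alpha> \<le> 2" and p: "0 < p" "p \<le> r"
  shows "\<exists>Q. dispersion_range \<alpha> p r Q"
proof -
  define a b where "a = p / 2" and "b = 2 * r"
  have ab: "0 < a" "a \<le> b" using p by (simp_all add: a_def b_def)
  hence b: "0 < b" by simp
  define Q where "Q = 6 + b + 1 / a + b\<^sup>2 + 1 / a\<^sup>2 + b powr (\<alpha> - 1) + 1 / a powr (\<alpha> - 1) + b powr (\<alpha> + 2) +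
    1 / a powr (\<alpha> + 2) + b powr (\<alpha> + 3) + 4 * (1 / a powr (\<alpha> + 3))"
  have nn: "0 \<le> b" "0 \<le> 1 / a" "0 \<le> b\<^sup>2" "0 \<le> 1 / a\<^sup>2" "0 \<le> b powr (\<alpha> - 1)" "0 \<le> 1 / a powr (\<alpha> - 1)"
    "0 \<le> b powr (\<alpha> + 2)" "0 \<le> 1 / a powr (\<alpha> + 2)" "0 \<le> b powr (\<alpha> + 3)" "0 \<le> 1 / a powr (\<alpha> + 3)"
    using ab b by simp_all
  have Qs: "6 \<le> Q" "b \<le> Q" "1 / a \<le> Q" "b\<^sup>2 \<le> Q" "1 / a\<^sup>2 \<le> Q" "b powr (\<alpha> - 1) \<le> Q" "1 / a powr (\<alpha> - 1) \<le> Q"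
    "b powr (\<alpha> + 2) \<le> Q" "1 / a powr (\<alpha> + 2) \<le> Q" "b powr (\<alpha> + 3) \<le> Q" "4 * (1 / a powr (\<alpha> + 3)) \<le> Q"
    unfolding Q_def using nn by linarith+
  have Q0: "0 < Q" using Qs(1) by simp
  have sandwich: "1 / Q \<le> u \<and> u \<le> Q" if "lo \<le> u" "u \<le> hi" "0 < lo" "1 / lo \<le> Q" "hi \<le> Q" for lo u hi :: real
  proof
    have "1 / Q \<le> 1 / (1 / lo)" using that(3,4) Q0 by (intro divide_left_mono) auto
    thus "1 / Q \<le> u" using that(1) by simp
    show "u \<le> Q" using that(2,5) by simp
  qed
  have powr_range: "a powr s \<le> x powr s" "x powr s \<le> b powr s" if "a \<le> x" "x \<le> b" "0 \<le> s" for x s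
    using that ab by (auto intro!: powr_mono2)
  have "dispersion_range \<alpha> p r Q"
  proof
    show "1 \<le> \<alpha>" "\<alpha> \<le> 2" "0 < p" "p \<le> r" "6 \<le> Q" using alpha p Qs by simp_all
  next
    fix x assume x: "p / 2 \<le> x" "x \<le> 2 * r"
    hence x': "a \<le> x" "x \<le> b" by (simp_all add: a_def b_def)
    have x0: "0 < x" using x' ab by simp
    show "1 / Q \<le> x \<and> x \<le> Q" by (rule sandwich[OF x' ab(1) Qs(3,2)])
    show "1 / Q \<le> 1 / x\<^sup>2 \<and> 1 / x\<^sup>2 \<le> Q"
    proof (rule sandwich[of "1 / b\<^sup>2" _ "1 / a\<^sup>2"])
      show "1 / b\<^sup>2 \<le> 1 / x\<^sup>2" using x' x0 by (intro divide_left_mono power_mono) auto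
      show "1 / x\<^sup>2 \<le> 1 / a\<^sup>2" using x' x0 ab by (intro divide_left_mono power_mono) auto
    qed (use Qs b in auto)
    show "1 / Q \<le> x powr (\<alpha> - 1) \<and> x powr (\<alpha> - 1) \<le> Q"
      using powr_range[OF x', of "\<alpha> - 1"] alpha ab Qs by (intro sandwich[of "a powr (\<alpha> - 1)" _ "b powr (\<alpha> - 1)"]) auto
    show "1 / Q \<le> 1 / x powr (\<alpha> + 2) \<and> 1 / x powr (\<alpha> + 2) \<le> Q"
    proof (rule sandwich[of "1 / b powr (\<alpha> + 2)" _ "1 / a powr (\<alpha> + 2)"])
      show "1 / b powr (\<alpha> + 2) \<le> 1 / x powr (\<alpha> + 2)" "1 / x powr (\<alpha> + 2) \<le> 1 / a powr (\<alpha> + 2)"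
        using powr_range[OF x', of "\<alpha> + 2"] alpha x0 ab b by (auto intro!: divide_left_mono)
    qed (use Qs b in auto)
  next
    fix x y assume xy: "p / 2 \<le> x" "x \<le> y" "y \<le> 2 * r"
    show "(y - x) / Q \<le> 1 / x powr (\<alpha> + 2) - 1 / y powr (\<alpha> + 2) \<and> 1 / x powr (\<alpha> + 2) - 1 / y powr (\<alpha> + 2) \<le> Q * (y - x)"
    proof (cases "x = y")
      case False
      hence lt: "x < y" using xy by simp
      have x0: "0 < x" using xy p by simp
      have "\<exists>z>x. z < y \<and> y powr (- (\<alpha> + 2)) - x powr (- (\<alpha> + 2)) = (y - x) * (- (\<alpha> + 2) * z powr (- (\<alpha> + 2) - 1))"
      proof (rule MVT2[OF lt])
        fix z assume z: "x \<le> z" "z \<le> y"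
        show "((\<lambda>z. z powr (- (\<alpha> + 2))) has_real_derivative - (\<alpha> + 2) * z powr (- (\<alpha> + 2) - 1)) (at z)"
          using has_real_derivative_powr[of z "- (\<alpha> + 2)"] x0 z by simp
      qed
      then obtain z where z: "x < z" "z < y"
        and eq: "y powr (- (\<alpha> + 2)) - x powr (- (\<alpha> + 2)) = (y - x) * (- (\<alpha> + 2) * z powr (- (\<alpha> + 2) - 1))" by blast
      define t where "t = 1 / z powr (\<alpha> + 3)"
      have zt: "z powr (- (\<alpha> + 2) - 1) = t"
        unfolding t_def powr_minus_divide[symmetric] by (simp add: algebra_simps)
      have eq': "1 / x powr (\<alpha> + 2) - 1 / y powr (\<alpha> + 2) = (y - x) * ((\<alpha> + 2) * t)"
        using eq unfolding zt powr_minus_divide by (simp add: algebra_simps)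
      have zr: "a \<le> z" "z \<le> b" using z xy by (simp_all add: a_def b_def)
      have z0: "0 < z" using z x0 by simp
      have "1 / b powr (\<alpha> + 3) \<le> t" "t \<le> 1 / a powr (\<alpha> + 3)"
        unfolding t_def using powr_range[OF zr, of "\<alpha> + 3"] alpha z0 ab b by (auto intro!: divide_left_mono)
      moreover have "1 / Q \<le> 1 / b powr (\<alpha> + 3)" using Qs(10) b Q0 by (intro divide_left_mono) auto
      ultimately have t: "1 / Q \<le> t" "t \<le> 1 / a powr (\<alpha> + 3)" by linarith+
      have t0: "0 < t" using z0 by (simp add: t_def)
      have "1 * t \<le> (\<alpha> + 2) * t" "(\<alpha> + 2) * t \<le> 4 * t" using alpha t0 by (intro mult_right_mono; simp)+
      hence "1 / Q \<le> (\<alpha> + 2) * t" "(\<alpha> + 2) * t \<le> Q" using t Qs(11) by linarith+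
      hence "(y - x) * (1 / Q) \<le> (y - x) * ((\<alpha> + 2) * t)" "(y - x) * ((\<alpha> + 2) * t) \<le> (y - x) * Q"
        using lt by (intro mult_left_mono; simp)+
      thus ?thesis unfolding eq' by (simp add: mult.commute)
    qed simp
  qed
  thus ?thesis ..
qed

text \<open>The exponent 1 + \<alpha>/2 for \<eta> is the one for which \<eta>^2/\<xi> scales like
  \<xi> |\<xi>|^\<alpha> under \<xi> = N x.\<close>

lemma dispersion_scaling:
  assumes "0 < N"
  shows "dispersion \<alpha> \<xi> \<eta> = N powr (\<alpha> + 1) * dispersion \<alpha> (\<xi> / N) (N powr (- (1 + \<alpha> / 2)) * \<eta>)"
proof -
  have 1: "\<xi> * \<bar>\<xi>\<bar> powr \<alpha> = N powr (\<alpha> + 1) * (\<xi> / N * \<bar>\<xi> / N\<bar> powr \<alpha>)"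
    using assms by (simp add: powr_add powr_divide abs_divide)
  have "N powr (\<alpha> + 1) * ((N powr (- (1 + \<alpha> / 2)))\<^sup>2 * N) = N powr ((\<alpha> + 1) + (- (1 + \<alpha> / 2) + - (1 + \<alpha> / 2) + 1))"
    using assms unfolding powr_add[of N] power2_eq_square by simp
  also have "\<dots> = 1" using assms by simp
  finally have 2: "N powr (\<alpha> + 1) * ((N powr (- (1 + \<alpha> / 2)))\<^sup>2 * N) = 1" .
  have "N powr (\<alpha> + 1) * ((N powr (- (1 + \<alpha> / 2)) * \<eta>)\<^sup>2 / (\<xi> / N)) =
      (N powr (\<alpha> + 1) * ((N powr (- (1 + \<alpha> / 2)))\<^sup>2 * N)) * (\<eta>\<^sup>2 / \<xi>)"
    by (simp add: power_mult_distrib)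
  hence 3: "\<eta>\<^sup>2 / \<xi> = N powr (\<alpha> + 1) * ((N powr (- (1 + \<alpha> / 2)) * \<eta>)\<^sup>2 / (\<xi> / N))" unfolding 2 mult_1_left by (rule sym)
  show ?thesis unfolding dispersion_def right_diff_distrib 1[symmetric] 3[symmetric] ..
qed

text \<open>Oddness in x and evenness in \<eta> reduce every sign pattern to the quadrant x > 0,
  \<eta> \<ge> 0 of the counting lemmas.\<close>

lemma dispersion_sign:
  assumes "s = 1 \<or> s = - 1" "s' = 1 \<or> s' = - 1"
  shows "dispersion \<alpha> (s * x) (s' * e) = s * dispersion \<alpha> x e"
  using assms by (auto simp: dispersion_def)

section \<open>Scaling of the window measures\<close>

lemma measurable_pair_slice:
  assumes P: "\<And>e. {x. (x, e) \<in> P} \<in> sets borel"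
  shows "pair_slice \<alpha> P X H \<tau> \<delta> h e \<in> sets borel"
proof -
  have 1: "{x. (X - x, H - e) \<in> P} \<in> sets borel"
  proof -
    have "(\<lambda>x. X - x) -` {y. (y, H - e) \<in> P} \<inter> space borel \<in> sets borel"
      by (rule measurable_sets[OF _ P]) measurable
    thus ?thesis by (simp add: vimage_def)
  qed
  have 2: "{x. \<bar>dispersion \<alpha> x e + dispersion \<alpha> (X - x) (H - e) - \<tau>\<bar> \<le> \<delta>} \<in> sets borel"
    unfolding dispersion_def by measurable
  have "pair_slice \<alpha> P X H \<tau> \<delta> h e = {x. (x, e) \<in> P} \<inter> ({x. (X - x, H - e) \<in> P} \<inter>
      {x. \<bar>dispersion \<alpha> x e + dispersion \<alpha> (X - x) (H - e) - \<tau>\<bar> \<le> \<delta>})"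
    unfolding pair_slice_def by blast
  thus ?thesis using P[of e] 1 2 by simp
qed

lemma emeasure_lborel_vimage_mult:
  fixes c :: real
  assumes "c \<noteq> 0" "A \<in> sets borel"
  shows "emeasure lborel {x. c * x \<in> A} = ennreal (inverse \<bar>c\<bar>) * emeasure lborel A"
proof -
  have "emeasure lborel {x. c * x \<in> A} = emeasure (distr lborel borel ((*) c)) A"
    using assms by (subst emeasure_distr) (auto simp: vimage_def)
  also have "\<dots> = emeasure (density lborel (\<lambda>_. ennreal (inverse \<bar>c\<bar>))) A"
    by (simp add: lborel_distr_mult[OF assms(1)])
  also have "\<dots> = ennreal (inverse \<bar>c\<bar>) * emeasure lborel A"
    using assms(2) by (intro emeasure_density_const) simp
  finally show ?thesis .
qed

text \<open>The signs s and si are common to all frequencies of R, so that sums of frequencies go to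
  sums of rescaled frequencies. The unit window shrinks to N^(-\<alpha>-1) \<le> \<delta>, the
  substitution in x contributes the factor N, and multiplication by si permutes the
  integers.\<close>

lemma window_scaling:
  fixes si :: int
  assumes N: "0 < N" and s: "s = 1 \<or> s = - 1" and si: "si = 1 \<or> si = - 1"
    and h: "h = N powr (- (1 + \<alpha> / 2))" and \<delta>: "N powr (- (\<alpha> + 1)) \<le> \<delta>"
    and R: "\<And>\<xi> k. (\<xi>, k) \<in> R \<Longrightarrow> (s * \<xi> / N, h * of_int (si * k)) \<in> P"
    and P: "\<And>e. {x. (x, e) \<in> P} \<in> sets borel"
    and B: "\<And>X H \<tau>. (\<integral>\<^sup>+k. emeasure lborel (pair_slice \<alpha> P X H \<tau> \<delta> h (h * of_int k)) \<partial>count_space UNIV) \<le> B"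
    and w: "w = (\<lambda>\<zeta>. dispersion \<alpha> (fst \<zeta>) (of_int (snd \<zeta>)))"
  shows "(\<integral>\<^sup>+k1. emeasure lborel {x. (x, k1) \<in> R \<and> (S - x, k - k1) \<in> R \<and>
    \<bar>w (x, k1) + w (S - x, k - k1) - \<tau>\<bar> \<le> 1} \<partial>count_space UNIV) \<le> ennreal N * B"
proof -
  define A where "A = (\<lambda>l::int. pair_slice \<alpha> P (s * S / N) (h * of_int (si * k)) (s * \<tau> * N powr (- (\<alpha> + 1))) \<delta> h (h * of_int l))"
  define \<nu> where "\<nu> = N powr (- (\<alpha> + 1))"
  have \<nu>: "0 < \<nu>" "N powr (\<alpha> + 1) = 1 / \<nu>" using N unfolding \<nu>_def powr_minus_divide by simp_all
  have ws: "s * \<nu> * w (\<xi>, l) = dispersion \<alpha> (s * \<xi> / N) (h * of_int (si * l))" for \<xi> l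
  proof -
    have "w (\<xi>, l) = 1 / \<nu> * dispersion \<alpha> (\<xi> / N) (h * of_int l)"
      unfolding w fst_conv snd_conv h \<nu>(2)[symmetric] by (rule dispersion_scaling[OF N])
    moreover have "dispersion \<alpha> (s * (\<xi> / N)) (of_int si * (h * of_int l)) = s * dispersion \<alpha> (\<xi> / N) (h * of_int l)"
      by (rule dispersion_sign) (use s si in auto)
    moreover have "s * (\<xi> / N) = s * \<xi> / N" "of_int si * (h * of_int l) = h * of_int (si * l)" by simp_all
    ultimately show ?thesis using \<nu> by simp
  qed
  have sub: "{x. (x, k1) \<in> R \<and> (S - x, k - k1) \<in> R \<and> \<bar>w (x, k1) + w (S - x, k - k1) - \<tau>\<bar> \<le> 1} \<subseteq>
      {x. (s / N) * x \<in> A (si * k1)}" for k1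
  proof
    fix x assume "x \<in> {x. (x, k1) \<in> R \<and> (S - x, k - k1) \<in> R \<and> \<bar>w (x, k1) + w (S - x, k - k1) - \<tau>\<bar> \<le> 1}"
    hence x: "(x, k1) \<in> R" "(S - x, k - k1) \<in> R" "\<bar>w (x, k1) + w (S - x, k - k1) - \<tau>\<bar> \<le> 1" by simp_all
    have e1: "s * S / N - s * x / N = s * (S - x) / N" by (simp add: diff_divide_distrib right_diff_distrib)
    have e2: "h * of_int (si * k) - h * of_int (si * k1) = h * of_int (si * (k - k1))" by (simp add: right_diff_distrib)
    have "dispersion \<alpha> (s * x / N) (h * of_int (si * k1)) + dispersion \<alpha> (s * (S - x) / N) (h * of_int (si * (k - k1))) - s * \<tau> * \<nu> =
        s * \<nu> * (w (x, k1) + w (S - x, k - k1) - \<tau>)"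
      unfolding ws[symmetric] by (simp add: right_diff_distrib distrib_left mult_ac)
    hence "\<bar>dispersion \<alpha> (s * x / N) (h * of_int (si * k1)) + dispersion \<alpha> (s * (S - x) / N) (h * of_int (si * (k - k1))) - s * \<tau> * \<nu>\<bar> =
        \<nu> * \<bar>w (x, k1) + w (S - x, k - k1) - \<tau>\<bar>"
      using s \<nu> by (auto simp: abs_mult)
    also have "\<dots> \<le> \<nu> * 1" by (intro mult_left_mono x) (use \<nu> in simp)
    also have "\<dots> \<le> \<delta>" using \<delta> by (simp add: \<nu>_def)
    finally have "s * x / N \<in> A (si * k1)"
      unfolding A_def pair_slice_def \<nu>_def[symmetric] mem_Collect_eq e1 e2 using R[OF x(1)] R[OF x(2)] by simp
    thus "x \<in> {x. (s / N) * x \<in> A (si * k1)}" by simp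
  qed
  have Am: "A l \<in> sets borel" for l unfolding A_def by (rule measurable_pair_slice[OF P])
  have c: "s / N \<noteq> 0" "inverse \<bar>s / N\<bar> = N" using s N by auto
  have Am': "{x. (s / N) * x \<in> A l} \<in> sets lborel" for l
  proof -
    have "(\<lambda>x. (s / N) * x) -` A l \<inter> space borel \<in> sets borel" by (rule measurable_sets[OF _ Am]) measurable
    thus ?thesis by (simp add: vimage_def)
  qed
  have "(\<integral>\<^sup>+k1. emeasure lborel {x. (x, k1) \<in> R \<and> (S - x, k - k1) \<in> R \<and>
      \<bar>w (x, k1) + w (S - x, k - k1) - \<tau>\<bar> \<le> 1} \<partial>count_space UNIV) \<le>
      (\<integral>\<^sup>+k1. ennreal N * emeasure lborel (A (si * k1)) \<partial>count_space UNIV)"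
  proof (rule nn_integral_mono)
    fix k1
    have "emeasure lborel {x. (s / N) * x \<in> A (si * k1)} = ennreal N * emeasure lborel (A (si * k1))"
      unfolding emeasure_lborel_vimage_mult[OF c(1) Am] c(2) ..
    thus "emeasure lborel {x. (x, k1) \<in> R \<and> (S - x, k - k1) \<in> R \<and> \<bar>w (x, k1) + w (S - x, k - k1) - \<tau>\<bar> \<le> 1} \<le>
        ennreal N * emeasure lborel (A (si * k1))"
      using emeasure_mono[OF sub[of k1] Am'] by simp
  qed
  also have "\<dots> = ennreal N * (\<integral>\<^sup>+k1. emeasure lborel (A (si * k1)) \<partial>count_space UNIV)"
    by (rule nn_integral_cmult) simp
  also have "(\<integral>\<^sup>+k1. emeasure lborel (A (si * k1)) \<partial>count_space UNIV) = (\<integral>\<^sup>+l. emeasure lborel (A l) \<partial>count_space UNIV)"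
  proof (rule nn_integral_bij_count_space)
    show "bij_betw (\<lambda>k. si * k) UNIV UNIV"
      using si by (intro bij_betwI[where g = "\<lambda>k. si * k"]) auto
  qed
  also have "\<dots> \<le> B" unfolding A_def by (rule B)
  finally show ?thesis by (simp add: mult_left_mono)
qed

context dispersion_range
begin

section \<open>Dyadic parameters and the pieces\<close>

lemma region_sections:
  "{x. (x, e) \<in> core_region d0} \<in> sets borel" "{x. (x, e) \<in> plus_region d0} \<in> sets borel"
  "{x. (x, e) \<in> minus_region d0 x0 z0 \<sigma>} \<in> sets borel"
  unfolding core_region_def plus_region_def minus_region_def curv_def mem_Collect_eq case_prod_conv by measurable

text \<open>\<delta> is four times the rescaled window, so h^2 = \<delta>/(4N) and h^2 \<le>
  \<delta> d0 is exactly d0 \<ge> 1/(4N). The threshold 1/(2N) meets the two conditions of the core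
  because \<alpha> \<le> 2. Of the 2k + q dyadic levels, 2k account for a factor N^2 between largest
  and smallest scale, and q absorbs 2 Q^4.\<close>

lemma dyadic_parameters:
  assumes N: "N = 2 ^ k" and q: "2 * Q ^ 4 < 2 ^ q"
    and h: "h = N powr (- (1 + \<alpha> / 2))" and \<delta>: "\<delta> = 4 * N powr (- (\<alpha> + 1))"
  shows "0 < h" "0 < \<delta>" "\<delta> / h = 4 * N powr (- (\<alpha> / 2))"
    "(1 / (2 * N)) ^ 3 \<le> \<delta>" "1 / (2 * N) \<le> \<delta> / h" "Q < 2 ^ (2 * k + q) * h"
    "1 / (4 * N) \<le> d0 \<Longrightarrow> h\<^sup>2 \<le> \<delta> * d0"
    "1 / (4 * N) \<le> d0 \<Longrightarrow> Q ^ 4 * sqrt (1 + d0) < 2 ^ (2 * k + q) * sqrt (\<delta> * d0)"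
proof -
  have N1: "1 \<le> N" by (simp add: N)
  hence N0: "0 < N" by simp
  have NN: "(2::real) ^ (2 * k) = N\<^sup>2" by (simp add: N power_mult[symmetric] mult.commute)
  show h0: "0 < h" and \<delta>0: "0 < \<delta>" using N0 by (simp_all add: h \<delta>)
  have "N powr (- (\<alpha> + 1)) = N powr (- (\<alpha> / 2)) * h"
  proof -
    have "- (\<alpha> + 1) = - (\<alpha> / 2) + - (1 + \<alpha> / 2)" by simp
    thus ?thesis unfolding h powr_add[symmetric] by (simp only:)
  qed
  thus \<delta>h: "\<delta> / h = 4 * N powr (- (\<alpha> / 2))" using h0 by (simp add: \<delta>)
  have Ninv: "N powr (- 1) = 1 / N" "N powr (- 2) = 1 / N\<^sup>2" "N powr (- 3) = 1 / N ^ 3"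
    using N0 by (simp_all add: powr_minus_divide powr_numeral)
  have p3: "1 / N ^ 3 \<le> N powr (- (\<alpha> + 1))" unfolding Ninv(3)[symmetric] using N1 alpha by (intro powr_mono) auto
  have "(1 / (2 * N)) ^ 3 = 1 / 8 * (1 / N ^ 3)" by (simp add: power_divide power_mult_distrib)
  moreover have "0 \<le> 1 / N ^ 3" using N0 by simp
  ultimately show "(1 / (2 * N)) ^ 3 \<le> \<delta>" using p3 unfolding \<delta> by linarith
  have "1 / N \<le> N powr (- (\<alpha> / 2))" unfolding Ninv(1)[symmetric] using N1 alpha by (intro powr_mono) auto
  moreover have "1 / (2 * N) = 1 / 2 * (1 / N)" "0 \<le> 1 / N" using N0 by simp_all
  ultimately show "1 / (2 * N) \<le> \<delta> / h" unfolding \<delta>h by linarith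
  have hN: "1 / N\<^sup>2 \<le> h" unfolding Ninv(2)[symmetric] h using N1 alpha by (intro powr_mono) auto
  have Q4: "Q \<le> Q ^ 4" using Q self_le_power[of Q 4] by simp
  have "Q < 2 ^ q" using Q4 q Q by linarith
  also have "\<dots> = 2 ^ (2 * k + q) * (1 / N\<^sup>2)" using N0 by (simp add: power_add NN)
  also have "\<dots> \<le> 2 ^ (2 * k + q) * h" by (intro mult_left_mono hN) simp
  finally show "Q < 2 ^ (2 * k + q) * h" .
  assume d0: "1 / (4 * N) \<le> d0"
  have d0': "0 < d0" using N0 d0 by (smt (verit) divide_pos_pos)
  have "h\<^sup>2 = N powr (- (\<alpha> + 1)) * N powr (- 1)"
  proof -
    have "- (1 + \<alpha> / 2) + - (1 + \<alpha> / 2) = - (\<alpha> + 1) + - 1" by simp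
    thus ?thesis unfolding h power2_eq_square powr_add[symmetric] by (simp only:)
  qed
  also have "\<dots> = \<delta> * (1 / (4 * N))" unfolding Ninv \<delta> by simp
  also have "\<dots> \<le> \<delta> * d0" using \<delta>0 d0 by (intro mult_left_mono) auto
  finally show "h\<^sup>2 \<le> \<delta> * d0" .
  have "1 \<le> 4 * (d0 * N)" using d0 N0 by (simp add: field_simps)
  moreover have "d0 * 1 \<le> d0 * N" using d0' N1 by (intro mult_left_mono) auto
  \<comment> \<open>The constant 16 is the 4 in \<delta> times the 4 in (2 N^2)^2.\<close>
  ultimately have "1 + d0 \<le> 16 * (d0 * N)" using d0' by linarith
  also have "N = 1 / N ^ 3 * N ^ 4" using N0 by (simp add: power_eq_if)
  also have "16 * (d0 * (1 / N ^ 3 * N ^ 4)) \<le> 16 * (d0 * (N powr (- (\<alpha> + 1)) * N ^ 4))"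
    using d0' N0 p3 by (intro mult_left_mono mult_right_mono) auto
  also have "\<dots> = (\<delta> * d0) * (2 * N\<^sup>2)\<^sup>2" by (simp add: \<delta> power_mult_distrib)
  finally have "sqrt (1 + d0) \<le> sqrt ((\<delta> * d0) * (2 * N\<^sup>2)\<^sup>2)" by (rule real_sqrt_le_mono)
  also have "\<dots> = sqrt (\<delta> * d0) * (2 * N\<^sup>2)"
    unfolding real_sqrt_mult[of "\<delta> * d0"] real_sqrt_abs by simp
  finally have "Q ^ 4 * sqrt (1 + d0) \<le> Q ^ 4 * (sqrt (\<delta> * d0) * (2 * N\<^sup>2))" using Q by (intro mult_left_mono) auto
  also have "\<dots> = (2 * Q ^ 4) * (N\<^sup>2 * sqrt (\<delta> * d0))" by simp
  also have "\<dots> < 2 ^ q * (N\<^sup>2 * sqrt (\<delta> * d0))"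
    using q N0 \<delta>0 d0' by (intro mult_strict_right_mono) auto
  also have "\<dots> = 2 ^ (2 * k + q) * sqrt (\<delta> * d0)" by (simp add: power_add NN)
  finally show "Q ^ 4 * sqrt (1 + d0) < 2 ^ (2 * k + q) * sqrt (\<delta> * d0)" .
qed

text \<open>The sign of the curvature and the exponent of its dyadic size. Sign 0 codes the core and
  comes with a dummy exponent.\<close>

definition band :: "real \<Rightarrow> real \<Rightarrow> int \<times> int" where
  "band d c = (if \<bar>c\<bar> \<le> d then (0, 0) else (if 0 < c then 1 else - 1, \<lfloor>log 2 \<bar>c\<bar>\<rfloor>))"

text \<open>Localisation to cells belongs to the count for negative curvature, so i and j enter only
  there.\<close>

definition piece :: "real \<Rightarrow> real \<Rightarrow> int \<times> int \<Rightarrow> int \<Rightarrow> int \<Rightarrow> (real \<times> real) set" where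
  "piece d \<sigma> b i j = (if fst b = 0 then core_region d else if fst b = 1 then plus_region (2 powr of_int (snd b))
    else minus_region (2 powr of_int (snd b)) (of_int i * \<sigma>) (of_int j * \<sigma>) \<sigma>)"

lemma piece_sections: "{x. (x, e) \<in> piece d \<sigma> b i j} \<in> sets borel"
  unfolding piece_def using region_sections by simp

text \<open>Outside the core |curv| exceeds d and is at most twice its dyadic size, which gives the
  second claim. For d = 1/(2N) it is the bound d0 \<ge> 1/(4N) of
  \<open>dyadic_parameters\<close>.\<close>

lemma mem_piece:
  assumes "p \<le> x" "x \<le> r" "0 \<le> e" "0 < \<sigma>" "0 < d"
  shows "(x, e) \<in> piece d \<sigma> (band d (curv \<alpha> x e)) \<lfloor>x / \<sigma>\<rfloor> \<lfloor>e / x / \<sigma>\<rfloor>"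
    and "fst (band d (curv \<alpha> x e)) \<noteq> 0 \<Longrightarrow> d / 2 \<le> 2 powr of_int (snd (band d (curv \<alpha> x e)))"
proof -
  define c where "c = curv \<alpha> x e"
  have fl: "of_int \<lfloor>u / \<sigma>\<rfloor> * \<sigma> \<le> u" "u \<le> of_int \<lfloor>u / \<sigma>\<rfloor> * \<sigma> + \<sigma>" for u
  proof -
    have "of_int \<lfloor>u / \<sigma>\<rfloor> * \<sigma> \<le> u / \<sigma> * \<sigma>" using assms(4) by (intro mult_right_mono) auto
    thus "of_int \<lfloor>u / \<sigma>\<rfloor> * \<sigma> \<le> u" using assms(4) by simp
    have "u / \<sigma> * \<sigma> \<le> (of_int \<lfloor>u / \<sigma>\<rfloor> + 1) * \<sigma>" using assms(4) by (intro mult_right_mono) linarith+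
    thus "u \<le> of_int \<lfloor>u / \<sigma>\<rfloor> * \<sigma> + \<sigma>" using assms(4) by (simp add: distrib_right)
  qed
  have lg: "2 powr of_int \<lfloor>log 2 \<bar>c\<bar>\<rfloor> \<le> \<bar>c\<bar>" "\<bar>c\<bar> \<le> 2 * 2 powr of_int \<lfloor>log 2 \<bar>c\<bar>\<rfloor>" if "d < \<bar>c\<bar>"
  proof -
    have c0: "0 < \<bar>c\<bar>" using that assms(5) by linarith
    have "2 powr of_int \<lfloor>log 2 \<bar>c\<bar>\<rfloor> \<le> 2 powr (log 2 \<bar>c\<bar>)" by (intro powr_mono) auto
    thus "2 powr of_int \<lfloor>log 2 \<bar>c\<bar>\<rfloor> \<le> \<bar>c\<bar>" using c0 by simp
    have "2 powr (log 2 \<bar>c\<bar>) \<le> 2 powr (1 + of_int \<lfloor>log 2 \<bar>c\<bar>\<rfloor>)" by (rule powr_mono) linarith+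
    thus "\<bar>c\<bar> \<le> 2 * 2 powr of_int \<lfloor>log 2 \<bar>c\<bar>\<rfloor>" using c0 by (simp add: powr_add)
  qed
  show "(x, e) \<in> piece d \<sigma> (band d (curv \<alpha> x e)) \<lfloor>x / \<sigma>\<rfloor> \<lfloor>e / x / \<sigma>\<rfloor>"
  proof (cases "\<bar>c\<bar> \<le> d")
    case True
    thus ?thesis using assms by (simp add: piece_def band_def core_region_def c_def)
  next
    case False
    note l = lg[OF False[unfolded not_le]]
    show ?thesis
    proof (cases "0 < c")
      case True
      thus ?thesis using False assms l by (simp add: piece_def band_def plus_region_def c_def)
    next
      case neg: False
      hence "\<bar>c\<bar> = - c" by simp
      moreover from this have "- 2 * 2 powr of_int \<lfloor>log 2 \<bar>c\<bar>\<rfloor> \<le> c" "c \<le> - (2 powr of_int \<lfloor>log 2 \<bar>c\<bar>\<rfloor>)" using l by linarith+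
      ultimately show ?thesis using neg False assms fl[of x] fl[of "e / x"]
        by (simp add: piece_def band_def minus_region_def c_def)
    qed
  qed
  show "d / 2 \<le> 2 powr of_int (snd (band d (curv \<alpha> x e)))" if "fst (band d (curv \<alpha> x e)) \<noteq> 0"
  proof -
    have f: "d < \<bar>c\<bar>" using that unfolding c_def[symmetric] by (auto simp: band_def split: if_splits)
    hence "snd (band d c) = \<lfloor>log 2 \<bar>c\<bar>\<rfloor>" by (simp add: band_def)
    thus ?thesis using lg[OF f] f unfolding c_def by simp
  qed
qed

text \<open>The three counts were given one common bound, so only the verification of their
  hypotheses depends on the kind of piece.\<close>

lemma piece_count:
  assumes N: "N = 2 ^ k" and q: "2 * Q ^ 4 < 2 ^ q"
    and h: "h = N powr (- (1 + \<alpha> / 2))" and \<delta>: "\<delta> = 4 * N powr (- (\<alpha> + 1))"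
    and \<sigma>: "Q ^ 10 * \<sigma> \<le> 1" and d: "d = 1 / (2 * N)"
    and b: "fst b \<noteq> 0 \<Longrightarrow> d / 2 \<le> 2 powr of_int (snd b)"
  shows "(\<integral>\<^sup>+l. emeasure lborel (pair_slice \<alpha> (piece d \<sigma> b i j) X H \<tau> \<delta> h (h * of_int l)) \<partial>count_space UNIV) \<le>
    ennreal (40 * Q * (32 * Q ^ 12) * (real (2 * k + q) + 1)\<^sup>2 * \<delta> / h)"
proof -
  note par = dyadic_parameters[OF N q h \<delta>]
  have N1: "1 \<le> N" by (simp add: N)
  show ?thesis
  proof (cases "fst b = 0")
    case True
    have "0 < d" "d \<le> 1 / 2" using N1 by (simp_all add: d field_simps)
    from core_count[OF par(1,2) this par(4,5)[folded d] par(6)] True show ?thesis by (simp add: piece_def)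
  next
    case False
    define d0 :: real where "d0 = 2 powr of_int (snd b)"
    have d0: "0 < d0" "1 / (4 * N) \<le> d0" using b[OF False] by (simp_all add: d0_def d)
    show ?thesis
    proof (cases "fst b = 1")
      case True
      from plus_count[OF par(1) par(7)[OF d0(2)] par(2) d0(1) par(8)[OF d0(2)]] True show ?thesis
        by (simp add: piece_def d0_def)
    next
      case f: False
      from minus_count[OF par(1) par(7)[OF d0(2)] par(2) d0(1) \<sigma> par(8)[OF d0(2)]] f False show ?thesis
        by (simp add: piece_def d0_def)
    qed
  qed
qed

end

section \<open>The number of pieces\<close>

lemma card_floor_interval_le:
  fixes u v :: real
  assumes "u \<le> v"
  shows "real (card {\<lfloor>u\<rfloor>..\<lfloor>v\<rfloor>}) \<le> v - u + 2"
proof -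
  have "\<lfloor>u\<rfloor> \<le> \<lfloor>v\<rfloor>" using assms by (rule floor_mono)
  hence "real (card {\<lfloor>u\<rfloor>..\<lfloor>v\<rfloor>}) = of_int (\<lfloor>v\<rfloor> - \<lfloor>u\<rfloor> + 1)" by simp
  also have "\<dots> \<le> v - u + 2" by linarith
  finally show ?thesis .
qed

context dispersion_range
begin

text \<open>Here u is x^(-\<alpha>). The frequency region confines the slope e/x, not e, to an
  interval of fixed length, so the curvature is rewritten in terms of the slope.\<close>

lemma curv_slope_form:
  assumes "p \<le> x" "x \<le> r"
  shows "\<exists>u. 1 / Q ^ 3 \<le> u \<and> u \<le> Q ^ 3 \<and> curv \<alpha> x e = \<alpha> * (\<alpha> + 1) - 2 * (e / x)\<^sup>2 * u"
proof (intro exI conjI)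
  have x0: "0 < x" using assms p by linarith
  have Q0: "0 < Q" using Q by simp
  have b: "1 / Q \<le> x" "x \<le> Q" "1 / Q \<le> 1 / x powr (\<alpha> + 2)" "1 / x powr (\<alpha> + 2) \<le> Q"
    using x_bounds[of x] inv_powr_bounds[of x] assms p by auto
  have "1 / Q ^ 3 = (1 / Q)\<^sup>2 * (1 / Q)" by (simp add: power_divide power2_eq_square power3_eq_cube)
  also have "\<dots> \<le> x\<^sup>2 * (1 / x powr (\<alpha> + 2))" using b Q0 by (intro mult_mono power_mono) auto
  finally show "1 / Q ^ 3 \<le> x\<^sup>2 * (1 / x powr (\<alpha> + 2))" .
  have "x\<^sup>2 * (1 / x powr (\<alpha> + 2)) \<le> Q\<^sup>2 * Q" using b Q0 x0 by (intro mult_mono power_mono) auto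
  thus "x\<^sup>2 * (1 / x powr (\<alpha> + 2)) \<le> Q ^ 3" by (simp add: power2_eq_square power3_eq_cube)
  show "curv \<alpha> x e = \<alpha> * (\<alpha> + 1) - 2 * (e / x)\<^sup>2 * (x\<^sup>2 * (1 / x powr (\<alpha> + 2)))"
    using x0 by (simp add: curv_def power_divide)
qed

text \<open>The slope varies in an interval of length 2 c3 with arbitrary centre a, and the range of
  the logarithm must not depend on a. For a \<le> a0 the curvature lies between 1/(2 2^k) and K, a
  range of length about k. For larger a the \<eta>-term dominates \<alpha>(\<alpha>+1), so |curv| is
  comparable to a^2 and its logarithm varies by a bounded amount.\<close>

lemma curv_log_range:
  assumes c3: "0 < c3"
  shows "\<exists>C\<ge>0. \<forall>a\<ge>0. \<forall>k::nat. \<exists>u v. u \<le> v \<and> v - u \<le> C + real k \<and>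
    (\<forall>x e. p \<le> x \<longrightarrow> x \<le> r \<longrightarrow> 0 \<le> e \<longrightarrow> \<bar>e / x - a\<bar> \<le> c3 \<longrightarrow> 1 / (2 * 2 ^ k) < \<bar>curv \<alpha> x e\<bar> \<longrightarrow>
      u \<le> log 2 \<bar>curv \<alpha> x e\<bar> \<and> log 2 \<bar>curv \<alpha> x e\<bar> \<le> v)"
proof -
  \<comment> \<open>The part 2 c3 keeps the slope between a/2 and 3a/2; the part 24 Q^3 makes a^2/(4
    Q^3) at least 6, the bound for \<alpha>(\<alpha>+1).\<close>
  define a0 where "a0 = 2 * c3 + 24 * Q ^ 3"
  define K where "K = 6 + 2 * (a0 + c3)\<^sup>2 * Q ^ 3"
  define C where "C = log 2 K + 1 + log 2 (24 * Q ^ 6)"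
  have Q0: "0 < Q" using Q by simp
  have Q1: "1 \<le> Q ^ 3" "1 \<le> Q ^ 6" using Q by (simp_all add: one_le_power)
  have K1: "1 \<le> K" unfolding K_def using Q0 by (smt (verit) mult_nonneg_nonneg zero_le_power zero_le_power2)
  have lK: "0 \<le> log 2 K" "0 \<le> log 2 (24 * Q ^ 6)" using K1 Q1 by (subst zero_le_log_cancel_iff; linarith)+
  have a1: "0 \<le> \<alpha> * (\<alpha> + 1)" "\<alpha> * (\<alpha> + 1) \<le> 6" using alpha_prod by auto
  have "\<exists>u v. u \<le> v \<and> v - u \<le> C + real k \<and>
    (\<forall>x e. p \<le> x \<longrightarrow> x \<le> r \<longrightarrow> 0 \<le> e \<longrightarrow> \<bar>e / x - a\<bar> \<le> c3 \<longrightarrow> 1 / (2 * 2 ^ k) < \<bar>curv \<alpha> x e\<bar> \<longrightarrow>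
      u \<le> log 2 \<bar>curv \<alpha> x e\<bar> \<and> log 2 \<bar>curv \<alpha> x e\<bar> \<le> v)" if a: "0 \<le> a" for a :: real and k :: nat
  proof (cases "a \<le> a0")
    case True
    have l: "log 2 (1 / (2 * 2 ^ k)) = - (real k + 1)"
    proof -
      have "(1 / (2 * 2 ^ k) :: real) = 2 powr (- (real k + 1))"
        unfolding powr_minus_divide powr_add by (simp add: powr_realpow)
      thus ?thesis by simp
    qed
    show ?thesis
    proof (rule exI[of _ "log 2 (1 / (2 * 2 ^ k))"], rule exI[of _ "log 2 K"], intro conjI allI impI)
      show "log 2 (1 / (2 * 2 ^ k)) \<le> log 2 K" "log 2 K - log 2 (1 / (2 * 2 ^ k)) \<le> C + real k"
        unfolding l C_def using lK by linarith+
      fix x e assume x: "p \<le> x" "x \<le> r" "0 \<le> e" "\<bar>e / x - a\<bar> \<le> c3" "1 / (2 * 2 ^ k) < \<bar>curv \<alpha> x e\<bar>"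
      have pos: "(0::real) < 1 / (2 * 2 ^ k)" by simp
      show "log 2 (1 / (2 * 2 ^ k)) \<le> log 2 \<bar>curv \<alpha> x e\<bar>"
        using x(5) pos by (subst log_le_cancel_iff) linarith+
      obtain u where u: "1 / Q ^ 3 \<le> u" "u \<le> Q ^ 3" "curv \<alpha> x e = \<alpha> * (\<alpha> + 1) - 2 * (e / x)\<^sup>2 * u"
        using curv_slope_form[OF x(1,2), of e] by blast
      have u0: "0 \<le> u" using u(1) Q0 by (smt (verit) divide_pos_pos zero_less_power)
      have "0 \<le> e / x" using x p by auto
      hence "(e / x)\<^sup>2 \<le> (a0 + c3)\<^sup>2" using x(4) True by (intro power_mono) linarith+
      hence "2 * (e / x)\<^sup>2 * u \<le> 2 * (a0 + c3)\<^sup>2 * Q ^ 3" using u u0 by (intro mult_mono) auto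
      moreover have "0 \<le> 2 * (e / x)\<^sup>2 * u" using u0 by simp
      ultimately have "\<bar>curv \<alpha> x e\<bar> \<le> K" unfolding u(3) K_def using a1 by linarith
      thus "log 2 \<bar>curv \<alpha> x e\<bar> \<le> log 2 K" using x(5) pos by (subst log_le_cancel_iff) linarith+
    qed
  next
    case False
    have a2: "2 * c3 \<le> a" "24 * Q ^ 3 \<le> a" using False c3 Q1 unfolding a0_def by linarith+
    have "1 \<le> a" using a2 Q1 by linarith
    hence aa: "24 * Q ^ 3 \<le> a\<^sup>2" using a2 self_le_power[of a 2] by simp
    have a0': "0 < a\<^sup>2" using \<open>1 \<le> a\<close> by simp
    have diff: "log 2 (6 * Q ^ 3 * a\<^sup>2) - log 2 (a\<^sup>2 / (4 * Q ^ 3)) = log 2 (24 * Q ^ 6)"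
    proof -
      have "log 2 (6 * Q ^ 3 * a\<^sup>2) - log 2 (a\<^sup>2 / (4 * Q ^ 3)) = log 2 ((6 * Q ^ 3 * a\<^sup>2) / (a\<^sup>2 / (4 * Q ^ 3)))"
        using a0' Q0 by (intro log_divide_pos[symmetric] mult_pos_pos divide_pos_pos) auto
      also have "(6 * Q ^ 3 * a\<^sup>2) / (a\<^sup>2 / (4 * Q ^ 3)) = 24 * Q ^ 6"
        using a0' Q0 by (simp flip: power_add)
      finally show ?thesis .
    qed
    show ?thesis
    proof (rule exI[of _ "log 2 (a\<^sup>2 / (4 * Q ^ 3))"], rule exI[of _ "log 2 (6 * Q ^ 3 * a\<^sup>2)"], intro conjI allI impI)
      show "log 2 (a\<^sup>2 / (4 * Q ^ 3)) \<le> log 2 (6 * Q ^ 3 * a\<^sup>2)"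
        "log 2 (6 * Q ^ 3 * a\<^sup>2) - log 2 (a\<^sup>2 / (4 * Q ^ 3)) \<le> C + real k"
        unfolding C_def using lK diff by linarith+
      fix x e assume x: "p \<le> x" "x \<le> r" "0 \<le> e" "\<bar>e / x - a\<bar> \<le> c3"
      obtain u where u: "1 / Q ^ 3 \<le> u" "u \<le> Q ^ 3" "curv \<alpha> x e = \<alpha> * (\<alpha> + 1) - 2 * (e / x)\<^sup>2 * u"
        using curv_slope_form[OF x(1,2), of e] by blast
      have u0: "0 \<le> u" using u(1) Q0 by (smt (verit) divide_pos_pos zero_less_power)
      have z: "a / 2 \<le> e / x" "e / x \<le> 3 / 2 * a" using x(4) a2 by linarith+
      have z2: "a\<^sup>2 / 4 \<le> (e / x)\<^sup>2" "(e / x)\<^sup>2 \<le> 9 / 4 * a\<^sup>2"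
        using power_mono[OF z(1), of 2] power_mono[OF z(2), of 2] z a by (simp_all add: power_divide power_mult_distrib)
      define t where "t = a\<^sup>2 / (4 * Q ^ 3)"
      have "2 * (a\<^sup>2 / 4) * (1 / Q ^ 3) \<le> 2 * (e / x)\<^sup>2 * u" using z2 u u0 Q0 by (intro mult_mono) auto
      hence lo: "2 * t \<le> 2 * (e / x)\<^sup>2 * u" by (simp add: t_def)
      have "2 * (e / x)\<^sup>2 * u \<le> 2 * (9 / 4 * a\<^sup>2) * Q ^ 3" using z2 u u0 by (intro mult_mono) auto
      hence hi: "2 * (e / x)\<^sup>2 * u \<le> 9 / 2 * (Q ^ 3 * a\<^sup>2)" by (simp add: mult_ac)
      have t6: "6 \<le> t" using aa Q0 by (simp add: t_def field_simps)
      have "24 * 1 \<le> 24 * Q ^ 3" using Q1 by simp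
      hence "1 * 24 \<le> Q ^ 3 * a\<^sup>2" using aa Q1 by (intro mult_mono) linarith+
      hence "t \<le> \<bar>curv \<alpha> x e\<bar>" "\<bar>curv \<alpha> x e\<bar> \<le> 6 * (Q ^ 3 * a\<^sup>2)"
        unfolding u(3) using lo hi t6 a1 by linarith+
      thus "log 2 (a\<^sup>2 / (4 * Q ^ 3)) \<le> log 2 \<bar>curv \<alpha> x e\<bar>" "log 2 \<bar>curv \<alpha> x e\<bar> \<le> log 2 (6 * Q ^ 3 * a\<^sup>2)"
        unfolding t_def[symmetric] mult.assoc using t6 by (auto intro!: log_mono)
    qed
  qed
  moreover have "0 \<le> C" unfolding C_def using lK by linarith
  ultimately show ?thesis by blast
qed

text \<open>The two signs are part of the label so that each piece lies in one quadrant; band and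
  cell are taken at the rescaled absolute values.\<close>

definition piece_label :: "real \<Rightarrow> real \<Rightarrow> real \<Rightarrow> real \<Rightarrow> real \<times> int \<Rightarrow> bool \<times> bool \<times> (int \<times> int) \<times> int \<times> int" where
  "piece_label N h d \<sigma> \<zeta> = (0 < fst \<zeta>, 0 \<le> snd \<zeta>, band d (curv \<alpha> (\<bar>fst \<zeta>\<bar> / N) (h * of_int \<bar>snd \<zeta>\<bar>)),
     \<lfloor>\<bar>fst \<zeta>\<bar> / N / \<sigma>\<rfloor>, \<lfloor>h * of_int \<bar>snd \<zeta>\<bar> / (\<bar>fst \<zeta>\<bar> / N) / \<sigma>\<rfloor>)"

lemma piece_label_measurable:
  assumes S: "S \<in> sets dual_cylinder"
  shows "{\<zeta>\<in>S. piece_label N h d \<sigma> \<zeta> = l} \<in> sets dual_cylinder"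
proof -
  obtain b1 b2 s b i j where l: "l = (b1, b2, (s, b), i, j)" by (metis surj_pair)
  have lg: "{c::real. \<lfloor>log 2 \<bar>c\<bar>\<rfloor> = b} \<in> sets borel" unfolding floor_eq_iff log_def by measurable
  have band: "{c. band d c = (s, b)} \<in> sets borel"
  proof -
    have "{c. band d c = (s, b)} = {c. \<bar>c\<bar> \<le> d} \<inter> {c. (s, b) = (0, 0)} \<union>
        ((- {c. \<bar>c\<bar> \<le> d} \<inter> {c. 0 < c} \<inter> {c. s = 1} \<union> - {c. \<bar>c\<bar> \<le> d} \<inter> - {c. 0 < c} \<inter> {c. s = - 1}) \<inter> {c. \<lfloor>log 2 \<bar>c\<bar>\<rfloor> = b})"
      by (auto simp: band_def)
    moreover have "{c::real. \<bar>c\<bar> \<le> d} \<in> sets borel" "{c::real. 0 < c} \<in> sets borel" by measurable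
    moreover have "{c::real. P} \<in> sets borel" for P by (cases P) simp_all
    ultimately show ?thesis using lg by (simp only: sets.Un sets.Int borel_comp)
  qed
  have "{\<zeta>. piece_label N h d \<sigma> \<zeta> = l} \<in> sets dual_cylinder"
  proof (rule sets_dual_cylinderI)
    fix k :: int
    define A1 where "A1 = {x::real. (0 < x) = b1}"
    define A2 where "A2 = {x::real. (0 \<le> k) = b2}"
    define A3 where "A3 = (\<lambda>x. curv \<alpha> (\<bar>x\<bar> / N) (h * of_int \<bar>k\<bar>)) -` {c. band d c = (s, b)}"
    define A4 where "A4 = {x. \<lfloor>\<bar>x\<bar> / N / \<sigma>\<rfloor> = i}"
    define A5 where "A5 = {x. \<lfloor>h * of_int \<bar>k\<bar> / (\<bar>x\<bar> / N) / \<sigma>\<rfloor> = j}"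
    have "A1 \<in> sets borel"
    proof (cases b1)
      case True
      have "A1 = {0<..}" using True by (auto simp: A1_def)
      thus ?thesis by simp
    next
      case False
      have "A1 = {..0}" using False by (auto simp: A1_def)
      thus ?thesis by simp
    qed
    moreover have "A2 \<in> sets borel" unfolding A2_def by (cases "(0 \<le> k) = b2") simp_all
    moreover have "A3 \<in> sets borel"
    proof -
      have "(\<lambda>x. curv \<alpha> (\<bar>x\<bar> / N) (h * of_int \<bar>k\<bar>)) \<in> borel_measurable borel" unfolding curv_def by measurable
      from measurable_sets[OF this band] show ?thesis by (simp add: A3_def)
    qed
    moreover have "A4 \<in> sets borel" "A5 \<in> sets borel" unfolding A4_def A5_def floor_eq_iff by measurable
    moreover have "{x. (x, k) \<in> {\<zeta>. piece_label N h d \<sigma> \<zeta> = l}} = A1 \<inter> A2 \<inter> A3 \<inter> A4 \<inter> A5"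
      unfolding piece_label_def l A1_def A2_def A3_def A4_def A5_def by auto
    ultimately show "{x. (x, k) \<in> {\<zeta>. piece_label N h d \<sigma> \<zeta> = l}} \<in> sets borel"
      by (simp only: sets.Int)
  qed
  hence "S \<inter> {\<zeta>. piece_label N h d \<sigma> \<zeta> = l} \<in> sets dual_cylinder" using S by blast
  thus ?thesis by (simp add: Int_def)
qed

text \<open>As h N = N^(-\<alpha>/2), rescaling turns the slope window c3 N^(\<alpha>/2) into one of
  size c3, centred at |A| N^(-\<alpha>/2). The reverse triangle inequality passes to absolute
  values.\<close>

lemma frequency_region_scaled:
  assumes N: "0 < N" and h: "h = N powr (- (1 + \<alpha> / 2))" and z: "(\<xi>, k) \<in> frequency_region p r c3 \<alpha> N A"
  shows "p \<le> \<bar>\<xi>\<bar> / N" "\<bar>\<xi>\<bar> / N \<le> r" "\<bar>h * of_int \<bar>k\<bar> / (\<bar>\<xi>\<bar> / N) - \<bar>A\<bar> * N powr (- (\<alpha> / 2))\<bar> \<le> c3"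
proof -
  have 1: "p * N \<le> \<bar>\<xi>\<bar>" "\<bar>\<xi>\<bar> \<le> r * N" "\<bar>of_int k / \<xi> - A\<bar> \<le> c3 * N powr (\<alpha> / 2)"
    using z by (simp_all add: frequency_region_def)
  show "p \<le> \<bar>\<xi>\<bar> / N" "\<bar>\<xi>\<bar> / N \<le> r" using 1 N by (simp_all add: field_simps)
  define \<mu> where "\<mu> = N powr (- (\<alpha> / 2))"
  have \<mu>: "0 < \<mu>" "N powr (\<alpha> / 2) = 1 / \<mu>" using N unfolding \<mu>_def powr_minus_divide by simp_all
  have "- (1 + \<alpha> / 2) + 1 = - (\<alpha> / 2)" by simp
  hence "h * N = \<mu>" using N powr_add[of N "- (1 + \<alpha> / 2)" 1] by (simp add: h \<mu>_def)
  hence eq: "h * of_int \<bar>k\<bar> / (\<bar>\<xi>\<bar> / N) = \<mu> * \<bar>of_int k / \<xi>\<bar>" by (auto simp: abs_divide mult_ac)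
  have "h * of_int \<bar>k\<bar> / (\<bar>\<xi>\<bar> / N) - \<bar>A\<bar> * \<mu> = \<mu> * (\<bar>of_int k / \<xi>\<bar> - \<bar>A\<bar>)"
    unfolding eq right_diff_distrib by (simp only: mult.commute)
  hence "\<bar>h * of_int \<bar>k\<bar> / (\<bar>\<xi>\<bar> / N) - \<bar>A\<bar> * \<mu>\<bar> = \<mu> * \<bar>\<bar>of_int k / \<xi>\<bar> - \<bar>A\<bar>\<bar>"
    by (simp only: abs_mult abs_of_pos[OF \<mu>(1)])
  also have "\<dots> \<le> \<mu> * (c3 * (1 / \<mu>))" using 1(3) unfolding \<mu>(2) using \<mu>(1) by (intro mult_left_mono) linarith+
  also have "\<dots> = c3" using \<mu> by simp
  finally show "\<bar>h * of_int \<bar>k\<bar> / (\<bar>\<xi>\<bar> / N) - \<bar>A\<bar> * N powr (- (\<alpha> / 2))\<bar> \<le> c3" by (simp only: \<mu>_def)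
qed

lemma piece_window:
  assumes N: "N = 2 ^ n" and q: "2 * Q ^ 4 < 2 ^ q"
    and h: "h = N powr (- (1 + \<alpha> / 2))" and \<sigma>: "0 < \<sigma>" "Q ^ 10 * \<sigma> \<le> 1" and d: "d = 1 / (2 * N)"
    and S: "S = frequency_region p r c3 \<alpha> N A"
    and w: "w = (\<lambda>\<zeta>. dispersion \<alpha> (fst \<zeta>) (of_int (snd \<zeta>)))"
  shows "(\<integral>\<^sup>+k1. emeasure lborel {x. (x, k1) \<in> {\<zeta>\<in>S. piece_label N h d \<sigma> \<zeta> = l} \<and>
      (s - x, k - k1) \<in> {\<zeta>\<in>S. piece_label N h d \<sigma> \<zeta> = l} \<and> \<bar>w (x, k1) + w (s - x, k - k1) - \<tau>\<bar> \<le> 1} \<partial>count_space UNIV) \<le>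
    ennreal N * ennreal (40 * Q * (32 * Q ^ 12) * (real (2 * n + q) + 1)\<^sup>2 * (4 * N powr (- (\<alpha> + 1))) / h)"
proof (cases "{\<zeta>\<in>S. piece_label N h d \<sigma> \<zeta> = l} = {}")
  case True
  show ?thesis unfolding True by simp
next
  case False
  obtain b1 b2 b i j where l: "l = (b1, b2, b, i, j)" by (metis surj_pair)
  have N0: "0 < N" by (simp add: N)
  have h0: "0 < h" using N0 by (simp add: h)
  have d0: "0 < d" using N0 by (simp add: d)
  have label: "(\<bar>\<xi>\<bar> / N, h * of_int \<bar>m\<bar>) \<in> piece d \<sigma> b i j" "(0 < \<xi>) = b1" "(0 \<le> m) = b2"
    "fst b \<noteq> 0 \<Longrightarrow> d / 2 \<le> 2 powr of_int (snd b)"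
    if "(\<xi>, m) \<in> {\<zeta>\<in>S. piece_label N h d \<sigma> \<zeta> = l}" for \<xi> m
  proof -
    have S': "(\<xi>, m) \<in> frequency_region p r c3 \<alpha> N A" using that S by simp
    have lb: "(0 < \<xi>) = b1" "(0 \<le> m) = b2" "band d (curv \<alpha> (\<bar>\<xi>\<bar> / N) (h * of_int \<bar>m\<bar>)) = b"
        "\<lfloor>\<bar>\<xi>\<bar> / N / \<sigma>\<rfloor> = i" "\<lfloor>h * of_int \<bar>m\<bar> / (\<bar>\<xi>\<bar> / N) / \<sigma>\<rfloor> = j"
      using that by (simp_all add: piece_label_def l)
    have e: "0 \<le> h * of_int \<bar>m\<bar>" using h0 by simp
    note mp = mem_piece[OF frequency_region_scaled(1,2)[OF N0 h S'] e \<sigma>(1) d0]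
    show "(\<bar>\<xi>\<bar> / N, h * of_int \<bar>m\<bar>) \<in> piece d \<sigma> b i j" using mp(1) unfolding lb .
    show "fst b \<noteq> 0 \<Longrightarrow> d / 2 \<le> 2 powr of_int (snd b)" using mp(2) unfolding lb .
    show "(0 < \<xi>) = b1" "(0 \<le> m) = b2" by (rule lb)+
  qed
  define si :: int where "si = (if b2 then 1 else - 1)"
  define s1 :: real where "s1 = (if b1 then 1 else - 1)"
  \<comment> \<open>The lower bound on the dyadic size is taken from a frequency inside the piece;
    this is why the empty piece is treated apart.\<close>
  have b: "fst b \<noteq> 0 \<Longrightarrow> d / 2 \<le> 2 powr of_int (snd b)" using False label(4) by fast
  show ?thesis
  proof (rule window_scaling[where s = s1 and si = si and P = "piece d \<sigma> b i j" and \<delta> = "4 * N powr (- (\<alpha> + 1))" and h = h])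
    show "(s1 * \<xi> / N, h * of_int (si * m)) \<in> piece d \<sigma> b i j" if "(\<xi>, m) \<in> {\<zeta>\<in>S. piece_label N h d \<sigma> \<zeta> = l}" for \<xi> m
    proof -
      note lb = label[OF that]
      have "s1 * \<xi> = \<bar>\<xi>\<bar>" using lb(2) by (auto simp: s1_def)
      moreover have "si * m = \<bar>m\<bar>" using lb(3) by (auto simp: si_def)
      ultimately show ?thesis using lb(1) by simp
    qed
    show "(\<integral>\<^sup>+l. emeasure lborel (pair_slice \<alpha> (piece d \<sigma> b i j) X H \<tau> (4 * N powr (- (\<alpha> + 1))) h (h * of_int l)) \<partial>count_space UNIV) \<le>
        ennreal (40 * Q * (32 * Q ^ 12) * (real (2 * n + q) + 1)\<^sup>2 * (4 * N powr (- (\<alpha> + 1))) / h)" for X H \<tau>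
      by (rule piece_count[OF N q h refl \<sigma>(2) d b])
  qed (use N0 h w piece_sections in \<open>auto simp: s1_def si_def\<close>)
qed

text \<open>The number of pieces is at most a multiple of n + 1 and enters with the power 4; the
  window bound carries (2n + q + 1)^2, whence the exponent 6. The power of N is that of N \<delta>/h
  = 4 N^(1-\<alpha>/2).\<close>

lemma propagator_L4_polylog:
  assumes c3: "0 < c3"
  shows "\<exists>C>0. \<forall>n A f. f \<in> L2_space cylinder \<longrightarrow>
    ess_support dual_cylinder (fourier f) \<subseteq> frequency_region p r c3 \<alpha> (2 ^ n) A \<longrightarrow>
    (\<integral>\<^sup>+t. \<integral>\<^sup>+z. ennreal (norm (propagator \<alpha> t f z) ^ 4) \<partial>cylinder \<partial>restrict_space lborel {0..1}) \<le>
      ennreal (C * (real n + 1) ^ 6 * (2 ^ n) powr (1 - \<alpha> / 2)) * (\<integral>\<^sup>+z. ennreal ((norm (f z))\<^sup>2) \<partial>cylinder)\<^sup>2"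
proof -
  have Q0: "0 < Q" using Q by simp
  obtain q :: nat where q: "2 * Q ^ 4 < 2 ^ q" using real_arch_pow[of 2 "2 * Q ^ 4"] by auto
  obtain C1 where C1: "0 \<le> C1" and range: "\<And>a k. 0 \<le> a \<Longrightarrow> \<exists>u v. u \<le> v \<and> v - u \<le> C1 + real k \<and>
    (\<forall>x e. p \<le> x \<longrightarrow> x \<le> r \<longrightarrow> 0 \<le> e \<longrightarrow> \<bar>e / x - a\<bar> \<le> c3 \<longrightarrow> 1 / (2 * 2 ^ k) < \<bar>curv \<alpha> x e\<bar> \<longrightarrow>
      u \<le> log 2 \<bar>curv \<alpha> x e\<bar> \<and> log 2 \<bar>curv \<alpha> x e\<bar> \<le> v)"
    using curv_log_range[OF c3] by blast
  \<comment> \<open>The largest cell size that \<open>minus_pair\<close> allows. It depends on Q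
    alone, so the number of cells is bounded uniformly in N and A.\<close>
  define \<sigma> where "\<sigma> = 1 / Q ^ 10"
  have \<sigma>: "0 < \<sigma>" "Q ^ 10 * \<sigma> \<le> 1" using Q0 by (simp_all add: \<sigma>_def)
  define U where "U = (r - p) / \<sigma> + 2"
  define V where "V = 2 * c3 / \<sigma> + 2"
  have UV: "0 < U" "0 < V" using pr c3 \<sigma> by (auto simp: U_def V_def intro!: add_nonneg_pos)
  define CL where "CL = 4 * (2 * C1 + 7) * U * V"
  have CL: "0 < CL" using UV C1 by (simp add: CL_def)
  define K where "K = 40 * Q * (32 * Q ^ 12)"
  have K: "0 < K" using Q0 by (simp add: K_def)
  define C where "C = CL ^ 4 * (192 * pi\<^sup>2 * (4 * K * (real q + 2)\<^sup>2) * (8 * pi\<^sup>2)\<^sup>2)"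
  have C: "0 < C" using CL K by (simp add: C_def)
  have main: "(\<integral>\<^sup>+t. \<integral>\<^sup>+z. ennreal (norm (propagator \<alpha> t f z) ^ 4) \<partial>cylinder \<partial>restrict_space lborel {0..1}) \<le>
      ennreal (C * (real n + 1) ^ 6 * (2 ^ n) powr (1 - \<alpha> / 2)) * (\<integral>\<^sup>+z. ennreal ((norm (f z))\<^sup>2) \<partial>cylinder)\<^sup>2"
    if f: "f \<in> L2_space cylinder" and supp: "ess_support dual_cylinder (fourier f) \<subseteq> frequency_region p r c3 \<alpha> (2 ^ n) A"
    for n A f
  proof -
    define N :: real where "N = 2 ^ n"
    have N0: "0 < N" by (simp add: N_def)
    define h where "h = N powr (- (1 + \<alpha> / 2))"
    have h0: "0 < h" using N0 by (simp add: h_def)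
    define d where "d = 1 / (2 * N)"
    define a where "a = \<bar>A\<bar> * N powr (- (\<alpha> / 2))"
    define S where "S = frequency_region p r c3 \<alpha> N A"
    have a: "0 \<le> a" by (simp add: a_def)
    from range[OF a, of n] obtain u v where uv: "u \<le> v" "v - u \<le> C1 + real n"
      and lr: "\<And>x e. p \<le> x \<Longrightarrow> x \<le> r \<Longrightarrow> 0 \<le> e \<Longrightarrow> \<bar>e / x - a\<bar> \<le> c3 \<Longrightarrow> 1 / (2 * 2 ^ n) < \<bar>curv \<alpha> x e\<bar> \<Longrightarrow>
        u \<le> log 2 \<bar>curv \<alpha> x e\<bar> \<and> log 2 \<bar>curv \<alpha> x e\<bar> \<le> v" by blast
    define J where "J = insert (0, 0) ({1, - 1} \<times> {\<lfloor>u\<rfloor>..\<lfloor>v\<rfloor>} :: (int \<times> int) set)"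
    define L where "L = (UNIV :: bool set) \<times> (UNIV :: bool set) \<times> J \<times> {\<lfloor>p / \<sigma>\<rfloor>..\<lfloor>r / \<sigma>\<rfloor>} \<times> {\<lfloor>(a - c3) / \<sigma>\<rfloor>..\<lfloor>(a + c3) / \<sigma>\<rfloor>}"
    have finL: "finite L" by (simp add: L_def J_def)
    have labL: "piece_label N h d \<sigma> ` S \<subseteq> L"
    proof
      fix l assume "l \<in> piece_label N h d \<sigma> ` S"
      then obtain \<xi> m where z: "(\<xi>, m) \<in> S" "l = piece_label N h d \<sigma> (\<xi>, m)" by auto
      define x where "x = \<bar>\<xi>\<bar> / N"
      define e where "e = h * of_int \<bar>m\<bar>"
      note sc = frequency_region_scaled[OF N0 h_def z(1)[unfolded S_def], folded x_def e_def a_def]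
      have e0: "0 \<le> e" using h0 by (simp add: e_def)
      have "band d (curv \<alpha> x e) \<in> J"
      proof (cases "\<bar>curv \<alpha> x e\<bar> \<le> d")
        case False
        hence "u \<le> log 2 \<bar>curv \<alpha> x e\<bar>" "log 2 \<bar>curv \<alpha> x e\<bar> \<le> v"
          using lr[OF sc(1,2) e0 sc(3)] by (simp_all add: d_def N_def)
        hence "\<lfloor>log 2 \<bar>curv \<alpha> x e\<bar>\<rfloor> \<in> {\<lfloor>u\<rfloor>..\<lfloor>v\<rfloor>}" by (auto intro: floor_mono)
        thus ?thesis using False by (simp add: band_def J_def)
      qed (simp add: band_def J_def)
      moreover have "\<lfloor>x / \<sigma>\<rfloor> \<in> {\<lfloor>p / \<sigma>\<rfloor>..\<lfloor>r / \<sigma>\<rfloor>}"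
        using sc(1,2) \<sigma> by (auto intro!: floor_mono divide_right_mono)
      moreover have "\<lfloor>e / x / \<sigma>\<rfloor> \<in> {\<lfloor>(a - c3) / \<sigma>\<rfloor>..\<lfloor>(a + c3) / \<sigma>\<rfloor>}"
      proof -
        have "(a - c3) / \<sigma> \<le> e / x / \<sigma>" "e / x / \<sigma> \<le> (a + c3) / \<sigma>"
          using sc(3) \<sigma> by (intro divide_right_mono; linarith)+
        thus ?thesis by (simp add: floor_mono)
      qed
      ultimately show "l \<in> L" unfolding z(2) piece_label_def fst_conv snd_conv x_def[symmetric] e_def[symmetric] L_def by simp
    qed
    have cardL: "real (card L) \<le> CL * (real n + 1)"
    proof -
      have "real (card J) \<le> 1 + 2 * real (card {\<lfloor>u\<rfloor>..\<lfloor>v\<rfloor>})"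
        unfolding J_def by (simp add: card_insert_if card_cartesian_product)
      also have "\<dots> \<le> 1 + 2 * (v - u + 2)" by (intro add_left_mono mult_left_mono card_floor_interval_le[OF uv(1)]) simp
      also have "\<dots> \<le> 1 + 2 * (C1 + real n + 2)" by (intro add_left_mono mult_left_mono add_right_mono uv(2)) simp
      also have "\<dots> \<le> (2 * C1 + 7) * (real n + 1)" using C1 by (simp add: algebra_simps)
      finally have cJ: "real (card J) \<le> (2 * C1 + 7) * (real n + 1)" .
      have "p / \<sigma> \<le> r / \<sigma>" using pr \<sigma> by (intro divide_right_mono) auto
      from card_floor_interval_le[OF this]
      have cU: "real (card {\<lfloor>p / \<sigma>\<rfloor>..\<lfloor>r / \<sigma>\<rfloor>}) \<le> U" by (simp add: U_def diff_divide_distrib)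
      have "(a - c3) / \<sigma> \<le> (a + c3) / \<sigma>" using c3 \<sigma> by (intro divide_right_mono) auto
      from card_floor_interval_le[OF this]
      have cV: "real (card {\<lfloor>(a - c3) / \<sigma>\<rfloor>..\<lfloor>(a + c3) / \<sigma>\<rfloor>}) \<le> V"
        by (simp add: V_def diff_divide_distrib[symmetric])
      have "real (card L) = 4 * (real (card J) * (real (card {\<lfloor>p / \<sigma>\<rfloor>..\<lfloor>r / \<sigma>\<rfloor>}) * real (card {\<lfloor>(a - c3) / \<sigma>\<rfloor>..\<lfloor>(a + c3) / \<sigma>\<rfloor>})))"
        unfolding L_def card_cartesian_product by (simp del: card_atLeastAtMost_int)
      also have "\<dots> \<le> 4 * (((2 * C1 + 7) * (real n + 1)) * (U * V))"
        using cJ cU cV UV C1 by (intro mult_left_mono mult_mono) auto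
      also have "\<dots> = CL * (real n + 1)" by (simp add: CL_def)
      finally show ?thesis .
    qed
    define m where "m = real (2 * n + q) + 1"
    have win: "ennreal N * ennreal (40 * Q * (32 * Q ^ 12) * (real (2 * n + q) + 1)\<^sup>2 * (4 * N powr (- (\<alpha> + 1))) / h) =
        ennreal (4 * K * m\<^sup>2 * N powr (1 - \<alpha> / 2))"
    proof -
      have "4 * N powr (- (\<alpha> + 1)) / h = 4 * N powr (- (\<alpha> / 2))"
        by (rule dyadic_parameters(3)[OF N_def q h_def refl])
      hence "N * (K * m\<^sup>2 * (4 * N powr (- (\<alpha> + 1))) / h) = N * (K * m\<^sup>2 * (4 * N powr (- (\<alpha> / 2))))"
        by (simp only: times_divide_eq_right[symmetric])
      also have "\<dots> = 4 * K * m\<^sup>2 * (N powr 1 * N powr (- (\<alpha> / 2)))" using N0 by simp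
      also have "N powr 1 * N powr (- (\<alpha> / 2)) = N powr (1 - \<alpha> / 2)"
        unfolding powr_add[symmetric] by simp
      finally have "N * (K * m\<^sup>2 * (4 * N powr (- (\<alpha> + 1))) / h) = 4 * K * m\<^sup>2 * N powr (1 - \<alpha> / 2)" .
      thus ?thesis unfolding K_def[symmetric] m_def[symmetric] using N0 K h0 by (subst ennreal_mult[symmetric]) auto
    qed
    define I where "I = (\<integral>\<^sup>+z. ennreal ((norm (f z))\<^sup>2) \<partial>cylinder)"
    have "(\<integral>\<^sup>+t. \<integral>\<^sup>+z. ennreal (norm (propagator \<alpha> t f z) ^ 4) \<partial>cylinder \<partial>restrict_space lborel {0..1}) \<le>
        ennreal (real (card L) ^ 4) * (ennreal (192 * pi\<^sup>2) * ennreal (4 * K * m\<^sup>2 * N powr (1 - \<alpha> / 2)) * (ennreal (8 * pi\<^sup>2) * I)\<^sup>2)"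
      unfolding I_def
    proof (rule propagator_L4_pieces[OF f _ _ _ refl finL labL])
      show "ess_support dual_cylinder (fourier f) \<subseteq> S" using supp by (simp add: S_def N_def)
      show Sm: "S \<in> sets dual_cylinder" "emeasure dual_cylinder S < \<infinity>"
        unfolding S_def by (rule frequency_region_measure[OF p N0])+
      show "{\<zeta>\<in>S. piece_label N h d \<sigma> \<zeta> = l} \<in> sets dual_cylinder" for l
        by (rule piece_label_measurable[OF Sm(1)])
    qed (rule piece_window[OF N_def q h_def \<sigma> d_def S_def refl, unfolded win])
    also have "\<dots> = ennreal (real (card L) ^ 4 * (192 * pi\<^sup>2 * (4 * K * m\<^sup>2 * N powr (1 - \<alpha> / 2)) * (8 * pi\<^sup>2)\<^sup>2)) * I\<^sup>2"
    proof -
      have sq: "(ennreal (8 * pi\<^sup>2) * I)\<^sup>2 = ennreal ((8 * pi\<^sup>2)\<^sup>2) * I\<^sup>2"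
        by (subst power_mult_distrib, subst ennreal_power) simp_all
      have e: "ennreal a1 * (ennreal a2 * ennreal a3 * (ennreal a4 * y)) = ennreal (a1 * (a2 * a3 * a4)) * y"
        if "0 \<le> a1" "0 \<le> a2" "0 \<le> a3" "0 \<le> a4" for a1 a2 a3 a4 y
        using that by (simp add: ennreal_mult mult_ac)
      show ?thesis unfolding sq by (rule e) (use K in auto)
    qed
    also have "\<dots> \<le> ennreal (C * (real n + 1) ^ 6 * N powr (1 - \<alpha> / 2)) * I\<^sup>2"
    proof (intro mult_right_mono ennreal_leI)
      have "m \<le> (real q + 2) * (real n + 1)" by (simp add: m_def algebra_simps)
      moreover have "0 \<le> m" by (simp add: m_def)
      ultimately have "real (card L) ^ 4 * (192 * pi\<^sup>2 * (4 * K * m\<^sup>2 * N powr (1 - \<alpha> / 2)) * (8 * pi\<^sup>2)\<^sup>2) \<le>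
          (CL * (real n + 1)) ^ 4 * (192 * pi\<^sup>2 * (4 * K * ((real q + 2) * (real n + 1))\<^sup>2 * N powr (1 - \<alpha> / 2)) * (8 * pi\<^sup>2)\<^sup>2)"
        using cardL K by (intro mult_mono mult_left_mono mult_right_mono power_mono) auto
      also have "\<dots> = C * ((real n + 1) ^ 4 * (real n + 1)\<^sup>2) * N powr (1 - \<alpha> / 2)"
        unfolding C_def by (simp add: power_mult_distrib)
      also have "(real n + 1) ^ 4 * (real n + 1)\<^sup>2 = (real n + 1) ^ 6" by (simp flip: power_add)
      finally show "real (card L) ^ 4 * (192 * pi\<^sup>2 * (4 * K * m\<^sup>2 * N powr (1 - \<alpha> / 2)) * (8 * pi\<^sup>2)\<^sup>2) \<le>
          C * (real n + 1) ^ 6 * N powr (1 - \<alpha> / 2)" .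
    qed simp
    finally show ?thesis by (simp only: I_def N_def)
  qed
  show ?thesis using C main by blast
qed

end

section \<open>Logarithms against powers of N, and the final estimate\<close>

lemma polylog_le_powr:
  assumes "0 < (\<epsilon>::real)"
  shows "\<exists>D>0. \<forall>n::nat. (real n + 1) ^ 6 \<le> D * (2 ^ n) powr \<epsilon>"
proof -
  define b where "b = \<epsilon> * ln 2"
  have b: "0 < b" using assms by (simp add: b_def)
  have "(\<lambda>n::nat. (real n + 1) ^ 6 * exp (- b * real n)) \<longlonglongrightarrow> 0" using b by real_asymp
  hence "Bseq (\<lambda>n::nat. (real n + 1) ^ 6 * exp (- b * real n))" by (intro convergent_imp_Bseq convergentI)
  then obtain D where D: "0 < D" "\<And>n::nat. norm ((real n + 1) ^ 6 * exp (- b * real n)) \<le> D" by (auto simp: Bseq_def)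
  have "(real n + 1) ^ 6 \<le> D * (2 ^ n) powr \<epsilon>" for n :: nat
  proof -
    have e: "(2 ^ n) powr \<epsilon> = exp (b * real n)"
      by (simp add: powr_def b_def ln_realpow mult_ac)
    have "(real n + 1) ^ 6 = (real n + 1) ^ 6 * exp (- b * real n) * exp (b * real n)"
      by (simp add: exp_minus)
    also have "\<dots> \<le> D * exp (b * real n)" using D(2)[of n] by (intro mult_right_mono) auto
    finally show ?thesis by (simp only: e)
  qed
  thus ?thesis using D(1) by blast
qed

theorem proposition3p9:
  fixes \<alpha> \<epsilon> c1 c2 c3 :: real
  assumes "1 \<le> \<alpha>" and "\<alpha> \<le> 2" and "\<epsilon> > 0"
    and "0 < c1" and "c1 \<le> c2" and "0 < c3"
  shows "\<exists>C>0. \<forall>N\<in>range (\<lambda>k::nat. (2::real) ^ k). \<forall>A::real. \<forall>f\<in>L2_space cylinder.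
    ess_support dual_cylinder (fourier f) \<subseteq> frequency_region c1 c2 c3 \<alpha> N A \<longrightarrow>
      ennLp 4 (restrict_space lborel {0..1}) (\<lambda>t. Lp_norm 4 cylinder (propagator \<alpha> t f))
        \<le> ennreal (C * N powr ((2 - \<alpha>) / 8 + \<epsilon>)) * Lp_norm 2 cylinder f"
proof -
  obtain Q where "dispersion_range \<alpha> c1 c2 Q" using dispersion_range_exists[OF assms(1,2,4,5)] by blast
  then interpret dispersion_range \<alpha> c1 c2 Q .
  obtain B where B: "0 < B" and L4: "\<And>n A f. f \<in> L2_space cylinder \<Longrightarrow>
    ess_support dual_cylinder (fourier f) \<subseteq> frequency_region c1 c2 c3 \<alpha> (2 ^ n) A \<Longrightarrow>
    (\<integral>\<^sup>+t. \<integral>\<^sup>+z. ennreal (norm (propagator \<alpha> t f z) ^ 4) \<partial>cylinder \<partial>restrict_space lborel {0..1}) \<le>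
      ennreal (B * (real n + 1) ^ 6 * (2 ^ n) powr (1 - \<alpha> / 2)) * (\<integral>\<^sup>+z. ennreal ((norm (f z))\<^sup>2) \<partial>cylinder)\<^sup>2"
    using propagator_L4_polylog[OF assms(6)] by blast
  \<comment> \<open>The exponent is 4 \<epsilon> because a fourth root is still to be taken.\<close>
  obtain D where D: "0 < D" and log: "\<And>n::nat. (real n + 1) ^ 6 \<le> D * (2 ^ n) powr (4 * \<epsilon>)"
    using polylog_le_powr[of "4 * \<epsilon>"] assms(3) by auto
  show ?thesis
  proof (intro exI[of _ "(B * D) powr (1 / 4)"] conjI ballI allI impI)
    show "0 < (B * D) powr (1 / 4)" using B D by simp
  next
    fix N A f assume N: "N \<in> range (\<lambda>k::nat. (2::real) ^ k)" and f: "f \<in> L2_space cylinder"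
      and supp: "ess_support dual_cylinder (fourier f) \<subseteq> frequency_region c1 c2 c3 \<alpha> N A"
    from N obtain n where n: "N = 2 ^ n" by blast
    have N0: "0 < N" by (simp add: n)
    define I where "I = (\<integral>\<^sup>+z. ennreal ((norm (f z))\<^sup>2) \<partial>cylinder)"
    define W where "W = B * D * N powr (1 - \<alpha> / 2 + 4 * \<epsilon>)"
    have W: "0 < W" using B D N0 by (simp add: W_def)
    have "B * (real n + 1) ^ 6 * N powr (1 - \<alpha> / 2) \<le> B * (D * N powr (4 * \<epsilon>)) * N powr (1 - \<alpha> / 2)"
      using B log[of n] by (intro mult_right_mono mult_left_mono) (auto simp: n)
    also have "\<dots> = W" by (simp add: W_def powr_add)
    finally have "ennreal (B * (real n + 1) ^ 6 * N powr (1 - \<alpha> / 2)) \<le> ennreal W" by (rule ennreal_leI)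
    hence "ennreal (B * (real n + 1) ^ 6 * N powr (1 - \<alpha> / 2)) * I\<^sup>2 \<le> ennreal W * I\<^sup>2" by (rule mult_right_mono) simp
    with L4[OF f supp[unfolded n]]
    have le: "(\<integral>\<^sup>+t. \<integral>\<^sup>+z. ennreal (norm (propagator \<alpha> t f z) ^ 4) \<partial>cylinder \<partial>restrict_space lborel {0..1}) \<le> ennreal W * I\<^sup>2"
      unfolding I_def n by (rule order_trans)
    \<comment> \<open>I is the square of the L2 norm, so the fourth root of I^2 is the norm
      itself.\<close>
    have I2: "ennpow (I\<^sup>2) (1 / 4) = ennpow I (1 / 2)"
    proof -
      have "I\<^sup>2 = ennpow I 2"
        by (cases I rule: ennreal_cases) (simp_all add: ennpow_ennreal ennreal_power powr_numeral ennpow_def)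
      thus ?thesis by (simp add: ennpow_ennpow)
    qed
    have Wp: "W powr (1 / 4) = (B * D) powr (1 / 4) * N powr ((2 - \<alpha>) / 8 + \<epsilon>)"
    proof -
      have "(1 - \<alpha> / 2 + 4 * \<epsilon>) * (1 / 4) = (2 - \<alpha>) / 8 + \<epsilon>" by (simp add: field_simps)
      hence "(N powr (1 - \<alpha> / 2 + 4 * \<epsilon>)) powr (1 / 4) = N powr ((2 - \<alpha>) / 8 + \<epsilon>)" by (simp only: powr_powr)
      moreover have "W powr (1 / 4) = (B * D) powr (1 / 4) * (N powr (1 - \<alpha> / 2 + 4 * \<epsilon>)) powr (1 / 4)"
        unfolding W_def by (rule powr_mult)
      ultimately show ?thesis by (simp only:)
    qed
    have "ennLp 4 (restrict_space lborel {0..1}) (\<lambda>t. Lp_norm 4 cylinder (propagator \<alpha> t f)) \<le> ennpow (ennreal W * I\<^sup>2) (1 / 4)"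
      unfolding ennLp_4_Lp_norm_4 by (rule ennpow_mono[OF le]) simp
    also have "\<dots> = ennreal (W powr (1 / 4)) * ennpow (I\<^sup>2) (1 / 4)" by (rule ennpow_mult[OF W]) simp
    also have "\<dots> = ennreal ((B * D) powr (1 / 4) * N powr ((2 - \<alpha>) / 8 + \<epsilon>)) * Lp_norm 2 cylinder f"
      unfolding I2 Wp Lp_norm_2 unfolding I_def ..
    finally show "ennLp 4 (restrict_space lborel {0..1}) (\<lambda>t. Lp_norm 4 cylinder (propagator \<alpha> t f))
        \<le> ennreal ((B * D) powr (1 / 4) * N powr ((2 - \<alpha>) / 8 + \<epsilon>)) * Lp_norm 2 cylinder f" .
  qed
qed

end
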